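(* Let $\Gamma$ be a countable group. Let $\{A_i\}_{i\in I}$ be a family of finite abelian feet of $\Gamma$ such that $MA(\Gamma)=\bigoplus_{i\in I}A_i$ (such a family exists), and recall that $MS(\Gamma)=MA(\Gamma)\oplus MH(\Gamma)$ with $MH(\Gamma)=\bigoplus_{H\in\mathcal H_\Gamma}H$. The following properties are equivalent: (i) $\Gamma$ is irreducibly represented, i.e. $\Gamma$ has a faithful irreducible unitary representation; (ii) $MA(\Gamma)$ has a $\Gamma$-faithful unitary character; (iii) $MS(\Gamma)$ has a $\Gamma$-faithful irreducible unitary representation; (iv) for every finite subset $E$ of $I$, there exists an element $x_E$ in $MA_E(\Gamma):=\bigoplus_{i\in E}A_i$ such that the $\Gamma$-conjugacy class of $x_E$ generates $MA_E(\Gamma)$; (v) for every pair of finite subsets $E\subset I$ and $F\subset\mathcal H_\Gamma$, there exists an element $z_{E,F}$ in $MS_{E,F}(\Gamma):=\left(\bigoplus_{i\in E}A_i\right)\oplus\left(\bigoplus_{H\in F}H\right)$ such that the $\Gamma$-conjugacy class of $z_{E,F}$ generates $MS_{E,F}(\Gamma)$. In particular, a countable group $\Gamma$ has a faithful irreducible unitary representation as soon as $MA(\Gamma)=\{e\}$, and a fortiori as soon as $MS(\Gamma)=\{e\}$.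
   Context: A foot of a group $\Gamma$ is a minimal normal subgroup of $\Gamma$: a normal subgroup $M\ne\{e\}$ such that every normal subgroup of $\Gamma$ contained in $M$ is $M$ or $\{e\}$. $\mathcal F_\Gamma$ is the set of finite feet of $\Gamma$, $\mathcal A_\Gamma\subset\mathcal F_\Gamma$ the subset of abelian ones, $\mathcal H_\Gamma=\mathcal F_\Gamma\setminus\mathcal A_\Gamma$. $MS(\Gamma)$ (the minisocle), $MA(\Gamma)$, $MH(\Gamma)$ are the subgroups of $\Gamma$ generated respectively by $\bigcup_{M\in\mathcal F_\Gamma}M$, $\bigcup_{A\in\mathcal A_\Gamma}A$, $\bigcup_{H\in\mathcal H_\Gamma}H$ (equal to $\{e\}$ if the corresponding set of feet is empty). Direct sums are internal (restricted) direct sums of subgroups. For a normal subgroup $N$ of $\Gamma$ and a unitary representation $\sigma$ of $N$, $\sigma^\gamma$ denotes the representation $n\mapsto\sigma(\gamma n\gamma^{-1})$ of $N$, for $\gamma\in\Gamma$. The representation $\sigma$ is $\Gamma$-faithful if $\bigcap_{\gamma\in\Gamma}\ker(\sigma^\gamma)=\{e\}$. Characters are unitary characters, i.e. homomorphisms to $\{z\in\mathbf C: |z|=1\}$. Countable groups may be finite. Unitary representations may be infinite dimensional. *)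

theory Defs
  imports "HOL-Analysis.Analysis" "HOL-Algebra.Module" "HOL-Algebra.Bij" "HOL-Algebra.Generated_Groups"
begin

section \<open>Complex Hilbert spaces on a carrier set\<close>

text \<open>The spaces of representations are quantified over inside formulas, so they are
  structures with an explicit carrier rather than instances of a type class.\<close>

definition complex_ring :: "complex ring" where
  "complex_ring = \<lparr>carrier = UNIV, mult = (*), one = 1, zero = 0, add = (+)\<rparr>"

record 'v inner_space = "(complex, 'v) module" +
  cinner :: "'v \<Rightarrow> 'v \<Rightarrow> complex"

text \<open>The multiplication and unit that the record \<open>module\<close> inherits from \<open>ring\<close> are not used.
  Distances are set to \<open>0\<close> off the carrier because the locale \<open>Metric_space\<close> demands
  nonnegativity and symmetry for all elements of the type.\<close>

definition cdist :: "('v, 'm) inner_space_scheme \<Rightarrow> 'v \<Rightarrow> 'v \<Rightarrow> real" where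
  "cdist V x y =
     (if x \<in> carrier V \<and> y \<in> carrier V
      then sqrt (Re (cinner V (x \<ominus>\<^bsub>V\<^esub> y) (x \<ominus>\<^bsub>V\<^esub> y))) else 0)"

abbreviation norm_topology :: "('v, 'm) inner_space_scheme \<Rightarrow> 'v topology" where
  "norm_topology V \<equiv> Metric_space.mtopology (carrier V) (cdist V)"

locale complex_hilbert_space = module complex_ring V
  for V :: "('v, 'm) inner_space_scheme" (structure) +
  assumes cinner_add_left:
      "\<lbrakk>x \<in> carrier V; y \<in> carrier V; z \<in> carrier V\<rbrakk>
        \<Longrightarrow> cinner V (x \<oplus>\<^bsub>V\<^esub> y) z = cinner V x z + cinner V y z"
    and cinner_smult_left:
      "\<lbrakk>x \<in> carrier V; z \<in> carrier V\<rbrakk> \<Longrightarrow> cinner V (a \<odot>\<^bsub>V\<^esub> x) z = a * cinner V x z"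
    and cinner_commute:
      "\<lbrakk>x \<in> carrier V; y \<in> carrier V\<rbrakk> \<Longrightarrow> cinner V y x = cnj (cinner V x y)"
    and cinner_pos:
      "\<lbrakk>x \<in> carrier V; x \<noteq> \<zero>\<^bsub>V\<^esub>\<rbrakk> \<Longrightarrow> 0 < Re (cinner V x x)"
    and complete: "Metric_space.mcomplete (carrier V) (cdist V)"


section \<open>Unitary representations and characters\<close>

definition unitary_group :: "('v, 'm) inner_space_scheme \<Rightarrow> ('v \<Rightarrow> 'v) monoid" where
  "unitary_group V = (BijGroup (carrier V))
     \<lparr>carrier := {U \<in> Bij (carrier V).
        (\<forall>x\<in>carrier V. \<forall>y\<in>carrier V. U (x \<oplus>\<^bsub>V\<^esub> y) = U x \<oplus>\<^bsub>V\<^esub> U y) \<and>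
        (\<forall>a. \<forall>x\<in>carrier V. U (a \<odot>\<^bsub>V\<^esub> x) = a \<odot>\<^bsub>V\<^esub> U x) \<and>
        (\<forall>x\<in>carrier V. \<forall>y\<in>carrier V. cinner V (U x) (U y) = cinner V x y)}\<rparr>"

definition unitary_rep ::
  "('g, 'b) monoid_scheme \<Rightarrow> ('v, 'm) inner_space_scheme \<Rightarrow> ('g \<Rightarrow> 'v \<Rightarrow> 'v) \<Rightarrow> bool" where
  "unitary_rep G V \<pi> \<longleftrightarrow> complex_hilbert_space V \<and> \<pi> \<in> hom G (unitary_group V)"

text \<open>The zero space does not count as irreducible.\<close>

definition irreducible_unitary_rep ::
  "('g, 'b) monoid_scheme \<Rightarrow> ('v, 'm) inner_space_scheme \<Rightarrow> ('g \<Rightarrow> 'v \<Rightarrow> 'v) \<Rightarrow> bool" where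
  "irreducible_unitary_rep G V \<pi> \<longleftrightarrow>
     unitary_rep G V \<pi> \<and> carrier V \<noteq> {\<zero>\<^bsub>V\<^esub>} \<and>
     (\<forall>W. submodule W complex_ring V \<and> closedin (norm_topology V) W \<and>
          (\<forall>g\<in>carrier G. \<forall>w\<in>W. \<pi> g w \<in> W) \<longrightarrow> W = {\<zero>\<^bsub>V\<^esub>} \<or> W = carrier V)"

definition circle_group :: "complex monoid" where
  "circle_group = \<lparr>carrier = {z. cmod z = 1}, mult = (*), one = 1\<rparr>"

definition unitary_character :: "('g, 'b) monoid_scheme \<Rightarrow> ('g \<Rightarrow> complex) \<Rightarrow> bool" where
  "unitary_character G \<xi> \<longleftrightarrow> \<xi> \<in> hom G circle_group"

definition conj_rep :: "('g, 'b) monoid_scheme \<Rightarrow> ('g \<Rightarrow> 'u) \<Rightarrow> 'g \<Rightarrow> 'g \<Rightarrow> 'u" where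
  "conj_rep G \<sigma> \<gamma> = (\<lambda>n. \<sigma> (\<gamma> \<otimes>\<^bsub>G\<^esub> n \<otimes>\<^bsub>G\<^esub> inv\<^bsub>G\<^esub> \<gamma>))"

text \<open>Here \<open>H\<close> is the group in which \<open>\<sigma>\<close> takes its values: \<open>unitary_group V\<close> for a
  representation on \<open>V\<close>, and \<open>circle_group\<close> for a character.\<close>

definition conj_faithful ::
  "('g, 'b) monoid_scheme \<Rightarrow> 'g set \<Rightarrow> ('u, 'c) monoid_scheme \<Rightarrow> ('g \<Rightarrow> 'u) \<Rightarrow> bool" where
  "conj_faithful G N H \<sigma> \<longleftrightarrow>
     (\<Inter>\<gamma>\<in>carrier G. kernel (G\<lparr>carrier := N\<rparr>) H (conj_rep G \<sigma> \<gamma>)) = {\<one>\<^bsub>G\<^esub>}"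

text \<open>The type argument gives the type that contains the carriers of the Hilbert spaces.
  For a countable group an irreducible representation is cyclic, so its space is separable and
  has at most the cardinality of the continuum; any type into which the reals inject is
  therefore large enough to hold an isomorphic copy of every irreducible representation.\<close>

definition irreducibly_represented :: "'v itself \<Rightarrow> ('g, 'b) monoid_scheme \<Rightarrow> bool" where
  "irreducibly_represented _ G \<longleftrightarrow>
     (\<exists>(V :: 'v inner_space) \<pi>. irreducible_unitary_rep G V \<pi> \<and>
        kernel G (unitary_group V) \<pi> = {\<one>\<^bsub>G\<^esub>})"

definition has_conj_faithful_irrep ::
  "'v itself \<Rightarrow> ('g, 'b) monoid_scheme \<Rightarrow> 'g set \<Rightarrow> bool" where
  "has_conj_faithful_irrep _ G N \<longleftrightarrow>
     (\<exists>(V :: 'v inner_space) \<sigma>. irreducible_unitary_rep (G\<lparr>carrier := N\<rparr>) V \<sigma> \<and>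
        conj_faithful G N (unitary_group V) \<sigma>)"

definition has_conj_faithful_character :: "('g, 'b) monoid_scheme \<Rightarrow> 'g set \<Rightarrow> bool" where
  "has_conj_faithful_character G N \<longleftrightarrow>
     (\<exists>\<xi>. unitary_character (G\<lparr>carrier := N\<rparr>) \<xi> \<and> conj_faithful G N circle_group \<xi>)"


section \<open>Feet and the minisocle\<close>

definition foot :: "('g, 'b) monoid_scheme \<Rightarrow> 'g set \<Rightarrow> bool" where
  "foot G M \<longleftrightarrow> M \<lhd> G \<and> M \<noteq> {\<one>\<^bsub>G\<^esub>} \<and>
     (\<forall>N. N \<lhd> G \<and> N \<subseteq> M \<longrightarrow> N = M \<or> N = {\<one>\<^bsub>G\<^esub>})"

definition finite_feet :: "('g, 'b) monoid_scheme \<Rightarrow> 'g set set" where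
  "finite_feet G = {M. foot G M \<and> finite M}"

definition abelian_feet :: "('g, 'b) monoid_scheme \<Rightarrow> 'g set set" where
  "abelian_feet G = {M \<in> finite_feet G. comm_group (G\<lparr>carrier := M\<rparr>)}"

definition nonabelian_feet :: "('g, 'b) monoid_scheme \<Rightarrow> 'g set set" where
  "nonabelian_feet G = finite_feet G - abelian_feet G"

definition minisocle :: "('g, 'b) monoid_scheme \<Rightarrow> 'g set" where
  "minisocle G = generate G (\<Union>(finite_feet G))"

definition MA :: "('g, 'b) monoid_scheme \<Rightarrow> 'g set" where
  "MA G = generate G (\<Union>(abelian_feet G))"

definition MH :: "('g, 'b) monoid_scheme \<Rightarrow> 'g set" where
  "MH G = generate G (\<Union>(nonabelian_feet G))"

definition internal_direct_sum ::
  "('g, 'b) monoid_scheme \<Rightarrow> 'i set \<Rightarrow> ('i \<Rightarrow> 'g set) \<Rightarrow> 'g set \<Rightarrow> bool" where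
  "internal_direct_sum G I A N \<longleftrightarrow>
     subgroup N G \<and> (\<forall>i\<in>I. A i \<lhd> G\<lparr>carrier := N\<rparr>) \<and>
     N = generate G (\<Union>i\<in>I. A i) \<and>
     (\<forall>i\<in>I. A i \<inter> generate G (\<Union>j\<in>I - {i}. A j) = {\<one>\<^bsub>G\<^esub>})"

definition conjugacy_class :: "('g, 'b) monoid_scheme \<Rightarrow> 'g \<Rightarrow> 'g set" where
  "conjugacy_class G x = {\<gamma> \<otimes>\<^bsub>G\<^esub> x \<otimes>\<^bsub>G\<^esub> inv\<^bsub>G\<^esub> \<gamma> |\<gamma>. \<gamma> \<in> carrier G}"

text \<open>A subfamily of the summands of an internal direct sum has as its direct sum the subgroup
  that it generates. \<open>MA_sub G A E\<close> is the direct sum of the \<open>A i\<close> for \<open>i \<in> E\<close>;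
  \<open>MS_sub G A E F\<close> has in addition the members of \<open>F\<close> as summands.\<close>

definition MA_sub :: "('g, 'b) monoid_scheme \<Rightarrow> ('i \<Rightarrow> 'g set) \<Rightarrow> 'i set \<Rightarrow> 'g set" where
  "MA_sub G A E = generate G (\<Union>i\<in>E. A i)"

definition MS_sub ::
  "('g, 'b) monoid_scheme \<Rightarrow> ('i \<Rightarrow> 'g set) \<Rightarrow> 'i set \<Rightarrow> 'g set set \<Rightarrow> 'g set" where
  "MS_sub G A E F = generate G ((\<Union>i\<in>E. A i) \<union> \<Union>F)"

end

theory Submission
  imports Defs "HOL-Algebra.Multiplicative_Group"
begin

text \<open>All properties turn out to be equivalent to the existence of a normalised positive definite
  function \<open>f\<close> on \<open>\<Gamma>\<close> whose sum over every coset of every finite foot vanishes: \<open>f\<close> is the vector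
  state of a representation in which no finite foot has a nonzero fixed vector.  An irreducible
  representation with no finite foot in its kernel has such vector states.  Conversely, an extreme
  point of the compact convex set of these functions gives, by the GNS construction, an
  irreducible representation with no finite foot in its kernel.  To keep the remaining normal
  closures \<open>N\<close> out of the kernel, one restricts to the closure of the functions that have finite
  support on every coset of every \<open>N\<close>; such \<open>N\<close> are infinite, and as they are countably many, a
  decreasing sequence of slices leads to an extreme point outside each set of functions that are
  \<open>1\<close> on \<open>N\<close>.

  A nonabelian foot meets the group generated by the other feet trivially, so the functions can be
  extended from the abelian feet one nonabelian foot at a time.  By compactness only finitely many
  abelian feet matter.  For these, let \<open>L\<close> be a sum of feet and \<open>A\<close> a further foot.  If the conjugacy
  class of \<open>x\<close> generates \<open>L\<close>, then that of \<open>x a\<close> generates \<open>L A\<close> unless \<open>a = \<theta> x\<close> for an equivariant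
  homomorphism \<open>\<theta>\<close> from \<open>L\<close> to \<open>A\<close>; if \<open>\<xi>\<close> is a character of \<open>L\<close> that is nontrivial on every foot, then
  a character \<open>\<alpha>\<close> of \<open>A\<close> extends it in the same way unless \<open>\<alpha>\<close> is the conjugate of \<open>\<xi> \<theta>\<close> for an
  equivariant \<open>\<theta>\<close> from \<open>A\<close> to \<open>L\<close>.  Both steps are possible exactly if there are fewer equivariant
  homomorphisms than elements of \<open>A\<close>, and there are equally many in both directions.\<close>

section \<open>Extreme points of compact convex sets of functions\<close>

text \<open>Positive definite functions replace representations because they move freely between
  groups: restriction to a subgroup and extension by zero preserve positivity and the coset sums of
  feet inside the subgroup, and so stand in for restricting and inducing representations. Hence a
  character of \<open>MA\<close>, an irreducible representation of the minisocle and one of the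
  whole group all reduce to one condition, \<open>annih\<close> of the abelian feet being nonempty.
  The obstacle is faithfulness. Extremality alone says nothing about normal subgroups without finite
  feet, and the functions that are \<open>1\<close> on such a subgroup may contain extreme points.
  Nonempty slices act as neighbourhoods here: each can be refined so as to miss a given one of these
  sets, and a countable sequence of refinements still closes in on an extreme point. The vectors
  must live in a type fixed in advance. The Hilbert space is therefore realised by functions on the
  countable group, of which there are no more than real numbers, and is then copied along
  \<open>emb\<close>.\<close>

definition mix :: "real \<Rightarrow> ('a \<Rightarrow> complex) \<Rightarrow> ('a \<Rightarrow> complex) \<Rightarrow> 'a \<Rightarrow> complex" where
  "mix t f g = (\<lambda>x. of_real t * f x + of_real (1 - t) * g x)"

definition mix_closed :: "('a \<Rightarrow> complex) set \<Rightarrow> bool" where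
  "mix_closed K \<longleftrightarrow> (\<forall>f\<in>K. \<forall>g\<in>K. \<forall>t\<in>{0..1}. mix t f g \<in> K)"

text \<open>These are the continuous real-linear functionals for pointwise convergence:
  \<open>Re (z * cnj c)\<close> is the general real-linear form in one complex coordinate, and
  continuity allows only finitely many coordinates.\<close>

definition lin :: "'a set \<Rightarrow> ('a \<Rightarrow> complex) \<Rightarrow> ('a \<Rightarrow> complex) \<Rightarrow> real" where
  "lin T c f = (\<Sum>x\<in>T. Re (f x * cnj (c x)))"

text \<open>The strict inequality makes a slice relatively open in \<open>K\<close>; a slice that
  contains a mixture of two points of \<open>K\<close> contains one of the two.\<close>

definition slice :: "('a \<Rightarrow> complex) set \<Rightarrow> 'a set \<Rightarrow> ('a \<Rightarrow> complex) \<Rightarrow> real \<Rightarrow> ('a \<Rightarrow> complex) set" where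
  "slice K T c \<alpha> = {f\<in>K. \<alpha> < lin T c f}"

text \<open>For nonempty convex sets this is the convex hull of their union. It is empty as soon as
  one of them is, which accounts for the case distinction in \<open>separate_join\<close>.\<close>

definition join :: "('a \<Rightarrow> complex) set \<Rightarrow> ('a \<Rightarrow> complex) set \<Rightarrow> ('a \<Rightarrow> complex) set" where
  "join A B = {mix t u v |t u v. t \<in> {0..1} \<and> u \<in> A \<and> v \<in> B}"

lemma mix_0 [simp]: "mix 0 f g = g" and mix_1 [simp]: "mix 1 f g = f"
  by (auto simp: mix_def)

lemma lin_mix: "lin T c (mix t f g) = t * lin T c f + (1 - t) * lin T c g"
  unfolding lin_def mix_def
  by (simp add: sum_distrib_left sum.distrib[symmetric] algebra_simps)

lemma continuous_on_eval [continuous_intros]: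
  "continuous_on S (\<lambda>f::'a \<Rightarrow> complex. f x)"
  by (rule continuous_on_subset[OF continuous_on_product_coordinates]) auto

lemma continuous_on_lin: "continuous_on S (lin T c)"
  unfolding lin_def by (intro continuous_intros)

lemma closed_lin_le: "closed {f. lin T c f \<le> \<alpha>}" and closed_lin_ge: "closed {f. \<alpha> \<le> lin T c f}"
  by (intro closed_Collect_le continuous_on_lin continuous_intros)+

lemma compact_lin_le: "compact K \<Longrightarrow> compact {f\<in>K. lin T c f \<le> \<alpha>}"
  using compact_Int_closed[OF _ closed_lin_le, of K T c \<alpha>] by (simp add: Int_def)

lemma mix_closed_lin_le: "mix_closed K \<Longrightarrow> mix_closed {f\<in>K. lin T c f \<le> \<alpha>}"
  unfolding mix_closed_def by (auto simp: lin_mix intro!: convex_bound_le)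

lemma compact_join:
  assumes "compact A" "compact B"
  shows "compact (join A B)"
proof -
  have "join A B = (\<lambda>(t, u, v). mix t u v) ` ({0..1} \<times> A \<times> B)"
    by (force simp: join_def image_iff)
  moreover have "continuous_on ({0..1} \<times> A \<times> B) (\<lambda>p. mix (fst p) (fst (snd p)) (snd (snd p)))"
    unfolding mix_def
  proof (intro continuous_on_coordinatewise_then_product continuous_intros)
    fix i
    show "continuous_on ({0..1} \<times> A \<times> B) (\<lambda>p. fst (snd p) i)"
      by (rule continuous_on_product_then_coordinatewise)
        (intro continuous_on_fst continuous_on_snd continuous_on_id)
    show "continuous_on ({0..1} \<times> A \<times> B) (\<lambda>p. snd (snd p) i)"
      by (rule continuous_on_product_then_coordinatewise)
        (intro continuous_on_fst continuous_on_snd continuous_on_id)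
  qed
  ultimately show ?thesis
    using assms by (auto intro!: compact_continuous_image compact_Times simp: case_prod_unfold)
qed

text \<open>Dividing the weights by their sum turns the combination into a mixture; a zero sum has
  to be treated apart. A mixture of two points of a \<open>join\<close> regroups into such
  combinations, one in each of the two sets.\<close>

lemma mix_weights:
  fixes a b :: real
  assumes "mix_closed A" "u \<in> A" "u' \<in> A" "0 \<le> a" "0 \<le> b"
  shows "\<exists>w\<in>A. \<forall>x. of_real a * u x + of_real b * u' x = of_real (a + b) * w x"
proof (cases "a + b = 0")
  case True
  then have "a = 0" "b = 0" using assms by auto
  then show ?thesis using assms by auto
next
  case False
  then have ab: "a + b > 0" using assms by auto
  have "mix (a / (a + b)) u u' \<in> A"
    using assms ab unfolding mix_closed_def by auto
  moreover have "of_real a * u x + of_real b * u' x = of_real (a + b) * mix (a / (a + b)) u u' x" for x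
  proof -
    have "of_real (a + b) * (of_real (a / (a + b)) :: complex) = of_real a"
      using ab by (subst of_real_mult[symmetric]) simp
    moreover have "(a + b) * (1 - a / (a + b)) = b"
      using ab by (simp add: field_simps)
    then have "of_real (a + b) * (of_real (1 - a / (a + b)) :: complex) = of_real b"
      by (metis of_real_mult)
    ultimately show ?thesis
      unfolding mix_def by (simp only: distrib_left mult.assoc[symmetric])
  qed
  ultimately show ?thesis by blast
qed

lemma mix_closed_join:
  assumes "mix_closed A" "mix_closed B"
  shows "mix_closed (join A B)"
  unfolding mix_closed_def
proof (intro ballI)
  fix f g t assume "f \<in> join A B" "g \<in> join A B" and t: "t \<in> {0..1::real}"
  then obtain s u v s' u' v' where f: "f = mix s u v" "s \<in> {0..1}" "u \<in> A" "v \<in> B"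
    and g: "g = mix s' u' v'" "s' \<in> {0..1}" "u' \<in> A" "v' \<in> B"
    unfolding join_def by blast
  obtain w where w: "w \<in> A"
    "\<forall>x. of_real (t * s) * u x + of_real ((1 - t) * s') * u' x = of_real (t * s + (1 - t) * s') * w x"
    using mix_weights[OF assms(1) f(3) g(3), of "t * s" "(1 - t) * s'"] t f g by auto
  obtain z where z: "z \<in> B"
    "\<forall>x. of_real (t * (1 - s)) * v x + of_real ((1 - t) * (1 - s')) * v' x
        = of_real (t * (1 - s) + (1 - t) * (1 - s')) * z x"
    using mix_weights[OF assms(2) f(4) g(4), of "t * (1 - s)" "(1 - t) * (1 - s')"] t f g by auto
  have "mix t f g = mix (t * s + (1 - t) * s') w z"
  proof
    fix x
    have "mix t f g x = (of_real (t * s) * u x + of_real ((1 - t) * s') * u' x)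
        + (of_real (t * (1 - s)) * v x + of_real ((1 - t) * (1 - s')) * v' x)"
      unfolding f g mix_def by (simp add: algebra_simps)
    also have "\<dots> = of_real (t * s + (1 - t) * s') * w x
        + of_real (t * (1 - s) + (1 - t) * (1 - s')) * z x"
      using w z by simp
    also have "t * (1 - s) + (1 - t) * (1 - s') = 1 - (t * s + (1 - t) * s')"
      by (simp add: algebra_simps)
    finally show "mix t f g x = mix (t * s + (1 - t) * s') w z x"
      by (simp add: mix_def)
  qed
  moreover have "t * s + (1 - t) * s' \<in> {0..1}"
    using t f g by (auto intro!: convex_bound_le)
  ultimately show "mix t f g \<in> join A B"
    using w z unfolding join_def by blast
qed

text \<open>Finitely many coordinates already tell \<open>f\<close> from the points of \<open>C\<close>; in these the point of
  \<open>C\<close> nearest to \<open>f\<close> gives the separating functional.\<close>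

lemma separate_point:
  assumes "compact C" "mix_closed C" "f \<notin> C"
  shows "\<exists>T c \<alpha>. finite T \<and> (\<forall>g\<in>C. lin T c g \<le> \<alpha>) \<and> \<alpha> < lin T c f"
proof (cases "C = {}")
  case True
  then show ?thesis by (intro exI[of _ "{}"] exI[of _ undefined] exI[of _ "-1"]) (simp add: lin_def)
next
  case False
  have sub: "C \<subseteq> (\<Union>x\<in>UNIV. {g. g x \<noteq> f x})"
    using assms(3) by (auto, metis ext)
  have opn: "open {g. g x \<noteq> f x}" for x
    by (intro open_Collect_neq continuous_intros)
  obtain T where T: "finite T" "C \<subseteq> (\<Union>x\<in>T. {g. g x \<noteq> f x})"
    by (rule compactE_image[OF assms(1) opn sub])
  define d where "d g = (\<Sum>x\<in>T. (cmod (g x - f x))\<^sup>2)" for g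
  have "continuous_on C d"
    unfolding d_def by (intro continuous_intros)
  then obtain c0 where c0: "c0 \<in> C" "\<And>g. g \<in> C \<Longrightarrow> d c0 \<le> d g"
    using continuous_attains_inf[OF assms(1) False] by blast
  define c where "c x = f x - c0 x" for x
  have "d c0 > 0"
  proof -
    obtain x where "x \<in> T" "c0 x \<noteq> f x" using T c0 by auto
    then show ?thesis unfolding d_def using T(1) by (intro sum_pos2[of T x]) auto
  qed
  moreover have "lin T c f - lin T c c0 = d c0"
    unfolding lin_def d_def sum_subtractf[symmetric]
    by (rule sum.cong) (simp_all add: c_def cmod_power2, simp add: power2_eq_square algebra_simps)
  moreover have "lin T c g \<le> lin T c c0" if g: "g \<in> C" for g
  proof -
    define A where "A = (\<Sum>x\<in>T. (cmod (g x - c0 x))\<^sup>2)"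
    define b where "b = lin T c g - lin T c c0"
    \<comment> \<open>Squared distance to \<open>f\<close> along the segment from \<open>c0\<close>
      towards \<open>g\<close>. Minimality at \<open>c0\<close> forbids a negative slope at
      \<open>t = 0\<close>, that is, \<open>b > 0\<close>.\<close>
    have exp: "d (mix t g c0) = t\<^sup>2 * A - 2 * t * b + d c0" for t
      unfolding A_def b_def d_def lin_def sum_subtractf[symmetric] sum_distrib_left sum.distrib[symmetric]
        by (rule sum.cong) (simp_all add: c_def mix_def cmod_power2, simp add: power2_eq_square algebra_simps)
    have ineq: "2 * b \<le> t * A" if t: "0 < t" "t \<le> 1" for t
    proof -
      have "d c0 \<le> d (mix t g c0)"
        using c0 g t assms(2) unfolding mix_closed_def by auto
      then have "t * (2 * b) \<le> t * (t * A)"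
        unfolding exp by (simp add: power2_eq_square algebra_simps)
      then show ?thesis using t by simp
    qed
    have "A \<ge> 0" unfolding A_def by (simp add: sum_nonneg)
    have "\<not> 0 < b"
    proof
      assume b: "0 < b"
      \<comment> \<open>\<open>A + 1\<close> avoids a division by zero; the choice gives
        \<open>t * A \<le> b < 2 * b\<close>, against \<open>ineq\<close>.\<close>
      define t where "t = min 1 (b / (A + 1))"
      have t: "0 < t" "t \<le> 1" "t \<le> b / (A + 1)" using b \<open>A \<ge> 0\<close> by (auto simp: t_def)
      have "t * A \<le> b / (A + 1) * A" using t \<open>A \<ge> 0\<close> by (intro mult_right_mono) auto
      also have "\<dots> \<le> b" using b \<open>A \<ge> 0\<close> by (simp add: field_simps)
      finally show False using ineq[of t] t b by linarith
    qed
    then show ?thesis by (simp add: b_def)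
  qed
  ultimately show ?thesis using T(1)
    by (intro exI[of _ T] exI[of _ c] exI[of _ "lin T c c0"]) auto
qed

text \<open>With both sets nonempty, the weights \<open>1\<close> and \<open>0\<close> show that
  \<open>join A B\<close> contains \<open>A\<close> and \<open>B\<close>, so a functional separating
  \<open>f\<close> from this one compact convex set serves for all three.\<close>

lemma separate_join:
  assumes "compact A" "mix_closed A" "compact B" "mix_closed B"
    and "f \<notin> A" "f \<notin> B" "f \<notin> join A B"
  shows "\<exists>T c \<alpha>. finite T \<and> (\<forall>g\<in>A \<union> B. lin T c g \<le> \<alpha>) \<and> \<alpha> < lin T c f"
proof -
  consider "A = {}" | "B = {}" | "A \<noteq> {}" "B \<noteq> {}" by blast
  then show ?thesis
  proof cases
    case 1 then show ?thesis using separate_point[OF assms(3,4,6)] by simp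
  next
    case 2 then show ?thesis using separate_point[OF assms(1,2,5)] by simp
  next
    case 3
    obtain u0 v0 where "u0 \<in> A" "v0 \<in> B" using 3 by blast
    then have "mix 1 u v0 \<in> join A B" if "u \<in> A" for u
      using that unfolding join_def by (intro CollectI exI conjI) (rule refl, auto)
    then have "A \<subseteq> join A B" by auto
    moreover have "mix 0 u0 v \<in> join A B" if "v \<in> B" for v
      using that \<open>u0 \<in> A\<close> unfolding join_def by (intro CollectI exI conjI) (rule refl, auto)
    then have "B \<subseteq> join A B" by auto
    moreover obtain T c \<alpha> where "finite T" "\<forall>g\<in>join A B. lin T c g \<le> \<alpha>" "\<alpha> < lin T c f"
      using separate_point[OF compact_join[OF assms(1,3)] mix_closed_join[OF assms(2,4)] assms(7)] by auto
    ultimately show ?thesis by (intro exI[of _ T] exI[of _ c] exI[of _ \<alpha>]) auto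
  qed
qed

text \<open>Adding to \<open>A\<close> the parts of \<open>K\<close> below increasing levels of \<open>\<phi>\<close>, one exhausts \<open>K\<close> at some
  step; what the step adds is \<open>\<phi>\<close>-thin, and near the top of a functional separating from the
  previous stage no other points are left.\<close>

lemma small_slice:
  assumes K: "compact K" "mix_closed K" and ne: "slice K T c \<alpha> \<noteq> {}" and e: "0 < (e::real)"
  obtains T1 c1 \<alpha>1 where "finite T1" "slice K T1 c1 \<alpha>1 \<noteq> {}" "slice K T1 c1 \<alpha>1 \<subseteq> slice K T c \<alpha>"
    "\<And>f g. f \<in> slice K T1 c1 \<alpha>1 \<Longrightarrow> g \<in> slice K T1 c1 \<alpha>1 \<Longrightarrow> \<bar>lin T' c' f - lin T' c' g\<bar> \<le> e"
proof -
  let ?\<phi> = "lin T' c'"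
  have "compact (?\<phi> ` K)" using K(1) by (intro compact_continuous_image continuous_on_lin)
  then have "bounded (?\<phi> ` K)" by (rule compact_imp_bounded)
  then obtain M0 where M0: "\<And>f. f \<in> K \<Longrightarrow> \<bar>?\<phi> f\<bar> \<le> M0" by (auto simp: bounded_iff)
  \<comment> \<open>A strict bound for the functional on \<open>K\<close>, so that the lowest level
    set \<open>B 0\<close> is empty.\<close>
  define M where "M = \<bar>M0\<bar> + 1"
  have M: "\<And>f. f \<in> K \<Longrightarrow> \<bar>?\<phi> f\<bar> < M" "M > 0" using M0 unfolding M_def by force+
  define A where "A = {f\<in>K. lin T c f \<le> \<alpha>}"
  define B where "B n = {f\<in>K. ?\<phi> f \<le> - M + real n * (e/3)}" for n
  have A: "compact A" "mix_closed A" and B: "compact (B n)" "mix_closed (B n)" for n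
    unfolding A_def B_def by (intro compact_lin_le mix_closed_lin_le K)+
  \<comment> \<open>\<open>good n\<close> says that the convex hull of \<open>A\<close> and
    \<open>B n\<close> exhausts \<open>K\<close>. It fails for \<open>n = 0\<close>, as the points
    of the given slice lie outside \<open>A\<close>, and it holds once the level exceeds
    \<open>M\<close>; so some step from \<open>n\<close> to \<open>Suc n\<close> makes the
    change.\<close>
  define good where "good n \<longleftrightarrow> K \<subseteq> A \<union> B n \<union> join A (B n)" for n
  have "\<not> good 0"
  proof -
    have "B 0 = {}" unfolding B_def using M by force
    moreover have "join A {} = {}" by (simp add: join_def)
    ultimately show ?thesis using ne unfolding good_def slice_def A_def by auto
  qed
  moreover have "\<exists>n. good n"
  proof -
    obtain n where "2 * M < real n * (e/3)"
      using reals_Archimedean3[of "e/3"] e by (meson divide_pos_pos zero_less_numeral)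
    then have "K \<subseteq> B n" unfolding B_def using M by force
    then show ?thesis unfolding good_def by auto
  qed
  ultimately obtain n where n: "\<not> good n" "good (Suc n)"
    by (metis not0_implies_Suc LeastI_ex lessI not_less_Least)
  then obtain f0 where f0: "f0 \<in> K" "f0 \<notin> A" "f0 \<notin> B n" "f0 \<notin> join A (B n)"
    unfolding good_def by auto
  obtain T1 c1 \<alpha>0 where T1: "finite T1" "\<And>g. g \<in> A \<union> B n \<Longrightarrow> lin T1 c1 g \<le> \<alpha>0" "\<alpha>0 < lin T1 c1 f0"
    using separate_join[OF A B f0(2-4)] by auto
  obtain fm where fm: "fm \<in> K" "\<And>g. g \<in> K \<Longrightarrow> lin T1 c1 g \<le> lin T1 c1 fm"
    using continuous_attains_sup[OF K(1) _ continuous_on_lin] f0(1) by blast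
  define m where "m = lin T1 c1 fm"
  have m: "\<alpha>0 < m" using fm f0(1) T1(3) unfolding m_def by force
  \<comment> \<open>Above \<open>\<alpha>1\<close> a point of \<open>join A (B (Suc n))\<close> has
    weight below \<open>\<delta>\<close> on \<open>A\<close>. Values of \<open>?\<phi>\<close>
    differ by at most \<open>2 * M\<close>, so this weight moves \<open>?\<phi>\<close> by at most
    \<open>e / 3\<close>; the step from level \<open>n\<close> to level \<open>Suc n\<close> costs
    another \<open>e / 3\<close>.\<close>
  define \<delta> where "\<delta> = min 1 (e / (6 * M))"
  have \<delta>: "0 < \<delta>" "\<delta> \<le> 1" "\<delta> \<le> e / (6 * M)" using e M(2) by (auto simp: \<delta>_def)
  define \<alpha>1 where "\<alpha>1 = m - \<delta> * (m - \<alpha>0)"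
  have "\<delta> * (m - \<alpha>0) \<le> m - \<alpha>0" using \<delta> m by (intro mult_left_le_one_le) auto
  then have a10: "\<alpha>0 \<le> \<alpha>1" unfolding \<alpha>1_def by linarith
  have "\<alpha>1 < m" using \<delta> m unfolding \<alpha>1_def by auto
  then have ne1: "slice K T1 c1 \<alpha>1 \<noteq> {}" using fm unfolding slice_def m_def by auto
  have notin: "f \<notin> A" "f \<notin> B n" if "f \<in> slice K T1 c1 \<alpha>1" for f
    using T1(2)[of f] that a10 unfolding slice_def by fastforce+
  have range: "- M + real n * (e/3) \<le> ?\<phi> f \<and> ?\<phi> f \<le> - M + real n * (e/3) + 2 * (e/3)"
    if f: "f \<in> slice K T1 c1 \<alpha>1" for f
  proof -
    have fK: "f \<in> K" using f by (simp add: slice_def)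
    have lo: "- M + real n * (e/3) \<le> ?\<phi> f" using notin(2)[OF f] fK unfolding B_def by auto
    have "f \<in> B (Suc n) \<union> join A (B (Suc n))" using n(2) fK notin(1)[OF f] unfolding good_def by auto
    then have "?\<phi> f \<le> - M + real n * (e/3) + 2 * (e/3)"
    proof
      assume "f \<in> B (Suc n)"
      then have "?\<phi> f \<le> - M + real (Suc n) * (e/3)" unfolding B_def by simp
      moreover have "real (Suc n) * (e/3) = real n * (e/3) + e/3" by (simp add: algebra_simps)
      ultimately show ?thesis using e by linarith
    next
      assume "f \<in> join A (B (Suc n))"
      then obtain t u v where t: "f = mix t u v" "0 \<le> t" "t \<le> 1" "u \<in> A" "v \<in> B (Suc n)"
        unfolding join_def by auto
      have uv: "u \<in> K" "v \<in> K" using t unfolding A_def B_def by auto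
      have "lin T1 c1 f = t * lin T1 c1 u + (1 - t) * lin T1 c1 v" by (simp add: t(1) lin_mix)
      also have "\<dots> \<le> t * \<alpha>0 + (1 - t) * m"
        using T1(2)[of u] fm(2)[OF uv(2)] t unfolding m_def by (intro add_mono mult_left_mono) auto
      finally have "m - \<delta> * (m - \<alpha>0) < m - t * (m - \<alpha>0)"
        using f unfolding slice_def \<alpha>1_def by (simp add: algebra_simps)
      then have "t < \<delta>" using m by simp
      have "t * (?\<phi> u - ?\<phi> v) \<le> t * (2 * M)"
        using M(1)[OF uv(1)] M(1)[OF uv(2)] t by (intro mult_left_mono) auto
      also have "\<dots> \<le> e / (6 * M) * (2 * M)"
        using \<open>t < \<delta>\<close> \<delta> M(2) by (intro mult_right_mono) auto
      also have "\<dots> = e / 3" using M(2) by simp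
      finally have "t * (?\<phi> u - ?\<phi> v) \<le> e / 3" .
      moreover have "?\<phi> f = t * (?\<phi> u - ?\<phi> v) + ?\<phi> v" by (simp add: t(1) lin_mix algebra_simps)
      moreover have "?\<phi> v \<le> - M + real (Suc n) * (e/3)" using t(5) unfolding B_def by simp
      moreover have "real (Suc n) * (e/3) = real n * (e/3) + e/3" by (simp add: algebra_simps)
      ultimately show ?thesis by linarith
    qed
    with lo show ?thesis by simp
  qed
  have "slice K T1 c1 \<alpha>1 \<subseteq> slice K T c \<alpha>"
    using notin(1) unfolding A_def slice_def by force
  moreover have "\<bar>?\<phi> f - ?\<phi> g\<bar> \<le> e" if "f \<in> slice K T1 c1 \<alpha>1" "g \<in> slice K T1 c1 \<alpha>1" for f g
    using range[OF that(1)] range[OF that(2)] e by (simp add: abs_le_iff)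
  ultimately show ?thesis by (rule that[OF T1(1) ne1])
qed

definition extreme_in :: "('a \<Rightarrow> complex) \<Rightarrow> ('a \<Rightarrow> complex) set \<Rightarrow> bool" where
  "extreme_in p K \<longleftrightarrow> p \<in> K \<and>
     (\<forall>q\<in>K. \<forall>r\<in>K. \<forall>t. 0 < t \<and> t < 1 \<and> p = mix t q r \<longrightarrow> q = p)"

text \<open>The intersection of a decreasing sequence of slices with oscillation tending to \<open>0\<close> in every
  coordinate is an extreme point: if it lies between \<open>q\<close> and \<open>r\<close>, each slice contains \<open>q\<close> or \<open>r\<close>.\<close>

theorem extreme_avoiding:
  fixes K :: "('a \<Rightarrow> complex) set"
  assumes K: "compact K" "mix_closed K" "K \<noteq> {}"
    and G: "countable G" "\<And>f x. f \<in> K \<Longrightarrow> x \<notin> G \<Longrightarrow> f x = 0"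
    and cF: "countable \<F>"
    and avoid: "\<And>F T c \<alpha>. F \<in> \<F> \<Longrightarrow> finite T \<Longrightarrow> slice K T c \<alpha> \<noteq> {} \<Longrightarrow>
       \<exists>T' c' \<alpha>'. finite T' \<and> slice K T' c' \<alpha>' \<noteq> {} \<and> slice K T' c' \<alpha>' \<subseteq> slice K T c \<alpha> \<and>
         slice K T' c' \<alpha>' \<inter> F = {}"
  shows "\<exists>p. extreme_in p K \<and> p \<notin> \<Union>\<F>"
proof -
  define isS where "isS S \<longleftrightarrow> (\<exists>T c \<alpha>. finite T \<and> S = slice K T c \<alpha> \<and> S \<noteq> {})" for S
  have isSI: "isS (slice K T c \<alpha>)" if "finite T" "slice K T c \<alpha> \<noteq> {}" for T c \<alpha>
    using that unfolding isS_def by auto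
  \<comment> \<open>The coefficients \<open>1\<close> and \<open>\<i>\<close> pick out the real and
    the imaginary part of the coordinate at \<open>x\<close>.\<close>
  define Osc where "Osc x c n = {S. \<forall>f\<in>S. \<forall>g\<in>S. \<bar>lin {x} (\<lambda>_. c) f - lin {x} (\<lambda>_. c) g\<bar> \<le> 1 / real (Suc n)}"
    for x :: 'a and c :: complex and n
  \<comment> \<open>All requirements in one countable set. The vacuous requirement
    \<open>UNIV\<close> guarantees that there is something to enumerate.\<close>
  define Req where "Req = insert UNIV ((\<lambda>(x, c, n). Osc x c n) ` (G \<times> {1, \<i>} \<times> UNIV) \<union>
      (\<lambda>F. {S. S \<inter> F = {}}) ` \<F>)"
  have Req: "countable Req" "Req \<noteq> {}"
    unfolding Req_def using G(1) cF by (auto intro!: countable_SIGMA countable_finite)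
  have step: "\<exists>S'. isS S' \<and> S' \<subseteq> S \<and> S' \<in> R" if S: "isS S" and R: "R \<in> Req" for S R
  proof -
    obtain T c \<alpha> where T: "finite T" "S = slice K T c \<alpha>" "S \<noteq> {}" using S unfolding isS_def by auto
    consider "R = UNIV" | x c' n where "R = Osc x c' n" | F where "F \<in> \<F>" "R = {S. S \<inter> F = {}}"
      using R unfolding Req_def by auto
    then show ?thesis
    proof cases
      case 1 then show ?thesis using S by auto
    next
      case 2
      obtain T1 c1 \<alpha>1 where "finite T1" "slice K T1 c1 \<alpha>1 \<noteq> {}" "slice K T1 c1 \<alpha>1 \<subseteq> slice K T c \<alpha>"
        "\<And>f g. f \<in> slice K T1 c1 \<alpha>1 \<Longrightarrow> g \<in> slice K T1 c1 \<alpha>1 \<Longrightarrow>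
          \<bar>lin {x} (\<lambda>_. c') f - lin {x} (\<lambda>_. c') g\<bar> \<le> 1 / real (Suc n)"
        using small_slice[OF K(1,2), of T c \<alpha> "1 / real (Suc n)" "{x}" "\<lambda>_. c'"] T(2,3) by auto
      then have "isS (slice K T1 c1 \<alpha>1) \<and> slice K T1 c1 \<alpha>1 \<subseteq> S \<and> slice K T1 c1 \<alpha>1 \<in> R"
        using isSI T(2) unfolding 2 Osc_def by simp
      then show ?thesis by (intro exI)
    next
      case 3
      obtain T' c' \<alpha>' where "finite T'" "slice K T' c' \<alpha>' \<noteq> {}" "slice K T' c' \<alpha>' \<subseteq> slice K T c \<alpha>"
        "slice K T' c' \<alpha>' \<inter> F = {}"
        using avoid[OF 3(1) T(1), of c \<alpha>] T(2,3) by auto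
      then have "isS (slice K T' c' \<alpha>') \<and> slice K T' c' \<alpha>' \<subseteq> S \<and> slice K T' c' \<alpha>' \<in> R"
        using isSI T(2) 3(2) by simp
      then show ?thesis by (intro exI)
    qed
  qed
  \<comment> \<open>A threshold \<open>\<beta>\<close> strictly between \<open>\<alpha>\<close> and
    a value attained in \<open>S\<close> puts a closed half-space between the new slice and the old
    one. The closed sets obtained in this way make compactness applicable to a decreasing sequence
    of open slices.\<close>
  have shrink: "\<exists>S' C. isS S' \<and> closed C \<and> S' \<subseteq> C \<and> C \<inter> K \<subseteq> S" if S: "isS S" for S
  proof -
    obtain T c \<alpha> f where T: "finite T" "S = slice K T c \<alpha>" "f \<in> S" using S unfolding isS_def by auto
    define \<beta> where "\<beta> = (\<alpha> + lin T c f) / 2"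
    have \<beta>: "\<alpha> < \<beta>" "\<beta> < lin T c f" using T unfolding \<beta>_def slice_def by auto
    have "isS (slice K T c \<beta>)" unfolding isS_def using T \<beta>
      by (intro exI[of _ T] exI[of _ c] exI[of _ \<beta>]) (auto simp: slice_def)
    moreover have "closed {f. \<beta> \<le> lin T c f}" by (rule closed_lin_ge)
    moreover have "slice K T c \<beta> \<subseteq> {f. \<beta> \<le> lin T c f}" unfolding slice_def by auto
    moreover have "{f. \<beta> \<le> lin T c f} \<inter> K \<subseteq> S" using T(2) \<beta> unfolding slice_def by auto
    ultimately have "isS (slice K T c \<beta>) \<and> closed {f. \<beta> \<le> lin T c f} \<and>
        slice K T c \<beta> \<subseteq> {f. \<beta> \<le> lin T c f} \<and> {f. \<beta> \<le> lin T c f} \<inter> K \<subseteq> S" by simp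
    then show ?thesis by (intro exI)
  qed
  have "\<exists>S C. \<forall>n. isS (S n) \<and>
      (closed (C n) \<and> S (Suc n) \<subseteq> C n \<and> C n \<inter> K \<subseteq> S n \<and> S (Suc n) \<in> from_nat_into Req n)"
  proof -
    have "\<exists>S'. isS S' \<and> (\<exists>C. closed C \<and> S' \<subseteq> C \<and> C \<inter> K \<subseteq> S \<and> S' \<in> from_nat_into Req n)"
      if S0: "isS S" for S n
    proof -
      obtain S1 C where 1: "isS S1" "closed C" "S1 \<subseteq> C" "C \<inter> K \<subseteq> S" using shrink[OF S0] by auto
      obtain S' where "isS S'" "S' \<subseteq> S1" "S' \<in> from_nat_into Req n"
        using step[OF 1(1) from_nat_into[OF Req(2)]] by auto
      then have "isS S' \<and> closed C \<and> S' \<subseteq> C \<and> C \<inter> K \<subseteq> S \<and> S' \<in> from_nat_into Req n"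
        using 1 by simp
      then show ?thesis by auto
    qed
    moreover have "isS K"
      unfolding isS_def slice_def lin_def using K(3)
      by (intro exI[of _ "{}"] exI[of _ undefined] exI[of _ "-1"]) auto
    ultimately have "\<exists>S. \<forall>n. isS (S n) \<and>
        (\<exists>C. closed C \<and> S (Suc n) \<subseteq> C \<and> C \<inter> K \<subseteq> S n \<and> S (Suc n) \<in> from_nat_into Req n)"
      by (intro dependent_nat_choice) auto
    then show ?thesis by metis
  qed
  then obtain S C where S: "\<And>n. isS (S n)" "\<And>n. closed (C n)" "\<And>n. S (Suc n) \<subseteq> C n"
    "\<And>n. C n \<inter> K \<subseteq> S n" "\<And>n. S (Suc n) \<in> from_nat_into Req n" by blast
  have SK: "S n \<subseteq> K" "S n \<noteq> {}" for n using S(1)[of n] unfolding isS_def slice_def by auto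
  have "S (Suc n) \<subseteq> S n" for n using S(3,4)[of n] SK(1)[of "Suc n"] by blast
  then have mono: "S n \<subseteq> S m" if "m \<le> n" for m n using that by (rule lift_Suc_antimono_le)
  have "K \<inter> (\<Inter>n\<in>UNIV. C n) \<noteq> {}"
  proof (rule compact_imp_fip_image[OF K(1)])
    fix I :: "nat set" assume "finite I"
    then obtain m where m: "\<And>n. n \<in> I \<Longrightarrow> n \<le> m" by (meson Max_ge)
    obtain f where f: "f \<in> S (Suc m)" using SK(2) by blast
    have "f \<in> C n" if "n \<in> I" for n using m[OF that] mono[of "Suc n" "Suc m"] S(3)[of n] f by auto
    then show "K \<inter> (\<Inter>n\<in>I. C n) \<noteq> {}" using f SK(1) by blast
  qed (simp add: S(2))
  then obtain p where p: "p \<in> K" "\<And>n. p \<in> C n" by auto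
  have pS: "p \<in> S n" for n using p S(4)[of n] by auto
  have req: "\<exists>n. S n \<in> R" if "R \<in> Req" for R
    using from_nat_into_surj[OF Req(1) that] S(5) by metis
  have uniq: "q = p" if q: "q \<in> K" "\<And>n. q \<in> S n" for q
  proof
    fix x show "q x = p x"
    proof (cases "x \<in> G")
      case False then show ?thesis using G(2)[OF p(1)] G(2)[OF q(1)] by metis
    next
      case True
      have eq: "lin {x} (\<lambda>_. c) q = lin {x} (\<lambda>_. c) p" if c: "c \<in> {1, \<i>}" for c
      proof (rule ccontr)
        assume "lin {x} (\<lambda>_. c) q \<noteq> lin {x} (\<lambda>_. c) p"
        then obtain n where n: "1 / real (Suc n) < \<bar>lin {x} (\<lambda>_. c) q - lin {x} (\<lambda>_. c) p\<bar>"
          using nat_approx_posE[of "\<bar>lin {x} (\<lambda>_. c) q - lin {x} (\<lambda>_. c) p\<bar>"] by auto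
        have "Osc x c n \<in> Req" 
          unfolding Req_def using True c by (intro insertI2 UnI1 image_eqI[of _ _ "(x, c, n)"]) auto
        then obtain k where "S k \<in> Osc x c n" using req by blast
        then show False using n q(2)[of k] pS[of k] unfolding Osc_def by force
      qed
      show ?thesis using eq[of 1] eq[of \<i>] by (auto simp: lin_def complex_eq_iff)
    qed
  qed
  have "extreme_in p K"
    unfolding extreme_in_def
  proof (intro conjI p ballI allI impI)
    fix q r t assume q: "q \<in> K" and r: "r \<in> K" and t: "0 < t \<and> t < 1 \<and> p = mix t q r"
    have or: "q \<in> S n \<or> r \<in> S n" for n
    proof (rule ccontr)
      obtain T c \<alpha> where T: "S n = slice K T c \<alpha>" using S(1)[of n] unfolding isS_def by auto
      assume "\<not> ?thesis"
      then have "lin T c q \<le> \<alpha>" "lin T c r \<le> \<alpha>" using q r unfolding T slice_def by auto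
      then have "lin T c p \<le> \<alpha>" using t by (simp add: lin_mix convex_bound_le)
      then show False using pS[of n] unfolding T slice_def by auto
    qed
    show "q = p"
    \<comment> \<open>The slices decrease, so a point missing from one is missing from all later
      ones. If this happens to \<open>q\<close>, then \<open>r\<close> lies in every slice and
      equals \<open>p\<close>, and a mixture of \<open>q\<close> and \<open>p\<close> that gives
      \<open>p\<close> forces \<open>q = p\<close>.\<close>
    proof (cases "\<forall>n. q \<in> S n")
      case True then show ?thesis using uniq q by blast
    next
      case False
      then obtain n0 where n0: "q \<notin> S n0" by auto
      have "r \<in> S n" for n
      proof -
        have "q \<notin> S (max n n0)" using n0 mono[of n0 "max n n0"] by auto
        then show ?thesis using or[of "max n n0"] mono[of n "max n n0"] by auto
      qed
      then have "r = p" using uniq r by blast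
      then have *: "p = mix t q p" using t by simp
      show ?thesis
      proof
        fix x
        have "p x = of_real t * q x + of_real (1 - t) * p x" using * unfolding mix_def by (rule fun_cong)
        then have "of_real t * (q x - p x) = 0" by (auto simp: algebra_simps)
        then show "q x = p x" using t by simp
      qed
    qed
  qed
  moreover have "p \<notin> F" if "F \<in> \<F>" for F
  proof -
    have "{S. S \<inter> F = {}} \<in> Req" using that unfolding Req_def by auto
    then show ?thesis using req pS by blast
  qed
  ultimately show ?thesis by blast
qed

section \<open>Positive definite functions\<close>

text \<open>Only the real part of the quadratic form is constrained, so the Hermitian symmetry that
  makes the form real is demanded separately. The value \<open>0\<close> off the carrier lets the
  values on the group determine the function.\<close>

definition pd :: "('g, 'b) monoid_scheme \<Rightarrow> ('g \<Rightarrow> complex) set" where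
  "pd G = {f. (\<forall>x. x \<notin> carrier G \<longrightarrow> f x = 0) \<and> f \<one>\<^bsub>G\<^esub> = 1 \<and>
     (\<forall>x\<in>carrier G. f (inv\<^bsub>G\<^esub> x) = cnj (f x)) \<and>
     (\<forall>S a. finite S \<and> S \<subseteq> carrier G \<longrightarrow>
        0 \<le> Re (\<Sum>x\<in>S. \<Sum>y\<in>S. a x * cnj (a y) * f (inv\<^bsub>G\<^esub> y \<otimes>\<^bsub>G\<^esub> x)))}"

text \<open>If \<open>f\<close> is the vector state of a unit vector \<open>\<xi>\<close> under \<open>\<pi>\<close>, then \<open>twist G f S a\<close> is the
  unnormalised vector state of \<open>\<Sum>x\<in>S. a x \<pi>(x) \<xi>\<close>.\<close>

definition twist ::
  "('g, 'b) monoid_scheme \<Rightarrow> ('g \<Rightarrow> complex) \<Rightarrow> 'g set \<Rightarrow> ('g \<Rightarrow> complex) \<Rightarrow> 'g \<Rightarrow> complex" where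
  "twist G f S a = (\<lambda>g. if g \<in> carrier G
     then \<Sum>x\<in>S. \<Sum>y\<in>S. a x * cnj (a y) * f (inv\<^bsub>G\<^esub> y \<otimes>\<^bsub>G\<^esub> g \<otimes>\<^bsub>G\<^esub> x) else 0)"

definition twist_closed :: "('g, 'b) monoid_scheme \<Rightarrow> ('g \<Rightarrow> complex) set \<Rightarrow> bool" where
  "twist_closed G K \<longleftrightarrow> (\<forall>f\<in>K. \<forall>S a. finite S \<and> S \<subseteq> carrier G \<and> twist G f S a \<one>\<^bsub>G\<^esub> \<noteq> 0 \<longrightarrow>
     (\<lambda>g. twist G f S a g / twist G f S a \<one>\<^bsub>G\<^esub>) \<in> K)"

text \<open>Vector states of representations in which no member of \<open>\<A>\<close> has a nonzero fixed vector.\<close>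

definition annih :: "('g, 'b) monoid_scheme \<Rightarrow> 'g set set \<Rightarrow> ('g \<Rightarrow> complex) set" where
  "annih G \<A> = {f\<in>pd G. \<forall>A\<in>\<A>. \<forall>\<gamma>\<in>carrier G. (\<Sum>x\<in>A. f (\<gamma> \<otimes>\<^bsub>G\<^esub> x)) = 0}"

lemma tendsto_funI:
  fixes f :: "'i \<Rightarrow> 'a \<Rightarrow> 'b::topological_space"
  assumes "\<And>x. ((\<lambda>i. f i x) \<longlongrightarrow> l x) F"
  shows "(f \<longlongrightarrow> l) F"
proof -
  have "limitin (product_topology (\<lambda>i. euclidean) UNIV) f l F"
    using assms by (simp add: limitin_componentwise)
  then show ?thesis by (simp add: euclidean_product_topology)
qed

lemma pd_off: "f \<in> pd G \<Longrightarrow> x \<notin> carrier G \<Longrightarrow> f x = 0"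
  and pd_one: "f \<in> pd G \<Longrightarrow> f \<one>\<^bsub>G\<^esub> = 1"
  and pd_inv: "f \<in> pd G \<Longrightarrow> x \<in> carrier G \<Longrightarrow> f (inv\<^bsub>G\<^esub> x) = cnj (f x)"
  and pd_nonneg: "f \<in> pd G \<Longrightarrow> finite S \<Longrightarrow> S \<subseteq> carrier G \<Longrightarrow>
        0 \<le> Re (\<Sum>x\<in>S. \<Sum>y\<in>S. a x * cnj (a y) * f (inv\<^bsub>G\<^esub> y \<otimes>\<^bsub>G\<^esub> x))"
  by (auto simp: pd_def)

lemma pdI:
  assumes "\<And>x. x \<notin> carrier G \<Longrightarrow> f x = 0" "f \<one>\<^bsub>G\<^esub> = 1"
    "\<And>x. x \<in> carrier G \<Longrightarrow> f (inv\<^bsub>G\<^esub> x) = cnj (f x)"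
    "\<And>S a. finite S \<Longrightarrow> S \<subseteq> carrier G \<Longrightarrow>
        0 \<le> Re (\<Sum>x\<in>S. \<Sum>y\<in>S. a x * cnj (a y) * f (inv\<^bsub>G\<^esub> y \<otimes>\<^bsub>G\<^esub> x))"
  shows "f \<in> pd G"
  unfolding pd_def using assms by blast

lemma closed_pd: "closed (pd G)"
proof -
  have "pd G = (\<Inter>x\<in>- carrier G. {f. f x = 0}) \<inter> {f. f \<one>\<^bsub>G\<^esub> = 1} \<inter>
     (\<Inter>x\<in>carrier G. {f. f (inv\<^bsub>G\<^esub> x) = cnj (f x)}) \<inter>
     (\<Inter>(S, a)\<in>{(S, a). finite S \<and> S \<subseteq> carrier G}.
        {f. 0 \<le> Re (\<Sum>x\<in>S. \<Sum>y\<in>S. a x * cnj (a y) * f (inv\<^bsub>G\<^esub> y \<otimes>\<^bsub>G\<^esub> x))})"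
    unfolding pd_def by auto
  moreover have "closed \<dots>"
    by (intro closed_Int closed_INT ballI)
      (auto intro!: closed_Collect_eq closed_Collect_le continuous_intros)
  ultimately show ?thesis by simp
qed

lemma mix_closed_pd: "mix_closed (pd G)"
  unfolding mix_closed_def
proof (intro ballI)
  fix f g t assume f: "f \<in> pd G" and g: "g \<in> pd G" and t: "t \<in> {0..1::real}"
  have "0 \<le> Re (\<Sum>x\<in>S. \<Sum>y\<in>S. a x * cnj (a y) * mix t f g (inv\<^bsub>G\<^esub> y \<otimes>\<^bsub>G\<^esub> x))"
    if "finite S" "S \<subseteq> carrier G" for S a
  proof -
    have "(\<Sum>x\<in>S. \<Sum>y\<in>S. a x * cnj (a y) * mix t f g (inv\<^bsub>G\<^esub> y \<otimes>\<^bsub>G\<^esub> x)) =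
        of_real t * (\<Sum>x\<in>S. \<Sum>y\<in>S. a x * cnj (a y) * f (inv\<^bsub>G\<^esub> y \<otimes>\<^bsub>G\<^esub> x)) +
        of_real (1 - t) * (\<Sum>x\<in>S. \<Sum>y\<in>S. a x * cnj (a y) * g (inv\<^bsub>G\<^esub> y \<otimes>\<^bsub>G\<^esub> x))"
      unfolding mix_def sum_distrib_left sum.distrib[symmetric]
      by (intro sum.cong refl) (simp add: algebra_simps)
    moreover have nn: "0 \<le> Re (of_real t * w + of_real (1 - t) * z)" if "0 \<le> Re w" "0 \<le> Re z" for w z
      using that t by simp
    ultimately show ?thesis
      by (simp only: nn[OF pd_nonneg[OF f that] pd_nonneg[OF g that]])
  qed
  moreover have "mix t f g x = 0" if "x \<notin> carrier G" for x
    using pd_off[OF f that] pd_off[OF g that] by (simp add: mix_def)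
  moreover have "mix t f g \<one>\<^bsub>G\<^esub> = 1"
    using pd_one[OF f] pd_one[OF g] by (simp add: mix_def)
  moreover have "mix t f g (inv\<^bsub>G\<^esub> x) = cnj (mix t f g x)" if "x \<in> carrier G" for x
    using pd_inv[OF f that] pd_inv[OF g that] by (simp add: mix_def)
  ultimately show "mix t f g \<in> pd G" by (intro pdI)
qed

text \<open>\<open>mix\<close> is continuous in one argument with the other one fixed, and
  \<open>sym\<close> exchanges the arguments; so the closure is entered one argument at a
  time.\<close>

lemma mix_closed_closure:
  fixes D :: "('a \<Rightarrow> complex) set"
  assumes D: "mix_closed D"
  shows "mix_closed (closure D)"
proof -
  have *: "mix t f g \<in> closure D" if "f \<in> closure D" "t \<in> {0..1}" "\<And>h. h \<in> D \<Longrightarrow> mix t h g \<in> closure D" for t f g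
  proof -
    have "continuous_on (closure D) (\<lambda>h. mix t h g)"
      unfolding mix_def by (intro continuous_on_coordinatewise_then_product continuous_intros)
    moreover have "(\<lambda>h. mix t h g) ` D \<subseteq> closure D" using that by auto
    ultimately have "(\<lambda>h. mix t h g) ` closure D \<subseteq> closure D"
      by (rule image_closure_subset[OF _ closed_closure])
    then show ?thesis using that(1) by auto
  qed
  have sym: "mix t f g = mix (1 - t) g f" for t and f g :: "'a \<Rightarrow> complex" by (simp add: mix_def add.commute)
  show ?thesis
    unfolding mix_closed_def
  proof (intro ballI)
    fix f g t assume f: "f \<in> closure D" and g: "g \<in> closure D" and t: "t \<in> {0..1::real}"
    show "mix t f g \<in> closure D"
    proof (rule *[OF f t])
      fix h assume h: "h \<in> D"
      have "mix (1 - t) g h \<in> closure D"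
      proof (rule *[OF g])
        fix k assume "k \<in> D"
        then have "mix (1 - t) k h \<in> D" using D h t unfolding mix_closed_def by auto
        then show "mix (1 - t) k h \<in> closure D" using closure_subset by auto
      qed (use t in auto)
      then show "mix t h g \<in> closure D" by (subst sym)
    qed
  qed
qed

context group
begin

text \<open>Repetitions in the family are harmless, since the coefficients of all indices with the
  same group element are added up. This allows families indexed by pairs, and two-point families
  whose points may coincide.\<close>

lemma pd_family:
  assumes f: "f \<in> pd G" and I: "finite I" and s: "s ` I \<subseteq> carrier G"
  shows "0 \<le> Re (\<Sum>i\<in>I. \<Sum>j\<in>I. a i * cnj (a j) * f (inv (s j) \<otimes> s i))"
proof -
  define b where "b z = (\<Sum>i\<in>{i\<in>I. s i = z}. a i)" for z
  have "(\<Sum>i\<in>I. \<Sum>j\<in>I. a i * cnj (a j) * f (inv (s j) \<otimes> s i)) =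
      (\<Sum>z\<in>s`I. \<Sum>i\<in>{i\<in>I. s i = z}. \<Sum>w\<in>s`I. \<Sum>j\<in>{j\<in>I. s j = w}. a i * cnj (a j) * f (inv (s j) \<otimes> s i))"
    by (rule trans[OF sum.cong[OF refl sum.image_gen[OF I, of _ s]] sum.image_gen[OF I, of _ s]])
  also have "\<dots> = (\<Sum>z\<in>s`I. \<Sum>w\<in>s`I. \<Sum>i\<in>{i\<in>I. s i = z}. \<Sum>j\<in>{j\<in>I. s j = w}. a i * cnj (a j) * f (inv (s j) \<otimes> s i))"
    by (intro sum.cong refl sum.swap)
  also have "\<dots> = (\<Sum>z\<in>s`I. \<Sum>w\<in>s`I. b z * cnj (b w) * f (inv w \<otimes> z))"
  proof (intro sum.cong refl)
    fix z w
    have "(\<Sum>i\<in>{i\<in>I. s i = z}. \<Sum>j\<in>{j\<in>I. s j = w}. a i * cnj (a j) * f (inv (s j) \<otimes> s i)) =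
        (\<Sum>i\<in>{i\<in>I. s i = z}. \<Sum>j\<in>{j\<in>I. s j = w}. a i * cnj (a j) * f (inv w \<otimes> z))"
      by (intro sum.cong refl) auto
    also have "\<dots> = b z * cnj (b w) * f (inv w \<otimes> z)"
      unfolding b_def cnj_sum sum_product by (simp add: sum_distrib_right)
    finally show "(\<Sum>i\<in>{i\<in>I. s i = z}. \<Sum>j\<in>{j\<in>I. s j = w}. a i * cnj (a j) * f (inv (s j) \<otimes> s i)) =
        b z * cnj (b w) * f (inv w \<otimes> z)" .
  qed
  finally show ?thesis using pd_nonneg[OF f finite_imageI[OF I] s, of b] by simp
qed

text \<open>Let \<open>u\<close> be the phase with \<open>u * f x = cmod (f x)\<close>. Positivity
  for the points \<open>\<one>\<close> and \<open>x\<close> with weights \<open>1\<close> and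
  \<open>- u\<close> reads \<open>0 \<le> 2 - 2 * cmod (f x)\<close>.\<close>

lemma pd_bound:
  assumes f: "f \<in> pd G"
  shows "cmod (f x) \<le> 1"
proof (cases "x \<in> carrier G \<and> f x \<noteq> 0")
  case False then show ?thesis using pd_off[OF f] by auto
next
  case True
  define u where "u = cnj (f x) / of_real (cmod (f x))"
  have "cnj (f x) * f x = of_real (cmod (f x)) * of_real (cmod (f x))"
    using complex_norm_square[of "f x"] by (simp add: power2_eq_square mult.commute)
  then have u: "u * f x = of_real (cmod (f x))" "u * cnj u = 1"
    using True complex_norm_square[of u] by (auto simp: u_def norm_divide)
  let ?a = "\<lambda>i::nat. if i = 0 then 1 else - u" and ?s = "\<lambda>i::nat. if i = 0 then \<one> else x"
  have "0 \<le> Re (\<Sum>i\<in>{0,1}. \<Sum>j\<in>{0,1}. ?a i * cnj (?a j) * f (inv (?s j) \<otimes> ?s i))"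
    using True by (intro pd_family[OF f]) auto
  also have "(\<Sum>i\<in>{0,1}. \<Sum>j\<in>{0,1}. ?a i * cnj (?a j) * f (inv (?s j) \<otimes> ?s i))
      = 1 + u * cnj u - (u * f x + cnj (u * f x))"
    using True pd_one[OF f] pd_inv[OF f, of x] by (simp add: algebra_simps)
  also have "\<dots> = 2 - 2 * of_real (cmod (f x))"
    using u by simp
  finally show ?thesis by simp
qed

text \<open>By \<open>pd_bound\<close> the set is a closed subset of a product of closed unit discs,
  which is compact by Tychonoff's theorem.\<close>

lemma compact_pd: "compact (pd G)"
proof -
  have "compactin (product_topology (\<lambda>_. euclidean) UNIV) (PiE UNIV (\<lambda>_::'a. cball (0::complex) 1))"
    by (subst compactin_PiE) auto
  then have "compact (PiE UNIV (\<lambda>_::'a. cball (0::complex) 1))"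
    by (simp add: euclidean_product_topology)
  moreover have "pd G \<subseteq> PiE UNIV (\<lambda>_. cball 0 1)"
    using pd_bound by auto
  ultimately show ?thesis
    using closed_pd compact_Int_closed inf.absorb_iff2 by metis
qed

lemma twist_one:
  assumes f: "f \<in> pd G" and S: "finite S" "S \<subseteq> carrier G"
  shows "twist G f S a \<one> = of_real (Re (twist G f S a \<one>))" "0 \<le> Re (twist G f S a \<one>)"
    and "g \<in> carrier G \<Longrightarrow> twist G f S a (inv g) = cnj (twist G f S a g)"
proof -
  show inv: "twist G f S a (inv g) = cnj (twist G f S a g)" if g: "g \<in> carrier G" for g
  proof -
    have "twist G f S a (inv g) = (\<Sum>y\<in>S. \<Sum>x\<in>S. a x * cnj (a y) * f (inv y \<otimes> inv g \<otimes> x))"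
      using g unfolding twist_def by (simp, subst sum.swap, simp)
    also have "\<dots> = (\<Sum>y\<in>S. \<Sum>x\<in>S. cnj (a y * cnj (a x) * f (inv x \<otimes> g \<otimes> y)))"
    proof (intro sum.cong refl)
      fix x y assume "x \<in> S" "y \<in> S"
      then have c: "x \<in> carrier G" "y \<in> carrier G" using S by auto
      then have "inv (inv x \<otimes> g \<otimes> y) = inv y \<otimes> inv g \<otimes> x"
        using g by (simp add: inv_mult_group m_assoc)
      then have "f (inv y \<otimes> inv g \<otimes> x) = cnj (f (inv x \<otimes> g \<otimes> y))"
        using pd_inv[OF f, of "inv x \<otimes> g \<otimes> y"] c g by simp
      then show "a x * cnj (a y) * f (inv y \<otimes> inv g \<otimes> x) = cnj (a y * cnj (a x) * f (inv x \<otimes> g \<otimes> y))"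
        by simp
    qed
    also have "\<dots> = cnj (twist G f S a g)"
      using g unfolding twist_def by simp
    finally show ?thesis .
  qed
  from inv[OF one_closed] have "Im (twist G f S a \<one>) = 0"
    by (simp add: complex_eq_iff)
  then show "twist G f S a \<one> = of_real (Re (twist G f S a \<one>))" by (simp add: complex_eq_iff)
  have "twist G f S a \<one> = (\<Sum>x\<in>S. \<Sum>y\<in>S. a x * cnj (a y) * f (inv y \<otimes> x))"
    using S unfolding twist_def by (auto intro!: sum.cong arg_cong[where f = f] simp: subsetD)
  then show "0 \<le> Re (twist G f S a \<one>)" using pd_nonneg[OF f S, of a] by simp
qed

text \<open>The form of the twist over \<open>T\<close> with weights \<open>b\<close> is the form of
  \<open>f\<close> over the products \<open>g \<otimes> x\<close> with weights
  \<open>b g * a x\<close>, indexed by \<open>T \<times> S\<close>.\<close>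

lemma twist_family:
  assumes f: "f \<in> pd G" and S: "finite S" "S \<subseteq> carrier G" and T: "finite T" "T \<subseteq> carrier G"
  shows "0 \<le> Re (\<Sum>g\<in>T. \<Sum>h\<in>T. b g * cnj (b h) * twist G f S a (inv h \<otimes> g))"
proof -
  have cp: "(\<Sum>g\<in>T. \<Sum>x\<in>S. E g x) = (\<Sum>p\<in>T \<times> S. E (fst p) (snd p))" for E :: "'a \<Rightarrow> 'a \<Rightarrow> complex"
    by (simp only: sum.cartesian_product case_prod_unfold)
  have "(\<Sum>g\<in>T. \<Sum>h\<in>T. b g * cnj (b h) * twist G f S a (inv h \<otimes> g)) =
     (\<Sum>g\<in>T. \<Sum>h\<in>T. \<Sum>x\<in>S. \<Sum>y\<in>S. (b g * a x) * cnj (b h * a y) * f (inv (h \<otimes> y) \<otimes> (g \<otimes> x)))"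
  proof (intro sum.cong refl)
    fix g h assume gh: "g \<in> T" "h \<in> T"
    then have c: "g \<in> carrier G" "h \<in> carrier G" using T by auto
    have "b g * cnj (b h) * twist G f S a (inv h \<otimes> g) =
      (\<Sum>x\<in>S. \<Sum>y\<in>S. (b g * cnj (b h)) * (a x * cnj (a y) * f (inv y \<otimes> (inv h \<otimes> g) \<otimes> x)))"
      using c unfolding twist_def by (simp add: sum_distrib_left)
    also have "\<dots> = (\<Sum>x\<in>S. \<Sum>y\<in>S. (b g * a x) * cnj (b h * a y) * f (inv (h \<otimes> y) \<otimes> (g \<otimes> x)))"
      using S c by (intro sum.cong refl) (auto simp: inv_mult_group m_assoc subset_iff algebra_simps)
    finally show "b g * cnj (b h) * twist G f S a (inv h \<otimes> g) =
      (\<Sum>x\<in>S. \<Sum>y\<in>S. (b g * a x) * cnj (b h * a y) * f (inv (h \<otimes> y) \<otimes> (g \<otimes> x)))" .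
  qed
  also have "\<dots> = (\<Sum>g\<in>T. \<Sum>x\<in>S. \<Sum>h\<in>T. \<Sum>y\<in>S. (b g * a x) * cnj (b h * a y) * f (inv (h \<otimes> y) \<otimes> (g \<otimes> x)))"
    by (intro sum.cong refl sum.swap)
  also have "\<dots> = (\<Sum>p\<in>T \<times> S. \<Sum>q\<in>T \<times> S. (b (fst p) * a (snd p)) * cnj (b (fst q) * a (snd q)) *
      f (inv (fst q \<otimes> snd q) \<otimes> (fst p \<otimes> snd p)))"
    by (simp only: cp)
  also have "0 \<le> Re \<dots>"
    using S T by (intro pd_family[OF f]) (auto simp: subset_iff)
  finally show ?thesis .
qed

lemma pd_twist:
  assumes f: "f \<in> pd G" and S: "finite S" "S \<subseteq> carrier G" and ne: "twist G f S a \<one> \<noteq> 0"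
  shows "(\<lambda>g. twist G f S a g / twist G f S a \<one>) \<in> pd G"
proof -
  define r where "r = Re (twist G f S a \<one>)"
  have r: "twist G f S a \<one> = of_real r" "r > 0"
    using twist_one(1,2)[OF f S, of a] ne unfolding r_def by (auto simp: order_le_less complex_eq_iff)
  have "0 \<le> Re (\<Sum>x\<in>T. \<Sum>y\<in>T. b x * cnj (b y) * (twist G f S a (inv y \<otimes> x) / of_real r))"
    if "finite T" "T \<subseteq> carrier G" for T b
  proof -
    have "(\<Sum>x\<in>T. \<Sum>y\<in>T. b x * cnj (b y) * (twist G f S a (inv y \<otimes> x) / of_real r)) =
      (\<Sum>x\<in>T. \<Sum>y\<in>T. b x * cnj (b y) * twist G f S a (inv y \<otimes> x)) / of_real r"
      by (simp add: sum_divide_distrib)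
    then show ?thesis using twist_family[OF f S that, of b a] r by simp
  qed
  moreover have "twist G f S a x = 0" if "x \<notin> carrier G" for x using that by (simp add: twist_def)
  ultimately show ?thesis
    unfolding r using r(2) by (intro pdI) (simp_all add: r(1) twist_one(3)[OF f S] del: Re_sum)
qed

text \<open>For fixed \<open>S\<close> and \<open>a\<close> every value of a twist is a finite
  combination of values of the function, hence continuous in it; the normaliser is nonzero at
  \<open>f\<close> and therefore nearby.\<close>

lemma twist_closed_closure:
  assumes D: "twist_closed G D"
  shows "twist_closed G (closure D)"
  unfolding twist_closed_def
proof (intro ballI allI impI)
  fix f S and a :: "'a \<Rightarrow> complex"
  assume f: "f \<in> closure D" and S: "finite S \<and> S \<subseteq> carrier G \<and> twist G f S a \<one> \<noteq> 0"
  \<comment> \<open>The trace on \<open>D\<close> of the neighbourhood filter of \<open>f\<close>;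
    it is proper because \<open>f\<close> lies in the closure.\<close>
  define F where "F = inf (nhds f) (principal D)"
  have "F \<noteq> bot"
  proof
    assume "F = bot"
    then have "eventually (\<lambda>h. h \<notin> D) (nhds f)"
      using eventually_inf_principal[of "\<lambda>_. False" "nhds f" D] unfolding F_def by simp
    then obtain U where "open U" "f \<in> U" "U \<inter> D = {}" by (auto simp: eventually_nhds)
    then show False using open_Int_closure_eq_empty[of U D] f by auto
  qed
  have F: "((\<lambda>h. h) \<longlongrightarrow> f) F" "eventually (\<lambda>h. h \<in> D) F"
    unfolding F_def by (auto simp: eventually_inf_principal filterlim_def le_infI1)
  have ev: "((\<lambda>h. h x) \<longlongrightarrow> f x) F" for x
    by (rule continuous_on_tendsto_compose[OF continuous_on_product_coordinates F(1)]) auto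
  have tw: "((\<lambda>h. twist G h S a g) \<longlongrightarrow> twist G f S a g) F" for g
    unfolding twist_def by (cases "g \<in> carrier G") (auto intro!: tendsto_intros ev)
  have lim: "((\<lambda>h g. twist G h S a g / twist G h S a \<one>) \<longlongrightarrow> (\<lambda>g. twist G f S a g / twist G f S a \<one>)) F"
    using S by (intro tendsto_funI tendsto_divide tw) auto
  have ev2: "eventually (\<lambda>h. (\<lambda>g. twist G h S a g / twist G h S a \<one>) \<in> closure D) F"
  proof -
    have "eventually (\<lambda>h. twist G h S a \<one> \<noteq> 0) F"
      using tw S by (intro tendsto_imp_eventually_ne) auto
    with F(2) show ?thesis
      by eventually_elim (use D S closure_subset[of D] in \<open>auto simp: twist_closed_def subset_iff\<close>)
  qed
  show "(\<lambda>g. twist G f S a g / twist G f S a \<one>) \<in> closure D"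
    by (rule Lim_in_closed_set[OF closed_closure ev2 \<open>F \<noteq> bot\<close> lim])
qed

end

lemma annihI:
  "f \<in> pd G \<Longrightarrow> (\<And>A \<gamma>. A \<in> \<A> \<Longrightarrow> \<gamma> \<in> carrier G \<Longrightarrow> (\<Sum>x\<in>A. f (\<gamma> \<otimes>\<^bsub>G\<^esub> x)) = 0) \<Longrightarrow> f \<in> annih G \<A>"
  by (auto simp: annih_def)

lemma annih_pd: "f \<in> annih G \<A> \<Longrightarrow> f \<in> pd G"
  and annih_sum: "f \<in> annih G \<A> \<Longrightarrow> A \<in> \<A> \<Longrightarrow> \<gamma> \<in> carrier G \<Longrightarrow> (\<Sum>x\<in>A. f (\<gamma> \<otimes>\<^bsub>G\<^esub> x)) = 0"
  by (auto simp: annih_def)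

lemma annih_mono: "\<A> \<subseteq> \<B> \<Longrightarrow> annih G \<B> \<subseteq> annih G \<A>"
  by (auto simp: annih_def)

lemma annih_eq: "annih G \<A> = pd G \<inter> (\<Inter>A\<in>\<A>. \<Inter>\<gamma>\<in>carrier G. {f. (\<Sum>x\<in>A. f (\<gamma> \<otimes>\<^bsub>G\<^esub> x)) = 0})"
  by (auto simp: annih_def)

lemma closed_annih: "closed (annih G \<A>)"
  unfolding annih_eq
  by (intro closed_Int closed_pd closed_INT ballI closed_Collect_eq continuous_intros)

lemma mix_closed_annih: "mix_closed (annih G \<A>)"
  unfolding mix_closed_def
proof (intro ballI annihI)
  fix f g and t :: real assume f: "f \<in> annih G \<A>" and g: "g \<in> annih G \<A>" and t: "t \<in> {0..1}"
  show "mix t f g \<in> pd G"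
    using mix_closed_pd[of G] annih_pd[OF f] annih_pd[OF g] t unfolding mix_closed_def by blast
  fix A \<gamma> assume "A \<in> \<A>" "\<gamma> \<in> carrier G"
  then show "(\<Sum>x\<in>A. mix t f g (\<gamma> \<otimes>\<^bsub>G\<^esub> x)) = 0"
    using annih_sum[OF f] annih_sum[OF g]
    unfolding mix_def sum.distrib sum_distrib_left[symmetric] by simp
qed

context group
begin

text \<open>\<open>inv y \<otimes> (\<gamma> \<otimes> h) \<otimes> x\<close> equals \<open>(inv y
  \<otimes> \<gamma> \<otimes> x) \<otimes> (inv x \<otimes> h \<otimes> x)\<close>. By normality
  the last factor runs through \<open>A\<close> with \<open>h\<close>, so a coset sum of the twist
  is a combination of coset sums of \<open>f\<close>.\<close>

lemma twist_closed_annih: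
  assumes \<A>: "\<And>A. A \<in> \<A> \<Longrightarrow> A \<lhd> G"
  shows "twist_closed G (annih G \<A>)"
  unfolding twist_closed_def
proof (intro ballI allI impI annihI)
  fix f S and a :: "'a \<Rightarrow> complex"
  assume f: "f \<in> annih G \<A>" and S: "finite S \<and> S \<subseteq> carrier G \<and> twist G f S a \<one> \<noteq> 0"
  show "(\<lambda>g. twist G f S a g / twist G f S a \<one>) \<in> pd G"
    using pd_twist[OF annih_pd[OF f]] S by auto
  fix A \<gamma> assume A: "A \<in> \<A>" and \<gamma>: "\<gamma> \<in> carrier G"
  interpret A: normal A G by (rule \<A>[OF A])
  have "(\<Sum>h\<in>A. f (inv y \<otimes> (\<gamma> \<otimes> h) \<otimes> x)) = 0" if x: "x \<in> carrier G" and y: "y \<in> carrier G" for x y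
  proof -
    have "(\<Sum>h\<in>A. f (inv y \<otimes> (\<gamma> \<otimes> h) \<otimes> x)) = (\<Sum>h\<in>A. f ((inv y \<otimes> \<gamma> \<otimes> x) \<otimes> h))"
    proof (rule sum.reindex_bij_witness[where i = "\<lambda>h. x \<otimes> h \<otimes> inv x" and j = "\<lambda>h. inv x \<otimes> h \<otimes> x"])
      fix h assume h: "h \<in> A"
      then have hG: "h \<in> carrier G" by (rule A.mem_carrier)
      show "x \<otimes> (inv x \<otimes> h \<otimes> x) \<otimes> inv x = h" "inv x \<otimes> (x \<otimes> h \<otimes> inv x) \<otimes> x = h"
        using x hG by (simp_all add: m_assoc, simp_all add: m_assoc[symmetric])
      show "inv x \<otimes> h \<otimes> x \<in> A" "x \<otimes> h \<otimes> inv x \<in> A"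
        using A.inv_op_closed1[OF x h] A.inv_op_closed2[OF x h] by auto
      have "inv y \<otimes> \<gamma> \<otimes> x \<otimes> (inv x \<otimes> h \<otimes> x) = inv y \<otimes> \<gamma> \<otimes> (x \<otimes> inv x) \<otimes> h \<otimes> x"
        using x y \<gamma> hG by (simp only: m_assoc m_closed inv_closed)
      then show "f (inv y \<otimes> \<gamma> \<otimes> x \<otimes> (inv x \<otimes> h \<otimes> x)) = f (inv y \<otimes> (\<gamma> \<otimes> h) \<otimes> x)"
        using x y \<gamma> hG by (simp add: m_assoc)
    qed
    also have "\<dots> = 0" using x y \<gamma> by (intro annih_sum[OF f A]) simp
    finally show ?thesis .
  qed
  then have "(\<Sum>x\<in>S. \<Sum>y\<in>S. a x * cnj (a y) * (\<Sum>h\<in>A. f (inv y \<otimes> (\<gamma> \<otimes> h) \<otimes> x))) = 0"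
    using S by (intro sum.neutral ballI) auto
  moreover have "(\<Sum>h\<in>A. twist G f S a (\<gamma> \<otimes> h)) =
      (\<Sum>h\<in>A. \<Sum>x\<in>S. \<Sum>y\<in>S. a x * cnj (a y) * f (inv y \<otimes> (\<gamma> \<otimes> h) \<otimes> x))"
    using \<gamma> by (intro sum.cong refl) (simp add: twist_def)
  moreover have "\<dots> = (\<Sum>x\<in>S. \<Sum>y\<in>S. a x * cnj (a y) * (\<Sum>h\<in>A. f (inv y \<otimes> (\<gamma> \<otimes> h) \<otimes> x)))"
    unfolding sum_distrib_left by (subst sum.swap, intro sum.cong refl sum.swap)
  ultimately show "(\<Sum>h\<in>A. twist G f S a (\<gamma> \<otimes> h) / twist G f S a \<one>) = 0"
    by (simp add: sum_divide_distrib[symmetric])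
qed

text \<open>The double sum over \<open>S\<close> decomposes along the left cosets of \<open>M\<close>; each coset is translated into \<open>M\<close>.\<close>

lemma pd_zero_extension:
  assumes M: "subgroup M G" and f: "f \<in> pd (G\<lparr>carrier := M\<rparr>)"
  shows "f \<in> pd G"
proof (rule pdI)
  interpret M: subgroup M G by (rule M)
  interpret GM: group "G\<lparr>carrier := M\<rparr>" by (rule subgroup_imp_group[OF M])
  have off: "f x = 0" if "x \<notin> M" for x using pd_off[OF f, of x] that by simp
  show "f x = 0" if "x \<notin> carrier G" for x using off M.subset that by auto
  show "f \<one> = 1" using pd_one[OF f] by simp
  show "f (inv x) = cnj (f x)" if x: "x \<in> carrier G" for x
  proof (cases "x \<in> M")
    case True
    then show ?thesis using pd_inv[OF f, of x] m_inv_consistent[OF M] by simp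
  next
    case False
    then have "inv x \<notin> M" using M.m_inv_closed[of "inv x"] x by auto
    then show ?thesis using off False by simp
  qed
  fix S and a :: "'a \<Rightarrow> complex" assume S: "finite S" "S \<subseteq> carrier G"
  define c where "c x = {z\<in>carrier G. inv z \<otimes> x \<in> M}" for x
  have mem: "z \<in> c x \<longleftrightarrow> inv z \<otimes> x \<in> M" if "z \<in> carrier G" for x z
    using that by (simp add: c_def)
  have tr: "inv z \<otimes> x = (inv z \<otimes> y) \<otimes> (inv y \<otimes> x)"
    if "x \<in> carrier G" "y \<in> carrier G" "z \<in> carrier G" for x y z
    using that by (metis inv_closed m_assoc m_closed r_inv r_one)
  have sy: "inv (inv y \<otimes> x) = inv x \<otimes> y" if "x \<in> carrier G" "y \<in> carrier G" for x y
    using that by (simp add: inv_mult_group)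
  have ceq: "c x = c y \<longleftrightarrow> inv y \<otimes> x \<in> M" if x: "x \<in> carrier G" and y: "y \<in> carrier G" for x y
  proof
    have "y \<in> c y" using y by (simp add: c_def)
    then show "inv y \<otimes> x \<in> M" if "c x = c y" using that unfolding c_def by blast
    assume a: "inv y \<otimes> x \<in> M"
    then have b: "inv x \<otimes> y \<in> M" using M.m_inv_closed[OF a] sy[OF x y] by simp
    show "c x = c y"
      unfolding c_def using tr[OF x y] tr[OF y x] a b by (metis (lifting) M.m_closed)
  qed
  have "(\<Sum>x\<in>S. \<Sum>y\<in>S. a x * cnj (a y) * f (inv y \<otimes> x)) =
      (\<Sum>C\<in>c`S. \<Sum>x\<in>{x\<in>S. c x = C}. \<Sum>y\<in>S. a x * cnj (a y) * f (inv y \<otimes> x))"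
    by (rule sum.image_gen[OF S(1)])
  also have "\<dots> = (\<Sum>C\<in>c`S. \<Sum>x\<in>{x\<in>S. c x = C}. \<Sum>y\<in>{x\<in>S. c x = C}. a x * cnj (a y) * f (inv y \<otimes> x))"
  proof (rule sum.cong[OF refl], rule sum.cong[OF refl], rule sum.mono_neutral_right[OF S(1)], blast, rule ballI)
    fix C x y assume x: "x \<in> {x\<in>S. c x = C}" and y: "y \<in> S - {x\<in>S. c x = C}"
    then have "c x \<noteq> c y" "x \<in> carrier G" "y \<in> carrier G" using S by auto
    then show "a x * cnj (a y) * f (inv y \<otimes> x) = 0" using ceq[of x y] off by simp
  qed
  finally have eq: "(\<Sum>x\<in>S. \<Sum>y\<in>S. a x * cnj (a y) * f (inv y \<otimes> x)) = \<dots>" .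
  have "0 \<le> Re (\<Sum>x\<in>{x\<in>S. c x = C}. \<Sum>y\<in>{x\<in>S. c x = C}. a x * cnj (a y) * f (inv y \<otimes> x))"
    if C: "C \<in> c ` S" for C
  proof -
    obtain t where t: "t \<in> S" "C = c t" using C by auto
    have tG: "t \<in> carrier G" using t S by auto
    let ?I = "{x\<in>S. c x = C}"
    have I: "(\<lambda>x. inv t \<otimes> x) ` ?I \<subseteq> M"
      using t S ceq[OF _ tG] by auto
    have "0 \<le> Re (\<Sum>x\<in>?I. \<Sum>y\<in>?I. a x * cnj (a y) *
        f (inv\<^bsub>G\<lparr>carrier := M\<rparr>\<^esub> (inv t \<otimes> y) \<otimes>\<^bsub>G\<lparr>carrier := M\<rparr>\<^esub> (inv t \<otimes> x)))"
      using I S by (intro GM.pd_family[OF f]) auto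
    also have "(\<Sum>x\<in>?I. \<Sum>y\<in>?I. a x * cnj (a y) *
        f (inv\<^bsub>G\<lparr>carrier := M\<rparr>\<^esub> (inv t \<otimes> y) \<otimes>\<^bsub>G\<lparr>carrier := M\<rparr>\<^esub> (inv t \<otimes> x))) =
      (\<Sum>x\<in>?I. \<Sum>y\<in>?I. a x * cnj (a y) * f (inv y \<otimes> x))"
    proof (intro sum.cong refl)
      fix x y assume xy: "x \<in> ?I" "y \<in> ?I"
      then have "inv t \<otimes> y \<in> M" "x \<in> carrier G" "y \<in> carrier G" using I S by auto
      then have "inv\<^bsub>G\<lparr>carrier := M\<rparr>\<^esub> (inv t \<otimes> y) \<otimes>\<^bsub>G\<lparr>carrier := M\<rparr>\<^esub> (inv t \<otimes> x) = inv y \<otimes> x"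
        using tG m_inv_consistent[OF M] sy[of y t] tr[of x t y] by simp
      then show "a x * cnj (a y) * f (inv\<^bsub>G\<lparr>carrier := M\<rparr>\<^esub> (inv t \<otimes> y) \<otimes>\<^bsub>G\<lparr>carrier := M\<rparr>\<^esub> (inv t \<otimes> x))
          = a x * cnj (a y) * f (inv y \<otimes> x)" by simp
    qed
    finally show ?thesis .
  qed
  then show "0 \<le> Re (\<Sum>x\<in>S. \<Sum>y\<in>S. a x * cnj (a y) * f (inv y \<otimes> x))"
    unfolding eq by (subst Re_sum, intro sum_nonneg)
qed

lemma pd_subgroup:
  assumes M: "subgroup M G" and f: "f \<in> pd G"
  shows "(\<lambda>x. if x \<in> M then f x else 0) \<in> pd (G\<lparr>carrier := M\<rparr>)"
proof (rule pdI)
  interpret M: subgroup M G by (rule M)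
  fix S and a :: "'a \<Rightarrow> complex" assume S: "finite S" "S \<subseteq> carrier (G\<lparr>carrier := M\<rparr>)"
  then have "S \<subseteq> carrier G" using M.subset by auto
  from pd_nonneg[OF f S(1) this, of a]
  show "0 \<le> Re (\<Sum>x\<in>S. \<Sum>y\<in>S. a x * cnj (a y) *
      (if inv\<^bsub>G\<lparr>carrier := M\<rparr>\<^esub> y \<otimes>\<^bsub>G\<lparr>carrier := M\<rparr>\<^esub> x \<in> M
       then f (inv\<^bsub>G\<lparr>carrier := M\<rparr>\<^esub> y \<otimes>\<^bsub>G\<lparr>carrier := M\<rparr>\<^esub> x) else 0))"
    using S by (elim order_trans, intro eq_refl arg_cong[where f = Re] sum.cong refl)
      (auto simp: m_inv_consistent[OF M] subset_iff)
qed (use assms pd_one[OF f] pd_inv[OF f] m_inv_consistent[OF M] subgroup.subset[OF M] subgroup.one_closed[OF M]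
     subgroup.m_inv_closed[OF M] in auto)

text \<open>Since \<open>A \<subseteq> M\<close>, a coset of \<open>A\<close> either lies in
  \<open>M\<close>, where its sum vanishes by assumption, or is disjoint from \<open>M\<close>,
  where every value is \<open>0\<close>.\<close>

lemma annih_zero_extension:
  assumes M: "subgroup M G" and \<A>: "\<And>A. A \<in> \<A> \<Longrightarrow> A \<subseteq> M" and f: "f \<in> annih (G\<lparr>carrier := M\<rparr>) \<A>"
  shows "f \<in> annih G \<A>"
proof (rule annihI)
  interpret M: subgroup M G by (rule M)
  show "f \<in> pd G" by (rule pd_zero_extension[OF M annih_pd[OF f]])
  fix A \<gamma> assume A: "A \<in> \<A>" and \<gamma>: "\<gamma> \<in> carrier G"
  show "(\<Sum>x\<in>A. f (\<gamma> \<otimes> x)) = 0"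
  proof (cases "\<gamma> \<in> M")
    case True then show ?thesis using annih_sum[OF f A, of \<gamma>] by simp
  next
    case False
    have "f (\<gamma> \<otimes> x) = 0" if x: "x \<in> A" for x
    proof -
      have xM: "x \<in> M" using x \<A>[OF A] by auto
      have "\<gamma> \<otimes> x \<notin> M"
      proof
        assume "\<gamma> \<otimes> x \<in> M"
        then have "\<gamma> \<otimes> x \<otimes> inv x \<in> M" using xM by blast
        then show False using False \<gamma> xM by (simp add: m_assoc)
      qed
      then show ?thesis using pd_off[OF annih_pd[OF f]] by simp
    qed
    then show ?thesis by simp
  qed
qed

lemma annih_subgroup:
  assumes M: "subgroup M G" and \<A>: "\<And>A. A \<in> \<A> \<Longrightarrow> A \<subseteq> M" and f: "f \<in> annih G \<A>"
  shows "(\<lambda>x. if x \<in> M then f x else 0) \<in> annih (G\<lparr>carrier := M\<rparr>) \<A>"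
proof (rule annihI)
  interpret M: subgroup M G by (rule M)
  show "(\<lambda>x. if x \<in> M then f x else 0) \<in> pd (G\<lparr>carrier := M\<rparr>)"
    by (rule pd_subgroup[OF M annih_pd[OF f]])
  fix A \<gamma> assume A: "A \<in> \<A>" and \<gamma>: "\<gamma> \<in> carrier (G\<lparr>carrier := M\<rparr>)"
  then have "(\<Sum>x\<in>A. if \<gamma> \<otimes> x \<in> M then f (\<gamma> \<otimes> x) else 0) = (\<Sum>x\<in>A. f (\<gamma> \<otimes> x))"
    using \<A>[OF A] by (intro sum.cong refl) auto
  then show "(\<Sum>x\<in>A. if \<gamma> \<otimes>\<^bsub>G\<lparr>carrier := M\<rparr>\<^esub> x \<in> M then f (\<gamma> \<otimes>\<^bsub>G\<lparr>carrier := M\<rparr>\<^esub> x) else 0) = 0"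
    using annih_sum[OF f A, of \<gamma>] \<gamma> by (simp cong: if_cong)
qed

text \<open>In terms of vector states, the vector is projected to the complement of the fixed space
  of \<open>H\<close>, by twisting with the indicator of \<open>\<one>\<close> minus the mean over \<open>H\<close>.\<close>

lemma annih_insert:
  assumes \<A>: "\<And>A. A \<in> \<A> \<Longrightarrow> A \<lhd> G" and f: "f \<in> annih G \<A>"
    and H: "H \<lhd> G" "finite H" "H \<noteq> {\<one>}" and van: "\<And>h. h \<in> H \<Longrightarrow> h \<noteq> \<one> \<Longrightarrow> f h = 0"
  obtains f' where "f' \<in> annih G (insert H \<A>)"
    "\<And>g. g \<in> carrier G \<Longrightarrow> f' g \<noteq> 0 \<Longrightarrow> \<exists>x\<in>H. \<exists>y\<in>H. f (inv y \<otimes> g \<otimes> x) \<noteq> 0"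
proof -
  interpret H: normal H G by (rule H)
  define n where "n = card H"
  have HG: "H \<subseteq> carrier G" by (rule H.subset)
  have "{\<one>} \<subset> H" using H(3) by auto
  then have n: "1 < n" using psubset_card_mono[OF H(2), of "{\<one>}"] unfolding n_def by simp
  define a :: "'a \<Rightarrow> complex" where "a x = (if x = \<one> then 1 else 0) - 1 / of_nat n" for x
  have suma: "(\<Sum>x\<in>H. a x) = 0"
    unfolding a_def sum_subtractf using H(2) n by (auto simp: n_def)
  \<comment> \<open>On \<open>H\<close> the function is the indicator of \<open>\<one>\<close>: in
    the representation the translates of the vector by \<open>H\<close> are orthonormal. The squared
    norm of the projected vector is therefore \<open>\<Sum>x\<in>H. (cmod (a x))\<^sup>2\<close>,
    which is positive.\<close>
  have "twist G f H a \<one> = (\<Sum>x\<in>H. \<Sum>y\<in>H. a x * cnj (a y) * f (inv y \<otimes> x))"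
    unfolding twist_def using HG by (auto intro!: sum.cong arg_cong[where f = f] simp: subset_iff)
  also have "\<dots> = (\<Sum>x\<in>H. a x * cnj (a x))"
  proof (rule sum.cong[OF refl])
    fix x assume x: "x \<in> H"
    have "a x * cnj (a y) * f (inv y \<otimes> x) = (if y = x then a x * cnj (a x) else 0)" if y: "y \<in> H" for y
    proof -
      have c: "x \<in> carrier G" "y \<in> carrier G" using x y HG by auto
      have "f (inv y \<otimes> x) = 0" if "y \<noteq> x"
      proof (rule van)
        show "inv y \<otimes> x \<in> H" using x y by blast
        show "inv y \<otimes> x \<noteq> \<one>"
          using c that by (metis inv_closed inv_equality inv_inv)
      qed
      then show ?thesis using c pd_one[OF annih_pd[OF f]] by simp
    qed
    then show "(\<Sum>y\<in>H. a x * cnj (a y) * f (inv y \<otimes> x)) = a x * cnj (a x)"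
      using H(2) x by simp
  qed
  also have "\<dots> = of_real (\<Sum>x\<in>H. (cmod (a x))\<^sup>2)"
    by (simp only: of_real_sum complex_norm_square)
  finally have tw1: "twist G f H a \<one> = of_real (\<Sum>x\<in>H. (cmod (a x))\<^sup>2)" .
  have "a \<one> \<noteq> 0" using n by (simp add: a_def)
  then have "0 < (\<Sum>x\<in>H. (cmod (a x))\<^sup>2)"
    using H(2) H.one_closed by (intro sum_pos2[of H \<one>]) auto
  then have ne: "twist G f H a \<one> \<noteq> 0" unfolding tw1 by (simp only: of_real_eq_0_iff)
  define f' where "f' = (\<lambda>g. twist G f H a g / twist G f H a \<one>)"
  have f': "f' \<in> annih G \<A>"
    using twist_closed_annih[OF \<A>] f H(2) HG ne unfolding twist_closed_def f'_def by blast
  have "(\<Sum>h\<in>H. twist G f H a (\<gamma> \<otimes> h)) = 0" if \<gamma>: "\<gamma> \<in> carrier G" for \<gamma>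
  proof -
    \<comment> \<open>Right translation by \<open>x\<close> permutes \<open>H\<close>, so the inner
      sum does not depend on \<open>x\<close>. The coefficients \<open>a x\<close>, which add up to
      \<open>0\<close>, can then be factored out.\<close>
    have tr: "(\<Sum>h\<in>H. f (inv y \<otimes> (\<gamma> \<otimes> h) \<otimes> x)) = (\<Sum>h\<in>H. f (inv y \<otimes> (\<gamma> \<otimes> h)))"
      if xy: "x \<in> H" "y \<in> H" for x y
    proof (rule sum.reindex_bij_witness[where i = "\<lambda>h. h \<otimes> inv x" and j = "\<lambda>h. h \<otimes> x"])
      fix h assume "h \<in> H"
      moreover from this have "h \<in> carrier G" "x \<in> carrier G" "y \<in> carrier G" using xy HG by auto
      ultimately show "h \<otimes> x \<otimes> inv x = h" "h \<otimes> inv x \<otimes> x = h" "h \<otimes> x \<in> H" "h \<otimes> inv x \<in> H"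
        "f (inv y \<otimes> (\<gamma> \<otimes> (h \<otimes> x))) = f (inv y \<otimes> (\<gamma> \<otimes> h) \<otimes> x)"
        using xy \<gamma> by (auto simp: m_assoc)
    qed
    have "(\<Sum>h\<in>H. twist G f H a (\<gamma> \<otimes> h)) =
      (\<Sum>h\<in>H. \<Sum>x\<in>H. \<Sum>y\<in>H. a x * cnj (a y) * f (inv y \<otimes> (\<gamma> \<otimes> h) \<otimes> x))"
      using \<gamma> HG by (intro sum.cong refl) (auto simp: twist_def)
    also have "\<dots> = (\<Sum>x\<in>H. \<Sum>y\<in>H. a x * cnj (a y) * (\<Sum>h\<in>H. f (inv y \<otimes> (\<gamma> \<otimes> h) \<otimes> x)))"
      unfolding sum_distrib_left by (subst sum.swap, intro sum.cong refl sum.swap)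
    also have "\<dots> = (\<Sum>x\<in>H. a x * (\<Sum>y\<in>H. cnj (a y) * (\<Sum>h\<in>H. f (inv y \<otimes> (\<gamma> \<otimes> h)))))"
      unfolding sum_distrib_left[of "a _"] by (intro sum.cong refl) (simp add: tr mult.assoc)
    also have "\<dots> = 0" unfolding sum_distrib_right[symmetric] suma by simp
    finally show ?thesis .
  qed
  then have "f' \<in> annih G (insert H \<A>)"
    using f' unfolding annih_def f'_def by (auto simp: sum_divide_distrib[symmetric])
  moreover have "\<exists>x\<in>H. \<exists>y\<in>H. f (inv y \<otimes> g \<otimes> x) \<noteq> 0" if "g \<in> carrier G" "f' g \<noteq> 0" for g
  proof (rule ccontr)
    assume "\<not> ?thesis"
    then show False using that unfolding f'_def twist_def by simp
  qed
  ultimately show ?thesis using that by blast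
qed

end

section \<open>Hilbert spaces and unitary representations\<close>

text \<open>The axioms of \<open>complex_hilbert_space\<close> without completeness, so that norm
  and metric are at hand while the completeness of a constructed space is still to be shown.\<close>

locale complex_inner_space = module complex_ring V
  for V :: "('v, 'm) inner_space_scheme" (structure) +
  assumes cinner_add_left:
      "\<lbrakk>x \<in> carrier V; y \<in> carrier V; z \<in> carrier V\<rbrakk>
        \<Longrightarrow> cinner V (x \<oplus> y) z = cinner V x z + cinner V y z"
    and cinner_smult_left:
      "\<lbrakk>x \<in> carrier V; z \<in> carrier V\<rbrakk> \<Longrightarrow> cinner V (a \<odot> x) z = a * cinner V x z"
    and cinner_commute:
      "\<lbrakk>x \<in> carrier V; y \<in> carrier V\<rbrakk> \<Longrightarrow> cinner V y x = cnj (cinner V x y)"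
    and cinner_pos:
      "\<lbrakk>x \<in> carrier V; x \<noteq> \<zero>\<rbrakk> \<Longrightarrow> 0 < Re (cinner V x x)"

sublocale complex_hilbert_space \<subseteq> complex_inner_space
  by unfold_locales (fact cinner_add_left cinner_smult_left cinner_commute cinner_pos)+

lemma complex_ring_simps [simp]:
  "carrier complex_ring = UNIV" "\<one>\<^bsub>complex_ring\<^esub> = 1" "\<zero>\<^bsub>complex_ring\<^esub> = 0"
  "a \<oplus>\<^bsub>complex_ring\<^esub> b = a + b" "a \<otimes>\<^bsub>complex_ring\<^esub> b = a * b"
  by (simp_all add: complex_ring_def)

lemma cring_complex_ring: "cring complex_ring"
  by (intro cringI abelian_groupI comm_monoidI)
    (auto simp: algebra_simps intro: exI[of _ "- _"] ab_left_minus)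

text \<open>The discriminant argument. For \<open>B > 0\<close> evaluate at the minimum
  \<open>s = - cnj c / B\<close>; for \<open>B = 0\<close> and \<open>c \<noteq> 0\<close> the
  multiple \<open>- t * cnj c\<close> makes the expression \<open>A - 2 * (A + 1)\<close>, which is
  negative. It gives both Cauchy-Schwarz inequalities and, with \<open>A = 0\<close>, the
  orthogonality of projections.\<close>

lemma quadratic_nonneg:
  assumes q: "\<And>s::complex. 0 \<le> A + 2 * Re (s * c) + (cmod s)\<^sup>2 * B" and AB: "0 \<le> A" "0 \<le> B"
  shows "(cmod c)\<^sup>2 \<le> A * B"
proof (cases "B = 0")
  case False
  then have B: "B > 0" using AB by simp
  have "0 \<le> A + 2 * Re (- cnj c / of_real B * c) + (cmod (- cnj c / of_real B))\<^sup>2 * B" by (rule q)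
  also have "- cnj c / of_real B * c = of_real (- (cmod c)\<^sup>2 / B)"
    using complex_norm_square[of c] by (simp add: mult.commute)
  also have "A + 2 * Re (of_real (- (cmod c)\<^sup>2 / B)) + (cmod (- cnj c / of_real B))\<^sup>2 * B = A - (cmod c)\<^sup>2 / B"
    using B by (simp add: norm_divide power_divide power2_eq_square)
  finally show ?thesis using B by (simp add: field_simps)
next
  case True
  have "c = 0"
  proof (rule ccontr)
    assume c: "c \<noteq> 0"
    define t where "t = (A + 1) / (cmod c)\<^sup>2"
    have "0 \<le> A + 2 * Re (- of_real t * cnj c * c)" using q[of "- of_real t * cnj c"] True by simp
    also have "- of_real t * cnj c * c = of_real (- t * (cmod c)\<^sup>2)"
      using complex_norm_square[of c] by (simp add: mult.commute mult.left_commute)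
    also have "- t * (cmod c)\<^sup>2 = - (A + 1)" using c by (simp add: t_def)
    finally show False using AB by simp
  qed
  then show ?thesis using AB by simp
qed

context complex_inner_space
begin

lemmas smult_closed' [simp] = smult_closed[simplified]

definition nsq :: "'v \<Rightarrow> real" where "nsq x = Re (cinner V x x)"

lemma cinner_zero_left [simp]: "z \<in> carrier V \<Longrightarrow> cinner V \<zero> z = 0"
  using cinner_add_left[of \<zero> \<zero> z] by simp

lemma cinner_minus_left: "x \<in> carrier V \<Longrightarrow> z \<in> carrier V \<Longrightarrow> cinner V (\<ominus> x) z = - cinner V x z"
  using cinner_add_left[of "\<ominus> x" x z] by (simp add: l_neg eq_neg_iff_add_eq_0)

lemma cinner_diff_left:
  "x \<in> carrier V \<Longrightarrow> y \<in> carrier V \<Longrightarrow> z \<in> carrier V \<Longrightarrow>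
    cinner V (x \<ominus> y) z = cinner V x z - cinner V y z"
  by (simp add: a_minus_def cinner_add_left cinner_minus_left)

lemma cinner_add_right:
  "x \<in> carrier V \<Longrightarrow> y \<in> carrier V \<Longrightarrow> z \<in> carrier V \<Longrightarrow>
    cinner V z (x \<oplus> y) = cinner V z x + cinner V z y"
  by (simp add: cinner_commute[of _ z] cinner_add_left)

lemma cinner_diff_right:
  "x \<in> carrier V \<Longrightarrow> y \<in> carrier V \<Longrightarrow> z \<in> carrier V \<Longrightarrow>
    cinner V z (x \<ominus> y) = cinner V z x - cinner V z y"
  by (simp add: cinner_commute[of _ z] cinner_diff_left)

lemma cinner_smult_right:
  "x \<in> carrier V \<Longrightarrow> z \<in> carrier V \<Longrightarrow> cinner V z (a \<odot> x) = cnj a * cinner V z x"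
  by (simp add: cinner_commute[of _ z] cinner_smult_left)

lemma nsq_nonneg [simp]: "x \<in> carrier V \<Longrightarrow> 0 \<le> nsq x"
  using cinner_pos[of x] by (cases "x = \<zero>") (auto simp: nsq_def)

lemma nsq_eq_0: "x \<in> carrier V \<Longrightarrow> nsq x = 0 \<longleftrightarrow> x = \<zero>"
  using cinner_pos[of x] by (cases "x = \<zero>") (auto simp: nsq_def)

lemma cinner_self: "x \<in> carrier V \<Longrightarrow> cinner V x x = of_real (nsq x)"
  using cinner_commute[of x x] by (simp add: nsq_def complex_eq_iff)

lemma Re_cinner_commute: "x \<in> carrier V \<Longrightarrow> y \<in> carrier V \<Longrightarrow> Re (cinner V y x) = Re (cinner V x y)"
  using cinner_commute[of x y] by simp

lemma nsq_add: "x \<in> carrier V \<Longrightarrow> y \<in> carrier V \<Longrightarrow>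
    nsq (x \<oplus> y) = nsq x + nsq y + 2 * Re (cinner V x y)"
  unfolding nsq_def by (simp add: cinner_add_left cinner_add_right Re_cinner_commute[of x y])

lemma nsq_diff: "x \<in> carrier V \<Longrightarrow> y \<in> carrier V \<Longrightarrow>
    nsq (x \<ominus> y) = nsq x + nsq y - 2 * Re (cinner V x y)"
  unfolding nsq_def by (simp add: cinner_diff_left cinner_diff_right Re_cinner_commute[of x y])

lemma nsq_smult: "x \<in> carrier V \<Longrightarrow> nsq (a \<odot> x) = (cmod a)\<^sup>2 * nsq x"
proof -
  assume x: "x \<in> carrier V"
  have "cinner V (a \<odot> x) (a \<odot> x) = of_real ((cmod a)\<^sup>2) * cinner V x x"
    using x complex_norm_square[of a] by (simp add: cinner_smult_left cinner_smult_right)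
  then show ?thesis unfolding nsq_def by (simp del: of_real_power)
qed

lemma Cauchy_Schwarz:
  assumes x: "x \<in> carrier V" and y: "y \<in> carrier V"
  shows "(cmod (cinner V x y))\<^sup>2 \<le> nsq x * nsq y"
proof (rule quadratic_nonneg)
  fix s
  have "0 \<le> nsq (x \<oplus> cnj s \<odot> y)" using x y by simp
  then show "0 \<le> nsq x + 2 * Re (s * cinner V x y) + (cmod s)\<^sup>2 * nsq y"
    using x y by (simp add: nsq_add nsq_smult cinner_smult_right)
qed (use x y in auto)

lemma norm_triangle:
  assumes x: "x \<in> carrier V" and y: "y \<in> carrier V"
  shows "sqrt (nsq (x \<oplus> y)) \<le> sqrt (nsq x) + sqrt (nsq y)"
proof (rule real_le_lsqrt)
  have "Re (cinner V x y) \<le> cmod (cinner V x y)" by (rule complex_Re_le_cmod)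
  also have "\<dots> \<le> sqrt (nsq x * nsq y)" using Cauchy_Schwarz[OF x y] by (rule real_le_rsqrt)
  finally show "nsq (x \<oplus> y) \<le> (sqrt (nsq x) + sqrt (nsq y))\<^sup>2"
    using x y by (simp add: nsq_add power2_sum real_sqrt_mult)
qed (use x y in auto)

lemma cdist_eq: "x \<in> carrier V \<Longrightarrow> y \<in> carrier V \<Longrightarrow> cdist V x y = sqrt (nsq (x \<ominus> y))"
  by (simp add: cdist_def nsq_def)

lemma Metric_space_cdist: "Metric_space (carrier V) (cdist V)"
proof
  fix x y
  show "0 \<le> cdist V x y"
    using nsq_nonneg[of "x \<ominus> y"] by (simp add: cdist_def nsq_def)
  show "cdist V x y = cdist V y x"
  proof (cases "x \<in> carrier V \<and> y \<in> carrier V")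
    case True
    then have "nsq (x \<ominus> y) = nsq (y \<ominus> x)" using Re_cinner_commute[of x y] by (simp add: nsq_diff)
    then show ?thesis using True by (simp add: cdist_eq)
  qed (auto simp: cdist_def)
next
  fix x y assume "x \<in> carrier V" "y \<in> carrier V"
  then show "cdist V x y = 0 \<longleftrightarrow> x = y"
    by (simp add: cdist_eq nsq_eq_0) (metis a_inv_closed a_minus_def minus_equality minus_minus r_neg)
next
  fix x y z assume xyz: "x \<in> carrier V" "y \<in> carrier V" "z \<in> carrier V"
  have "x \<ominus> z = (x \<ominus> y) \<oplus> (y \<ominus> z)"
    using xyz by (simp add: a_minus_def a_assoc r_neg1)
  then show "cdist V x z \<le> cdist V x y + cdist V y z"
    using norm_triangle[of "x \<ominus> y" "y \<ominus> z"] xyz by (simp add: cdist_eq)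
qed

end

sublocale complex_inner_space \<subseteq> Metric_space "carrier V" "cdist V"
  by (rule Metric_space_cdist)

lemma (in complex_inner_space) submoduleD:
  assumes "submodule W complex_ring V"
  shows "W \<subseteq> carrier V" "\<zero> \<in> W" "x \<in> W \<Longrightarrow> y \<in> W \<Longrightarrow> x \<oplus> y \<in> W" "x \<in> W \<Longrightarrow> a \<odot> x \<in> W"
proof -
  interpret W: submodule W complex_ring V by (rule assms)
  show "W \<subseteq> carrier V" "\<zero> \<in> W" "x \<in> W \<Longrightarrow> y \<in> W \<Longrightarrow> x \<oplus> y \<in> W" "x \<in> W \<Longrightarrow> a \<odot> x \<in> W"
    using W.subset W.one_closed W.m_closed W.smult_closed by auto
qed

text \<open>The point of \<open>W\<close> nearest to \<open>x\<close> exists by completeness, as minimising sequences are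
  Cauchy by the parallelogram law.\<close>

lemma (in complex_hilbert_space) projection:
  assumes W: "submodule W complex_ring V" "closedin mtopology W" and x: "x \<in> carrier V"
  obtains w where "w \<in> W" "\<And>u. u \<in> W \<Longrightarrow> cinner V (x \<ominus> w) u = 0"
proof -
  note WD = submoduleD[OF W(1)]
  have WV: "w \<in> carrier V" if "w \<in> W" for w using WD(1) that by auto
  define d where "d = (INF w\<in>W. nsq (x \<ominus> w))"
  have bdd: "bdd_below ((\<lambda>w. nsq (x \<ominus> w)) ` W)"
    using WV x by (intro bdd_belowI2[of _ 0]) auto
  have d_le: "d \<le> nsq (x \<ominus> w)" if "w \<in> W" for w
    unfolding d_def using bdd that by (rule cINF_lower)
  have d0: "0 \<le> d" unfolding d_def using WD(2) WV x by (intro cINF_greatest) auto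
  have "\<exists>w\<in>W. nsq (x \<ominus> w) < d + e" if "e > 0" for e
    using cINF_less_iff[OF _ bdd, of "d + e"] WD(2) that unfolding d_def by auto
  then have "\<exists>w\<in>W. nsq (x \<ominus> w) < d + 1 / real (Suc n)" for n by simp
  then obtain w where w: "\<And>n. w n \<in> W" "\<And>n. nsq (x \<ominus> w n) < d + 1 / real (Suc n)" by metis
  have wV: "w n \<in> carrier V" for n using w WV by auto
  have two: "2 / real k = 2 * (1 / real k)" for k by simp
  have par: "nsq (w n \<ominus> w m) < 2 / real (Suc n) + 2 / real (Suc m)" for n m
  proof -
    have "(1/2) \<odot> (w n \<oplus> w m) \<in> W" using w WD by auto
    then have "d \<le> nsq (x \<ominus> (1/2) \<odot> (w n \<oplus> w m))" by (rule d_le)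
    also have "\<dots> = nsq x + (nsq (w n) + nsq (w m) + 2 * Re (cinner V (w n) (w m))) / 4
        - Re (cinner V x (w n)) - Re (cinner V x (w m))"
      using x wV by (simp add: nsq_diff nsq_smult nsq_add cinner_smult_right cinner_add_right
          power2_eq_square norm_divide add_divide_distrib)
    finally show ?thesis
      using w(2)[of n, unfolded nsq_diff[OF x wV]] w(2)[of m, unfolded nsq_diff[OF x wV]]
      unfolding nsq_diff[OF wV wV] two by argo
  qed
  have "MCauchy w"
    unfolding MCauchy_def
  proof (intro conjI allI impI)
    show "range w \<subseteq> carrier V" using wV by auto
    fix e :: real assume e: "e > 0"
    obtain N where N: "4 / e\<^sup>2 < real N" using reals_Archimedean2 by blast
    have "cdist V (w n) (w m) < e" if "N \<le> n" "N \<le> m" for n m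
    proof -
      have "0 < 4 / e\<^sup>2" using e by simp
      then have N0: "0 < real N" using N by linarith
      have le: "2 / real (Suc k) \<le> 2 / real N" if "N \<le> k" for k
        using N0 that by (intro divide_left_mono) auto
      have "nsq (w n \<ominus> w m) < 4 / real N"
        using par[of n m] le[OF that(1)] le[OF that(2)] by simp
      also have "4 / real N < e\<^sup>2" using N N0 e by (simp add: field_simps)
      finally show ?thesis using wV e by (simp add: cdist_eq real_less_lsqrt)
    qed
    then show "\<exists>N. \<forall>n n'. N \<le> n \<longrightarrow> N \<le> n' \<longrightarrow> cdist V (w n) (w n') < e" by blast
  qed
  then obtain l where l: "limitin mtopology w l sequentially"
    using complete unfolding mcomplete_def by blast
  have lW: "l \<in> W"
    using W(2) l w(1) unfolding metric_closedin_iff_sequentially_closed by blast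
  have lV: "l \<in> carrier V" using lW WV by auto
  have "(\<lambda>n. cdist V (w n) l) \<longlonglongrightarrow> 0"
  proof (rule LIMSEQ_I)
    fix e :: real assume "e > 0"
    then obtain N where "\<forall>n\<ge>N. w n \<in> carrier V \<and> cdist V (w n) l < e"
      using l unfolding limit_metric_sequentially by blast
    then show "\<exists>N. \<forall>n\<ge>N. norm (cdist V (w n) l - 0) < e" by auto
  qed
  then have "(\<lambda>n. sqrt (d + 1 / real (Suc n)) + cdist V (w n) l) \<longlonglongrightarrow> sqrt (d + 0) + 0"
    by (intro tendsto_intros LIMSEQ_Suc[OF lim_1_over_n])
  moreover have "cdist V x l \<le> sqrt (d + 1 / real (Suc n)) + cdist V (w n) l" for n
  proof -
    have "cdist V x (w n) \<le> sqrt (d + 1 / real (Suc n))"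
      using w(2)[of n] wV x by (simp add: cdist_eq)
    then show ?thesis using triangle[OF x wV lV, of n] by simp
  qed
  ultimately have "cdist V x l \<le> sqrt d"
    using LIMSEQ_le_const[of _ "sqrt (d + 0) + 0" "cdist V x l"] by auto
  then have dl: "nsq (x \<ominus> l) \<le> d" using x lV by (simp add: cdist_eq)
  have "cinner V (x \<ominus> l) u = 0" if u: "u \<in> W" for u
  proof -
    have uV: "u \<in> carrier V" using u WV by auto
    \<comment> \<open>\<open>quadratic_nonneg\<close> with constant term \<open>0\<close>: moving
      \<open>l\<close> inside \<open>W\<close> by multiples of \<open>u\<close> does not decrease
      the distance to \<open>x\<close>, so no linear term can be present.\<close>
    have "(cmod (cinner V (x \<ominus> l) u))\<^sup>2 \<le> 0 * nsq u"
    proof (rule quadratic_nonneg)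
      fix s
      have "l \<oplus> cnj (- s) \<odot> u \<in> W" using lW u WD by auto
      then have "nsq (x \<ominus> l) \<le> nsq (x \<ominus> (l \<oplus> cnj (- s) \<odot> u))" using dl d_le by fastforce
      also have "\<dots> = nsq (x \<ominus> l) + 2 * Re (s * cinner V (x \<ominus> l) u) + (cmod s)\<^sup>2 * nsq u"
        using x lV uV by (simp add: nsq_diff nsq_add nsq_smult cinner_smult_right cinner_add_right
            cinner_diff_left algebra_simps)
      finally show "0 \<le> 0 + 2 * Re (s * cinner V (x \<ominus> l) u) + (cmod s)\<^sup>2 * nsq u" by simp
    qed (use uV in auto)
    then show ?thesis by simp
  qed
  then show ?thesis using that lW by blast
qed

lemma (in complex_inner_space) cinner_finsum_left:
  assumes "finite S" "f ` S \<subseteq> carrier V" "z \<in> carrier V"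
  shows "cinner V (finsum V f S) z = (\<Sum>x\<in>S. cinner V (f x) z)"
  using assms
proof (induction S rule: finite_induct)
  case (insert x S)
  then have "f \<in> S \<rightarrow> carrier V" "f x \<in> carrier V" by auto
  then show ?case using insert by (simp add: cinner_add_left)
qed simp

lemma (in complex_inner_space) cinner_finsum_right:
  assumes "finite S" "f ` S \<subseteq> carrier V" "z \<in> carrier V"
  shows "cinner V z (finsum V f S) = (\<Sum>x\<in>S. cinner V z (f x))"
proof -
  have "f \<in> S \<rightarrow> carrier V" using assms by auto
  then have "cinner V z (finsum V f S) = cnj (\<Sum>x\<in>S. cinner V (f x) z)"
    using assms cinner_commute[of "finsum V f S" z] by (simp add: cinner_finsum_left)
  also have "\<dots> = (\<Sum>x\<in>S. cinner V z (f x))"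
    using assms unfolding cnj_sum by (intro sum.cong refl) (metis cinner_commute image_subset_iff)
  finally show ?thesis .
qed

text \<open>In the next locale the name \<open>m_assoc\<close> refers to the ring of scalars.\<close>

lemmas (in group) group_m_assoc = m_assoc

locale unitary_representation = group G + complex_hilbert_space V
  for G :: "('g, 'b) monoid_scheme" (structure) and V :: "('v, 'm) inner_space_scheme" +
  fixes \<pi> :: "'g \<Rightarrow> 'v \<Rightarrow> 'v"
  assumes rep: "\<pi> \<in> hom G (unitary_group V)"
begin

lemma rep_carrier: "g \<in> carrier G \<Longrightarrow> \<pi> g \<in> carrier (unitary_group V)"
  using rep by (auto simp: hom_def)

lemma rep_closed [simp]: "g \<in> carrier G \<Longrightarrow> x \<in> carrier V \<Longrightarrow> \<pi> g x \<in> carrier V"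
  using rep_carrier[of g] Bij_imp_funcset[of "\<pi> g" "carrier V"] by (auto simp: unitary_group_def)

lemma rep_add: "g \<in> carrier G \<Longrightarrow> x \<in> carrier V \<Longrightarrow> y \<in> carrier V \<Longrightarrow> \<pi> g (x \<oplus>\<^bsub>V\<^esub> y) = \<pi> g x \<oplus>\<^bsub>V\<^esub> \<pi> g y"
  and rep_smult: "g \<in> carrier G \<Longrightarrow> x \<in> carrier V \<Longrightarrow> \<pi> g (a \<odot>\<^bsub>V\<^esub> x) = a \<odot>\<^bsub>V\<^esub> \<pi> g x"
  and rep_cinner: "g \<in> carrier G \<Longrightarrow> x \<in> carrier V \<Longrightarrow> y \<in> carrier V \<Longrightarrow> cinner V (\<pi> g x) (\<pi> g y) = cinner V x y"
  using rep_carrier[of g] by (auto simp: unitary_group_def)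

lemma rep_mult: "g \<in> carrier G \<Longrightarrow> h \<in> carrier G \<Longrightarrow> x \<in> carrier V \<Longrightarrow> \<pi> (g \<otimes> h) x = \<pi> g (\<pi> h x)"
  using rep rep_carrier[of g] rep_carrier[of h]
  by (simp add: hom_def unitary_group_def BijGroup_def compose_def)

lemma unitary_group_one: "\<one>\<^bsub>unitary_group V\<^esub> = (\<lambda>x\<in>carrier V. x)"
  by (simp add: unitary_group_def BijGroup_def)

lemma rep_extensional: "g \<in> carrier G \<Longrightarrow> \<pi> g \<in> extensional (carrier V)"
  using rep_carrier[of g] Bij_imp_extensional[of "\<pi> g"] by (auto simp: unitary_group_def)

lemma rep_trivial_iff: "g \<in> carrier G \<Longrightarrow> \<pi> g = \<one>\<^bsub>unitary_group V\<^esub> \<longleftrightarrow> (\<forall>x\<in>carrier V. \<pi> g x = x)"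
  using rep_extensional[of g] unfolding unitary_group_one
  by (auto intro!: extensionalityI[of _ "carrier V"])

text \<open>\<open>\<pi> \<one>\<close> is idempotent and injective, hence the identity on the
  space.\<close>

lemma rep_one: "x \<in> carrier V \<Longrightarrow> \<pi> \<one> x = x"
proof -
  assume x: "x \<in> carrier V"
  have "inj_on (\<pi> \<one>) (carrier V)"
    using rep_carrier[of \<one>] by (auto simp: unitary_group_def Bij_def bij_betw_def)
  then show ?thesis using rep_mult[of \<one> \<one> x] x by (auto dest: inj_onD)
qed

lemma rep_inv: "g \<in> carrier G \<Longrightarrow> x \<in> carrier V \<Longrightarrow> y \<in> carrier V \<Longrightarrow>
    cinner V (\<pi> g x) y = cinner V x (\<pi> (inv g) y)"
  using rep_cinner[of "inv g" "\<pi> g x" y] rep_mult[of "inv g" g x] rep_one[of x] by simp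

lemma rep_zero: "g \<in> carrier G \<Longrightarrow> \<pi> g \<zero>\<^bsub>V\<^esub> = \<zero>\<^bsub>V\<^esub>"
  using rep_smult[of g "\<zero>\<^bsub>V\<^esub>" 0] smult_l_null[of "\<pi> g \<zero>\<^bsub>V\<^esub>"] smult_l_null[of "\<zero>\<^bsub>V\<^esub>"] by simp

lemma rep_finsum:
  assumes "g \<in> carrier G" "finite S" "f ` S \<subseteq> carrier V"
  shows "\<pi> g (finsum V f S) = finsum V (\<lambda>s. \<pi> g (f s)) S"
  using assms(2,3)
proof (induction S rule: finite_induct)
  case (insert x S)
  then have "f \<in> S \<rightarrow> carrier V" "f x \<in> carrier V" "(\<lambda>s. \<pi> g (f s)) \<in> S \<rightarrow> carrier V"
    using assms(1) by auto
  then show ?case using insert assms(1) by (simp add: rep_add)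
qed (simp add: rep_zero assms)

text \<open>The quadratic form with weights \<open>a\<close> is the squared norm of the combination
  \<open>v\<close> of the vectors \<open>\<pi> x \<xi>\<close>, divided by that of
  \<open>\<xi>\<close>.\<close>

lemma pd_vector_state:
  assumes \<xi>: "\<xi> \<in> carrier V" "\<xi> \<noteq> \<zero>\<^bsub>V\<^esub>"
  shows "(\<lambda>g. if g \<in> carrier G then cinner V (\<pi> g \<xi>) \<xi> / cinner V \<xi> \<xi> else 0) \<in> pd G"
proof (rule pdI)
  have c: "cinner V \<xi> \<xi> = of_real (nsq \<xi>)" "nsq \<xi> > 0"
    using \<xi> cinner_self cinner_pos by (auto simp: nsq_def)
  show "(if \<one> \<in> carrier G then cinner V (\<pi> \<one> \<xi>) \<xi> / cinner V \<xi> \<xi> else 0) = 1"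
    using c \<xi> by (simp add: rep_one)
  fix x assume x: "x \<in> carrier G"
  have "cinner V (\<pi> (inv x) \<xi>) \<xi> = cnj (cinner V (\<pi> x \<xi>) \<xi>)"
    using rep_inv[of x \<xi> \<xi>] x \<xi> cinner_commute[of \<xi> "\<pi> (inv x) \<xi>"] by simp
  then show "(if inv x \<in> carrier G then cinner V (\<pi> (inv x) \<xi>) \<xi> / cinner V \<xi> \<xi> else 0) =
      cnj (if x \<in> carrier G then cinner V (\<pi> x \<xi>) \<xi> / cinner V \<xi> \<xi> else 0)"
    using x c by simp
next
  fix S and a :: "'g \<Rightarrow> complex" assume S: "finite S" "S \<subseteq> carrier G"
  have c: "cinner V \<xi> \<xi> = of_real (nsq \<xi>)" "nsq \<xi> > 0"
    using \<xi> cinner_self cinner_pos by (auto simp: nsq_def)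
  define v where "v = finsum V (\<lambda>x. a x \<odot>\<^bsub>V\<^esub> \<pi> x \<xi>) S"
  have im: "(\<lambda>x. a x \<odot>\<^bsub>V\<^esub> \<pi> x \<xi>) ` S \<subseteq> carrier V" using S \<xi> by auto
  then have "(\<lambda>x. a x \<odot>\<^bsub>V\<^esub> \<pi> x \<xi>) \<in> S \<rightarrow> carrier V" by auto
  then have vV: "v \<in> carrier V" unfolding v_def by (rule finsum_closed)
  have "(\<Sum>x\<in>S. \<Sum>y\<in>S. a x * cnj (a y) *
      (if inv y \<otimes> x \<in> carrier G then cinner V (\<pi> (inv y \<otimes> x) \<xi>) \<xi> / cinner V \<xi> \<xi> else 0)) =
    (\<Sum>x\<in>S. \<Sum>y\<in>S. cinner V (a x \<odot>\<^bsub>V\<^esub> \<pi> x \<xi>) (a y \<odot>\<^bsub>V\<^esub> \<pi> y \<xi>) / cinner V \<xi> \<xi>)"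
  proof (intro sum.cong refl)
    fix x y assume "x \<in> S" "y \<in> S"
    then have xy: "x \<in> carrier G" "y \<in> carrier G" using S by auto
    have "cinner V (\<pi> (inv y \<otimes> x) \<xi>) \<xi> = cinner V (\<pi> x \<xi>) (\<pi> y \<xi>)"
      using rep_inv[of "inv y" "\<pi> x \<xi>" \<xi>] rep_mult[of "inv y" x \<xi>] xy \<xi> by simp
    then show "a x * cnj (a y) *
      (if inv y \<otimes> x \<in> carrier G then cinner V (\<pi> (inv y \<otimes> x) \<xi>) \<xi> / cinner V \<xi> \<xi> else 0) =
      cinner V (a x \<odot>\<^bsub>V\<^esub> \<pi> x \<xi>) (a y \<odot>\<^bsub>V\<^esub> \<pi> y \<xi>) / cinner V \<xi> \<xi>"
      using xy \<xi> by (simp add: cinner_smult_left cinner_smult_right)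
  qed
  also have "\<dots> = cinner V v v / cinner V \<xi> \<xi>"
  proof -
    have "cinner V v v = (\<Sum>x\<in>S. cinner V (a x \<odot>\<^bsub>V\<^esub> \<pi> x \<xi>) v)"
      using cinner_finsum_left[OF S(1) im vV] by (simp add: v_def)
    also have "\<dots> = (\<Sum>x\<in>S. \<Sum>y\<in>S. cinner V (a x \<odot>\<^bsub>V\<^esub> \<pi> x \<xi>) (a y \<odot>\<^bsub>V\<^esub> \<pi> y \<xi>))"
      unfolding v_def using im by (intro sum.cong refl cinner_finsum_right[OF S(1) im]) auto
    finally show ?thesis by (simp add: sum_divide_distrib)
  qed
  also have "\<dots> = of_real (nsq v / nsq \<xi>)" using vV c(1) by (simp add: cinner_self)
  finally show "0 \<le> Re (\<Sum>x\<in>S. \<Sum>y\<in>S. a x * cnj (a y) *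
      (if inv y \<otimes> x \<in> carrier G then cinner V (\<pi> (inv y \<otimes> x) \<xi>) \<xi> / cinner V \<xi> \<xi> else 0))"
    using vV c by simp
qed auto

text \<open>Normality makes the space invariant: \<open>a\<close> acts on \<open>\<pi> g w\<close>
  as \<open>inv g \<otimes> a \<otimes> g\<close> acts on \<open>w\<close>. It is closed because a
  sequence of fixed vectors has the same distances to \<open>l\<close> and to
  \<open>\<pi> a l\<close>, so a limit \<open>l\<close> is fixed as well.\<close>

lemma fixed_space:
  assumes A: "A \<lhd> G"
  defines "W \<equiv> {v\<in>carrier V. \<forall>a\<in>A. \<pi> a v = v}"
  shows "submodule W complex_ring V" "closedin mtopology W" "\<And>g w. g \<in> carrier G \<Longrightarrow> w \<in> W \<Longrightarrow> \<pi> g w \<in> W"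
proof -
  interpret A: normal A G by (rule A)
  have AG: "a \<in> carrier G" if "a \<in> A" for a using that by (rule A.mem_carrier)
  show "submodule W complex_ring V"
  proof (rule submoduleI)
    show "\<zero>\<^bsub>V\<^esub> \<in> W" unfolding W_def by (auto simp: rep_zero AG)
    show "W \<subseteq> carrier V" by (auto simp: W_def)
    fix v assume v: "v \<in> W"
    have m: "\<ominus>\<^bsub>V\<^esub> v = (- 1) \<odot>\<^bsub>V\<^esub> v"
      using v minus_equality[of "(-1) \<odot>\<^bsub>V\<^esub> v" v] smult_l_distr[of "-1" 1 v] smult_one[of v] smult_l_null[of v]
      by (simp add: W_def)
    show "\<ominus>\<^bsub>V\<^esub> v \<in> W" using v unfolding m by (auto simp: W_def rep_smult AG)
    show "a \<odot>\<^bsub>V\<^esub> v \<in> W" for a using v by (auto simp: W_def rep_smult AG)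
    show "v \<oplus>\<^bsub>V\<^esub> u \<in> W" if "u \<in> W" for u using v that by (auto simp: W_def rep_add AG)
  qed
  show "\<pi> g w \<in> W" if g: "g \<in> carrier G" and w: "w \<in> W" for g w
  proof -
    have wV: "w \<in> carrier V" using w by (simp add: W_def)
    have "\<pi> a (\<pi> g w) = \<pi> g w" if a: "a \<in> A" for a
    proof -
      have b: "inv g \<otimes> a \<otimes> g \<in> A" using A.inv_op_closed1[OF g a] .
      have "g \<otimes> (inv g \<otimes> a \<otimes> g) = a \<otimes> g" using g AG[OF a] by (simp add: group_m_assoc[symmetric])
      then have "\<pi> a (\<pi> g w) = \<pi> g (\<pi> (inv g \<otimes> a \<otimes> g) w)"
        using rep_mult[OF AG[OF a] g wV] rep_mult[OF g AG[OF b] wV] by simp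
      then show ?thesis using b w by (simp add: W_def)
    qed
    then show ?thesis using g wV by (auto simp: W_def)
  qed
  show "closedin mtopology W"
    unfolding metric_closedin_iff_sequentially_closed
  proof (intro conjI allI impI)
    show "W \<subseteq> carrier V" by (auto simp: W_def)
    fix w l assume "range w \<subseteq> W \<and> limitin mtopology w l sequentially"
    then have w: "\<And>n. w n \<in> W" and l: "limitin mtopology w l sequentially" by auto
    have lV: "l \<in> carrier V" using l by (rule limitin_mspace)
    have "\<pi> a l = l" if a: "a \<in> A" for a
    proof -
      have wa: "\<pi> a (w n) = w n" "w n \<in> carrier V" for n using w a by (auto simp: W_def)
      have iso: "cdist V (w n) (\<pi> a l) = cdist V (w n) l" for n
      proof -
        have "nsq (w n \<ominus>\<^bsub>V\<^esub> \<pi> a l) = nsq (w n \<ominus>\<^bsub>V\<^esub> l)"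
          using rep_cinner[OF AG[OF a] wa(2) lV, of n] rep_cinner[OF AG[OF a] lV lV] wa[of n] lV AG[OF a]
          by (simp add: nsq_diff) (simp add: nsq_def)
        then show ?thesis using wa lV AG[OF a] by (simp add: cdist_eq)
      qed
      have "limitin mtopology w (\<pi> a l) sequentially"
        using l lV AG[OF a] unfolding limit_metric_sequentially iso by simp
      then show ?thesis using l limitin_metric_unique by (meson trivial_limit_sequentially)
    qed
    then show "l \<in> W" using lV by (simp add: W_def)
  qed
qed

text \<open>The vectors fixed by \<open>A\<close> form a closed invariant subspace that is not the
  whole space, hence \<open>0\<close>. The sum of \<open>\<pi> x \<xi>\<close> over \<open>x\<close>
  in \<open>A\<close> is fixed by \<open>A\<close>, so it vanishes, and its inner product with
  \<open>\<xi>\<close> after applying \<open>\<pi> \<gamma>\<close> is the coset sum.\<close>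

lemma annih_of_irreducible:
  assumes irr: "irreducible_unitary_rep G V \<pi>"
    and \<A>: "\<And>A. A \<in> \<A> \<Longrightarrow> A \<lhd> G \<and> finite A \<and> \<not> A \<subseteq> kernel G (unitary_group V) \<pi>"
  shows "annih G \<A> \<noteq> {}"
proof -
  obtain \<xi> where \<xi>: "\<xi> \<in> carrier V" "\<xi> \<noteq> \<zero>\<^bsub>V\<^esub>"
    using irr unfolding irreducible_unitary_rep_def by auto
  have "(\<lambda>g. if g \<in> carrier G then cinner V (\<pi> g \<xi>) \<xi> / cinner V \<xi> \<xi> else 0) \<in> annih G \<A>"
  proof (rule annihI[OF pd_vector_state[OF \<xi>]])
    fix A \<gamma> assume A: "A \<in> \<A>" and \<gamma>: "\<gamma> \<in> carrier G"
    have An: "A \<lhd> G" "finite A" "\<not> A \<subseteq> kernel G (unitary_group V) \<pi>" using \<A>[OF A] by auto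
    interpret A: normal A G by (rule An)
    define W where "W = {v\<in>carrier V. \<forall>a\<in>A. \<pi> a v = v}"
    have "W = {\<zero>\<^bsub>V\<^esub>} \<or> W = carrier V"
      using irr fixed_space[OF An(1)] unfolding irreducible_unitary_rep_def W_def by blast
    moreover have "W \<noteq> carrier V"
      using An(3) A.subset rep_trivial_iff unfolding W_def kernel_def by blast
    ultimately have W0: "W = {\<zero>\<^bsub>V\<^esub>}" by simp
    define v where "v = finsum V (\<lambda>x. \<pi> x \<xi>) A"
    have im: "(\<lambda>x. \<pi> x \<xi>) ` A \<subseteq> carrier V" using \<xi> A.subset by auto
    have vV: "v \<in> carrier V" unfolding v_def using im by (intro finsum_closed) auto
    have "\<pi> a v = v" if a: "a \<in> A" for a
    proof -
      have aG: "a \<in> carrier G" using a A.subset by auto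
      have "\<pi> a v = finsum V (\<lambda>x. \<pi> a (\<pi> x \<xi>)) A"
        unfolding v_def using aG An(2) im by (rule rep_finsum)
      also have "\<dots> = finsum V (\<lambda>x. \<pi> (a \<otimes> x) \<xi>) A"
        using aG A.subset \<xi> by (intro finsum_cong') (auto simp: rep_mult subset_iff)
      also have "\<dots> = finsum V (\<lambda>x. \<pi> x \<xi>) ((\<lambda>x. a \<otimes> x) ` A)"
        using aG A.subset \<xi> by (intro finsum_reindex[symmetric]) (auto intro!: inj_onI simp: subset_iff)
      also have "(\<lambda>x. a \<otimes> x) ` A = A"
      proof
        show "(\<lambda>x. a \<otimes> x) ` A \<subseteq> A" using a by auto
        show "A \<subseteq> (\<lambda>x. a \<otimes> x) ` A"
        proof
          fix x assume x: "x \<in> A"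
          then have "x = a \<otimes> (inv a \<otimes> x)" using aG A.mem_carrier[OF x] by (simp add: group_m_assoc[symmetric])
          then show "x \<in> (\<lambda>x. a \<otimes> x) ` A" using a x by blast
        qed
      qed
      finally show ?thesis by (simp add: v_def)
    qed
    then have "v = \<zero>\<^bsub>V\<^esub>" using W0 vV unfolding W_def by blast
    then have "0 = cinner V (\<pi> \<gamma> v) \<xi>" using \<gamma> \<xi> by (simp add: rep_zero)
    also have "\<dots> = cinner V (finsum V (\<lambda>x. \<pi> \<gamma> (\<pi> x \<xi>)) A) \<xi>"
      unfolding v_def using rep_finsum[OF \<gamma> An(2) im] by simp
    also have "\<dots> = (\<Sum>x\<in>A. cinner V (\<pi> \<gamma> (\<pi> x \<xi>)) \<xi>)"
      using An(2) \<gamma> \<xi> A.subset by (intro cinner_finsum_left) auto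
    also have "\<dots> = (\<Sum>x\<in>A. cinner V (\<pi> (\<gamma> \<otimes> x) \<xi>) \<xi>)"
      using \<gamma> \<xi> A.subset by (intro sum.cong refl) (auto simp: rep_mult subset_iff)
    finally have s0: "(\<Sum>x\<in>A. cinner V (\<pi> (\<gamma> \<otimes> x) \<xi>) \<xi>) = 0" by simp
    have "(\<Sum>x\<in>A. if \<gamma> \<otimes> x \<in> carrier G then cinner V (\<pi> (\<gamma> \<otimes> x) \<xi>) \<xi> / cinner V \<xi> \<xi> else 0) =
        (\<Sum>x\<in>A. cinner V (\<pi> (\<gamma> \<otimes> x) \<xi>) \<xi>) / cinner V \<xi> \<xi>"
      unfolding sum_divide_distrib using \<gamma> A.subset by (intro sum.cong refl) auto
    then show "(\<Sum>x\<in>A. if \<gamma> \<otimes> x \<in> carrier G then cinner V (\<pi> (\<gamma> \<otimes> x) \<xi>) \<xi> / cinner V \<xi> \<xi> else 0) = 0"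
      using s0 by simp
  qed
  then show ?thesis by blast
qed

end

context unitary_representation
begin

lemma diff_eq_zero_iff: "x \<in> carrier V \<Longrightarrow> y \<in> carrier V \<Longrightarrow> x \<ominus>\<^bsub>V\<^esub> y = \<zero>\<^bsub>V\<^esub> \<longleftrightarrow> x = y"
  using Metric_space.zero[OF Metric_space_cdist, of x y] by (simp add: cdist_eq nsq_eq_0)

text \<open>\<open>approx\<close> expresses that \<open>v\<close> is a limit of finite combinations
  of the orbit of a cyclic vector. The normalisers tend to \<open>nsq v\<close>, which is not
  \<open>0\<close>, so the state of \<open>v\<close> is a pointwise limit of normalised twists, and
  these lie in \<open>K\<close>.\<close>

lemma vector_state_mem:
  assumes K: "closed K" "twist_closed G K" "p \<in> K" and v: "v \<in> carrier V" "v \<noteq> \<zero>\<^bsub>V\<^esub>"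
    and approx: "\<exists>S a. (\<forall>n::nat. finite (S n) \<and> S n \<subseteq> carrier G) \<and>
      (\<forall>g\<in>carrier G. (\<lambda>n. twist G p (S n) (a n) g) \<longlonglongrightarrow> cinner V (\<pi> g v) v)"
  shows "(\<lambda>g. if g \<in> carrier G then cinner V (\<pi> g v) v / of_real (nsq v) else 0) \<in> K"
proof -
  obtain S a where S: "\<And>n::nat. finite (S n) \<and> S n \<subseteq> carrier G"
    and lim: "\<And>g. g \<in> carrier G \<Longrightarrow> (\<lambda>n. twist G p (S n) (a n) g) \<longlonglongrightarrow> cinner V (\<pi> g v) v"
    using approx by blast
  have ne: "complex_of_real (nsq v) \<noteq> 0" using v nsq_eq_0 by simp
  have lim1: "(\<lambda>n. twist G p (S n) (a n) \<one>) \<longlonglongrightarrow> of_real (nsq v)"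
    using lim[of \<one>] v by (simp add: rep_one cinner_self)
  have conv: "(\<lambda>n g. twist G p (S n) (a n) g / twist G p (S n) (a n) \<one>) \<longlonglongrightarrow>
      (\<lambda>g. if g \<in> carrier G then cinner V (\<pi> g v) v / of_real (nsq v) else 0)"
  proof (rule tendsto_funI)
    fix g
    show "(\<lambda>n. twist G p (S n) (a n) g / twist G p (S n) (a n) \<one>) \<longlonglongrightarrow>
      (if g \<in> carrier G then cinner V (\<pi> g v) v / of_real (nsq v) else 0)"
    proof (cases "g \<in> carrier G")
      case True then show ?thesis using tendsto_divide[OF lim lim1 ne] by simp
    next
      case False then show ?thesis by (simp add: twist_def)
    qed
  qed
  have ev: "eventually (\<lambda>n. (\<lambda>g. twist G p (S n) (a n) g / twist G p (S n) (a n) \<one>) \<in> K) sequentially"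
    using tendsto_imp_eventually_ne[OF lim1 ne]
    by eventually_elim (use K S in \<open>auto simp: twist_closed_def\<close>)
  show ?thesis
    by (rule Lim_in_closed_set[OF K(1) ev trivial_limit_sequentially conv])
qed

text \<open>If \<open>w\<close> is the projection of \<open>\<xi>\<close> to a closed invariant subspace, then \<open>p\<close> is a convex
  combination of the states of \<open>w\<close> and \<open>\<xi> - w\<close>; extremality forces \<open>w\<close> to be a multiple of \<open>\<xi>\<close>.\<close>

lemma irreducible_of_extreme:
  assumes \<xi>: "\<xi> \<in> carrier V"
    and state: "\<And>g. g \<in> carrier G \<Longrightarrow> cinner V (\<pi> g \<xi>) \<xi> = p g"
    and total: "\<And>v. v \<in> carrier V \<Longrightarrow> (\<And>g. g \<in> carrier G \<Longrightarrow> cinner V v (\<pi> g \<xi>) = 0) \<Longrightarrow> v = \<zero>\<^bsub>V\<^esub>"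
    and approx: "\<And>v. v \<in> carrier V \<Longrightarrow> \<exists>S a. (\<forall>n::nat. finite (S n) \<and> S n \<subseteq> carrier G) \<and>
      (\<forall>g\<in>carrier G. (\<lambda>n. twist G p (S n) (a n) g) \<longlonglongrightarrow> cinner V (\<pi> g v) v)"
    and K: "closed K" "twist_closed G K" "K \<subseteq> pd G" and p: "extreme_in p K"
  shows "irreducible_unitary_rep G V \<pi>"
proof -
  have pK: "p \<in> K" and ppd: "p \<in> pd G" using p K(3) by (auto simp: extreme_in_def)
  have "cinner V \<xi> \<xi> = 1" using state[of \<one>] \<xi> pd_one[OF ppd] by (simp add: rep_one)
  then have n1: "nsq \<xi> = 1" by (simp add: nsq_def)
  have "W = {\<zero>\<^bsub>V\<^esub>} \<or> W = carrier V"
    if W: "submodule W complex_ring V" "closedin mtopology W" "\<And>g u. g \<in> carrier G \<Longrightarrow> u \<in> W \<Longrightarrow> \<pi> g u \<in> W" for W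
  proof -
    note WD = submoduleD[OF W(1)]
    have WV: "u \<in> carrier V" if "u \<in> W" for u using WD(1) that by auto
    obtain w where w: "w \<in> W" "\<And>u. u \<in> W \<Longrightarrow> cinner V (\<xi> \<ominus>\<^bsub>V\<^esub> w) u = 0"
      using projection[OF W(1,2) \<xi>] by blast
    define b where "b = \<xi> \<ominus>\<^bsub>V\<^esub> w"
    have wV: "w \<in> carrier V" using w WV by auto
    have bV: "b \<in> carrier V" using \<xi> wV by (simp add: b_def)
    have orth: "cinner V b u = 0" "cinner V u b = 0" if "u \<in> W" for u
      using w(2)[OF that] cinner_commute[OF bV WV[OF that]] by (auto simp: b_def)
    have orthg: "cinner V (\<pi> g b) u = 0" if "u \<in> W" "g \<in> carrier G" for u g
      using rep_inv[of g b u] that bV WV orth(1)[of "\<pi> (inv g) u"] W(3) by auto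
    have \<xi>u: "cinner V \<xi> u = cinner V w u" if "u \<in> W" for u
      using w(2)[OF that] \<xi> wV WV[OF that] by (simp add: cinner_diff_left)
    \<comment> \<open>\<open>\<xi>\<close> is cyclic: a vector orthogonal to \<open>W\<close> is
      orthogonal to the orbit of \<open>\<xi>\<close> and therefore \<open>0\<close>.\<close>
    have full: "W = carrier V" if "\<xi> \<in> W"
    proof -
      have "v \<in> W" if v: "v \<in> carrier V" for v
      proof -
        obtain v' where v': "v' \<in> W" "\<And>u. u \<in> W \<Longrightarrow> cinner V (v \<ominus>\<^bsub>V\<^esub> v') u = 0"
          using projection[OF W(1,2) v] by blast
        have "v \<ominus>\<^bsub>V\<^esub> v' = \<zero>\<^bsub>V\<^esub>"
          using v v' WV W(3) \<open>\<xi> \<in> W\<close> by (intro total) auto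
        then have "v = v'" using diff_eq_zero_iff v v' WV by auto
        then show ?thesis using v' by simp
      qed
      then show ?thesis using WD(1) by auto
    qed
    have zero: "W = {\<zero>\<^bsub>V\<^esub>}" if "w = \<zero>\<^bsub>V\<^esub>"
    proof -
      have "u = \<zero>\<^bsub>V\<^esub>" if u: "u \<in> W" for u
      proof (rule total[OF WV[OF u]])
        fix g assume g: "g \<in> carrier G"
        have "cinner V (\<pi> g \<xi>) u = cinner V \<xi> (\<pi> (inv g) u)" using g \<xi> u WV by (simp add: rep_inv)
        also have "\<dots> = 0" using \<xi>u[of "\<pi> (inv g) u"] W(3)[of "inv g" u] g u WV \<open>w = \<zero>\<^bsub>V\<^esub>\<close> by simp
        finally show "cinner V u (\<pi> g \<xi>) = 0"
          using cinner_commute[of "\<pi> g \<xi>" u] g \<xi> u WV by simp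
      qed
      then show ?thesis using WD(2) by blast
    qed
    consider "w = \<zero>\<^bsub>V\<^esub>" | "b = \<zero>\<^bsub>V\<^esub>" | "w \<noteq> \<zero>\<^bsub>V\<^esub>" "b \<noteq> \<zero>\<^bsub>V\<^esub>" by blast
    then show ?thesis
    proof cases
      case 1 then show ?thesis using zero by simp
    next
      case 2
      then have "\<xi> = w" using diff_eq_zero_iff \<xi> wV by (simp add: b_def)
      then show ?thesis using full w by simp
    next
      case 3
      define t where "t = nsq w"
      have "nsq b = nsq \<xi> + nsq w - 2 * Re (cinner V \<xi> w)" unfolding b_def using \<xi> wV by (simp add: nsq_diff)
      then have nb: "nsq b = 1 - t" using \<xi>u[OF w(1)] n1 by (simp add: t_def nsq_def)
      have t: "0 < t" "t < 1"
        using 3 nsq_eq_0[OF wV] nsq_eq_0[OF bV] nsq_nonneg[OF wV] nsq_nonneg[OF bV] nb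
        by (auto simp: t_def)
      let ?f = "\<lambda>v g. if g \<in> carrier G then cinner V (\<pi> g v) v / of_real (nsq v) else 0"
      have fw: "?f w \<in> K" "?f b \<in> K"
        using vector_state_mem[OF K(1,2) pK] approx wV bV 3 by auto
      have dec: "\<xi> = w \<oplus>\<^bsub>V\<^esub> b" using \<xi> wV
        unfolding b_def a_minus_def by (metis M.add.inv_solve_left' M.add.m_comm M.add.m_closed a_inv_closed)
      have "p = mix t (?f w) (?f b)"
      proof
        fix g show "p g = mix t (?f w) (?f b) g"
        proof (cases "g \<in> carrier G")
          case False then show ?thesis using pd_off[OF ppd] by (simp add: mix_def)
        next
          case True
          have "p g = cinner V (\<pi> g (w \<oplus>\<^bsub>V\<^esub> b)) (w \<oplus>\<^bsub>V\<^esub> b)" using state[OF True] dec by simp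
          also have "\<dots> = cinner V (\<pi> g w) w + cinner V (\<pi> g b) b"
            using True wV bV w(1) W(3) by (simp add: rep_add cinner_add_left cinner_add_right orth orthg)
          also have "\<dots> = mix t (?f w) (?f b) g"
            using True t nb by (simp add: mix_def t_def[symmetric] flip: of_real_diff)
          finally show ?thesis .
        qed
      qed
      then have pf: "?f w = p" using p fw t unfolding extreme_in_def by blast
      \<comment> \<open>As \<open>?f w = p\<close>, the vectors \<open>w\<close> and
        \<open>t\<close> times \<open>\<xi>\<close> have the same inner products with every
        \<open>\<pi> g \<xi>\<close>; totality of the orbit identifies them.\<close>
      define v where "v = w \<ominus>\<^bsub>V\<^esub> of_real t \<odot>\<^bsub>V\<^esub> \<xi>"
      have "v = \<zero>\<^bsub>V\<^esub>"
      proof (rule total)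
        show "v \<in> carrier V" using wV \<xi> by (simp add: v_def)
        fix g assume g: "g \<in> carrier G"
        have "cinner V (\<pi> g \<xi>) w = cinner V (\<pi> g w) w"
          using dec g wV bV w(1) by (simp add: rep_add cinner_add_left orthg)
        also have "\<dots> = of_real t * p g"
          using fun_cong[OF pf, of g] g t by (simp add: t_def field_simps)
        finally have "cinner V (\<pi> g \<xi>) v = 0"
          using g \<xi> wV state[OF g] by (simp add: v_def cinner_diff_right cinner_smult_right)
        then show "cinner V v (\<pi> g \<xi>) = 0"
          using cinner_commute[of "\<pi> g \<xi>" v] g \<xi> wV by (simp add: v_def)
      qed
      then have wt: "w = of_real t \<odot>\<^bsub>V\<^esub> \<xi>" using diff_eq_zero_iff wV \<xi> by (simp add: v_def)
      have "of_real (1 / t) \<odot>\<^bsub>V\<^esub> w = \<xi>"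
        unfolding wt using t \<xi> smult_assoc1[of "of_real (1 / t)" "of_real t" \<xi>] smult_one[of \<xi>] by simp
      then have "\<xi> \<in> W" using WD(4)[OF w(1), of "of_real (1 / t)"] by simp
      then show ?thesis using full by simp
    qed
  qed
  moreover have "\<xi> \<noteq> \<zero>\<^bsub>V\<^esub>" using n1 nsq_eq_0[OF \<xi>] by auto
  ultimately show ?thesis
    unfolding irreducible_unitary_rep_def unitary_rep_def using \<xi> rep complex_hilbert_space_axioms by blast
qed

end

section \<open>The reproducing kernel Hilbert space of a positive semidefinite kernel\<close>

text \<open>Applied below to the carrier of a group with the kernel
  \<open>f (inv y \<otimes> x)\<close>. The space depends on \<open>k\<close> alone; the group
  action is added afterwards.\<close>

locale psd_kernel =
  fixes X :: "'g set" and k :: "'g \<Rightarrow> 'g \<Rightarrow> complex"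
  assumes k_herm: "x \<in> X \<Longrightarrow> y \<in> X \<Longrightarrow> k y x = cnj (k x y)"
    and k_psd: "finite S \<Longrightarrow> S \<subseteq> X \<Longrightarrow> 0 \<le> Re (\<Sum>x\<in>S. \<Sum>y\<in>S. a x * cnj (a y) * k x y)"
begin

definition supp :: "('g \<Rightarrow> complex) \<Rightarrow> 'g set" where "supp a = {x. a x \<noteq> 0}"

definition fs :: "('g \<Rightarrow> complex) set" where "fs = {a. finite (supp a) \<and> supp a \<subseteq> X}"

definition bil :: "('g \<Rightarrow> complex) \<Rightarrow> ('g \<Rightarrow> complex) \<Rightarrow> complex" where
  "bil a b = (\<Sum>x\<in>supp a. \<Sum>y\<in>supp b. a x * cnj (b y) * k x y)"

abbreviation q :: "('g \<Rightarrow> complex) \<Rightarrow> real" where "q a \<equiv> Re (bil a a)"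

definition delta :: "'g \<Rightarrow> 'g \<Rightarrow> complex" where "delta y = (\<lambda>x. if x = y then 1 else 0)"

lemma bil_eq:
  assumes "finite S" "supp a \<subseteq> S" "finite T" "supp b \<subseteq> T"
  shows "bil a b = (\<Sum>x\<in>S. \<Sum>y\<in>T. a x * cnj (b y) * k x y)"
proof -
  have "(\<Sum>x\<in>S. \<Sum>y\<in>T. a x * cnj (b y) * k x y) = (\<Sum>x\<in>S. \<Sum>y\<in>supp b. a x * cnj (b y) * k x y)"
    by (rule sum.cong[OF refl], rule sum.mono_neutral_right) (use assms in \<open>auto simp: supp_def\<close>)
  also have "\<dots> = bil a b"
    unfolding bil_def by (rule sum.mono_neutral_right) (use assms in \<open>auto simp: supp_def\<close>)
  finally show ?thesis ..
qed

lemma supp_lin: "supp (\<lambda>x. a x + c * b x) \<subseteq> supp a \<union> supp b"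
  by (auto simp: supp_def)

lemma fs_lin [simp]: "a \<in> fs \<Longrightarrow> b \<in> fs \<Longrightarrow> (\<lambda>x. a x + c * b x) \<in> fs"
  using supp_lin[of a c b] finite_subset[of "supp (\<lambda>x. a x + c * b x)" "supp a \<union> supp b"]
  by (auto simp: fs_def)

lemma fs_diff [simp]: "a \<in> fs \<Longrightarrow> b \<in> fs \<Longrightarrow> (\<lambda>x. a x - b x) \<in> fs"
  using fs_lin[of a b "- 1"] by simp

lemma fs_zero [simp]: "(\<lambda>_. 0) \<in> fs" by (simp add: fs_def supp_def)

lemma fs_delta [simp]: "x \<in> X \<Longrightarrow> delta x \<in> fs"
  by (auto simp: fs_def supp_def delta_def)

lemma bil_zero [simp]: "bil (\<lambda>_. 0) b = 0"
  by (simp add: bil_def supp_def)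

lemma bil_lin_left:
  assumes "a \<in> fs" "b \<in> fs" "d \<in> fs"
  shows "bil (\<lambda>x. a x + c * b x) d = bil a d + c * bil b d"
proof -
  let ?S = "supp a \<union> supp b"
  have f: "finite ?S" "finite (supp d)" using assms by (auto simp: fs_def)
  show ?thesis
    using bil_eq[OF f(1) supp_lin f(2) order_refl, of c]
      bil_eq[of ?S a "supp d" d] bil_eq[of ?S b "supp d" d] f
    by (simp add: sum_distrib_left sum.distrib[symmetric] algebra_simps)
qed

lemma bil_commute:
  assumes "a \<in> fs" "b \<in> fs"
  shows "bil b a = cnj (bil a b)"
proof -
  have "bil b a = (\<Sum>y\<in>supp a. \<Sum>x\<in>supp b. b x * cnj (a y) * k x y)"
    unfolding bil_def by (rule sum.swap)
  also have "\<dots> = (\<Sum>y\<in>supp a. \<Sum>x\<in>supp b. cnj (a y * cnj (b x) * k y x))"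
  proof (intro sum.cong refl)
    fix y x assume "y \<in> supp a" "x \<in> supp b"
    then have "k x y = cnj (k y x)" using assms by (intro k_herm) (auto simp: fs_def)
    then show "b x * cnj (a y) * k x y = cnj (a y * cnj (b x) * k y x)" by simp
  qed
  finally show ?thesis unfolding bil_def by simp
qed

lemma bil_lin_right:
  assumes "a \<in> fs" "b \<in> fs" "d \<in> fs"
  shows "bil d (\<lambda>x. a x + c * b x) = bil d a + cnj c * bil d b"
  using assms bil_lin_left[OF assms, of c] by (simp add: bil_commute[of _ d])

lemma bil_diff_left: "a \<in> fs \<Longrightarrow> b \<in> fs \<Longrightarrow> d \<in> fs \<Longrightarrow> bil (\<lambda>x. a x - b x) d = bil a d - bil b d"
  and bil_diff_right: "a \<in> fs \<Longrightarrow> b \<in> fs \<Longrightarrow> d \<in> fs \<Longrightarrow> bil d (\<lambda>x. a x - b x) = bil d a - bil d b"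
  using bil_lin_left[of a b d "-1"] bil_lin_right[of a b d "-1"] by simp_all

lemma q_nonneg [simp]: "a \<in> fs \<Longrightarrow> 0 \<le> q a"
  using k_psd[of "supp a" a] by (auto simp: fs_def bil_def)

lemma bil_CS:
  assumes a: "a \<in> fs" and b: "b \<in> fs"
  shows "cmod (bil a b) \<le> sqrt (q a) * sqrt (q b)"
proof -
  have "(cmod (bil a b))\<^sup>2 \<le> q a * q b"
  proof (rule quadratic_nonneg)
    fix s
    have "bil (\<lambda>x. a x + cnj s * b x) (\<lambda>x. a x + cnj s * b x) =
        bil a a + s * bil a b + cnj s * bil b a + (s * cnj s) * bil b b"
      using a b by (simp add: bil_lin_left bil_lin_right algebra_simps)
    also have "s * cnj s = of_real ((cmod s)\<^sup>2)" by (rule complex_norm_square[symmetric])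
    also have "cnj s * bil b a = cnj (s * bil a b)" using bil_commute[OF a b] by simp
    finally show "0 \<le> q a + 2 * Re (s * bil a b) + (cmod s)\<^sup>2 * q b"
      using q_nonneg[OF fs_lin[OF a b, of "cnj s"]] by (simp del: of_real_power)
  qed (use a b in auto)
  then show ?thesis using a b by (simp add: real_sqrt_mult[symmetric] real_le_rsqrt)
qed

lemma q_triangle:
  assumes a: "a \<in> fs" and b: "b \<in> fs"
  shows "sqrt (q (\<lambda>x. a x + b x)) \<le> sqrt (q a) + sqrt (q b)"
proof (rule real_le_lsqrt)
  have "bil (\<lambda>x. a x + 1 * b x) (\<lambda>x. a x + 1 * b x) = bil a a + bil b b + (bil a b + bil b a)"
    using a b by (simp only: bil_lin_left bil_lin_right fs_lin) simp
  then have "q (\<lambda>x. a x + b x) = q a + q b + 2 * Re (bil a b)"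
    using bil_commute[OF a b] by simp
  also have "Re (bil a b) \<le> sqrt (q a) * sqrt (q b)"
    using bil_CS[OF a b] complex_Re_le_cmod order_trans by blast
  finally show "q (\<lambda>x. a x + b x) \<le> (sqrt (q a) + sqrt (q b))\<^sup>2"
    using a b by (simp add: power2_sum)
qed (use a b fs_lin[of a b 1] q_nonneg in auto)

lemma q_diff_commute: "a \<in> fs \<Longrightarrow> b \<in> fs \<Longrightarrow> q (\<lambda>x. a x - b x) = q (\<lambda>x. b x - a x)"
  by (simp add: bil_diff_left bil_diff_right)

lemma sqrt_q_diff:
  assumes a: "a \<in> fs" and b: "b \<in> fs"
  shows "\<bar>sqrt (q a) - sqrt (q b)\<bar> \<le> sqrt (q (\<lambda>x. a x - b x))"
  using q_triangle[of "\<lambda>x. a x - b x" b] q_triangle[of "\<lambda>x. b x - a x" a] a b q_diff_commute[OF a b]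
  by simp

lemma bil_right_delta:
  assumes a: "a \<in> fs" and b: "b \<in> fs"
  shows "bil a b = (\<Sum>y\<in>supp b. cnj (b y) * bil a (delta y))"
proof -
  have "bil a (delta y) = (\<Sum>x\<in>supp a. a x * k x y)" for y
    by (simp add: bil_def supp_def delta_def)
  then show ?thesis
    unfolding bil_def by (subst sum.swap) (simp add: sum_distrib_left mult.assoc mult.left_commute)
qed

definition qCauchy :: "(nat \<Rightarrow> 'g \<Rightarrow> complex) \<Rightarrow> bool" where
  "qCauchy A \<longleftrightarrow> (\<forall>n. A n \<in> fs) \<and>
     (\<forall>e>0. \<exists>N. \<forall>m\<ge>N. \<forall>n\<ge>N. sqrt (q (\<lambda>x. A m x - A n x)) < e)"

text \<open>The completion is realised by functions: a sequence of formal sums that is Cauchy for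
  the seminorm represents the function of its limiting pairings with the points of \<open>X\<close>.
  Null vectors and equivalent sequences are thereby identified without forming classes.\<close>

definition rep :: "(nat \<Rightarrow> 'g \<Rightarrow> complex) \<Rightarrow> ('g \<Rightarrow> complex) \<Rightarrow> bool" where
  "rep A v \<longleftrightarrow> qCauchy A \<and> (\<forall>x\<in>X. (\<lambda>n. bil (A n) (delta x)) \<longlonglongrightarrow> v x) \<and> (\<forall>x. x \<notin> X \<longrightarrow> v x = 0)"

definition H :: "('g \<Rightarrow> complex) set" where "H = {v. \<exists>A. rep A v}"

text \<open>The choice of representing sequences does not matter, by \<open>ip_lim\<close>.\<close>

definition ip :: "('g \<Rightarrow> complex) \<Rightarrow> ('g \<Rightarrow> complex) \<Rightarrow> complex" where
  "ip v w = lim (\<lambda>n. bil ((SOME A. rep A v) n) ((SOME A. rep A w) n))"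

lemma qCauchyD:
  "qCauchy A \<Longrightarrow> 0 < e \<Longrightarrow> \<exists>N. \<forall>m\<ge>N. \<forall>n\<ge>N. sqrt (q (\<lambda>x. A m x - A n x)) < e"
  by (simp add: qCauchy_def)

lemma qCauchy_fs: "qCauchy A \<Longrightarrow> A n \<in> fs" by (simp add: qCauchy_def)
lemma rep_fs: "rep A v \<Longrightarrow> A n \<in> fs" by (simp add: rep_def qCauchy_def)

lemma qCauchy_bounded:
  assumes "qCauchy A"
  obtains M where "0 < M" "\<And>n. sqrt (q (A n)) \<le> M"
proof -
  have "Cauchy (\<lambda>n. sqrt (q (A n)))"
    unfolding Cauchy_def dist_real_def
  proof (intro allI impI)
    fix e :: real assume "e > 0"
    then obtain N where "\<forall>m\<ge>N. \<forall>n\<ge>N. sqrt (q (\<lambda>x. A m x - A n x)) < e"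
      using assms unfolding qCauchy_def by blast
    then show "\<exists>M. \<forall>m\<ge>M. \<forall>n\<ge>M. \<bar>sqrt (q (A m)) - sqrt (q (A n))\<bar> < e"
      using sqrt_q_diff[OF qCauchy_fs[OF assms] qCauchy_fs[OF assms]] by (meson le_less_trans)
  qed
  then have "Bseq (\<lambda>n. sqrt (q (A n)))" by (rule Cauchy_Bseq)
  then obtain M where "M > 0" "\<forall>n. norm (sqrt (q (A n))) \<le> M" by (auto simp: Bseq_def)
  then show ?thesis using that by (metis abs_le_iff real_norm_def)
qed

lemma bil_convergent:
  assumes A: "qCauchy A" and B: "qCauchy B"
  shows "convergent (\<lambda>n. bil (A n) (B n))"
proof -
  note fA = qCauchy_fs[OF A] and fB = qCauchy_fs[OF B]
  obtain M M' where M: "0 < M" "\<And>n. sqrt (q (A n)) \<le> M" "0 < M'" "\<And>n. sqrt (q (B n)) \<le> M'"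
    using qCauchy_bounded[OF A] qCauchy_bounded[OF B] by metis
  have "Cauchy (\<lambda>n. bil (A n) (B n))"
    unfolding Cauchy_def dist_norm
  proof (intro allI impI)
    fix e :: real assume e: "e > 0"
    obtain N where "\<forall>m\<ge>N. \<forall>n\<ge>N. sqrt (q (\<lambda>x. A m x - A n x)) < e / (2 * M')"
      using qCauchyD[OF A, of "e / (2 * M')"] e M by auto
    then have N: "\<And>m n. m \<ge> N \<Longrightarrow> n \<ge> N \<Longrightarrow> sqrt (q (\<lambda>x. A m x - A n x)) < e / (2 * M')" by blast
    obtain N' where "\<forall>m\<ge>N'. \<forall>n\<ge>N'. sqrt (q (\<lambda>x. B m x - B n x)) < e / (2 * M)"
      using qCauchyD[OF B, of "e / (2 * M)"] e M by auto
    then have N': "\<And>m n. m \<ge> N' \<Longrightarrow> n \<ge> N' \<Longrightarrow> sqrt (q (\<lambda>x. B m x - B n x)) < e / (2 * M)" by blast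
    have "cmod (bil (A m) (B m) - bil (A n) (B n)) < e" if "m \<ge> max N N'" "n \<ge> max N N'" for m n
    proof -
      have "bil (A m) (B m) - bil (A n) (B n) =
          bil (\<lambda>x. A m x - A n x) (B m) + bil (A n) (\<lambda>x. B m x - B n x)"
        using fA fB by (simp add: bil_diff_left bil_diff_right)
      also have "cmod \<dots> \<le> cmod (bil (\<lambda>x. A m x - A n x) (B m)) + cmod (bil (A n) (\<lambda>x. B m x - B n x))"
        by (rule norm_triangle_ineq)
      also have "\<dots> \<le> sqrt (q (\<lambda>x. A m x - A n x)) * sqrt (q (B m)) + sqrt (q (A n)) * sqrt (q (\<lambda>x. B m x - B n x))"
        by (rule add_mono[OF bil_CS bil_CS]) (simp_all only: fs_diff fA fB)
      also have "\<dots> \<le> sqrt (q (\<lambda>x. A m x - A n x)) * M' + M * sqrt (q (\<lambda>x. B m x - B n x))"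
        by (intro add_mono mult_left_mono mult_right_mono M real_sqrt_ge_zero q_nonneg fs_diff fA fB)
      also have "\<dots> < e / (2 * M') * M' + M * (e / (2 * M))"
        using that by (intro add_strict_mono mult_strict_right_mono mult_strict_left_mono M N N') auto
      also have "\<dots> = e" using M by simp
      finally show ?thesis .
    qed
    then show "\<exists>M. \<forall>m\<ge>M. \<forall>n\<ge>M. cmod (bil (A m) (B m) - bil (A n) (B n)) < e" by blast
  qed
  then show ?thesis by (rule Cauchy_convergent)
qed

lemma qCauchy_lin:
  assumes A: "qCauchy A" and B: "qCauchy B"
  shows "qCauchy (\<lambda>n x. A n x + c * B n x)"
  unfolding qCauchy_def
proof (intro conjI allI impI)
  note fA = qCauchy_fs[OF A] and fB = qCauchy_fs[OF B]
  show "(\<lambda>x. A n x + c * B n x) \<in> fs" for n using fA fB by simp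
  fix e :: real assume e: "e > 0"
  \<comment> \<open>Adding \<open>1\<close> keeps the divisor positive when
    \<open>c = 0\<close>.\<close>
  define C where "C = cmod c + 1"
  have C: "C > 0" "cmod c \<le> C" by (auto simp: C_def add_nonneg_pos)
  obtain N where "\<forall>m\<ge>N. \<forall>n\<ge>N. sqrt (q (\<lambda>x. A m x - A n x)) < e / 2"
    using qCauchyD[OF A, of "e / 2"] e by auto
  then have N: "\<And>m n. m \<ge> N \<Longrightarrow> n \<ge> N \<Longrightarrow> sqrt (q (\<lambda>x. A m x - A n x)) < e / 2" by blast
  obtain N' where "\<forall>m\<ge>N'. \<forall>n\<ge>N'. sqrt (q (\<lambda>x. B m x - B n x)) < e / (2 * C)"
    using qCauchyD[OF B, of "e / (2 * C)"] e C by auto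
  then have N': "\<And>m n. m \<ge> N' \<Longrightarrow> n \<ge> N' \<Longrightarrow> sqrt (q (\<lambda>x. B m x - B n x)) < e / (2 * C)" by blast
  have "sqrt (q (\<lambda>x. (A m x + c * B m x) - (A n x + c * B n x))) < e"
    if mn: "m \<ge> max N N'" "n \<ge> max N N'" for m n
  proof -
    let ?a = "\<lambda>x. A m x - A n x" and ?b = "\<lambda>x. B m x - B n x"
    have ab: "?a \<in> fs" "?b \<in> fs" "(\<lambda>x. c * ?b x) \<in> fs"
      using fA fB fs_lin[OF fs_zero, of ?b c] by auto
    have "bil (\<lambda>x. 0 + c * ?b x) (\<lambda>x. 0 + c * ?b x) = (c * cnj c) * bil ?b ?b"
      using ab fs_lin[OF fs_zero ab(2), of c]
      by (simp only: bil_lin_left bil_lin_right fs_zero) (simp add: bil_def supp_def)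
    also have "c * cnj c = of_real ((cmod c)\<^sup>2)" by (rule complex_norm_square[symmetric])
    finally have qc: "sqrt (q (\<lambda>x. c * ?b x)) = cmod c * sqrt (q ?b)"
      by (simp del: of_real_power add: real_sqrt_mult)
    have "(\<lambda>x. (A m x + c * B m x) - (A n x + c * B n x)) = (\<lambda>x. ?a x + c * ?b x)"
      by (auto simp: algebra_simps)
    then have "sqrt (q (\<lambda>x. (A m x + c * B m x) - (A n x + c * B n x))) \<le> sqrt (q ?a) + cmod c * sqrt (q ?b)"
      using q_triangle[OF ab(1,3)] qc by simp
    also have "\<dots> < e / 2 + C * (e / (2 * C))"
      using N[of m n] N'[of m n] mn C ab(2) by (intro add_less_le_mono mult_mono) auto
    also have "\<dots> = e" using C by simp
    finally show ?thesis .
  qed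
  then show "\<exists>N. \<forall>m\<ge>N. \<forall>n\<ge>N. sqrt (q (\<lambda>x. (A m x + c * B m x) - (A n x + c * B n x))) < e" by blast
qed

lemma rep_lin:
  assumes A: "rep A v" and B: "rep B w"
  shows "rep (\<lambda>n x. A n x + c * B n x) (\<lambda>x. v x + c * w x)"
  using assms unfolding rep_def
  by (auto intro!: qCauchy_lin tendsto_intros simp: bil_lin_left qCauchy_fs)

lemma rep_diff:
  assumes A: "rep A v" and B: "rep B w"
  shows "rep (\<lambda>n x. A n x - B n x) (\<lambda>x. v x - w x)"
  using rep_lin[OF assms, of "-1"] by simp

lemma rep_zero: "rep (\<lambda>_ _. 0) (\<lambda>_. 0)"
  by (auto simp: rep_def qCauchy_def bil_def supp_def)

text \<open>The point on which the completion rests: a Cauchy sequence whose pairings with all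
  \<open>delta x\<close> tend to \<open>0\<close> is a null sequence. Compare \<open>C n\<close>
  with a fixed late term \<open>C m\<close>. The pairing with the difference is small because the
  sequence is bounded, and the pairing with \<open>C m\<close> tends to \<open>0\<close> because
  \<open>C m\<close> has finite support.\<close>

lemma rep_null:
  assumes C: "rep C (\<lambda>_. 0)"
  shows "(\<lambda>n. sqrt (q (C n))) \<longlonglongrightarrow> 0"
proof (rule LIMSEQ_I)
  have fC: "C n \<in> fs" for n using C by (rule rep_fs)
  have qC: "qCauchy C" using C by (simp add: rep_def)
  fix e :: real assume e: "e > 0"
  obtain M where M: "0 < M" "\<And>n. sqrt (q (C n)) \<le> M" using qCauchy_bounded[OF qC] by metis
  have "0 < e\<^sup>2 / (2 * M)" using e M by simp
  then obtain m where "\<forall>k\<ge>m. \<forall>n\<ge>m. sqrt (q (\<lambda>x. C k x - C n x)) < e\<^sup>2 / (2 * M)"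
    using qCauchyD[OF qC, of "e\<^sup>2 / (2 * M)"] by auto
  then have m: "\<And>n. n \<ge> m \<Longrightarrow> sqrt (q (\<lambda>x. C n x - C m x)) < e\<^sup>2 / (2 * M)" by blast
  have "(\<lambda>n. bil (C n) (C m)) \<longlonglongrightarrow> (\<Sum>y\<in>supp (C m). cnj (C m y) * 0)"
    unfolding bil_right_delta[OF fC fC]
    using C fC[of m] by (intro tendsto_intros) (auto simp: rep_def fs_def)
  then have "(\<lambda>n. bil (C n) (C m)) \<longlonglongrightarrow> 0" by simp
  from LIMSEQ_D[OF this, of "e\<^sup>2 / 2"] e
  obtain N where N: "\<And>n. n \<ge> N \<Longrightarrow> cmod (bil (C n) (C m)) < e\<^sup>2 / 2" by auto
  have "norm (sqrt (q (C n)) - 0) < e" if n: "n \<ge> max N m" for n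
  proof -
    have "bil (C n) (C n) = bil (C n) (\<lambda>x. C n x - C m x) + bil (C n) (C m)"
      using fC by (simp add: bil_diff_right)
    then have "q (C n) \<le> cmod (bil (C n) (\<lambda>x. C n x - C m x)) + cmod (bil (C n) (C m))"
      by (metis complex_Re_le_cmod norm_triangle_ineq order_trans)
    also have "cmod (bil (C n) (\<lambda>x. C n x - C m x)) \<le> M * sqrt (q (\<lambda>x. C n x - C m x))"
      by (rule order_trans[OF bil_CS[OF fC fs_diff[OF fC fC]]])
        (intro mult_right_mono M real_sqrt_ge_zero q_nonneg fs_diff fC)
    also have "\<dots> < M * (e\<^sup>2 / (2 * M))" using m[of n] n M by (intro mult_strict_left_mono) auto
    also have "M * (e\<^sup>2 / (2 * M)) = e\<^sup>2 / 2" using M by simp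
    finally have "q (C n) < e\<^sup>2" using N[of n] n by simp
    then show ?thesis using e fC by (simp add: real_less_lsqrt)
  qed
  then show "\<exists>N. \<forall>n\<ge>N. norm (sqrt (q (C n)) - 0) < e" by blast
qed

lemma bil_null:
  assumes C: "rep C (\<lambda>_. 0)" and B: "qCauchy B"
  shows "(\<lambda>n. bil (C n) (B n)) \<longlonglongrightarrow> 0"
proof -
  obtain M where M: "0 < M" "\<And>n. sqrt (q (B n)) \<le> M" using qCauchy_bounded[OF B] by metis
  have "(\<lambda>n. sqrt (q (C n)) * M) \<longlonglongrightarrow> 0 * M" by (intro tendsto_intros rep_null C)
  then have lim: "(\<lambda>n. sqrt (q (C n)) * M) \<longlonglongrightarrow> 0" by simp
  have bound: "cmod (bil (C n) (B n)) \<le> sqrt (q (C n)) * M" for n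
    by (rule order_trans[OF bil_CS[OF rep_fs[OF C] qCauchy_fs[OF B]]])
      (intro mult_left_mono M real_sqrt_ge_zero q_nonneg rep_fs[OF C])
  show ?thesis by (rule Lim_null_comparison[OF always_eventually[OF allI[OF bound]] lim])
qed

lemma rep_cauchy: "rep A v \<Longrightarrow> qCauchy A" by (simp add: rep_def)

text \<open>Two sequences representing the same function differ by one that represents
  \<open>0\<close>, and by \<open>bil_null\<close> such a difference contributes nothing in the
  limit.\<close>

lemma ip_lim:
  assumes A: "rep A v" and B: "rep B w"
  shows "(\<lambda>n. bil (A n) (B n)) \<longlonglongrightarrow> ip v w"
proof -
  define A' where "A' = (SOME A. rep A v)"
  define B' where "B' = (SOME A. rep A w)"
  have A': "rep A' v" unfolding A'_def by (rule someI[of "\<lambda>A. rep A v", OF A])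
  have B': "rep B' w" unfolding B'_def by (rule someI[of "\<lambda>A. rep A w", OF B])
  note fsx = rep_fs[OF A] rep_fs[OF A'] rep_fs[OF B] rep_fs[OF B']
  have "(\<lambda>n. bil (A' n) (B' n)) \<longlonglongrightarrow> ip v w"
    using bil_convergent[OF rep_cauchy[OF A'] rep_cauchy[OF B']]
    unfolding ip_def A'_def[symmetric] B'_def[symmetric] by (simp add: convergent_LIMSEQ_iff)
  moreover have "(\<lambda>n. bil (\<lambda>x. A n x - A' n x) (B n)) \<longlonglongrightarrow> 0"
    using bil_null[OF _ rep_cauchy[OF B]] rep_diff[OF A A'] by simp
  moreover have "(\<lambda>n. cnj (bil (\<lambda>x. B n x - B' n x) (A' n))) \<longlonglongrightarrow> cnj 0"
    using bil_null[OF _ rep_cauchy[OF A']] rep_diff[OF B B'] by (intro tendsto_cnj) simp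
  ultimately have "(\<lambda>n. bil (A' n) (B' n) + bil (\<lambda>x. A n x - A' n x) (B n) + cnj (bil (\<lambda>x. B n x - B' n x) (A' n)))
      \<longlonglongrightarrow> ip v w + 0 + cnj 0"
    by (intro tendsto_add)
  moreover have "bil (A' n) (B' n) + bil (\<lambda>x. A n x - A' n x) (B n) + cnj (bil (\<lambda>x. B n x - B' n x) (A' n))
      = bil (A n) (B n)" for n
    using fsx by (simp add: bil_diff_left bil_commute[symmetric])
  ultimately show ?thesis by simp
qed

lemma H_rep: "v \<in> H \<Longrightarrow> \<exists>A. rep A v" by (simp add: H_def)

lemma H_lin: "v \<in> H \<Longrightarrow> w \<in> H \<Longrightarrow> (\<lambda>x. v x + c * w x) \<in> H"
  unfolding H_def using rep_lin by blast

lemma H_zero: "(\<lambda>_. 0) \<in> H" unfolding H_def using rep_zero by blast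

lemma ip_lin_left:
  assumes "v \<in> H" "w \<in> H" "u \<in> H"
  shows "ip (\<lambda>x. v x + c * w x) u = ip v u + c * ip w u"
proof -
  obtain A B C where r: "rep A v" "rep B w" "rep C u" using assms H_rep by meson
  have "(\<lambda>n. bil (A n) (C n) + c * bil (B n) (C n)) \<longlonglongrightarrow> ip v u + c * ip w u"
    using r by (intro tendsto_intros ip_lim)
  moreover have "(\<lambda>n. bil (A n) (C n) + c * bil (B n) (C n)) \<longlonglongrightarrow> ip (\<lambda>x. v x + c * w x) u"
    using ip_lim[OF rep_lin[OF r(1,2)] r(3), of c] rep_fs[OF r(1)] rep_fs[OF r(2)] rep_fs[OF r(3)]
    by (simp add: bil_lin_left)
  ultimately show ?thesis by (rule LIMSEQ_unique[rotated])
qed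

lemma ip_commute:
  assumes "v \<in> H" "w \<in> H"
  shows "ip w v = cnj (ip v w)"
proof -
  obtain A B where r: "rep A v" "rep B w" using assms H_rep by meson
  have "(\<lambda>n. cnj (bil (A n) (B n))) \<longlonglongrightarrow> cnj (ip v w)"
    using r by (intro tendsto_cnj ip_lim)
  then have "(\<lambda>n. bil (B n) (A n)) \<longlonglongrightarrow> cnj (ip v w)"
    using rep_fs[OF r(1)] rep_fs[OF r(2)] by (simp add: bil_commute[of "A _" "B _"])
  with ip_lim[OF r(2,1)] show ?thesis by (rule LIMSEQ_unique)
qed

text \<open>The element of \<open>H\<close> represented by the constant sequence \<open>b\<close>;
  \<open>hat (delta x)\<close> is the kernel function at \<open>x\<close>.\<close>

definition hat :: "('g \<Rightarrow> complex) \<Rightarrow> 'g \<Rightarrow> complex" where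
  "hat b = (\<lambda>x. if x \<in> X then bil b (delta x) else 0)"

lemma rep_hat: "b \<in> fs \<Longrightarrow> rep (\<lambda>_. b) (hat b)"
  by (auto simp: rep_def qCauchy_def hat_def bil_diff_left bil_diff_right)

lemma hat_H: "b \<in> fs \<Longrightarrow> hat b \<in> H" unfolding H_def using rep_hat by blast

lemma ip_hat_delta:
  assumes v: "v \<in> H" and x: "x \<in> X"
  shows "ip v (hat (delta x)) = v x"
proof -
  obtain A where A: "rep A v" using v H_rep by blast
  have "(\<lambda>n. bil (A n) (delta x)) \<longlonglongrightarrow> ip v (hat (delta x))"
    using ip_lim[OF A rep_hat[OF fs_delta[OF x]]] .
  moreover have "(\<lambda>n. bil (A n) (delta x)) \<longlonglongrightarrow> v x" using A x by (simp add: rep_def)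
  ultimately show ?thesis by (rule LIMSEQ_unique)
qed

text \<open>By Cauchy-Schwarz the values \<open>v x\<close> are limits of pairings bounded by the
  seminorm of \<open>A n\<close>, so a vector of norm \<open>0\<close> is the zero function.\<close>

lemma ip_pos:
  assumes v: "v \<in> H" "v \<noteq> (\<lambda>_. 0)"
  shows "0 < Re (ip v v)"
proof -
  obtain A where A: "rep A v" using v H_rep by blast
  have lim: "(\<lambda>n. q (A n)) \<longlonglongrightarrow> Re (ip v v)" using ip_lim[OF A A] by (rule tendsto_Re)
  then have "0 \<le> Re (ip v v)" using rep_fs[OF A] by (intro LIMSEQ_le_const[OF lim]) auto
  moreover have "Re (ip v v) \<noteq> 0"
  proof
    assume "Re (ip v v) = 0"
    then have s0: "(\<lambda>n. sqrt (q (A n))) \<longlonglongrightarrow> 0" using tendsto_real_sqrt[OF lim] by simp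
    have "v x = 0" for x
    proof (cases "x \<in> X")
      case True
      have "(\<lambda>n. sqrt (q (A n)) * sqrt (q (delta x))) \<longlonglongrightarrow> 0 * sqrt (q (delta x))"
        by (intro tendsto_intros s0)
      then have lim0: "(\<lambda>n. sqrt (q (A n)) * sqrt (q (delta x))) \<longlonglongrightarrow> 0" by simp
      have "(\<lambda>n. bil (A n) (delta x)) \<longlonglongrightarrow> 0"
        by (rule Lim_null_comparison[OF always_eventually[OF allI[OF bil_CS[OF rep_fs[OF A] fs_delta[OF True]]]] lim0])
      moreover have "(\<lambda>n. bil (A n) (delta x)) \<longlonglongrightarrow> v x" using A True by (simp add: rep_def)
      ultimately show ?thesis by (rule LIMSEQ_unique[rotated])
    next
      case False then show ?thesis using A by (simp add: rep_def)
    qed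
    then show False using v by auto
  qed
  ultimately show ?thesis by simp
qed

definition RK :: "('g \<Rightarrow> complex) inner_space" where
  "RK = \<lparr>carrier = H, mult = undefined, one = undefined, zero = (\<lambda>_. 0), add = (\<lambda>v w x. v x + w x),
     smult = (\<lambda>c v x. c * v x), cinner = ip\<rparr>"

lemma RK_simps [simp]: "carrier RK = H" "\<zero>\<^bsub>RK\<^esub> = (\<lambda>_. 0)" "v \<oplus>\<^bsub>RK\<^esub> w = (\<lambda>x. v x + w x)"
  "c \<odot>\<^bsub>RK\<^esub> v = (\<lambda>x. c * v x)" "cinner RK = ip"
  by (simp_all add: RK_def)

lemma RK_inner_space: "complex_inner_space RK"
proof -
  have add: "(\<lambda>x. v x + w x) \<in> H" if "v \<in> H" "w \<in> H" for v w using H_lin[OF that, of 1] by simp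
  have smult: "(\<lambda>x. c * v x) \<in> H" if "v \<in> H" for c v using H_lin[OF H_zero that, of c] by simp
  have "abelian_group RK"
  proof (rule abelian_groupI)
    fix v assume "v \<in> carrier RK"
    then show "\<exists>y\<in>carrier RK. y \<oplus>\<^bsub>RK\<^esub> v = \<zero>\<^bsub>RK\<^esub>"
      using smult[of v "-1"] by (intro bexI[of _ "\<lambda>x. (-1) * v x"]) auto
  qed (auto simp: add H_zero algebra_simps)
  then have "module complex_ring RK"
    by (intro moduleI cring_complex_ring) (auto simp: smult algebra_simps)
  moreover have "ip (\<lambda>x. v x + w x) u = ip v u + ip w u" if "v \<in> H" "w \<in> H" "u \<in> H" for v w u
    using ip_lin_left[OF that, of 1] by simp
  moreover have "ip (\<lambda>x. c * v x) u = c * ip v u" if "v \<in> H" "u \<in> H" for c v u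
  proof -
    have "ip (\<lambda>_. 0) u = 0" using ip_lin_left[OF H_zero H_zero that(2), of 1] by simp
    then show ?thesis using ip_lin_left[OF H_zero that, of c] by simp
  qed
  ultimately show ?thesis
    by (intro complex_inner_space.intro complex_inner_space_axioms.intro) (auto intro: ip_commute ip_pos)
qed

end

context psd_kernel
begin

interpretation RK: complex_inner_space RK by (rule RK_inner_space)

lemma RK_diff:
  assumes "v \<in> H" "w \<in> H"
  shows "v \<ominus>\<^bsub>RK\<^esub> w = (\<lambda>x. v x - w x)"
proof -
  have "(\<lambda>x. - w x) \<in> H" using H_lin[OF H_zero assms(2), of "-1"] by simp
  then have "\<ominus>\<^bsub>RK\<^esub> w = (\<lambda>x. - w x)" using assms by (intro RK.minus_equality) auto
  then show ?thesis by (simp add: a_minus_def)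
qed

lemma cdist_RK: "v \<in> H \<Longrightarrow> w \<in> H \<Longrightarrow> cdist RK v w = sqrt (Re (ip (\<lambda>x. v x - w x) (\<lambda>x. v x - w x)))"
  by (simp add: RK.cdist_eq RK_diff RK.nsq_def)

lemma cdist_lim:
  assumes A: "rep A v" and B: "rep B w"
  shows "(\<lambda>n. sqrt (q (\<lambda>x. A n x - B n x))) \<longlonglongrightarrow> cdist RK v w"
proof -
  have "v \<in> H" "w \<in> H" using assms by (auto simp: H_def)
  then show ?thesis
    unfolding cdist_RK[OF \<open>v \<in> H\<close> \<open>w \<in> H\<close>]
    by (intro tendsto_real_sqrt tendsto_Re ip_lim rep_diff assms)
qed

lemma cdist_hat:
  assumes "a \<in> fs" "b \<in> fs"
  shows "cdist RK (hat a) (hat b) = sqrt (q (\<lambda>x. a x - b x))"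
  using LIMSEQ_unique[OF cdist_lim[OF rep_hat[OF assms(1)] rep_hat[OF assms(2)]] tendsto_const] .

lemma hat_approx:
  assumes A: "rep A v" and e: "0 < e"
  shows "\<exists>N. \<forall>n\<ge>N. cdist RK v (hat (A n)) \<le> e"
proof -
  obtain N where N: "\<forall>m\<ge>N. \<forall>n\<ge>N. sqrt (q (\<lambda>x. A m x - A n x)) < e"
    using qCauchyD[OF rep_cauchy[OF A] e] by auto
  have "cdist RK v (hat (A n)) \<le> e" if "n \<ge> N" for n
  proof (rule LIMSEQ_le_const2[OF cdist_lim[OF A rep_hat[OF rep_fs[OF A]]]])
    show "\<exists>N. \<forall>l\<ge>N. sqrt (q (\<lambda>x. A l x - A n x)) \<le> e"
      using N that by (intro exI[of _ N]) (auto intro: less_imp_le)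
  qed
  then show ?thesis by blast
qed

lemma qCauchy_rep:
  assumes b: "qCauchy b"
  shows "\<exists>v. rep b v"
proof -
  have "convergent (\<lambda>n. bil (b n) (delta x))" if "x \<in> X" for x
    using bil_convergent[OF b rep_cauchy[OF rep_hat[OF fs_delta[OF that]]]] .
  then have "rep b (\<lambda>x. if x \<in> X then lim (\<lambda>n. bil (b n) (delta x)) else 0)"
    using b unfolding rep_def by (auto simp: convergent_LIMSEQ_iff)
  then show ?thesis by blast
qed

text \<open>Replace each term of a Cauchy sequence by a formal sum at distance at most
  \<open>1 / real (Suc n)\<close>. These formal sums are Cauchy for the seminorm, and the function
  that they represent is the limit.\<close>

lemma RK_hilbert: "complex_hilbert_space RK"
proof -
  have "RK.mcomplete"
    unfolding RK.mcomplete_def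
  proof (intro allI impI)
    fix \<sigma> assume \<sigma>: "RK.MCauchy \<sigma>"
    then have \<sigma>H: "\<sigma> n \<in> H" for n using RK.MCauchy_def by auto
    have "\<exists>b. b \<in> fs \<and> cdist RK (\<sigma> n) (hat b) \<le> 1 / real (Suc n)" for n
    proof -
      obtain A where A: "rep A (\<sigma> n)" using H_rep[OF \<sigma>H] by blast
      obtain N where "\<forall>m\<ge>N. cdist RK (\<sigma> n) (hat (A m)) \<le> 1 / real (Suc n)"
        using hat_approx[OF A, of "1 / real (Suc n)"] by auto
      then show ?thesis using rep_fs[OF A] by blast
    qed
    then obtain b where b: "\<And>n. b n \<in> fs" "\<And>n. cdist RK (\<sigma> n) (hat (b n)) \<le> 1 / real (Suc n)" by metis
    have hH: "hat (b n) \<in> H" for n using b hat_H by blast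
    have small: "\<exists>N. \<forall>n\<ge>N. 1 / real (Suc n) < e" if e: "0 < e" for e :: real
    proof -
      obtain N where N: "1 / real (Suc N) < e" using nat_approx_posE[OF e] by blast
      have "1 / real (Suc n) \<le> 1 / real (Suc N)" if "n \<ge> N" for n
        using that by (intro divide_left_mono) auto
      then show ?thesis using N by (intro exI[of _ N]) (auto intro: le_less_trans)
    qed
    have "qCauchy b"
      unfolding qCauchy_def
    proof (intro conjI allI impI b(1))
      fix e :: real assume e: "0 < e"
      obtain N where N: "\<forall>n\<ge>N. 1 / real (Suc n) < e / 3" using small[of "e / 3"] e by auto
      obtain N' where N': "\<forall>m n. N' \<le> m \<longrightarrow> N' \<le> n \<longrightarrow> cdist RK (\<sigma> m) (\<sigma> n) < e / 3"
        using \<sigma> e unfolding RK.MCauchy_def by (meson divide_pos_pos zero_less_numeral)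
      have "sqrt (q (\<lambda>x. b m x - b n x)) < e" if "m \<ge> max N N'" "n \<ge> max N N'" for m n
      proof -
        have "sqrt (q (\<lambda>x. b m x - b n x)) = cdist RK (hat (b m)) (hat (b n))"
          using b by (simp add: cdist_hat)
        also have "\<dots> \<le> cdist RK (hat (b m)) (\<sigma> m) + cdist RK (\<sigma> m) (hat (b n))"
          using hH \<sigma>H by (intro RK.triangle) auto
        also have "\<dots> \<le> cdist RK (hat (b m)) (\<sigma> m) + (cdist RK (\<sigma> m) (\<sigma> n) + cdist RK (\<sigma> n) (hat (b n)))"
          using hH \<sigma>H by (intro add_left_mono RK.triangle) auto
        also have "\<dots> \<le> 1 / real (Suc m) + (cdist RK (\<sigma> m) (\<sigma> n) + 1 / real (Suc n))"
          using b(2)[of m] b(2)[of n] RK.commute[of "hat (b m)" "\<sigma> m"] by simp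
        also have "\<dots> < e / 3 + (e / 3 + e / 3)"
          using N N' that by (intro add_strict_mono) auto
        finally show ?thesis by simp
      qed
      then show "\<exists>N. \<forall>m\<ge>N. \<forall>n\<ge>N. sqrt (q (\<lambda>x. b m x - b n x)) < e" by blast
    qed
    then obtain v where v: "rep b v" using qCauchy_rep by blast
    have vH: "v \<in> H" using v by (auto simp: H_def)
    have "limitin RK.mtopology \<sigma> v sequentially"
      unfolding RK.limit_metric_sequentially
    proof (intro conjI allI impI)
      show "v \<in> carrier RK" using vH by simp
      fix e :: real assume e: "0 < e"
      obtain N where N: "\<forall>n\<ge>N. 1 / real (Suc n) < e / 2" using small[of "e / 2"] e by auto
      obtain N' where N': "\<forall>n\<ge>N'. cdist RK v (hat (b n)) \<le> e / 2" using hat_approx[OF v, of "e / 2"] e by auto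
      have "cdist RK (\<sigma> n) v < e" if "n \<ge> max N N'" for n
      proof -
        have "cdist RK (\<sigma> n) v \<le> cdist RK (\<sigma> n) (hat (b n)) + cdist RK (hat (b n)) v"
          using hH \<sigma>H vH by (intro RK.triangle) auto
        also have "\<dots> < e / 2 + e / 2"
          using b(2)[of n] N N' that RK.commute[of "hat (b n)" v] by (intro add_less_le_mono) (auto intro: le_less_trans)
        finally show ?thesis by simp
      qed
      then show "\<exists>N. \<forall>n\<ge>N. \<sigma> n \<in> carrier RK \<and> cdist RK (\<sigma> n) v < e"
        using \<sigma>H by (intro exI[of _ "max N N'"]) auto
    qed
    then show "\<exists>x. limitin RK.mtopology \<sigma> x sequentially" by blast
  qed
  then show ?thesis
    by (intro complex_hilbert_space.intro complex_hilbert_space_axioms.intro RK.module_axioms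
        RK.cinner_add_left RK.cinner_smult_left RK.cinner_commute RK.cinner_pos)
qed

end

section \<open>Copying a Hilbert space along an injection into another type\<close>

definition transport :: "('v \<Rightarrow> 'w) \<Rightarrow> 'v inner_space \<Rightarrow> 'w inner_space" where
  "transport J V = (let K = inv_into (carrier V) J in
     \<lparr>carrier = J ` carrier V, mult = undefined, one = undefined, zero = J \<zero>\<^bsub>V\<^esub>,
      add = (\<lambda>x y. J (K x \<oplus>\<^bsub>V\<^esub> K y)), smult = (\<lambda>a x. J (a \<odot>\<^bsub>V\<^esub> K x)),
      cinner = (\<lambda>x y. cinner V (K x) (K y))\<rparr>)"

context
  fixes J :: "'v \<Rightarrow> 'w" and V :: "'v inner_space"
  assumes J: "inj_on J (carrier V)" and V: "complex_hilbert_space V"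
begin

interpretation V: complex_hilbert_space V by (rule V)

lemma transport_simps [simp]:
  "carrier (transport J V) = J ` carrier V" "\<zero>\<^bsub>transport J V\<^esub> = J \<zero>\<^bsub>V\<^esub>"
  "x \<in> carrier V \<Longrightarrow> y \<in> carrier V \<Longrightarrow> J x \<oplus>\<^bsub>transport J V\<^esub> J y = J (x \<oplus>\<^bsub>V\<^esub> y)"
  "x \<in> carrier V \<Longrightarrow> a \<odot>\<^bsub>transport J V\<^esub> J x = J (a \<odot>\<^bsub>V\<^esub> x)"
  "x \<in> carrier V \<Longrightarrow> y \<in> carrier V \<Longrightarrow> cinner (transport J V) (J x) (J y) = cinner V x y"
  using J by (simp_all add: transport_def Let_def)

lemma transport_inner_space: "complex_inner_space (transport J V)"
proof -
  have inj: "J x = J y \<longleftrightarrow> x = y" if "x \<in> carrier V" "y \<in> carrier V" for x y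
    using J that by (auto dest: inj_onD)
  have "abelian_group (transport J V)"
  proof (rule abelian_groupI)
    fix x assume "x \<in> carrier (transport J V)"
    then show "\<exists>y\<in>carrier (transport J V). y \<oplus>\<^bsub>transport J V\<^esub> x = \<zero>\<^bsub>transport J V\<^esub>"
      by (auto intro!: bexI[of _ "\<ominus>\<^bsub>V\<^esub> _"] simp: V.l_neg)
  qed (auto simp: V.a_ac)
  then have "module complex_ring (transport J V)"
    by (intro moduleI cring_complex_ring)
      (auto simp: V.smult_l_distr[simplified] V.smult_r_distr[simplified]
        V.smult_assoc1[simplified] V.smult_one[simplified])
  then show ?thesis
    by (intro complex_inner_space.intro complex_inner_space_axioms.intro)
      (auto simp: V.cinner_add_left V.cinner_smult_left inj intro: V.cinner_commute V.cinner_pos)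
qed

interpretation T: complex_inner_space "transport J V" by (rule transport_inner_space)

lemma transport_cdist:
  assumes "x \<in> carrier V" "y \<in> carrier V"
  shows "cdist (transport J V) (J x) (J y) = cdist V x y"
proof -
  have "\<ominus>\<^bsub>transport J V\<^esub> J y = J (\<ominus>\<^bsub>V\<^esub> y)"
    using assms by (intro T.minus_equality) (auto simp: V.l_neg)
  then show ?thesis using assms by (simp add: cdist_def a_minus_def)
qed

lemma transport_hilbert: "complex_hilbert_space (transport J V)"
proof -
  have "T.mcomplete"
    unfolding T.mcomplete_def
  proof (intro allI impI)
    fix \<sigma> assume \<sigma>: "T.MCauchy \<sigma>"
    then have "range \<sigma> \<subseteq> J ` carrier V" unfolding T.MCauchy_def by simp
    then have "\<sigma> n \<in> J ` carrier V" for n by (rule subsetD) simp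
    then have "\<forall>n. \<exists>x\<in>carrier V. \<sigma> n = J x" by (simp add: image_iff)
    then obtain \<tau> where \<tau>: "\<And>n. \<tau> n \<in> carrier V" "\<And>n. \<sigma> n = J (\<tau> n)" by metis
    have "V.MCauchy \<tau>"
      using \<sigma> \<tau> unfolding T.MCauchy_def V.MCauchy_def by (auto simp: transport_cdist)
    then obtain l where l: "limitin V.mtopology \<tau> l sequentially"
      using V.complete unfolding V.mcomplete_def by blast
    have "limitin T.mtopology \<sigma> (J l) sequentially"
      using l \<tau> unfolding T.limit_metric_sequentially V.limit_metric_sequentially
      by (auto simp: transport_cdist)
    then show "\<exists>x. limitin T.mtopology \<sigma> x sequentially" by blast
  qed
  then show ?thesis
    by (intro complex_hilbert_space.intro complex_hilbert_space_axioms.intro T.module_axioms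
        T.cinner_add_left T.cinner_smult_left T.cinner_commute T.cinner_pos)
qed

end

text \<open>Sets of naturals are equinumerous with the reals. One such set codes the whole function:
  with the index of \<open>x\<close> as first component, the set belonging to the real part of
  \<open>v x\<close> is stored under even second components and that of the imaginary part under odd
  ones.\<close>

lemma complex_functions_embed_real:
  assumes X: "countable X"
  shows "\<exists>J :: ('a \<Rightarrow> complex) \<Rightarrow> real. inj_on J {v. \<forall>x. x \<notin> X \<longrightarrow> v x = 0}"
proof -
  obtain h :: "nat set \<Rightarrow> real" where h: "bij h"
    using nat_sets_eqpoll_reals unfolding eqpoll_def by auto
  define g where "g = inv_into UNIV h"
  have "h (g r) = r" for r unfolding g_def using h by (simp add: bij_def f_inv_into_f)
  then have g: "g r = g s \<longleftrightarrow> r = s" for r s by metis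
  define e where "e = to_nat_on X"
  have e: "e x = e y \<longleftrightarrow> x = y" if "x \<in> X" "y \<in> X" for x y
    unfolding e_def using X that by simp
  define code where "code v = {prod_encode (e x, 2 * m) |x m. x \<in> X \<and> m \<in> g (Re (v x))} \<union>
      {prod_encode (e x, 2 * m + 1) |x m. x \<in> X \<and> m \<in> g (Im (v x))}" for v :: "'a \<Rightarrow> complex"
  have re: "prod_encode (e x, 2 * m) \<in> code v \<longleftrightarrow> m \<in> g (Re (v x))" if "x \<in> X" for x m v
    using that e unfolding code_def by (auto simp: prod_encode_eq) presburger
  have im: "prod_encode (e x, 2 * m + 1) \<in> code v \<longleftrightarrow> m \<in> g (Im (v x))" if "x \<in> X" for x m v
    using that e unfolding code_def by (auto simp: prod_encode_eq) presburger
  have "inj_on (h \<circ> code) {v. \<forall>x. x \<notin> X \<longrightarrow> v x = 0}"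
  proof (rule inj_onI)
    fix v w assume v: "v \<in> {v. \<forall>x. x \<notin> X \<longrightarrow> v x = 0}" and w: "w \<in> {v. \<forall>x. x \<notin> X \<longrightarrow> v x = 0}"
      and eq: "(h \<circ> code) v = (h \<circ> code) w"
    have c: "code v = code w" using eq h by (simp add: bij_def inj_eq)
    show "v = w"
    proof
      fix x show "v x = w x"
      proof (cases "x \<in> X")
        case True
        have "g (Re (v x)) = g (Re (w x))" "g (Im (v x)) = g (Im (w x))"
          using re[OF True] im[OF True] c by blast+
        then show ?thesis by (simp add: g complex_eq_iff)
      qed (use v w in auto)
    qed
  qed
  then show ?thesis by blast
qed

section \<open>The translation action and the GNS construction\<close>

context group
begin

definition act :: "'a \<Rightarrow> ('a \<Rightarrow> complex) \<Rightarrow> 'a \<Rightarrow> complex" where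
  "act g v = (\<lambda>x. if x \<in> carrier G then v (inv g \<otimes> x) else 0)"

lemma act_mult: "g \<in> carrier G \<Longrightarrow> h \<in> carrier G \<Longrightarrow> act (g \<otimes> h) v = act g (act h v)"
  by (auto simp: act_def inv_mult_group m_assoc)

lemma act_one: "(\<And>x. x \<notin> carrier G \<Longrightarrow> v x = 0) \<Longrightarrow> act \<one> v = v"
  by (auto simp: act_def)

lemma act_translate: "g \<in> carrier G \<Longrightarrow> x \<in> carrier G \<Longrightarrow> act g v (g \<otimes> x) = v x"
  by (simp add: act_def m_assoc[symmetric])

lemma pd_kernel:
  assumes f: "f \<in> pd G"
  shows "psd_kernel (carrier G) (\<lambda>x y. f (inv y \<otimes> x))"
proof
  fix x y assume "x \<in> carrier G" "y \<in> carrier G"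
  then show "f (inv x \<otimes> y) = cnj (f (inv y \<otimes> x))"
    using pd_inv[OF f, of "inv y \<otimes> x"] by (simp add: inv_mult_group)
qed (rule pd_nonneg[OF f])

context
  fixes f assumes f: "f \<in> pd G"
begin

interpretation K: psd_kernel "carrier G" "\<lambda>x y. f (inv y \<otimes> x)" by (rule pd_kernel[OF f])

lemma supp_act:
  assumes g: "g \<in> carrier G" and a: "a \<in> K.fs"
  shows "K.supp (act g a) = (\<lambda>x. g \<otimes> x) ` K.supp a" "inj_on (\<lambda>x. g \<otimes> x) (K.supp a)"
proof -
  have sub: "K.supp a \<subseteq> carrier G" using a by (simp add: K.fs_def)
  show "inj_on (\<lambda>x. g \<otimes> x) (K.supp a)" using g sub by (auto intro!: inj_onI simp: subset_iff)
  show "K.supp (act g a) = (\<lambda>x. g \<otimes> x) ` K.supp a"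
  proof
    show "(\<lambda>x. g \<otimes> x) ` K.supp a \<subseteq> K.supp (act g a)"
      using g sub by (auto simp: K.supp_def act_translate subset_iff)
    show "K.supp (act g a) \<subseteq> (\<lambda>x. g \<otimes> x) ` K.supp a"
    proof
      fix x assume "x \<in> K.supp (act g a)"
      then have "x \<in> carrier G" "inv g \<otimes> x \<in> K.supp a" by (auto simp: K.supp_def act_def split: if_splits)
      moreover from this have "x = g \<otimes> (inv g \<otimes> x)" using g by (simp add: m_assoc[symmetric])
      ultimately show "x \<in> (\<lambda>x. g \<otimes> x) ` K.supp a" by blast
    qed
  qed
qed

lemma fs_act: "g \<in> carrier G \<Longrightarrow> a \<in> K.fs \<Longrightarrow> act g a \<in> K.fs"
  using supp_act(1)[of g a] by (auto simp: K.fs_def subset_iff)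

text \<open>For \<open>b = a\<close> the right-hand side is the value at \<open>g\<close> of the
  twist of \<open>f\<close> by \<open>a\<close>; this is how matrix coefficients become limits of
  twists.\<close>

lemma bil_act_left:
  assumes g: "g \<in> carrier G" and a: "a \<in> K.fs" and b: "b \<in> K.fs"
  shows "K.bil (act g a) b = (\<Sum>x\<in>K.supp a. \<Sum>y\<in>K.supp b. a x * cnj (b y) * f (inv y \<otimes> g \<otimes> x))"
proof -
  have sub: "K.supp a \<subseteq> carrier G" "K.supp b \<subseteq> carrier G" using a b by (auto simp: K.fs_def)
  have "K.bil (act g a) b = (\<Sum>x\<in>K.supp a. \<Sum>y\<in>K.supp b. act g a (g \<otimes> x) * cnj (b y) * f (inv y \<otimes> (g \<otimes> x)))"
    unfolding K.bil_def supp_act(1)[OF g a] sum.reindex[OF supp_act(2)[OF g a]] by simp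
  also have "\<dots> = (\<Sum>x\<in>K.supp a. \<Sum>y\<in>K.supp b. a x * cnj (b y) * f (inv y \<otimes> g \<otimes> x))"
    using sub g by (intro sum.cong refl) (auto simp: act_translate m_assoc subset_iff)
  finally show ?thesis .
qed

lemma bil_act:
  assumes g: "g \<in> carrier G" and a: "a \<in> K.fs" and b: "b \<in> K.fs"
  shows "K.bil (act g a) (act g b) = K.bil a b"
proof -
  have sub: "K.supp a \<subseteq> carrier G" "K.supp b \<subseteq> carrier G" using a b by (auto simp: K.fs_def)
  have "K.bil (act g a) (act g b) = (\<Sum>x\<in>K.supp a. \<Sum>y\<in>K.supp b.
      a x * cnj (act g b (g \<otimes> y)) * f (inv (g \<otimes> y) \<otimes> g \<otimes> x))"
    unfolding bil_act_left[OF g a fs_act[OF g b]] supp_act(1)[OF g b] sum.reindex[OF supp_act(2)[OF g b]]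
    by simp
  also have "\<dots> = (\<Sum>x\<in>K.supp a. \<Sum>y\<in>K.supp b. a x * cnj (b y) * f (inv y \<otimes> x))"
  proof (intro sum.cong refl)
    fix x y assume "x \<in> K.supp a" "y \<in> K.supp b"
    then have c: "x \<in> carrier G" "y \<in> carrier G" using sub by auto
    then have "inv (g \<otimes> y) \<otimes> g \<otimes> x = inv y \<otimes> (inv g \<otimes> g) \<otimes> x"
      using g by (simp only: inv_mult_group m_assoc m_closed inv_closed)
    then show "a x * cnj (act g b (g \<otimes> y)) * f (inv (g \<otimes> y) \<otimes> g \<otimes> x) = a x * cnj (b y) * f (inv y \<otimes> x)"
      using c g by (simp add: act_translate)
  qed
  finally show ?thesis by (simp add: K.bil_def)
qed

lemma act_delta: "g \<in> carrier G \<Longrightarrow> y \<in> carrier G \<Longrightarrow> act g (K.delta y) = K.delta (g \<otimes> y)"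
proof
  fix x assume g: "g \<in> carrier G" and y: "y \<in> carrier G"
  have "inv g \<otimes> x = y \<longleftrightarrow> x = g \<otimes> y" if "x \<in> carrier G"
    using that g y by (metis inv_closed inv_inv inv_solve_left)
  then show "act g (K.delta y) x = K.delta (g \<otimes> y) x"
    using g y by (auto simp: act_def K.delta_def)
qed

lemma rep_act:
  assumes g: "g \<in> carrier G" and A: "K.rep A v"
  shows "K.rep (\<lambda>n. act g (A n)) (act g v)"
  unfolding K.rep_def K.qCauchy_def
proof (intro conjI allI impI ballI)
  note fA = K.rep_fs[OF A]
  show "act g (A n) \<in> K.fs" for n using g fA by (rule fs_act)
  have "act g (A m) x - act g (A n) x = act g (\<lambda>x. A m x - A n x) x" for m n x by (simp add: act_def)
  then have "K.q (\<lambda>x. act g (A m) x - act g (A n) x) = K.q (\<lambda>x. A m x - A n x)" for m n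
    using bil_act[OF g K.fs_diff K.fs_diff, OF fA fA fA fA] by simp
  then show "\<exists>N. \<forall>m\<ge>N. \<forall>n\<ge>N. sqrt (K.q (\<lambda>x. act g (A m) x - act g (A n) x)) < e" if "0 < e" for e
    using K.qCauchyD[OF K.rep_cauchy[OF A] that] by simp
  show "(\<lambda>n. K.bil (act g (A n)) (K.delta x)) \<longlonglongrightarrow> act g v x" if x: "x \<in> carrier G" for x
  proof -
    have y: "inv g \<otimes> x \<in> carrier G" using g x by simp
    have "K.delta x = act g (K.delta (inv g \<otimes> x))"
      using act_delta[OF g y] g x by (simp add: m_assoc[symmetric])
    then have "K.bil (act g (A n)) (K.delta x) = K.bil (A n) (K.delta (inv g \<otimes> x))" for n
      using bil_act[OF g fA K.fs_delta[OF y]] by simp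
    then show ?thesis using A y x by (simp add: K.rep_def act_def)
  qed
  show "act g v x = 0" if "x \<notin> carrier G" for x using that by (simp add: act_def)
qed

lemma H_act: "g \<in> carrier G \<Longrightarrow> v \<in> K.H \<Longrightarrow> act g v \<in> K.H"
  unfolding K.H_def using rep_act by blast

lemma ip_act:
  assumes g: "g \<in> carrier G" and v: "v \<in> K.H" and w: "w \<in> K.H"
  shows "K.ip (act g v) (act g w) = K.ip v w"
proof -
  obtain A B where A: "K.rep A v" and B: "K.rep B w" using v w K.H_rep by meson
  have "(\<lambda>n. K.bil (A n) (B n)) \<longlonglongrightarrow> K.ip (act g v) (act g w)"
    using K.ip_lim[OF rep_act[OF g A] rep_act[OF g B]] bil_act[OF g K.rep_fs[OF A] K.rep_fs[OF B]] by simp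
  then show ?thesis using K.ip_lim[OF A B] by (rule LIMSEQ_unique)
qed

lemma H_off: "v \<in> K.H \<Longrightarrow> x \<notin> carrier G \<Longrightarrow> v x = 0"
  by (auto simp: K.H_def K.rep_def)

text \<open>Besides a cyclic vector with state \<open>f\<close>, the construction must deliver the
  two facts used for irreducibility: totality of the orbit, and the approximation of every vector
  state by twists.\<close>

lemma gns:
  fixes emb :: "real \<Rightarrow> 'v"
  assumes cnt: "countable (carrier G)" and emb: "inj emb"
  shows "\<exists>(V :: 'v inner_space) \<pi> \<xi>. unitary_representation G V \<pi> \<and> \<xi> \<in> carrier V \<and>
    (\<forall>g\<in>carrier G. cinner V (\<pi> g \<xi>) \<xi> = f g) \<and>
    (\<forall>v\<in>carrier V. (\<forall>g\<in>carrier G. cinner V v (\<pi> g \<xi>) = 0) \<longrightarrow> v = \<zero>\<^bsub>V\<^esub>) \<and>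
    (\<forall>v\<in>carrier V. \<exists>S a. (\<forall>n::nat. finite (S n) \<and> S n \<subseteq> carrier G) \<and>
      (\<forall>g\<in>carrier G. (\<lambda>n. twist G f (S n) (a n) g) \<longlonglongrightarrow> cinner V (\<pi> g v) v))"
proof -
  obtain J0 :: "('a \<Rightarrow> complex) \<Rightarrow> real" where J0: "inj_on J0 {v. \<forall>x. x \<notin> carrier G \<longrightarrow> v x = 0}"
    using complex_functions_embed_real[OF cnt] by blast
  \<comment> \<open>The elements of \<open>K.H\<close> vanish off the countable carrier, so they can
    be coded by reals and then by elements of the prescribed type.\<close>
  define J where "J = emb \<circ> J0"
  have J: "inj_on J K.H"
    unfolding J_def
  proof (rule comp_inj_on)
    show "inj_on J0 K.H" using J0 by (rule inj_on_subset) (auto simp: H_off)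
  qed (use emb in \<open>auto intro: inj_on_subset\<close>)
  then have J': "inj_on J (carrier K.RK)" by simp
  define V where "V = transport J K.RK"
  have hilb: "complex_hilbert_space V" unfolding V_def by (rule transport_hilbert[OF J' K.RK_hilbert])
  note simps = transport_simps[OF J' K.RK_hilbert, folded V_def, simplified]
  have inv: "inv_into K.H J (J v) = v" if "v \<in> K.H" for v using J that by simp
  define \<pi> where "\<pi> g = (\<lambda>u\<in>J ` K.H. J (act g (inv_into K.H J u)))" for g
  have \<pi>: "\<pi> g (J v) = J (act g v)" if "v \<in> K.H" for g v
    using that inv by (simp add: \<pi>_def)
  have sums: "(\<lambda>x. v x + w x) \<in> K.H" "(\<lambda>x. c * v x) \<in> K.H" if "v \<in> K.H" "w \<in> K.H" for v w c
    using K.H_lin[OF that, of 1] K.H_lin[OF K.H_zero that(1), of c] by simp_all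
  have act_inv: "act (inv g) (act g v) = v" "act g (act (inv g) v) = v" if "g \<in> carrier G" "v \<in> K.H" for g v
    using act_mult[of "inv g" g v] act_mult[of g "inv g" v] act_one[of v] H_off that by auto
  have Bij: "\<pi> g \<in> Bij (carrier V)" if g: "g \<in> carrier G" for g
  proof -
    have "bij_betw (\<pi> g) (J ` K.H) (J ` K.H)"
      by (rule bij_betw_byWitness[where f' = "\<pi> (inv g)"]) (use g in \<open>auto simp: \<pi> H_act act_inv\<close>)
    then show ?thesis by (simp add: Bij_def simps \<pi>_def)
  qed
  have U: "\<pi> g \<in> carrier (unitary_group V)" if g: "g \<in> carrier G" for g
  proof -
    have "\<pi> g (J v \<oplus>\<^bsub>V\<^esub> J w) = \<pi> g (J v) \<oplus>\<^bsub>V\<^esub> \<pi> g (J w)" if "v \<in> K.H" "w \<in> K.H" for v w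
    proof -
      have "act g (\<lambda>x. v x + w x) = (\<lambda>x. act g v x + act g w x)" by (auto simp: act_def)
      then show ?thesis using that g by (simp add: simps \<pi> sums H_act)
    qed
    moreover have "\<pi> g (a \<odot>\<^bsub>V\<^esub> J v) = a \<odot>\<^bsub>V\<^esub> \<pi> g (J v)" if "v \<in> K.H" for v a
    proof -
      have "act g (\<lambda>x. a * v x) = (\<lambda>x. a * act g v x)" by (auto simp: act_def)
      then show ?thesis using that g by (simp add: simps \<pi> sums H_act)
    qed
    moreover have "cinner V (\<pi> g (J v)) (\<pi> g (J w)) = cinner V (J v) (J w)" if "v \<in> K.H" "w \<in> K.H" for v w
      using that g by (simp add: simps \<pi> H_act ip_act)
    ultimately show ?thesis
      using Bij[OF g] unfolding unitary_group_def by (auto simp: simps(1))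
  qed
  have hom: "\<pi> \<in> hom G (unitary_group V)"
  proof (rule homI)
    fix g h assume gh: "g \<in> carrier G" "h \<in> carrier G"
    have "\<pi> (g \<otimes> h) = compose (carrier V) (\<pi> g) (\<pi> h)"
    proof
      fix u show "\<pi> (g \<otimes> h) u = compose (carrier V) (\<pi> g) (\<pi> h) u"
      proof (cases "u \<in> J ` K.H")
        case True
        then show ?thesis using gh by (auto simp: compose_def simps(1) \<pi> act_mult H_act)
      next
        case False then show ?thesis by (simp add: compose_def simps(1) \<pi>_def)
      qed
    qed
    then show "\<pi> (g \<otimes> h) = \<pi> g \<otimes>\<^bsub>unitary_group V\<^esub> \<pi> h"
      using Bij gh by (simp add: unitary_group_def BijGroup_def)
  qed (rule U)
  \<comment> \<open>The kernel function at \<open>\<one>\<close>. Its translate by \<open>g\<close>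
    is the kernel function at \<open>g\<close>, so totality of the orbit is the reproducing property
    \<open>K.ip_hat_delta\<close>.\<close>
  define \<xi> where "\<xi> = J (K.hat (K.delta \<one>))"
  have \<xi>: "K.hat (K.delta \<one>) \<in> K.H" by (simp add: K.hat_H)
  have act\<xi>: "act g (K.hat (K.delta \<one>)) = K.hat (K.delta g)" if g: "g \<in> carrier G" for g
  proof
    fix x show "act g (K.hat (K.delta \<one>)) x = K.hat (K.delta g) x"
    proof (cases "x \<in> carrier G")
      case True
      have "K.bil (K.delta \<one>) (K.delta (inv g \<otimes> x)) = K.bil (act g (K.delta \<one>)) (act g (K.delta (inv g \<otimes> x)))"
        using bil_act[OF g] g True by simp
      also have "\<dots> = K.bil (K.delta g) (K.delta x)"
        using g True by (simp add: act_delta m_assoc[symmetric])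
      finally show ?thesis using g True by (simp add: K.hat_def act_def)
    qed (simp add: K.hat_def act_def)
  qed
  have \<pi>\<xi>: "\<pi> g \<xi> = J (K.hat (K.delta g))" if "g \<in> carrier G" for g
    using that \<xi> by (simp add: \<xi>_def \<pi> act\<xi>)
  have hatd: "K.hat (K.delta g) \<in> K.H" if "g \<in> carrier G" for g using that by (simp add: K.hat_H)
  have "unitary_representation G V \<pi>"
    by (intro unitary_representation.intro unitary_representation_axioms.intro group_axioms hilb hom)
  moreover have "\<xi> \<in> carrier V" using \<xi> by (simp add: simps \<xi>_def)
  moreover have "cinner V (\<pi> g \<xi>) \<xi> = f g" if g: "g \<in> carrier G" for g
  proof -
    have "cinner V (\<pi> g \<xi>) \<xi> = K.ip (K.hat (K.delta g)) (K.hat (K.delta \<one>))"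
      using g hatd by (simp add: \<pi>\<xi> simps) (simp add: \<xi>_def simps hatd)
    also have "\<dots> = K.bil (K.delta g) (K.delta \<one>)"
      using hatd[OF g] by (simp add: K.ip_hat_delta) (simp add: K.hat_def)
    also have "\<dots> = f g"
      using g by (simp add: K.bil_def K.supp_def K.delta_def)
    finally show ?thesis .
  qed
  moreover have "v = \<zero>\<^bsub>V\<^esub>" if v: "v \<in> carrier V" and z: "\<forall>g\<in>carrier G. cinner V v (\<pi> g \<xi>) = 0" for v
  proof -
    obtain w where w: "w \<in> K.H" "v = J w" using v by (auto simp: simps)
    have "w x = 0" for x
    proof (cases "x \<in> carrier G")
      case True
      then have "K.ip w (K.hat (K.delta x)) = 0" using z w hatd by (simp add: \<pi>\<xi> simps)
      then show ?thesis using K.ip_hat_delta[OF w(1) True] by simp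
    qed (use H_off w in auto)
    then have "w = (\<lambda>_. 0)" by auto
    then show ?thesis using w by (simp add: simps)
  qed
  moreover have "\<exists>S a. (\<forall>n::nat. finite (S n) \<and> S n \<subseteq> carrier G) \<and>
      (\<forall>g\<in>carrier G. (\<lambda>n. twist G f (S n) (a n) g) \<longlonglongrightarrow> cinner V (\<pi> g v) v)" if v: "v \<in> carrier V" for v
  proof -
    obtain w where w: "w \<in> K.H" "v = J w" using v by (auto simp: simps)
    obtain A where A: "K.rep A w" using w K.H_rep by blast
    note fA = K.rep_fs[OF A]
    have "(\<lambda>n. twist G f (K.supp (A n)) (A n) g) \<longlonglongrightarrow> cinner V (\<pi> g v) v" if g: "g \<in> carrier G" for g
    proof -
      have "K.bil (act g (A n)) (A n) = twist G f (K.supp (A n)) (A n) g" for n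
        using g by (simp add: bil_act_left[OF g fA fA] twist_def)
      moreover have "cinner V (\<pi> g v) v = K.ip (act g w) w" using g w by (simp add: \<pi> simps H_act)
      ultimately show ?thesis using K.ip_lim[OF rep_act[OF g A] A] by simp
    qed
    moreover have "finite (K.supp (A n)) \<and> K.supp (A n) \<subseteq> carrier G" for n
      using fA by (simp add: K.fs_def)
    ultimately show ?thesis by (intro exI[of _ "\<lambda>n. K.supp (A n)"] exI[of _ A]) auto
  qed
  ultimately show ?thesis by (intro exI[of _ V] exI[of _ \<pi>] exI[of _ \<xi>]) auto
qed

end

end

section \<open>Feet\<close>

definition normal_closure :: "('g, 'b) monoid_scheme \<Rightarrow> 'g \<Rightarrow> 'g set" where
  "normal_closure G x = generate G (conjugacy_class G x)"

context group
begin

lemma normal_subset: "N \<lhd> G \<Longrightarrow> N \<subseteq> carrier G"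
  and normal_one: "N \<lhd> G \<Longrightarrow> \<one> \<in> N"
  and normal_mult: "N \<lhd> G \<Longrightarrow> x \<in> N \<Longrightarrow> y \<in> N \<Longrightarrow> x \<otimes> y \<in> N"
  and normal_minv: "N \<lhd> G \<Longrightarrow> x \<in> N \<Longrightarrow> inv x \<in> N"
  and normal_conj: "N \<lhd> G \<Longrightarrow> g \<in> carrier G \<Longrightarrow> x \<in> N \<Longrightarrow> g \<otimes> x \<otimes> inv g \<in> N"
  by (auto simp: normal_inv_iff dest: subgroup.subset subgroup.one_closed subgroup.m_closed subgroup.m_inv_closed)

lemma normal_mem_iff:
  assumes N: "N \<lhd> G" and x: "x \<in> N" and y: "y \<in> carrier G"
  shows "x \<otimes> y \<in> N \<longleftrightarrow> y \<in> N" "y \<otimes> x \<in> N \<longleftrightarrow> y \<in> N"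
proof -
  have xG: "x \<in> carrier G" using normal_subset[OF N] x by auto
  show "x \<otimes> y \<in> N \<longleftrightarrow> y \<in> N"
  proof
    assume "x \<otimes> y \<in> N"
    then have "inv x \<otimes> (x \<otimes> y) \<in> N" by (rule normal_mult[OF N normal_minv[OF N x]])
    then show "y \<in> N" using xG y by (simp add: m_assoc[symmetric])
  qed (use N x in \<open>auto intro: normal_mult\<close>)
  show "y \<otimes> x \<in> N \<longleftrightarrow> y \<in> N"
  proof
    assume "y \<otimes> x \<in> N"
    then have "(y \<otimes> x) \<otimes> inv x \<in> N" by (rule normal_mult[OF N _ normal_minv[OF N x]])
    then show "y \<in> N" using xG y by (simp add: m_assoc)
  qed (use N x in \<open>auto intro: normal_mult\<close>)
qed

lemma normal_imp_sub: "N \<lhd> G \<Longrightarrow> subgroup N G" by (simp add: normal_inv_iff)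

lemma generate_finite_support:
  assumes "x \<in> generate G (\<Union>i\<in>I. A i)"
  shows "\<exists>E\<subseteq>I. finite E \<and> x \<in> generate G (\<Union>i\<in>E. A i)"
  using assms
proof (induction rule: generate.induct)
  case one
  show ?case by (intro exI[of _ "{}"]) (auto intro: generate.one)
next
  case (incl h)
  then obtain i where "i \<in> I" "h \<in> A i" by auto
  then show ?case by (intro exI[of _ "{i}"]) (auto intro: generate.incl)
next
  case (inv h)
  then obtain i where "i \<in> I" "h \<in> A i" by auto
  then show ?case by (intro exI[of _ "{i}"]) (auto intro: generate.inv)
next
  case (eng x y)
  then obtain E E' where E: "E \<subseteq> I" "finite E" "x \<in> generate G (\<Union>i\<in>E. A i)"
    "E' \<subseteq> I" "finite E'" "y \<in> generate G (\<Union>i\<in>E'. A i)" by blast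
  have "generate G (\<Union>i\<in>E. A i) \<subseteq> generate G (\<Union>i\<in>E \<union> E'. A i)"
    "generate G (\<Union>i\<in>E'. A i) \<subseteq> generate G (\<Union>i\<in>E \<union> E'. A i)"
    by (intro mono_generate; blast)+
  then have "x \<otimes> y \<in> generate G (\<Union>i\<in>E \<union> E'. A i)"
    using E by (intro generate.eng) auto
  then show ?case using E by (intro exI[of _ "E \<union> E'"]) auto
qed

lemma normal_generate_UN:
  assumes "\<And>i. i \<in> I \<Longrightarrow> A i \<lhd> G"
  shows "generate G (\<Union>i\<in>I. A i) \<lhd> G"
proof (rule normal_generateI)
  show "(\<Union>i\<in>I. A i) \<subseteq> carrier G" using assms normal_subset by blast
  fix h g assume "h \<in> (\<Union>i\<in>I. A i)" "g \<in> carrier G"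
  then show "g \<otimes> h \<otimes> inv g \<in> (\<Union>i\<in>I. A i)" using assms normal_conj by blast
qed

lemma normal_set_mult:
  assumes N: "N \<lhd> G" and M: "M \<lhd> G"
  shows "N <#> M \<lhd> G"
proof -
  note NG = normal_subset[OF N] and MG = normal_subset[OF M]
  have sub: "N <#> M \<subseteq> carrier G" using NG MG by (rule setmult_subset_G)
  have mem: "\<exists>a\<in>N. \<exists>b\<in>M. x = a \<otimes> b" if "x \<in> N <#> M" for x using that by (auto simp: set_mult_def)
  have intro: "a \<otimes> b \<in> N <#> M" if "a \<in> N" "b \<in> M" for a b using that by (auto simp: set_mult_def)
  have "subgroup (N <#> M) G"
  proof (rule subgroupI[OF sub])
    show "N <#> M \<noteq> {}" using intro[OF normal_one[OF N] normal_one[OF M]] by auto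
    fix x assume "x \<in> N <#> M"
    then obtain a b where x: "a \<in> N" "b \<in> M" "x = a \<otimes> b" using mem by blast
    then have c: "a \<in> carrier G" "b \<in> carrier G" using NG MG by auto
    have "inv x = (inv b \<otimes> inv a \<otimes> inv (inv b)) \<otimes> inv b"
      using c x by (simp add: inv_mult_group m_assoc)
    then show "inv x \<in> N <#> M"
      using normal_conj[OF N, of "inv b" "inv a"] normal_minv[OF N] normal_minv[OF M] x c intro by simp
    fix y assume "y \<in> N <#> M"
    then obtain a' b' where y: "a' \<in> N" "b' \<in> M" "y = a' \<otimes> b'" using mem by blast
    then have c': "a' \<in> carrier G" "b' \<in> carrier G" using NG MG by auto
    have "x \<otimes> y = (a \<otimes> (b \<otimes> a' \<otimes> inv b)) \<otimes> (b \<otimes> b')"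
      using c c' x y by (simp add: m_assoc) (simp add: m_assoc[symmetric])
    then show "x \<otimes> y \<in> N <#> M"
      using normal_conj[OF N c(2) y(1)] normal_mult[OF N] normal_mult[OF M] x y intro by simp
  qed
  moreover have "g \<otimes> x \<otimes> inv g \<in> N <#> M" if g: "g \<in> carrier G" and x: "x \<in> N <#> M" for g x
  proof -
    obtain a b where ab: "a \<in> N" "b \<in> M" "x = a \<otimes> b" using mem x by blast
    then have c: "a \<in> carrier G" "b \<in> carrier G" using NG MG by auto
    have "g \<otimes> x \<otimes> inv g = (g \<otimes> a \<otimes> inv g) \<otimes> (g \<otimes> b \<otimes> inv g)"
      using c g ab by (simp add: m_assoc) (simp add: m_assoc[symmetric])
    then show ?thesis using normal_conj[OF N g ab(1)] normal_conj[OF M g ab(2)] intro by simp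
  qed
  ultimately show ?thesis by (simp add: normal_inv_iff)
qed

lemma set_mult_le:
  assumes N: "N \<lhd> G" and M: "M \<lhd> G"
  shows "N \<subseteq> N <#> M" "M \<subseteq> N <#> M"
proof
  fix x assume x: "x \<in> N"
  then have "x = x \<otimes> \<one>" using normal_subset[OF N] by auto
  then show "x \<in> N <#> M" using x normal_one[OF M] by (auto simp: set_mult_def)
next
  show "M \<subseteq> N <#> M"
  proof
    fix x assume x: "x \<in> M"
    then have "x = \<one> \<otimes> x" using normal_subset[OF M] by auto
    then show "x \<in> N <#> M" using x normal_one[OF N] by (auto simp: set_mult_def)
  qed
qed

lemma generate_insert:
  assumes "\<And>i. i \<in> insert j E \<Longrightarrow> A i \<lhd> G"
  shows "generate G (\<Union>i\<in>insert j E. A i) = generate G (\<Union>i\<in>E. A i) <#> A j"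
proof
  let ?L = "generate G (\<Union>i\<in>E. A i)"
  have L: "?L \<lhd> G" and A: "A j \<lhd> G" using assms by (auto intro: normal_generate_UN)
  have sub: "(\<Union>i\<in>E. A i) \<subseteq> ?L" by (auto intro: generate.incl)
  show "generate G (\<Union>i\<in>insert j E. A i) \<subseteq> ?L <#> A j"
    using set_mult_le[OF L A] sub
    by (intro generate_subgroup_incl normal_imp_sub normal_set_mult L A) auto
  have G: "generate G (\<Union>i\<in>insert j E. A i) \<lhd> G" using assms by (intro normal_generate_UN)
  have "?L \<subseteq> generate G (\<Union>i\<in>insert j E. A i)" by (intro mono_generate) auto
  moreover have "A j \<subseteq> generate G (\<Union>i\<in>insert j E. A i)" by (auto intro: generate.incl)
  ultimately show "?L <#> A j \<subseteq> generate G (\<Union>i\<in>insert j E. A i)"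
    using normal_mult[OF G] by (auto simp: set_mult_def)
qed

lemma finite_set_mult: "finite N \<Longrightarrow> finite M \<Longrightarrow> finite (N <#> M)"
  by (auto simp: set_mult_def)

lemma finite_generate_UN:
  assumes "finite E" "\<And>i. i \<in> E \<Longrightarrow> A i \<lhd> G \<and> finite (A i)"
  shows "finite (generate G (\<Union>i\<in>E. A i))"
  using assms
proof (induction E rule: finite_induct)
  case empty
  then show ?case by (simp add: generate_empty)
next
  case (insert j E)
  then show ?case by (subst generate_insert) (auto intro: finite_set_mult)
qed

text \<open>The commutator of \<open>x\<close> and \<open>y\<close> lies in both subgroups.\<close>

lemma disjoint_normal_commute:
  assumes N: "N \<lhd> G" and M: "M \<lhd> G" and d: "N \<inter> M \<subseteq> {\<one>}" and x: "x \<in> N" and y: "y \<in> M"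
  shows "x \<otimes> y = y \<otimes> x"
proof -
  have c: "x \<in> carrier G" "y \<in> carrier G" using normal_subset[OF N] normal_subset[OF M] x y by auto
  let ?c = "x \<otimes> y \<otimes> inv x \<otimes> inv y"
  have "?c = x \<otimes> (y \<otimes> inv x \<otimes> inv y)" using c by (simp add: m_assoc)
  then have "?c \<in> N" using normal_mult[OF N x normal_conj[OF N c(2) normal_minv[OF N x]]] by simp
  moreover have "?c \<in> M" using normal_mult[OF M normal_conj[OF M c(1) y] normal_minv[OF M y]] by simp
  ultimately have "?c = \<one>" using d by auto
  then have "x \<otimes> y \<otimes> inv x = y" using c by (metis inv_closed inv_equality inv_inv m_closed)
  then show ?thesis using c by (metis inv_closed inv_solve_right m_closed)
qed

lemma generate_commute:
  assumes S: "S \<subseteq> carrier G" and h: "h \<in> carrier G" and c: "\<And>s. s \<in> S \<Longrightarrow> s \<otimes> h = h \<otimes> s"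
    and x: "x \<in> generate G S"
  shows "x \<otimes> h = h \<otimes> x"
  using x
proof (induction rule: generate.induct)
  case (inv s)
  then have "s \<in> carrier G" "s \<otimes> h = h \<otimes> s" using S c by auto
  note sG = this(1) and sh = this(2)
  have "h = inv s \<otimes> (s \<otimes> h)" using sG h by (simp add: m_assoc[symmetric])
  also have "\<dots> = (inv s \<otimes> h) \<otimes> s" unfolding sh using sG h by (simp add: m_assoc)
  finally have "h \<otimes> inv s = (inv s \<otimes> h) \<otimes> s \<otimes> inv s" by simp
  then show ?case using sG h by (simp add: m_assoc)
next
  case (eng x y)
  then have "x \<in> carrier G" "y \<in> carrier G" using generate_in_carrier[OF S] by auto
  then show ?case using eng h by (metis m_assoc)
qed (use h c in auto)

lemma normal_closure_normal:
  assumes "x \<in> carrier G"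
  shows "normal_closure G x \<lhd> G" "x \<in> normal_closure G x" "N \<lhd> G \<Longrightarrow> x \<in> N \<Longrightarrow> normal_closure G x \<subseteq> N"
proof -
  show "normal_closure G x \<lhd> G"
    unfolding normal_closure_def
  proof (rule normal_generateI)
    show "conjugacy_class G x \<subseteq> carrier G" using assms by (auto simp: conjugacy_class_def)
    fix h g assume "h \<in> conjugacy_class G x" and g: "g \<in> carrier G"
    then obtain c where c: "c \<in> carrier G" "h = c \<otimes> x \<otimes> inv c" by (auto simp: conjugacy_class_def)
    then have "g \<otimes> h \<otimes> inv g = (g \<otimes> c) \<otimes> x \<otimes> inv (g \<otimes> c)"
      using g assms by (simp add: m_assoc inv_mult_group)
    then show "g \<otimes> h \<otimes> inv g \<in> conjugacy_class G x" using c g unfolding conjugacy_class_def by blast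
  qed
  have "x = \<one> \<otimes> x \<otimes> inv \<one>" using assms by simp
  then have "x \<in> conjugacy_class G x" unfolding conjugacy_class_def by blast
  then show "x \<in> normal_closure G x" unfolding normal_closure_def by (rule generate.incl)
  show "normal_closure G x \<subseteq> N" if N: "N \<lhd> G" and x: "x \<in> N"
    unfolding normal_closure_def
    using normal_conj[OF N _ x] by (intro generate_subgroup_incl normal_imp_sub N) (auto simp: conjugacy_class_def)
qed

lemma normal_Int: "N \<lhd> G \<Longrightarrow> M \<lhd> G \<Longrightarrow> N \<inter> M \<lhd> G"
  using normal_inv_iff subgroups_Inter_pair by auto

lemma finite_feet_normal: "M \<in> finite_feet G \<Longrightarrow> M \<lhd> G \<and> finite M \<and> M \<noteq> {\<one>}"
  by (auto simp: finite_feet_def foot_def)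

lemma foot_Int:
  assumes M: "M \<in> finite_feet G" and N: "N \<lhd> G"
  shows "M \<subseteq> N \<or> M \<inter> N = {\<one>}"
  using M normal_Int[of M N] N unfolding finite_feet_def foot_def by blast

lemma finite_feet_distinct:
  assumes "M \<in> finite_feet G" "N \<in> finite_feet G" "M \<noteq> N"
  shows "M \<inter> N = {\<one>}"
proof (rule ccontr)
  assume "M \<inter> N \<noteq> {\<one>}"
  then have "M \<subseteq> N" using foot_Int[OF assms(1)] finite_feet_normal[OF assms(2)] by blast
  then show False
    using assms finite_feet_normal[OF assms(1)] unfolding finite_feet_def foot_def by blast
qed

lemma finite_feet_commute:
  assumes "M \<in> finite_feet G" "N \<in> finite_feet G" "M \<noteq> N" "x \<in> M" "y \<in> N"
  shows "x \<otimes> y = y \<otimes> x"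
  using assms finite_feet_distinct[OF assms(1-3)] finite_feet_normal disjoint_normal_commute[of M N x y] by auto

text \<open>Take a nontrivial normal subgroup of least cardinality inside \<open>N\<close>.\<close>

lemma exists_finite_foot:
  assumes "N \<lhd> G" "finite N" "N \<noteq> {\<one>}"
  shows "\<exists>M\<in>finite_feet G. M \<subseteq> N"
proof -
  define P where "P M \<longleftrightarrow> M \<lhd> G \<and> M \<subseteq> N \<and> M \<noteq> {\<one>}" for M
  have "P N" using assms by (simp add: P_def)
  then obtain M where M: "P M" "\<And>M'. P M' \<Longrightarrow> card M \<le> card M'"
    using exists_least_iff[of "\<lambda>k. \<exists>M. P M \<and> card M = k"] by (metis not_le)
  have "finite M" using M(1) assms finite_subset by (auto simp: P_def)
  moreover have "foot G M"
    unfolding foot_def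
  proof (intro conjI allI impI)
    show "M \<lhd> G" "M \<noteq> {\<one>}" using M(1) by (auto simp: P_def)
    fix K assume K: "K \<lhd> G \<and> K \<subseteq> M"
    show "K = M \<or> K = {\<one>}"
    proof (rule ccontr)
      assume c: "\<not> ?thesis"
      then have "P K" using K M(1) by (auto simp: P_def)
      then show False using M(2)[of K] psubset_card_mono[OF \<open>finite M\<close>, of K] K c by auto
    qed
  qed
  ultimately show ?thesis using M(1) unfolding P_def finite_feet_def by auto
qed

text \<open>\<open>N\<close> may be infinite. A nontrivial common element involves only finitely
  many feet; \<open>N\<close> meets the finite normal subgroup that they generate in a finite
  nontrivial one, which contains a foot.\<close>

lemma generate_feet_contains_foot:
  assumes \<A>: "\<A> \<subseteq> finite_feet G" and N: "N \<lhd> G" "N \<inter> generate G (\<Union>\<A>) \<noteq> {\<one>}"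
  shows "\<exists>M\<in>finite_feet G. M \<subseteq> N \<and> M \<subseteq> generate G (\<Union>\<A>)"
proof -
  have nor: "generate G (\<Union>\<A>) \<lhd> G"
    using normal_generate_UN[of \<A> "\<lambda>x. x"] \<A> finite_feet_normal by auto
  then obtain x where x: "x \<in> N" "x \<in> generate G (\<Union>\<A>)" "x \<noteq> \<one>"
    using N(2) normal_one[OF N(1)] normal_one[OF nor] by blast
  have "x \<in> generate G (\<Union>i\<in>\<A>. i)" using x(2) by simp
  then obtain \<B> where B: "\<B> \<subseteq> \<A>" "finite \<B>" "x \<in> generate G (\<Union>i\<in>\<B>. i)"
    using generate_finite_support[of x "\<lambda>x. x" \<A>] by blast
  let ?L = "generate G (\<Union>i\<in>\<B>. i)"
  have B': "i \<lhd> G \<and> finite i" if "i \<in> \<B>" for i using that B(1) \<A> finite_feet_normal by blast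
  have L: "?L \<lhd> G" "finite ?L"
    using B' by (blast intro: normal_generate_UN) (rule finite_generate_UN[OF B(2) B'])
  have "?L \<inter> N \<lhd> G" "finite (?L \<inter> N)" "?L \<inter> N \<noteq> {\<one>}"
    using L N(1) x B normal_Int by auto
  then obtain M where M: "M \<in> finite_feet G" "M \<subseteq> ?L \<inter> N" using exists_finite_foot by blast
  moreover have "?L \<subseteq> generate G (\<Union>\<A>)" using B by (intro mono_generate) auto
  ultimately show ?thesis by blast
qed

text \<open>The centre of \<open>H\<close> is normal in the whole group. By minimality it is trivial
  or equal to \<open>H\<close>, and the latter would make \<open>H\<close> abelian.\<close>

lemma nonabelian_foot_center:
  assumes H: "H \<in> nonabelian_feet G" and x: "x \<in> H" "\<And>h. h \<in> H \<Longrightarrow> x \<otimes> h = h \<otimes> x"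
  shows "x = \<one>"
proof -
  have Hf: "H \<in> finite_feet G" and na: "\<not> comm_group (G\<lparr>carrier := H\<rparr>)"
    using H by (auto simp: nonabelian_feet_def abelian_feet_def)
  have Hn: "H \<lhd> G" using finite_feet_normal[OF Hf] by simp
  note HG = normal_subset[OF Hn]
  define Z where "Z = {z\<in>H. \<forall>h\<in>H. z \<otimes> h = h \<otimes> z}"
  have "subgroup Z G"
  proof (rule subgroupI)
    show "Z \<subseteq> carrier G" using HG by (auto simp: Z_def)
    have "\<one> \<in> Z" using HG normal_one[OF Hn] by (auto simp: Z_def)
    then show "Z \<noteq> {}" by blast
    fix a assume a: "a \<in> Z"
    then have aG: "a \<in> carrier G" using HG by (auto simp: Z_def)
    have "inv a \<otimes> h = h \<otimes> inv a" if h: "h \<in> H" for h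
      using generate_commute[of "{a}" h "inv a"] aG h HG a generate.inv[of a "{a}" G] by (auto simp: Z_def)
    moreover have "inv a \<in> H" using a normal_minv[OF Hn] unfolding Z_def by blast
    ultimately show "inv a \<in> Z" unfolding Z_def by blast
    fix b assume b: "b \<in> Z"
    then have bG: "b \<in> carrier G" using HG by (auto simp: Z_def)
    have "a \<otimes> b \<otimes> h = h \<otimes> (a \<otimes> b)" if h: "h \<in> H" for h
    proof -
      have hG: "h \<in> carrier G" using h HG by auto
      have "a \<otimes> b \<otimes> h = a \<otimes> (h \<otimes> b)" using b h aG bG hG by (simp add: Z_def m_assoc)
      also have "\<dots> = (h \<otimes> a) \<otimes> b" using a h aG bG hG by (simp add: Z_def m_assoc[symmetric])
      finally show ?thesis using aG bG hG by (simp add: m_assoc)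
    qed
    moreover have "a \<otimes> b \<in> H" using a b normal_mult[OF Hn] unfolding Z_def by blast
    ultimately show "a \<otimes> b \<in> Z" unfolding Z_def by blast
  qed
  moreover have "g \<otimes> z \<otimes> inv g \<in> Z" if g: "g \<in> carrier G" and z: "z \<in> Z" for g z
  proof -
    have zH: "z \<in> H" and zG: "z \<in> carrier G" using z HG by (auto simp: Z_def)
    have "g \<otimes> z \<otimes> inv g \<otimes> h = h \<otimes> (g \<otimes> z \<otimes> inv g)" if h: "h \<in> H" for h
    proof -
      have hG: "h \<in> carrier G" using h HG by auto
      have "inv g \<otimes> h \<otimes> inv (inv g) \<in> H" using normal_conj[OF Hn, of "inv g" h] g h by simp
      then have "z \<otimes> (inv g \<otimes> h \<otimes> g) = (inv g \<otimes> h \<otimes> g) \<otimes> z" using z g by (simp add: Z_def)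
      then have "g \<otimes> (z \<otimes> (inv g \<otimes> h \<otimes> g)) \<otimes> inv g = g \<otimes> ((inv g \<otimes> h \<otimes> g) \<otimes> z) \<otimes> inv g" by simp
      then show ?thesis
        using g hG zG by (simp add: m_assoc) (simp add: m_assoc[symmetric])
    qed
    then show ?thesis using normal_conj[OF Hn g zH] unfolding Z_def by blast
  qed
  ultimately have "Z \<lhd> G" by (simp add: normal_inv_iff)
  then have "Z = H \<or> Z = {\<one>}" using Hf unfolding finite_feet_def foot_def Z_def by blast
  moreover have "Z \<noteq> H"
  proof
    assume "Z = H"
    then have "comm_group (G\<lparr>carrier := H\<rparr>)"
      using subgroup_imp_group[OF normal_imp_sub[OF Hn]]
      by (intro group.group_comm_groupI) (auto simp: Z_def)
    then show False using na by simp
  qed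
  moreover have "x \<in> Z" using x by (simp add: Z_def)
  ultimately show ?thesis by auto
qed

text \<open>Distinct feet commute elementwise, so an element of \<open>H\<close> generated by other
  feet is central in \<open>H\<close>.\<close>

lemma nonabelian_foot_disjoint:
  assumes H: "H \<in> nonabelian_feet G" and \<A>: "\<A> \<subseteq> finite_feet G" "H \<notin> \<A>"
  shows "H \<inter> generate G (\<Union>\<A>) = {\<one>}"
proof -
  have Hf: "H \<in> finite_feet G" using H by (simp add: nonabelian_feet_def)
  have Hn: "H \<lhd> G" using finite_feet_normal[OF Hf] by simp
  have "x = \<one>" if x: "x \<in> H" "x \<in> generate G (\<Union>\<A>)" for x
  proof (rule nonabelian_foot_center[OF H x(1)])
    fix h assume h: "h \<in> H"
    have sub: "\<Union>\<A> \<subseteq> carrier G" using \<A> finite_feet_normal normal_subset by blast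
    show "x \<otimes> h = h \<otimes> x"
    proof (rule generate_commute[OF sub _ _ x(2)])
      show "h \<in> carrier G" using h normal_subset[OF Hn] by auto
      fix s assume "s \<in> \<Union>\<A>"
      then show "s \<otimes> h = h \<otimes> s" using \<A> Hf h finite_feet_commute by blast
    qed
  qed
  then show ?thesis using normal_one[OF Hn] generate.one by auto
qed

end

section \<open>Faithful irreducible representations from positive definite functions\<close>

lemma (in unitary_representation) kernel_normal: "kernel G (unitary_group V) \<pi> \<lhd> G"
proof -
  let ?N = "kernel G (unitary_group V) \<pi>"
  have mem: "g \<in> ?N \<longleftrightarrow> g \<in> carrier G \<and> (\<forall>x\<in>carrier V. \<pi> g x = x)" for g
    using rep_trivial_iff[of g] by (auto simp: kernel_def)
  have "subgroup ?N G"
  proof (rule subgroupI)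
    show "?N \<subseteq> carrier G" by (auto simp: kernel_def)
    show "?N \<noteq> {}" using mem[of \<one>] rep_one by auto
    fix g assume g: "g \<in> ?N"
    then have gG: "g \<in> carrier G" by (simp add: kernel_def)
    have "\<pi> (inv g) x = x" if x: "x \<in> carrier V" for x
      using rep_mult[of "inv g" g x] g gG x mem[of g] rep_one[of x] by simp
    then show "inv g \<in> ?N" using gG mem by simp
    fix h assume "h \<in> ?N"
    then show "g \<otimes> h \<in> ?N" using g mem by (simp add: rep_mult)
  qed
  moreover have "g \<otimes> h \<otimes> inv g \<in> ?N" if g: "g \<in> carrier G" and h: "h \<in> ?N" for g h
  proof -
    have hG: "h \<in> carrier G" using h by (simp add: kernel_def)
    have "\<pi> (g \<otimes> h \<otimes> inv g) x = x" if x: "x \<in> carrier V" for x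
    proof -
      have "\<pi> (g \<otimes> h \<otimes> inv g) x = \<pi> g (\<pi> h (\<pi> (inv g) x))"
        using g hG x by (simp add: rep_mult)
      also have "\<dots> = \<pi> (g \<otimes> inv g) x" using rep_mult[OF g _ x, of "inv g"] g h x mem[of h] by simp
      finally show ?thesis using g x rep_one by simp
    qed
    then show ?thesis using g hG mem by simp
  qed
  ultimately show ?thesis by (simp add: normal_inv_iff)
qed

context group
begin

text \<open>The kernel fixes the cyclic vector, so \<open>p\<close> is \<open>1\<close> on it.
  Taking for \<open>F\<close> the states that are \<open>1\<close> on a given subgroup, a point
  \<open>p\<close> outside \<open>F\<close> keeps that subgroup from lying in the kernel.\<close>

lemma irreducible_rep_of_states:
  fixes emb :: "real \<Rightarrow> 'v"
  assumes cnt: "countable (carrier G)" and emb: "inj emb"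
    and K: "K \<noteq> {}" "K \<subseteq> pd G" "closed K" "mix_closed K" "twist_closed G K"
    and \<F>: "countable \<F>"
    and avoid: "\<And>F T c \<alpha>. F \<in> \<F> \<Longrightarrow> finite T \<Longrightarrow> slice K T c \<alpha> \<noteq> {} \<Longrightarrow>
       \<exists>T' c' \<alpha>'. finite T' \<and> slice K T' c' \<alpha>' \<noteq> {} \<and> slice K T' c' \<alpha>' \<subseteq> slice K T c \<alpha> \<and>
         slice K T' c' \<alpha>' \<inter> F = {}"
  shows "\<exists>p\<in>K. p \<notin> \<Union>\<F> \<and> (\<exists>(V :: 'v inner_space) \<pi>. irreducible_unitary_rep G V \<pi> \<and>
    kernel G (unitary_group V) \<pi> \<lhd> G \<and> (\<forall>g\<in>kernel G (unitary_group V) \<pi>. p g = 1))"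
proof -
  have "compact K"
    using compact_Int_closed[OF compact_pd K(3)] K(2) by (simp add: inf.absorb2)
  have off: "f x = 0" if "f \<in> K" "x \<notin> carrier G" for f x
    using that K(2) pd_off[of f G x] by auto
  have "\<exists>p. extreme_in p K \<and> p \<notin> \<Union>\<F>"
    by (rule extreme_avoiding[OF \<open>compact K\<close> K(4,1) cnt _ \<F> avoid]) (rule off)
  then obtain p where p: "extreme_in p K" "p \<notin> \<Union>\<F>" by auto
  then have pK: "p \<in> K" and ppd: "p \<in> pd G" using K(2) by (auto simp: extreme_in_def)
  obtain V :: "'v inner_space" and \<pi> \<xi> where rep: "unitary_representation G V \<pi>" and \<xi>: "\<xi> \<in> carrier V"
    and st: "\<And>g. g \<in> carrier G \<Longrightarrow> cinner V (\<pi> g \<xi>) \<xi> = p g"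
    and tot: "\<And>v. v \<in> carrier V \<Longrightarrow> (\<And>g. g \<in> carrier G \<Longrightarrow> cinner V v (\<pi> g \<xi>) = 0) \<Longrightarrow> v = \<zero>\<^bsub>V\<^esub>"
    and app: "\<And>v. v \<in> carrier V \<Longrightarrow> \<exists>S a. (\<forall>n::nat. finite (S n) \<and> S n \<subseteq> carrier G) \<and>
      (\<forall>g\<in>carrier G. (\<lambda>n. twist G p (S n) (a n) g) \<longlonglongrightarrow> cinner V (\<pi> g v) v)"
    using gns[OF ppd cnt emb] by auto
  interpret R: unitary_representation G V \<pi> by (rule rep)
  have "irreducible_unitary_rep G V \<pi>"
    by (rule R.irreducible_of_extreme[OF \<xi> st tot app K(3,5,2) p(1)])
  moreover have "p g = 1" if "g \<in> kernel G (unitary_group V) \<pi>" for g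
  proof -
    have g: "g \<in> carrier G" "\<pi> g = \<one>\<^bsub>unitary_group V\<^esub>" using that by (auto simp: kernel_def)
    then have "\<pi> g \<xi> = \<xi>" using R.rep_trivial_iff \<xi> by blast
    then show ?thesis using st[OF g(1)] st[OF one_closed] R.rep_one[OF \<xi>] pd_one[OF ppd] by simp
  qed
  ultimately show ?thesis using p(2) pK R.kernel_normal by blast
qed

text \<open>If \<open>f\<close> were \<open>1\<close> on \<open>A\<close>, its sum over
  \<open>A\<close> would be the cardinality of \<open>A\<close> rather than
  \<open>0\<close>.\<close>

lemma annih_not_one:
  assumes "f \<in> annih G \<A>" "A \<in> \<A>" "finite A" "A \<subseteq> carrier G" "\<one> \<in> A"
  shows "\<exists>g\<in>A. f g \<noteq> 1"
proof (rule ccontr)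
  assume c: "\<not> ?thesis"
  have "(\<Sum>x\<in>A. f (\<one> \<otimes> x)) = (\<Sum>x\<in>A. 1)"
    using c assms(4) by (intro sum.cong refl) (auto simp: subset_iff)
  then have "of_nat (card A) = (0 :: complex)" using annih_sum[OF assms(1,2) one_closed] by simp
  then show False using assms(3,5) by auto
qed

text \<open>Finiteness is asked on every coset of \<open>N\<close>, not only on \<open>N\<close>
  itself, because twisting moves one coset to another.\<close>

definition thin_states :: "'a set set \<Rightarrow> 'a set set \<Rightarrow> ('a \<Rightarrow> complex) set" where
  "thin_states \<A> \<N> = {f\<in>annih G \<A>. \<forall>N\<in>\<N>. \<forall>\<gamma>\<in>carrier G. finite {n\<in>N. f (\<gamma> \<otimes> n) \<noteq> 0}}"

lemma mix_closed_thin_states: "mix_closed (thin_states \<A> \<N>)"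
  unfolding mix_closed_def
proof (intro ballI)
  fix f g and t :: real assume f: "f \<in> thin_states \<A> \<N>" and g: "g \<in> thin_states \<A> \<N>" and t: "t \<in> {0..1}"
  have "mix t f g \<in> annih G \<A>"
    using mix_closed_annih[of G \<A>] f g t unfolding mix_closed_def thin_states_def by blast
  moreover have "finite {n\<in>N. mix t f g (\<gamma> \<otimes> n) \<noteq> 0}" if "N \<in> \<N>" "\<gamma> \<in> carrier G" for N \<gamma>
  proof (rule finite_subset)
    show "{n\<in>N. mix t f g (\<gamma> \<otimes> n) \<noteq> 0} \<subseteq> {n\<in>N. f (\<gamma> \<otimes> n) \<noteq> 0} \<union> {n\<in>N. g (\<gamma> \<otimes> n) \<noteq> 0}"
      by (auto simp: mix_def)
  qed (use f g that in \<open>auto simp: thin_states_def\<close>)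
  ultimately show "mix t f g \<in> thin_states \<A> \<N>" by (simp add: thin_states_def)
qed

text \<open>A nonzero value of the twist at \<open>\<gamma> \<otimes> n\<close> comes from a nonzero
  value of \<open>f\<close> on the coset of \<open>inv y \<otimes> \<gamma> \<otimes> x\<close>, at
  the conjugate of \<open>n\<close> by \<open>inv x\<close>. There are finitely many pairs
  \<open>x\<close>, \<open>y\<close>, and finitely many such values for each.\<close>

lemma twist_closed_thin_states:
  assumes \<A>: "\<And>A. A \<in> \<A> \<Longrightarrow> A \<lhd> G" and \<N>: "\<And>N. N \<in> \<N> \<Longrightarrow> N \<lhd> G"
  shows "twist_closed G (thin_states \<A> \<N>)"
  unfolding twist_closed_def
proof (intro ballI allI impI)
  fix f S and a :: "'a \<Rightarrow> complex"
  assume f: "f \<in> thin_states \<A> \<N>" and S: "finite S \<and> S \<subseteq> carrier G \<and> twist G f S a \<one> \<noteq> 0"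
  let ?f = "\<lambda>g. twist G f S a g / twist G f S a \<one>"
  have "?f \<in> annih G \<A>"
    using twist_closed_annih[OF \<A>] f S unfolding twist_closed_def thin_states_def by blast
  moreover have "finite {n\<in>N. ?f (\<gamma> \<otimes> n) \<noteq> 0}" if N: "N \<in> \<N>" and \<gamma>: "\<gamma> \<in> carrier G" for N \<gamma>
  proof (rule finite_subset)
    have Nn: "N \<lhd> G" by (rule \<N>[OF N])
    let ?U = "\<Union>x\<in>S. \<Union>y\<in>S. (\<lambda>m. x \<otimes> m \<otimes> inv x) ` {m\<in>N. f ((inv y \<otimes> \<gamma> \<otimes> x) \<otimes> m) \<noteq> 0}"
    show "finite ?U" using f N \<gamma> S by (auto simp: thin_states_def subset_iff)
    show "{n\<in>N. ?f (\<gamma> \<otimes> n) \<noteq> 0} \<subseteq> ?U"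
    proof
      fix n assume n: "n \<in> {n\<in>N. ?f (\<gamma> \<otimes> n) \<noteq> 0}"
      then have nG: "n \<in> carrier G" using normal_subset[OF Nn] by auto
      have "\<exists>x\<in>S. \<exists>y\<in>S. f (inv y \<otimes> (\<gamma> \<otimes> n) \<otimes> x) \<noteq> 0"
      proof (rule ccontr)
        assume "\<not> ?thesis"
        then have "twist G f S a (\<gamma> \<otimes> n) = 0" unfolding twist_def by simp
        then show False using n by simp
      qed
      then obtain x y where xy: "x \<in> S" "y \<in> S" "f (inv y \<otimes> (\<gamma> \<otimes> n) \<otimes> x) \<noteq> 0" by blast
      then have c: "x \<in> carrier G" "y \<in> carrier G" using S by auto
      define m where "m = inv x \<otimes> n \<otimes> x"
      have mN: "m \<in> N" using normal_conj[OF Nn, of "inv x" n] n c by (simp add: m_def)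
      have "(inv y \<otimes> \<gamma> \<otimes> x) \<otimes> m = inv y \<otimes> \<gamma> \<otimes> (x \<otimes> inv x) \<otimes> n \<otimes> x"
        unfolding m_def using c \<gamma> nG by (simp only: m_assoc m_closed inv_closed)
      then have "(inv y \<otimes> \<gamma> \<otimes> x) \<otimes> m = inv y \<otimes> (\<gamma> \<otimes> n) \<otimes> x"
        using c \<gamma> nG by (simp add: m_assoc)
      then have "m \<in> {m\<in>N. f ((inv y \<otimes> \<gamma> \<otimes> x) \<otimes> m) \<noteq> 0}" using mN xy by simp
      moreover have "n = x \<otimes> m \<otimes> inv x"
        unfolding m_def using c nG by (simp add: m_assoc) (simp add: m_assoc[symmetric])
      ultimately show "n \<in> ?U" using xy by blast
    qed
  qed
  ultimately show "?f \<in> thin_states \<A> \<N>" by (simp add: thin_states_def)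
qed

text \<open>A thin state \<open>f\<close> has no component \<open>v\<close> that is \<open>1\<close> on an infinite \<open>N\<close>: for \<open>S \<subseteq> N\<close> with \<open>k\<close> elements
  the sum of \<open>f\<close> over the quotients of elements of \<open>S\<close> is at least \<open>(1 - t) k\<^sup>2\<close>, but grows linearly.\<close>

lemma thin_state_component:
  assumes f: "f \<in> pd G" "finite {n\<in>N. f n \<noteq> 0}" and N: "N \<lhd> G" "infinite N"
    and u: "u \<in> pd G" and v: "\<And>n. n \<in> N \<Longrightarrow> v n = 1" and t: "0 \<le> t" "t \<le> 1" and mix: "f = mix t u v"
  shows "t = 1"
proof (rule ccontr)
  assume "t \<noteq> 1"
  then have t1: "t < 1" using t by simp
  define m where "m = card {n\<in>N. f n \<noteq> 0}"
  obtain k :: nat where k: "real m < (1 - t) * real k"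
    using reals_Archimedean3[of "1 - t"] t1 by (metis diff_gt_0_iff_gt mult.commute)
  obtain S where S: "finite S" "card S = k" "S \<subseteq> N" using infinite_arbitrarily_large[OF N(2)] by blast
  have NG: "N \<subseteq> carrier G" by (rule normal_subset[OF N(1)])
  have SG: "S \<subseteq> carrier G" using S NG by blast
  have q: "inv y \<otimes> x \<in> N" if "x \<in> S" "y \<in> S" for x y
    using normal_mult[OF N(1) normal_minv[OF N(1)]] S(3) that by blast
  have "(\<Sum>x\<in>S. \<Sum>y\<in>S. f (inv y \<otimes> x)) =
      of_real t * (\<Sum>x\<in>S. \<Sum>y\<in>S. u (inv y \<otimes> x)) + of_real (1 - t) * (of_nat k * of_nat k)"
  proof -
    have "(\<Sum>x\<in>S. \<Sum>y\<in>S. f (inv y \<otimes> x)) = (\<Sum>x\<in>S. \<Sum>y\<in>S. of_real t * u (inv y \<otimes> x) + of_real (1 - t))"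
      using q v by (intro sum.cong refl) (simp add: mix mix_def)
    then show ?thesis using S(2) by (simp add: sum.distrib sum_distrib_left mult_ac)
  qed
  moreover have "0 \<le> Re (\<Sum>x\<in>S. \<Sum>y\<in>S. u (inv y \<otimes> x))"
    using pd_nonneg[OF u S(1) SG, of "\<lambda>_. 1"] by simp
  ultimately have low: "(1 - t) * (real k * real k) \<le> Re (\<Sum>x\<in>S. \<Sum>y\<in>S. f (inv y \<otimes> x))"
    using t by simp
  have "cmod (\<Sum>y\<in>S. f (inv y \<otimes> x)) \<le> real m" if x: "x \<in> S" for x
  proof -
    have inj: "inj_on (\<lambda>y. inv y \<otimes> x) {y\<in>S. f (inv y \<otimes> x) \<noteq> 0}"
    proof (rule inj_onI)
      fix y z assume yz: "y \<in> {y\<in>S. f (inv y \<otimes> x) \<noteq> 0}" "z \<in> {y\<in>S. f (inv y \<otimes> x) \<noteq> 0}"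
        and eq: "inv y \<otimes> x = inv z \<otimes> x"
      have c: "x \<in> carrier G" "y \<in> carrier G" "z \<in> carrier G" using x yz SG by auto
      then have "inv y = inv z" using eq by (metis inv_closed right_cancel)
      then show "y = z" using c by (metis inv_inv)
    qed
    have "(\<lambda>y. inv y \<otimes> x) ` {y\<in>S. f (inv y \<otimes> x) \<noteq> 0} \<subseteq> {n\<in>N. f n \<noteq> 0}" using q x by auto
    then have cm: "card {y\<in>S. f (inv y \<otimes> x) \<noteq> 0} \<le> m"
      unfolding m_def by (rule card_inj_on_le[OF inj _ f(2)])
    have "(\<Sum>y\<in>S. f (inv y \<otimes> x)) = (\<Sum>y\<in>{y\<in>S. f (inv y \<otimes> x) \<noteq> 0}. f (inv y \<otimes> x))"
      using S(1) by (intro sum.mono_neutral_right) auto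
    also have "cmod \<dots> \<le> (\<Sum>y\<in>{y\<in>S. f (inv y \<otimes> x) \<noteq> 0}. 1)"
      by (rule sum_norm_le) (rule pd_bound[OF f(1)])
    finally show ?thesis using cm by simp
  qed
  then have "cmod (\<Sum>x\<in>S. \<Sum>y\<in>S. f (inv y \<otimes> x)) \<le> (\<Sum>x\<in>S. real m)"
    by (rule sum_norm_le)
  then have "Re (\<Sum>x\<in>S. \<Sum>y\<in>S. f (inv y \<otimes> x)) \<le> real k * real m"
    using complex_Re_le_cmod order_trans S(2) by fastforce
  with low have "real k * ((1 - t) * real k) \<le> real k * real m" by (simp add: mult_ac)
  moreover have "0 < real k" using k t1 by (cases k) auto
  ultimately show False using k by simp
qed

theorem faithful_irrep_of_annih:
  fixes emb :: "real \<Rightarrow> 'v"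
  assumes cnt: "countable (carrier G)" and emb: "inj emb" and ne: "annih G (finite_feet G) \<noteq> {}"
  shows "irreducibly_represented TYPE('v) G"
proof -
  let ?M = "minisocle G"
  have M: "?M \<lhd> G" "\<And>A. A \<in> finite_feet G \<Longrightarrow> A \<subseteq> ?M"
    using normal_generate_UN[of "finite_feet G" "\<lambda>x. x"] finite_feet_normal
    by (auto simp: minisocle_def intro: generate.incl)
  note Msub = normal_imp_sub[OF M(1)]
  \<comment> \<open>The normal closures that contain no finite foot. All the others are kept out of
    the kernel by the coset sums, which every state in \<open>K\<close> satisfies.\<close>
  define \<N> where "\<N> = {N. \<exists>g\<in>carrier G. N = normal_closure G g \<and> g \<noteq> \<one> \<and> N \<inter> ?M = {\<one>}}"
  have \<N>: "N \<lhd> G" "N \<inter> ?M = {\<one>}" "infinite N" if NN: "N \<in> \<N>" for N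
  proof -
    obtain g where g: "g \<in> carrier G" "N = normal_closure G g" "g \<noteq> \<one>" "N \<inter> ?M = {\<one>}"
      using NN by (auto simp: \<N>_def)
    show N: "N \<lhd> G" "N \<inter> ?M = {\<one>}" using g normal_closure_normal by auto
    \<comment> \<open>A finite \<open>N\<close> would contain a foot, and every finite foot lies in
      \<open>?M\<close>.\<close>
    show "infinite N"
    proof
      assume "finite N"
      moreover have "N \<noteq> {\<one>}" using normal_closure_normal(2)[OF g(1)] g by auto
      ultimately obtain A where A: "A \<in> finite_feet G" "A \<subseteq> N" using exists_finite_foot[OF N(1)] by blast
      then have "A \<subseteq> {\<one>}" using M(2)[OF A(1)] N(2) by blast
      then show False using finite_feet_normal[OF A(1)] normal_one by blast
    qed
  qed
  have cN: "countable \<N>"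
    by (rule countable_subset[of _ "normal_closure G ` carrier G"]) (auto simp: \<N>_def cnt)
  define D where "D = thin_states (finite_feet G) \<N>"
  define K where "K = closure D"
  have Dann: "D \<subseteq> annih G (finite_feet G)" by (auto simp: D_def thin_states_def)
  have Kann: "K \<subseteq> annih G (finite_feet G)" unfolding K_def by (rule closure_minimal[OF Dann closed_annih])
  have DK: "D \<subseteq> K" unfolding K_def by (rule closure_subset)
  obtain f0 where f0: "f0 \<in> annih G (finite_feet G)" using ne by blast
  \<comment> \<open>Cut off outside the minisocle, which meets each coset of a member of
    \<open>\<N>\<close> at most once; so \<open>f1\<close> is thin.\<close>
  define f1 where "f1 = (\<lambda>x. if x \<in> ?M then f0 x else 0)"
  have "f1 \<in> annih G (finite_feet G)"
    unfolding f1_def by (intro annih_zero_extension[OF Msub] annih_subgroup[OF Msub] f0 M(2))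
  moreover have "finite {n\<in>N. f1 (\<gamma> \<otimes> n) \<noteq> 0}" if N: "N \<in> \<N>" and \<gamma>: "\<gamma> \<in> carrier G" for N \<gamma>
  proof -
    have "n = n'" if n: "n \<in> N" "\<gamma> \<otimes> n \<in> ?M" "n' \<in> N" "\<gamma> \<otimes> n' \<in> ?M" for n n'
    proof -
      have c: "n \<in> carrier G" "n' \<in> carrier G" using n normal_subset[OF \<N>(1)[OF N]] by auto
      have "inv (\<gamma> \<otimes> n) \<otimes> (\<gamma> \<otimes> n') = inv n \<otimes> (inv \<gamma> \<otimes> \<gamma>) \<otimes> n'"
        using c \<gamma> by (simp only: inv_mult_group m_assoc m_closed inv_closed)
      then have "inv n \<otimes> n' \<in> ?M"
        using normal_mult[OF M(1) normal_minv[OF M(1) n(2)] n(4)] c \<gamma> by simp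
      moreover have "inv n \<otimes> n' \<in> N" using n \<N>(1)[OF N] normal_mult normal_minv by blast
      ultimately have "inv n \<otimes> n' = \<one>" using \<N>(2)[OF N] by blast
      then show ?thesis using c by (metis inv_closed inv_equality inv_inv)
    qed
    then have "{n\<in>N. f1 (\<gamma> \<otimes> n) \<noteq> 0} \<subseteq> {THE n. n \<in> N \<and> \<gamma> \<otimes> n \<in> ?M}"
      unfolding f1_def by (auto intro!: the_equality[symmetric] split: if_splits)
    then show ?thesis by (rule finite_subset) simp
  qed
  ultimately have "f1 \<in> D" by (simp add: D_def thin_states_def)
  then have Kne: "K \<noteq> {}" using DK by auto
  have Kpd: "K \<subseteq> pd G" using Kann annih_pd by blast
  have Kclosed: "closed K" by (simp add: K_def)
  have Kmix: "mix_closed K" unfolding K_def D_def by (intro mix_closed_closure mix_closed_thin_states)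
  have Ktw: "twist_closed G K"
    unfolding K_def D_def
    by (intro twist_closed_closure twist_closed_thin_states) (auto simp: finite_feet_normal \<N>)
  have Kcompact: "compact K"
    using compact_Int_closed[OF compact_pd Kclosed] Kpd by (simp add: inf.absorb2)
  define ones where "ones N = K \<inter> (\<Inter>n\<in>N. {f. f n = 1})" for N
  have ones_mem: "f \<in> ones N \<longleftrightarrow> f \<in> K \<and> (\<forall>n\<in>N. f n = 1)" for f N by (auto simp: ones_def)
  have oc: "compact (ones N)" for N
    unfolding ones_def
    by (intro compact_Int_closed Kcompact closed_INT ballI closed_Collect_eq continuous_intros)
  have om: "mix_closed (ones N)" for N
    unfolding mix_closed_def
  proof (intro ballI)
    fix f g and t :: real assume fg: "f \<in> ones N" "g \<in> ones N" and t: "t \<in> {0..1}"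
    then have "mix t f g \<in> K" using Kmix unfolding mix_closed_def ones_mem by blast
    moreover have "mix t f g n = 1" if "n \<in> N" for n
      using fg that by (simp add: mix_def ones_mem)
    ultimately show "mix t f g \<in> ones N" by (simp add: ones_mem)
  qed
  \<comment> \<open>Since \<open>D\<close> is dense in \<open>K\<close>, the open slice contains a
    thin state \<open>f\<close>. By \<open>thin_state_component\<close>, \<open>f\<close> is not in
    the convex hull of the rest of \<open>K\<close> and \<open>ones N\<close>; separating it from
    both cuts out a smaller slice that misses \<open>ones N\<close>.\<close>
  have av: "\<exists>T' c' \<alpha>'. finite T' \<and> slice K T' c' \<alpha>' \<noteq> {} \<and> slice K T' c' \<alpha>' \<subseteq> slice K T c \<alpha> \<and>
         slice K T' c' \<alpha>' \<inter> F = {}"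
      if F: "F \<in> ones ` \<N>" and T: "finite T" "slice K T c \<alpha> \<noteq> {}" for F T c \<alpha>
    proof -
      obtain N where N: "N \<in> \<N>" "F = ones N" using F by auto
      have op: "open {f. \<alpha> < lin T c f}" by (intro open_Collect_less continuous_on_lin continuous_intros)
      obtain f' where "f' \<in> {f. \<alpha> < lin T c f} \<inter> closure D" using T(2) by (auto simp: slice_def K_def)
      then have "{f. \<alpha> < lin T c f} \<inter> D \<noteq> {}" using open_Int_closure_eq_empty[OF op, of D] by blast
      then obtain f where f: "f \<in> D" "\<alpha> < lin T c f" by auto
      let ?A = "{f\<in>K. lin T c f \<le> \<alpha>}"
      have fpd: "f \<in> pd G" using f(1) Dann annih_pd by blast
      have fin: "finite {n\<in>N. f n \<noteq> 0}"
      proof -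
        have "finite {n\<in>N. f (\<one> \<otimes> n) \<noteq> 0}" using f(1) N(1) by (auto simp: D_def thin_states_def)
        moreover have "{n\<in>N. f (\<one> \<otimes> n) \<noteq> 0} = {n\<in>N. f n \<noteq> 0}"
          using normal_subset[OF \<N>(1)[OF N(1)]] by (auto simp: subset_iff)
        ultimately show ?thesis by simp
      qed
      have nA: "f \<notin> ?A" using f by auto
      have nB: "f \<notin> ones N"
      proof
        assume "f \<in> ones N"
        then have "{n\<in>N. f n \<noteq> 0} = N" by (auto simp: ones_mem)
        then show False using fin \<N>(3)[OF N(1)] by simp
      qed
      have nJ: "f \<notin> join ?A (ones N)"
      proof
        assume "f \<in> join ?A (ones N)"
        then obtain t u v where j: "f = mix t u v" "t \<in> {0..1}" "u \<in> ?A" "v \<in> ones N"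
          unfolding join_def by blast
        have "t = 1"
          using thin_state_component[OF fpd fin \<N>(1)[OF N(1)] \<N>(3)[OF N(1)] _ _ _ _ j(1)] j Kpd
          by (auto simp: ones_mem)
        then show False using j(1,3) nA by simp
      qed
      obtain T' c' \<alpha>' where T': "finite T'" "\<forall>g\<in>?A \<union> ones N. lin T' c' g \<le> \<alpha>'" "\<alpha>' < lin T' c' f"
        using separate_join[OF compact_lin_le[OF Kcompact] mix_closed_lin_le[OF Kmix] oc om nA nB nJ] by auto
      have "f \<in> slice K T' c' \<alpha>'" using T'(3) f(1) DK by (auto simp: slice_def)
      moreover have out: "g \<notin> ?A \<union> ones N" if "g \<in> slice K T' c' \<alpha>'" for g
        using bspec[OF T'(2), of g] that by (auto simp: slice_def)
      have "slice K T' c' \<alpha>' \<subseteq> slice K T c \<alpha>"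
        using out by (auto simp: slice_def not_le[symmetric])
      moreover have "slice K T' c' \<alpha>' \<inter> F = {}" using out unfolding N(2) by blast
      ultimately show ?thesis using T'(1) by (intro exI[of _ T'] exI[of _ c'] exI[of _ \<alpha>']) auto
    qed
  have ex: "\<exists>p\<in>K. p \<notin> \<Union>(ones ` \<N>) \<and> (\<exists>(V :: 'v inner_space) \<pi>. irreducible_unitary_rep G V \<pi> \<and>
    kernel G (unitary_group V) \<pi> \<lhd> G \<and> (\<forall>g\<in>kernel G (unitary_group V) \<pi>. p g = 1))"
    by (rule irreducible_rep_of_states[OF cnt emb Kne Kpd Kclosed Kmix Ktw countable_image[OF cN]]) (rule av)
  then obtain p where p: "p \<in> K" "p \<notin> \<Union>(ones ` \<N>)" and ex': "\<exists>(V :: 'v inner_space) \<pi>.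
    irreducible_unitary_rep G V \<pi> \<and> kernel G (unitary_group V) \<pi> \<lhd> G \<and>
    (\<forall>g\<in>kernel G (unitary_group V) \<pi>. p g = 1)" by meson
  from ex' obtain V :: "'v inner_space" and \<pi> where irr: "irreducible_unitary_rep G V \<pi>"
    "kernel G (unitary_group V) \<pi> \<lhd> G" and ker: "\<And>g. g \<in> kernel G (unitary_group V) \<pi> \<Longrightarrow> p g = 1"
    by auto
  let ?ker = "kernel G (unitary_group V) \<pi>"
  have "g = \<one>" if g: "g \<in> ?ker" for g
  proof (rule ccontr)
    assume g1: "g \<noteq> \<one>"
    have gG: "g \<in> carrier G" using g by (simp add: kernel_def)
    let ?N = "normal_closure G g"
    note N = normal_closure_normal[OF gG]
    have Nk: "?N \<subseteq> ?ker" using N(3)[OF irr(2) g] .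
    show False
    \<comment> \<open>If the normal closure of \<open>g\<close> meets the minisocle trivially, it
      belongs to \<open>\<N>\<close>, and \<open>p\<close> was chosen outside
      \<open>ones ?N\<close>. Otherwise it contains a finite foot, on which \<open>p\<close> cannot
      be constantly \<open>1\<close>.\<close>
    proof (cases "?N \<inter> ?M = {\<one>}")
      case True
      then have "?N \<in> \<N>" using gG g1 unfolding \<N>_def by blast
      moreover have "p \<in> ones ?N" using p(1) Nk ker by (auto simp: ones_mem)
      ultimately show False using p(2) by blast
    next
      case False
      then obtain A where A: "A \<in> finite_feet G" "A \<subseteq> ?N"
        using generate_feet_contains_foot[OF order_refl N(1)] by (auto simp: minisocle_def)
      have "\<exists>g\<in>A. p g \<noteq> 1"
        using annih_not_one[of p _ A] p(1) Kann A(1) finite_feet_normal[OF A(1)] normal_subset normal_one by blast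
      then show False using A(2) Nk ker by blast
    qed
  qed
  then have "?ker = {\<one>}" using normal_one[OF irr(2)] by blast
  then show ?thesis unfolding irreducibly_represented_def using irr(1) by blast
qed

end

lemma twist_closedD:
  "twist_closed G K \<Longrightarrow> f \<in> K \<Longrightarrow> finite S \<Longrightarrow> S \<subseteq> carrier G \<Longrightarrow> twist G f S a \<one>\<^bsub>G\<^esub> \<noteq> 0 \<Longrightarrow>
    (\<lambda>g. twist G f S a g / twist G f S a \<one>\<^bsub>G\<^esub>) \<in> K"
  by (simp add: twist_closed_def)

section \<open>States on normal subgroups, characters, and the nonabelian feet\<close>

context group
begin

lemma exists_extreme:
  assumes cnt: "countable (carrier G)" and K: "K \<noteq> {}" "K \<subseteq> pd G" "closed K" "mix_closed K"
  shows "\<exists>p. extreme_in p K"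
proof -
  have "compact K"
    using compact_Int_closed[OF compact_pd K(3)] K(2) by (simp add: inf.absorb2)
  have off: "f x = 0" if "f \<in> K" "x \<notin> carrier G" for f x
    using that K(2) pd_off[of f G x] by auto
  have "\<exists>p. extreme_in p K \<and> p \<notin> \<Union>{}"
    by (rule extreme_avoiding[OF \<open>compact K\<close> K(4,1) cnt]) (rule off, auto)
  then show ?thesis by auto
qed

text \<open>The twists of \<open>p\<close> by \<open>\<one> + z g\<close> and \<open>\<one> - z g\<close> average to a multiple of \<open>p\<close>, hence both are
  multiples of \<open>p\<close>; taking \<open>\<bar>z\<bar> < 1\<close> keeps them from vanishing.\<close>

lemma extreme_abelian_mult:
  assumes comm: "\<And>x y. x \<in> carrier G \<Longrightarrow> y \<in> carrier G \<Longrightarrow> x \<otimes> y = y \<otimes> x"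
    and K: "twist_closed G K" "K \<subseteq> pd G" and p: "extreme_in p K"
    and h: "h \<in> carrier G" and g: "g \<in> carrier G"
  shows "p (h \<otimes> g) = p h * p g"
proof (cases "g = \<one>")
  case True
  then show ?thesis using p K(2) h pd_one[of p G] by (auto simp: extreme_in_def)
next
  case False
  have pK: "p \<in> K" and ppd: "p \<in> pd G" using p K(2) by (auto simp: extreme_in_def)
  have key: "\<exists>c. \<forall>h\<in>carrier G. cnj z * p (inv g \<otimes> h) + z * p (h \<otimes> g) = c * p h" if z: "cmod z = 1/2" for z
  proof -
    define a where "a w x = (if x = \<one> then 1 else if x = g then w else 0)" for w :: complex and x
    define T where "T w = twist G p {\<one>, g} (a w)" for w
    have T: "T w h = (1 + w * cnj w) * p h + cnj w * p (inv g \<otimes> h) + w * p (h \<otimes> g)"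
      if h: "h \<in> carrier G" for w h
    proof -
      have "inv g \<otimes> h \<otimes> g = h" using comm[of h g] h g by (simp add: m_assoc) (simp add: m_assoc[symmetric])
      then show ?thesis
        using False g h unfolding T_def twist_def a_def by (simp add: algebra_simps)
    qed
    have Toff: "T w h = 0" if "h \<notin> carrier G" for w h using that by (simp add: T_def twist_def)
    \<comment> \<open>The value at \<open>\<one>\<close> of the twist, where \<open>5/4\<close> is
      \<open>1 + w * cnj w\<close> for \<open>cmod w = 1/2\<close>. It is positive because
      \<open>cmod (p g) \<le> 1\<close>.\<close>
    define r where "r w = 5/4 + 2 * Re (w * p g)" for w
    have T1: "T w \<one> = of_real (r w)" if w: "cmod w = 1/2" for w
    proof -
      have "w * cnj w = of_real ((cmod w)\<^sup>2)" by (rule complex_norm_square[symmetric])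
      then have "w * cnj w = of_real (1/4)" by (simp only: w) (simp add: power2_eq_square)
      then have "T w \<one> = of_real (5/4) + (w * p g + cnj (w * p g))"
        using T[OF one_closed] pd_one[OF ppd] pd_inv[OF ppd g] g by simp
      then show ?thesis unfolding r_def by (simp add: complex_eq_iff)
    qed
    have rpos: "0 < r w" if w: "cmod w = 1/2" for w
    proof -
      have "\<bar>Re (w * p g)\<bar> \<le> cmod w * cmod (p g)" by (metis abs_Re_le_cmod norm_mult)
      also have "\<dots> \<le> 1/2" unfolding w using pd_bound[OF ppd, of g] by simp
      finally show ?thesis unfolding r_def by (simp add: abs_le_iff del: times_complex.sel)
    qed
    have mz: "cmod (- z) = 1/2" using z by simp
    have mem: "(\<lambda>h. T w h / of_real (r w)) \<in> K" if w: "cmod w = 1/2" for w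
    proof -
      have "twist G p {\<one>, g} (a w) \<one> = of_real (r w)" using T1[OF w] by (simp add: T_def)
      moreover have "of_real (r w) \<noteq> (0 :: complex)" using rpos[OF w] by simp
      ultimately have "(\<lambda>h. twist G p {\<one>, g} (a w) h / twist G p {\<one>, g} (a w) \<one>) \<in> K"
        using g by (intro twist_closedD[OF K(1) pK]) auto
      then show ?thesis using T1[OF w] by (simp add: T_def)
    qed
    \<comment> \<open>The weights are proportional to \<open>r z\<close> and \<open>r (- z)\<close>,
      whose sum is \<open>5/2\<close>. With them the unnormalised twists are simply added, and their
      terms linear in \<open>z\<close> cancel.\<close>
    define t where "t = r z / (5/2)"
    have rr: "r z + r (- z) = 5/2" by (simp add: r_def)
    then have t: "0 < t" "t < 1" "1 - t = r (- z) / (5/2)"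
      using rpos[OF z] rpos[OF mz] by (auto simp: t_def field_simps)
    have "p = mix t (\<lambda>h. T z h / of_real (r z)) (\<lambda>h. T (- z) h / of_real (r (- z)))"
    proof
      fix h
      have "of_real t * (T z h / of_real (r z)) = T z h * (2/5)"
        using rpos[OF z] by (simp add: t_def field_simps)
      moreover have "of_real (1 - t) * (T (- z) h / of_real (r (- z))) = T (- z) h * (2/5)"
        using rpos[OF mz] by (simp only: t(3)) (simp add: field_simps)
      moreover have "p h = (T z h + T (- z) h) * (2/5)"
      proof (cases "h \<in> carrier G")
        case True
        have "z * cnj z = of_real ((cmod z)\<^sup>2)" by (rule complex_norm_square[symmetric])
        then have "z * cnj z = 1/4" by (simp only: z) (simp add: power2_eq_square)
        then show ?thesis by (simp add: T[OF True] mult.commute[of 4])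
      next
        case False then show ?thesis using Toff pd_off[OF ppd] by simp
      qed
      ultimately show "p h = mix t (\<lambda>h. T z h / of_real (r z)) (\<lambda>h. T (- z) h / of_real (r (- z))) h"
        by (simp only: mix_def distrib_right)
    qed
    then have "(\<lambda>h. T z h / of_real (r z)) = p"
      using p mem[OF z] mem[OF mz] t unfolding extreme_in_def by blast
    then have Tz: "T z h = of_real (r z) * p h" for h
      using rpos[OF z] by (auto simp: fun_eq_iff field_simps)
    have "\<forall>h\<in>carrier G. cnj z * p (inv g \<otimes> h) + z * p (h \<otimes> g) = (of_real (r z) - (1 + z * cnj z)) * p h"
    proof
      fix h assume h: "h \<in> carrier G"
      have "(1 + z * cnj z) * p h + cnj z * p (inv g \<otimes> h) + z * p (h \<otimes> g) = of_real (r z) * p h"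
        using T[OF h, of z] Tz[of h] by simp
      then show "cnj z * p (inv g \<otimes> h) + z * p (h \<otimes> g) = (of_real (r z) - (1 + z * cnj z)) * p h"
        by (simp add: algebra_simps)
    qed
    then show ?thesis by blast
  qed
  \<comment> \<open>The relations for \<open>z = 1/2\<close> and \<open>z = \<i>/2\<close> are two
    linear equations for \<open>p (inv g \<otimes> h)\<close> and \<open>p (h \<otimes> g)\<close>;
    the combination \<open>c - \<i> * d\<close> eliminates the former.\<close>
  obtain c where c: "\<forall>h\<in>carrier G. cnj (1/2) * p (inv g \<otimes> h) + (1/2) * p (h \<otimes> g) = c * p h"
    using key[of "1/2"] by (auto simp: norm_divide)
  obtain d where d: "\<forall>h\<in>carrier G. cnj (\<i>/2) * p (inv g \<otimes> h) + (\<i>/2) * p (h \<otimes> g) = d * p h"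
    using key[of "\<i>/2"] by (auto simp: norm_divide)
  have e: "p (h \<otimes> g) = (c - \<i> * d) * p h" if "h \<in> carrier G" for h
  proof -
    have "(c - \<i> * d) * p h = c * p h - \<i> * (d * p h)" by (simp add: algebra_simps)
    also have "\<dots> = (cnj (1/2) * p (inv g \<otimes> h) + (1/2) * p (h \<otimes> g)) -
        \<i> * (cnj (\<i>/2) * p (inv g \<otimes> h) + (\<i>/2) * p (h \<otimes> g))"
      using c d that by simp
    also have "\<dots> = p (h \<otimes> g)" by (simp add: algebra_simps)
    finally show ?thesis ..
  qed
  have "c - \<i> * d = p g" using e[OF one_closed] g pd_one[OF ppd] by simp
  then show ?thesis using e[OF h] by simp
qed

text \<open>Each condition on a single \<open>A\<close> cuts out a closed subset of the compact set
  \<open>pd G\<close>, so the finite intersection property applies.\<close>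

lemma annih_compactness:
  assumes "\<And>\<B>. finite \<B> \<Longrightarrow> \<B> \<subseteq> \<A> \<Longrightarrow> annih G \<B> \<noteq> {}"
  shows "annih G \<A> \<noteq> {}"
proof -
  have "pd G \<inter> (\<Inter>A\<in>\<A>. annih G {A}) \<noteq> {}"
  proof (rule compact_imp_fip_image[OF compact_pd closed_annih])
    fix \<B> assume "finite \<B>" "\<B> \<subseteq> \<A>"
    then obtain f where "f \<in> annih G \<B>" using assms by blast
    then have "f \<in> pd G \<inter> (\<Inter>A\<in>\<B>. annih G {A})" by (auto simp: annih_def)
    then show "pd G \<inter> (\<Inter>A\<in>\<B>. annih G {A}) \<noteq> {}" by blast
  qed
  then show ?thesis by (auto simp: annih_def)
qed

lemma annih_of_faithful_irrep:
  assumes "irreducibly_represented TYPE('v) G"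
  shows "annih G (finite_feet G) \<noteq> {}"
proof -
  obtain V :: "'v inner_space" and \<pi> where V: "irreducible_unitary_rep G V \<pi>" "kernel G (unitary_group V) \<pi> = {\<one>}"
    using assms unfolding irreducibly_represented_def by blast
  interpret R: unitary_representation G V \<pi>
    using V(1) unfolding irreducible_unitary_rep_def unitary_rep_def
    by (intro unitary_representation.intro unitary_representation_axioms.intro group_axioms) auto
  show ?thesis
  proof (rule R.annih_of_irreducible[OF V(1)])
    fix A assume A: "A \<in> finite_feet G"
    then have "\<not> A \<subseteq> {\<one>}" using finite_feet_normal[OF A] normal_one by blast
    then show "A \<lhd> G \<and> finite A \<and> \<not> A \<subseteq> kernel G (unitary_group V) \<pi>"
      using finite_feet_normal[OF A] V(2) by simp
  qed
qed

text \<open>A member of \<open>\<A>\<close> is normal in the whole group. If it lay in the kernel of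
  \<open>\<sigma>\<close> it would lie in the kernel of every conjugate, so
  \<open>annih_of_irreducible\<close> applies inside \<open>M\<close>, and extension by zero leads
  back to \<open>G\<close>.\<close>

lemma annih_of_conj_faithful_irrep:
  assumes M: "M \<lhd> G" and \<A>: "\<A> \<subseteq> finite_feet G" "\<And>A. A \<in> \<A> \<Longrightarrow> A \<subseteq> M"
    and irr: "has_conj_faithful_irrep TYPE('v) G M"
  shows "annih G \<A> \<noteq> {}"
proof -
  let ?GM = "G\<lparr>carrier := M\<rparr>"
  obtain V :: "'v inner_space" and \<sigma> where V: "irreducible_unitary_rep ?GM V \<sigma>"
    and cf: "conj_faithful G M (unitary_group V) \<sigma>"
    using irr unfolding has_conj_faithful_irrep_def by blast
  note Msub = normal_imp_sub[OF M]
  interpret R: unitary_representation ?GM V \<sigma>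
    using V unfolding irreducible_unitary_rep_def unitary_rep_def
    by (intro unitary_representation.intro unitary_representation_axioms.intro subgroup_imp_group[OF Msub]) auto
  have "annih ?GM \<A> \<noteq> {}"
  proof (rule R.annih_of_irreducible[OF V])
    fix A assume A: "A \<in> \<A>"
    then have An: "A \<lhd> G" "finite A" "A \<noteq> {\<one>}" using finite_feet_normal \<A> by blast+
    have "\<not> A \<subseteq> kernel ?GM (unitary_group V) \<sigma>"
    proof
      assume k: "A \<subseteq> kernel ?GM (unitary_group V) \<sigma>"
      have "a = \<one>" if a: "a \<in> A" for a
      proof -
        have "\<sigma> (\<gamma> \<otimes> a \<otimes> inv \<gamma>) = \<one>\<^bsub>unitary_group V\<^esub>" if "\<gamma> \<in> carrier G" for \<gamma>
          using normal_conj[OF An(1) that a] k by (auto simp: kernel_def)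
        then have "a \<in> (\<Inter>\<gamma>\<in>carrier G. kernel ?GM (unitary_group V) (conj_rep G \<sigma> \<gamma>))"
          using a \<A>(2)[OF A] by (auto simp: kernel_def conj_rep_def)
        then show ?thesis using cf unfolding conj_faithful_def by blast
      qed
      then show False using An normal_one by blast
    qed
    then show "A \<lhd> ?GM \<and> finite A \<and> \<not> A \<subseteq> kernel ?GM (unitary_group V) \<sigma>"
      using An normal_restrict_supergroup[OF Msub An(1) \<A>(2)[OF A]] by simp
  qed
  then show ?thesis using annih_zero_extension[OF Msub \<A>(2)] by blast
qed

text \<open>When \<open>k\<close> is the kernel of a representation or character of
  \<open>M\<close>, this set is the intersection of the kernels of its conjugates. Normality in the
  whole group is what lets feet detect it.\<close>

lemma conj_core_normal:
  assumes M: "M \<lhd> G" and k: "subgroup k G" "k \<subseteq> M"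
  shows "{n\<in>M. \<forall>\<gamma>\<in>carrier G. \<gamma> \<otimes> n \<otimes> inv \<gamma> \<in> k} \<lhd> G" (is "?L \<lhd> G")
proof -
  interpret k: subgroup k G by (rule k)
  note MG = normal_subset[OF M]
  have "subgroup ?L G"
  proof (rule subgroupI)
    show "?L \<subseteq> carrier G" using MG by auto
    have "\<one> \<in> ?L" using normal_one[OF M] k.one_closed by simp
    then show "?L \<noteq> {}" by blast
    fix a assume a: "a \<in> ?L"
    then have aG: "a \<in> carrier G" using MG by auto
    have "\<gamma> \<otimes> inv a \<otimes> inv \<gamma> \<in> k" if \<gamma>: "\<gamma> \<in> carrier G" for \<gamma>
    proof -
      have "\<gamma> \<otimes> inv a \<otimes> inv \<gamma> = inv (\<gamma> \<otimes> a \<otimes> inv \<gamma>)" using aG \<gamma> by (simp add: inv_mult_group m_assoc)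
      then show ?thesis using a \<gamma> by simp
    qed
    then show "inv a \<in> ?L" using a normal_minv[OF M] by blast
    fix b assume b: "b \<in> ?L"
    then have bG: "b \<in> carrier G" using MG by auto
    have "\<gamma> \<otimes> (a \<otimes> b) \<otimes> inv \<gamma> \<in> k" if \<gamma>: "\<gamma> \<in> carrier G" for \<gamma>
    proof -
      have "\<gamma> \<otimes> (a \<otimes> b) \<otimes> inv \<gamma> = (\<gamma> \<otimes> a \<otimes> inv \<gamma>) \<otimes> (\<gamma> \<otimes> b \<otimes> inv \<gamma>)"
        using aG bG \<gamma> by (simp add: m_assoc) (simp add: m_assoc[symmetric])
      then show ?thesis using a b \<gamma> by simp
    qed
    then show "a \<otimes> b \<in> ?L" using a b normal_mult[OF M] by blast
  qed
  moreover have "g \<otimes> n \<otimes> inv g \<in> ?L" if g: "g \<in> carrier G" and n: "n \<in> ?L" for g n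
  proof -
    have nG: "n \<in> carrier G" using n MG by auto
    have "\<gamma> \<otimes> (g \<otimes> n \<otimes> inv g) \<otimes> inv \<gamma> \<in> k" if \<gamma>: "\<gamma> \<in> carrier G" for \<gamma>
    proof -
      have "\<gamma> \<otimes> (g \<otimes> n \<otimes> inv g) \<otimes> inv \<gamma> = (\<gamma> \<otimes> g) \<otimes> n \<otimes> inv (\<gamma> \<otimes> g)"
        using nG g \<gamma> by (simp add: m_assoc inv_mult_group)
      then show ?thesis using n g \<gamma> by simp
    qed
    then show ?thesis using n normal_conj[OF M g] by blast
  qed
  ultimately show ?thesis by (simp add: normal_inv_iff)
qed

text \<open>The intersection of the conjugate kernels is normal and contained in the kernel; if it
  were nontrivial, \<open>det\<close> would place a member of \<open>\<A>\<close> in the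
  kernel.\<close>

lemma conj_faithfulI:
  assumes M: "M \<lhd> G" and det: "\<And>N. N \<lhd> G \<Longrightarrow> N \<subseteq> M \<Longrightarrow> N \<noteq> {\<one>} \<Longrightarrow> \<exists>A\<in>\<A>. A \<subseteq> N"
    and ker: "subgroup (kernel (G\<lparr>carrier := M\<rparr>) H \<sigma>) G" "\<And>A. A \<in> \<A> \<Longrightarrow> \<not> A \<subseteq> kernel (G\<lparr>carrier := M\<rparr>) H \<sigma>"
  shows "conj_faithful G M H \<sigma>"
proof -
  let ?k = "kernel (G\<lparr>carrier := M\<rparr>) H \<sigma>"
  let ?L = "{n\<in>M. \<forall>\<gamma>\<in>carrier G. \<gamma> \<otimes> n \<otimes> inv \<gamma> \<in> ?k}"
  have kM: "?k \<subseteq> M" by (auto simp: kernel_def)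
  have LM: "?L \<subseteq> M" by auto
  have Lk: "?L \<subseteq> ?k"
  proof
    fix n assume n: "n \<in> ?L"
    then have "n \<in> carrier G" using normal_subset[OF M] by auto
    moreover have "\<one> \<otimes> n \<otimes> inv \<one> \<in> ?k" using n one_closed by blast
    ultimately show "n \<in> ?k" by simp
  qed
  have L: "?L \<lhd> G" by (rule conj_core_normal[OF M ker(1) kM])
  have "?L = {\<one>}"
  proof (rule ccontr)
    assume "?L \<noteq> {\<one>}"
    then obtain A where "A \<in> \<A>" "A \<subseteq> ?L" using det[OF L LM] by blast
    then show False using ker(2) Lk by blast
  qed
  moreover have "(\<Inter>\<gamma>\<in>carrier G. kernel (G\<lparr>carrier := M\<rparr>) H (conj_rep G \<sigma> \<gamma>)) = ?L"
    using normal_conj[OF M] one_closed by (auto simp: kernel_def conj_rep_def)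
  ultimately show ?thesis by (simp add: conj_faithful_def)
qed

text \<open>By \<open>det\<close> it suffices to keep the members of \<open>\<A>\<close> out of the
  kernel, and every state in \<open>annih\<close> does this. So any extreme state over
  \<open>M\<close> works and the family of sets to be avoided is empty.\<close>

lemma conj_faithful_irrep_of_annih:
  fixes emb :: "real \<Rightarrow> 'v"
  assumes cnt: "countable (carrier G)" and emb: "inj emb"
    and M: "M \<lhd> G" and \<A>: "\<A> \<subseteq> finite_feet G" "\<And>A. A \<in> \<A> \<Longrightarrow> A \<subseteq> M"
    and det: "\<And>N. N \<lhd> G \<Longrightarrow> N \<subseteq> M \<Longrightarrow> N \<noteq> {\<one>} \<Longrightarrow> \<exists>A\<in>\<A>. A \<subseteq> N"
    and ne: "annih G \<A> \<noteq> {}"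
  shows "has_conj_faithful_irrep TYPE('v) G M"
proof -
  let ?GM = "G\<lparr>carrier := M\<rparr>"
  note Msub = normal_imp_sub[OF M]
  interpret GM: group ?GM by (rule subgroup_imp_group[OF Msub])
  have An: "A \<lhd> ?GM" if "A \<in> \<A>" for A
    using that \<A> finite_feet_normal by (intro normal_restrict_supergroup[OF Msub]) auto
  have K: "annih ?GM \<A> \<noteq> {}" "annih ?GM \<A> \<subseteq> pd ?GM"
    using annih_subgroup[OF Msub \<A>(2)] ne by (blast, auto simp: annih_def)
  have cM: "countable (carrier ?GM)" using cnt normal_subset[OF M] countable_subset by auto
  have "\<exists>p\<in>annih ?GM \<A>. p \<notin> \<Union>{} \<and> (\<exists>(V :: 'v inner_space) \<pi>. irreducible_unitary_rep ?GM V \<pi> \<and>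
    kernel ?GM (unitary_group V) \<pi> \<lhd> ?GM \<and> (\<forall>g\<in>kernel ?GM (unitary_group V) \<pi>. p g = 1))"
    by (rule GM.irreducible_rep_of_states[OF cM emb K closed_annih mix_closed_annih GM.twist_closed_annih[OF An]]) auto
  then obtain p and V :: "'v inner_space" and \<pi> where p: "p \<in> annih ?GM \<A>"
    and irr: "irreducible_unitary_rep ?GM V \<pi>"
    and ker: "kernel ?GM (unitary_group V) \<pi> \<lhd> ?GM" "\<forall>g\<in>kernel ?GM (unitary_group V) \<pi>. p g = 1"
    by auto
  have "conj_faithful G M (unitary_group V) \<pi>"
  proof (rule conj_faithfulI[OF M det])
    show "subgroup (kernel ?GM (unitary_group V) \<pi>) G"
      using GM.normal_imp_sub[OF ker(1)] by (rule incl_subgroup[OF Msub])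
    fix A assume A: "A \<in> \<A>"
    have "\<exists>g\<in>A. p g \<noteq> 1"
      using GM.annih_not_one[OF p A] A \<A> finite_feet_normal GM.normal_one[OF An[OF A]] by auto
    then show "\<not> A \<subseteq> kernel ?GM (unitary_group V) \<pi>" using ker(2) by blast
  qed
  then show ?thesis unfolding has_conj_faithful_irrep_def using irr by blast
qed

text \<open>Over the commutative group \<open>M\<close> an extreme state is multiplicative by
  \<open>extreme_abelian_mult\<close>, hence a character, and \<open>annih_not_one\<close> keeps it
  from being trivial on a member of \<open>\<A>\<close>.\<close>

lemma character_of_annih:
  assumes cnt: "countable (carrier G)"
    and M: "M \<lhd> G" "\<And>x y. x \<in> M \<Longrightarrow> y \<in> M \<Longrightarrow> x \<otimes> y = y \<otimes> x"
    and \<A>: "\<And>A. A \<in> \<A> \<Longrightarrow> A \<lhd> G \<and> finite A \<and> A \<subseteq> M"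
    and ne: "annih G \<A> \<noteq> {}"
  shows "\<exists>\<xi>. unitary_character (G\<lparr>carrier := M\<rparr>) \<xi> \<and> (\<forall>A\<in>\<A>. \<exists>a\<in>A. \<xi> a \<noteq> 1)"
proof -
  let ?GM = "G\<lparr>carrier := M\<rparr>"
  note Msub = normal_imp_sub[OF M(1)]
  interpret GM: group ?GM by (rule subgroup_imp_group[OF Msub])
  have An: "A \<lhd> ?GM" if "A \<in> \<A>" for A
    using that \<A> by (intro normal_restrict_supergroup[OF Msub]) auto
  have AM: "A \<subseteq> M" if "A \<in> \<A>" for A using \<A>[OF that] by simp
  have K: "annih ?GM \<A> \<noteq> {}" "annih ?GM \<A> \<subseteq> pd ?GM"
    using annih_subgroup[OF Msub AM] ne by (blast, auto simp: annih_def)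
  have cM: "countable (carrier ?GM)" using cnt normal_subset[OF M(1)] countable_subset by auto
  obtain p where p: "extreme_in p (annih ?GM \<A>)"
    using GM.exists_extreme[OF cM K closed_annih mix_closed_annih] by blast
  then have pA: "p \<in> annih ?GM \<A>" and ppd: "p \<in> pd ?GM" using K(2) by (auto simp: extreme_in_def)
  have mult: "p (x \<otimes> y) = p x * p y" if "x \<in> M" "y \<in> M" for x y
    using GM.extreme_abelian_mult[OF _ GM.twist_closed_annih[OF An] K(2) p, of x y] M(2) that by auto
  have "cmod (p x) = 1" if x: "x \<in> M" for x
  proof -
    have "p x * p (inv x) = 1"
      using mult[OF x normal_minv[OF M(1) x]] normal_subset[OF M(1)] x pd_one[OF ppd] by auto
    moreover have "p (inv x) = cnj (p x)"
      using pd_inv[OF ppd, of x] x m_inv_consistent[OF Msub x] by simp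
    ultimately have "of_real ((cmod (p x))\<^sup>2) = (1 :: complex)" by (simp only: complex_norm_square)
    then have "(cmod (p x))\<^sup>2 = 1" by (simp only: of_real_eq_1_iff)
    then show ?thesis using norm_ge_zero[of "p x"] unfolding power2_eq_1_iff by linarith
  qed
  then have "unitary_character ?GM p"
    unfolding unitary_character_def by (intro homI) (auto simp: circle_group_def mult)
  moreover have "\<exists>a\<in>A. p a \<noteq> 1" if A: "A \<in> \<A>" for A
    using GM.annih_not_one[OF pA A] \<A>[OF A] GM.normal_one[OF An[OF A]] by auto
  ultimately show ?thesis by blast
qed

text \<open>The quadratic form of a character is the squared modulus of one sum. A character that is
  nontrivial on \<open>A\<close> has sum \<open>0\<close> over \<open>A\<close>, by translation with
  an element where it is not \<open>1\<close>.\<close>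

lemma annih_of_character:
  assumes M: "M \<lhd> G"
    and \<A>: "\<And>A. A \<in> \<A> \<Longrightarrow> A \<lhd> G \<and> finite A \<and> A \<subseteq> M"
    and \<xi>: "unitary_character (G\<lparr>carrier := M\<rparr>) \<xi>" "\<And>A. A \<in> \<A> \<Longrightarrow> \<exists>a\<in>A. \<xi> a \<noteq> 1"
  shows "annih G \<A> \<noteq> {}"
proof -
  let ?GM = "G\<lparr>carrier := M\<rparr>"
  note Msub = normal_imp_sub[OF M] and MG = normal_subset[OF M]
  have mult: "\<xi> (x \<otimes> y) = \<xi> x * \<xi> y" if "x \<in> M" "y \<in> M" for x y
    using \<xi>(1) that by (auto simp: unitary_character_def hom_def circle_group_def)
  have nm: "cmod (\<xi> x) = 1" if "x \<in> M" for x
    using \<xi>(1) that by (auto simp: unitary_character_def hom_def circle_group_def)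
  have one: "\<xi> \<one> = 1"
    using mult[OF normal_one[OF M] normal_one[OF M]] nm[OF normal_one[OF M]] by auto
  have unit: "\<xi> x * cnj (\<xi> x) = 1" if "x \<in> M" for x
    using complex_norm_square[of "\<xi> x"] nm[OF that] by simp
  have inv: "\<xi> (inv x) = cnj (\<xi> x)" if x: "x \<in> M" for x
  proof -
    have "\<xi> (inv x) * \<xi> x = 1"
      using mult[OF normal_minv[OF M x] x] one MG x by (simp add: subset_iff)
    then have "\<xi> (inv x) * (\<xi> x * cnj (\<xi> x)) = cnj (\<xi> x)" by (simp add: mult.assoc[symmetric])
    then show ?thesis using unit[OF x] by simp
  qed
  define f where "f x = (if x \<in> M then \<xi> x else 0)" for x
  have "f \<in> annih ?GM \<A>"
  proof (rule annihI)
    show "f \<in> pd ?GM"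
    proof (rule pdI)
      fix S and a :: "'a \<Rightarrow> complex" assume S: "finite S" "S \<subseteq> carrier ?GM"
      have "(\<Sum>x\<in>S. \<Sum>y\<in>S. a x * cnj (a y) * f (inv\<^bsub>?GM\<^esub> y \<otimes>\<^bsub>?GM\<^esub> x)) =
          (\<Sum>x\<in>S. \<Sum>y\<in>S. (a x * \<xi> x) * cnj (a y * \<xi> y))"
      proof (intro sum.cong refl)
        fix x y assume "x \<in> S" "y \<in> S"
        then have xy: "x \<in> M" "y \<in> M" using S by auto
        then have "f (inv\<^bsub>?GM\<^esub> y \<otimes>\<^bsub>?GM\<^esub> x) = cnj (\<xi> y) * \<xi> x"
          using m_inv_consistent[OF Msub] normal_mult[OF M normal_minv[OF M xy(2)] xy(1)]
            mult[OF normal_minv[OF M xy(2)] xy(1)] inv by (simp add: f_def)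
        then show "a x * cnj (a y) * f (inv\<^bsub>?GM\<^esub> y \<otimes>\<^bsub>?GM\<^esub> x) = (a x * \<xi> x) * cnj (a y * \<xi> y)" by simp
      qed
      also have "\<dots> = (\<Sum>x\<in>S. a x * \<xi> x) * cnj (\<Sum>x\<in>S. a x * \<xi> x)"
        by (simp only: cnj_sum sum_product)
      also have "\<dots> = of_real ((cmod (\<Sum>x\<in>S. a x * \<xi> x))\<^sup>2)" by (rule complex_norm_square[symmetric])
      finally have eq: "(\<Sum>x\<in>S. \<Sum>y\<in>S. a x * cnj (a y) * f (inv\<^bsub>?GM\<^esub> y \<otimes>\<^bsub>?GM\<^esub> x)) =
        of_real ((cmod (\<Sum>x\<in>S. a x * \<xi> x))\<^sup>2)" .
      show "0 \<le> Re (\<Sum>x\<in>S. \<Sum>y\<in>S. a x * cnj (a y) * f (inv\<^bsub>?GM\<^esub> y \<otimes>\<^bsub>?GM\<^esub> x))"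
        unfolding eq by (simp del: of_real_power)
    qed (use one inv normal_one[OF M] normal_minv[OF M] m_inv_consistent[OF Msub] in \<open>auto simp: f_def\<close>)
    fix A \<gamma> assume A: "A \<in> \<A>" and \<gamma>: "\<gamma> \<in> carrier ?GM"
    have An: "A \<lhd> G" "finite A" "A \<subseteq> M" using \<A>[OF A] by auto
    obtain b where b: "b \<in> A" "\<xi> b \<noteq> 1" using \<xi>(2)[OF A] by blast
    have "(\<Sum>x\<in>A. \<xi> x) = (\<Sum>x\<in>A. \<xi> (b \<otimes> x))"
    proof (rule sum.reindex_bij_witness[where i = "\<lambda>x. b \<otimes> x" and j = "\<lambda>x. inv b \<otimes> x"])
      fix x assume x: "x \<in> A"
      have c: "b \<in> carrier G" "x \<in> carrier G" using x b normal_subset[OF An(1)] by auto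
      then show e: "b \<otimes> (inv b \<otimes> x) = x" "inv b \<otimes> (b \<otimes> x) = x" by (simp_all add: m_assoc[symmetric])
      show "inv b \<otimes> x \<in> A" "b \<otimes> x \<in> A" using normal_mult[OF An(1)] normal_minv[OF An(1)] b x by auto
      show "\<xi> (b \<otimes> (inv b \<otimes> x)) = \<xi> x" using e by simp
    qed
    also have "\<dots> = \<xi> b * (\<Sum>x\<in>A. \<xi> x)"
      unfolding sum_distrib_left using An(3) b by (intro sum.cong refl mult) auto
    finally have s0: "(\<Sum>x\<in>A. \<xi> x) = 0" using b(2) by auto
    have "(\<Sum>x\<in>A. f (\<gamma> \<otimes>\<^bsub>?GM\<^esub> x)) = (\<Sum>x\<in>A. \<xi> \<gamma> * \<xi> x)"
      using \<gamma> An(3) mult normal_mult[OF M] by (intro sum.cong refl) (auto simp: f_def)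
    also have "\<dots> = 0" unfolding sum_distrib_left[symmetric] s0 by simp
    finally show "(\<Sum>x\<in>A. f (\<gamma> \<otimes>\<^bsub>?GM\<^esub> x)) = 0" .
  qed
  then have "f \<in> annih G \<A>" by (rule annih_zero_extension[OF Msub, rotated]) (use \<A> in auto)
  then show ?thesis by blast
qed

text \<open>By compactness only finitely many feet matter, and the nonabelian ones among them are
  added by \<open>annih_insert\<close>. The states are kept supported on the group generated by the
  feet treated so far; a new nonabelian foot meets this group trivially, which is the vanishing that
  \<open>annih_insert\<close> asks for.\<close>

lemma annih_nonabelian_feet:
  assumes ne: "annih G (abelian_feet G) \<noteq> {}"
  shows "annih G (finite_feet G) \<noteq> {}"
proof (rule annih_compactness)
  have ab: "abelian_feet G \<subseteq> finite_feet G" by (auto simp: abelian_feet_def)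
  have nor: "generate G (\<Union>\<A>) \<lhd> G" if "\<A> \<subseteq> finite_feet G" for \<A>
    using normal_generate_UN[of \<A> "\<lambda>x. x"] that finite_feet_normal by auto
  fix \<B> assume B: "finite \<B>" "\<B> \<subseteq> finite_feet G"
  have step: "\<exists>f\<in>annih G (abelian_feet G \<union> \<H>). \<forall>x. f x \<noteq> 0 \<longrightarrow> x \<in> generate G (\<Union>(abelian_feet G \<union> \<H>))"
    if "finite \<H>" "\<H> \<subseteq> nonabelian_feet G" for \<H>
    using that
  proof (induction \<H> rule: finite_induct)
    case empty
    let ?M = "generate G (\<Union>(abelian_feet G))"
    obtain f where f: "f \<in> annih G (abelian_feet G)" using ne by blast
    have "(\<lambda>x. if x \<in> ?M then f x else 0) \<in> annih G (abelian_feet G)"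
    proof -
      have M: "subgroup ?M G" by (rule normal_imp_sub[OF nor[OF ab]])
      have AM: "A \<subseteq> ?M" if "A \<in> abelian_feet G" for A using that by (auto intro: generate.incl)
      show ?thesis by (rule annih_zero_extension[OF M AM annih_subgroup[OF M AM f]])
    qed
    then show ?case by (intro bexI[of _ "\<lambda>x. if x \<in> ?M then f x else 0"]) auto
  next
    case (insert H \<H>)
    let ?M = "generate G (\<Union>(abelian_feet G \<union> \<H>))" and ?M' = "generate G (\<Union>(abelian_feet G \<union> insert H \<H>))"
    have Hn: "H \<in> nonabelian_feet G" using insert by simp
    then have Hf: "H \<in> finite_feet G" "H \<notin> abelian_feet G" by (auto simp: nonabelian_feet_def)
    have sub: "abelian_feet G \<union> \<H> \<subseteq> finite_feet G" using insert ab by (auto simp: nonabelian_feet_def)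
    have sub': "abelian_feet G \<union> insert H \<H> \<subseteq> finite_feet G" using sub Hf by auto
    obtain f where f: "f \<in> annih G (abelian_feet G \<union> \<H>)" "\<And>x. f x \<noteq> 0 \<Longrightarrow> x \<in> ?M"
      using insert by auto
    have disj: "H \<inter> ?M = {\<one>}"
      using insert Hf by (intro nonabelian_foot_disjoint[OF Hn sub]) auto
    have van: "f h = 0" if "h \<in> H" "h \<noteq> \<one>" for h using disj f(2)[of h] that by blast
    obtain f' where f': "f' \<in> annih G (insert H (abelian_feet G \<union> \<H>))"
      "\<And>g. g \<in> carrier G \<Longrightarrow> f' g \<noteq> 0 \<Longrightarrow> \<exists>x\<in>H. \<exists>y\<in>H. f (inv y \<otimes> g \<otimes> x) \<noteq> 0"
    proof (rule annih_insert[OF _ f(1) _ _ _ van])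
      fix f' assume "f' \<in> annih G (insert H (abelian_feet G \<union> \<H>))"
        "\<And>g. g \<in> carrier G \<Longrightarrow> f' g \<noteq> 0 \<Longrightarrow> \<exists>x\<in>H. \<exists>y\<in>H. f (inv y \<otimes> g \<otimes> x) \<noteq> 0"
      then show thesis by (rule that)
    next
      show "A \<lhd> G" if "A \<in> abelian_feet G \<union> \<H>" for A using that sub finite_feet_normal by blast
      show "H \<lhd> G" "finite H" "H \<noteq> {\<one>}" using finite_feet_normal[OF Hf(1)] by auto
    qed
    \<comment> \<open>The support grows only by factors from \<open>H\<close> on both sides, so the
      induction hypothesis on supports survives the insertion.\<close>
    have "g \<in> ?M'" if g: "f' g \<noteq> 0" for g
    proof -
      have gG: "g \<in> carrier G" using g pd_off[OF annih_pd[OF f'(1)], of g] by blast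
      obtain x y where xy: "x \<in> H" "y \<in> H" "f (inv y \<otimes> g \<otimes> x) \<noteq> 0" using f'(2)[OF gG g] by blast
      note n' = nor[OF sub']
      have "?M \<subseteq> ?M'" by (intro mono_generate) auto
      then have "inv y \<otimes> g \<otimes> x \<in> ?M'" using f(2)[OF xy(3)] by blast
      moreover have xM: "x \<in> ?M'" "y \<in> ?M'" using xy by (auto intro: generate.incl)
      moreover have yG: "y \<in> carrier G" using xM normal_subset[OF n'] by blast
      ultimately have "inv y \<otimes> g \<in> ?M'" using normal_mem_iff(2)[OF n' xM(1), of "inv y \<otimes> g"] gG by simp
      then show ?thesis using normal_mem_iff(1)[OF n' normal_minv[OF n' xM(2)] gG] by simp
    qed
    moreover have "f' \<in> annih G (abelian_feet G \<union> insert H \<H>)"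
      using f'(1) by (simp only: Un_insert_right)
    ultimately show ?case by (intro bexI[of _ f'] allI impI)
  qed
  have "finite (\<B> \<inter> nonabelian_feet G)" "\<B> \<inter> nonabelian_feet G \<subseteq> nonabelian_feet G" using B by auto
  from step[OF this] have "annih G (abelian_feet G \<union> (\<B> \<inter> nonabelian_feet G)) \<noteq> {}" by blast
  moreover have "\<B> \<subseteq> abelian_feet G \<union> (\<B> \<inter> nonabelian_feet G)" using B by (auto simp: nonabelian_feet_def)
  ultimately show "annih G \<B> \<noteq> {}" using annih_mono by blast
qed

end

section \<open>Equivariant homomorphisms and counting\<close>

text \<open>Extensional functions, so that between finite sets there are finitely many and
  \<open>card\<close> counts homomorphisms; likewise for \<open>characters\<close>.\<close>

definition eqhom :: "('g, 'b) monoid_scheme \<Rightarrow> 'g set \<Rightarrow> 'g set \<Rightarrow> ('g \<Rightarrow> 'g) set" where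
  "eqhom G X Y = {\<theta> \<in> X \<rightarrow>\<^sub>E Y. (\<forall>x\<in>X. \<forall>y\<in>X. \<theta> (x \<otimes>\<^bsub>G\<^esub> y) = \<theta> x \<otimes>\<^bsub>G\<^esub> \<theta> y) \<and>
     (\<forall>\<gamma>\<in>carrier G. \<forall>x\<in>X. \<theta> (\<gamma> \<otimes>\<^bsub>G\<^esub> x \<otimes>\<^bsub>G\<^esub> inv\<^bsub>G\<^esub> \<gamma>) = \<gamma> \<otimes>\<^bsub>G\<^esub> \<theta> x \<otimes>\<^bsub>G\<^esub> inv\<^bsub>G\<^esub> \<gamma>)}"

definition characters :: "('g, 'b) monoid_scheme \<Rightarrow> ('g \<Rightarrow> complex) set" where
  "characters G = {\<alpha> \<in> extensional (carrier G). unitary_character G \<alpha>}"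

lemma eqhomD:
  assumes "\<theta> \<in> eqhom G X Y"
  shows "x \<in> X \<Longrightarrow> \<theta> x \<in> Y" "x \<in> X \<Longrightarrow> y \<in> X \<Longrightarrow> \<theta> (x \<otimes>\<^bsub>G\<^esub> y) = \<theta> x \<otimes>\<^bsub>G\<^esub> \<theta> y"
    "\<gamma> \<in> carrier G \<Longrightarrow> x \<in> X \<Longrightarrow> \<theta> (\<gamma> \<otimes>\<^bsub>G\<^esub> x \<otimes>\<^bsub>G\<^esub> inv\<^bsub>G\<^esub> \<gamma>) = \<gamma> \<otimes>\<^bsub>G\<^esub> \<theta> x \<otimes>\<^bsub>G\<^esub> inv\<^bsub>G\<^esub> \<gamma>"
    "\<theta> \<in> extensional X"
  using assms by (auto simp: eqhom_def PiE_def)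

lemma eqhom_eqI:
  "\<theta> \<in> eqhom G X Y \<Longrightarrow> \<theta>' \<in> eqhom G X Z \<Longrightarrow> (\<And>x. x \<in> X \<Longrightarrow> \<theta> x = \<theta>' x) \<Longrightarrow> \<theta> = \<theta>'"
  by (rule extensionalityI[of _ X]) (auto dest: eqhomD(4))

lemma finite_eqhom: "finite X \<Longrightarrow> finite Y \<Longrightarrow> finite (eqhom G X Y)"
  by (rule finite_subset[of _ "X \<rightarrow>\<^sub>E Y"]) (auto simp: eqhom_def finite_PiE)

lemma eqhom_codomain: "\<theta> \<in> eqhom G X Y \<Longrightarrow> (\<And>x. x \<in> X \<Longrightarrow> \<theta> x \<in> Z) \<Longrightarrow> \<theta> \<in> eqhom G X Z"
  by (auto simp: eqhom_def PiE_iff)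

context group
begin

lemma unitary_characterD:
  assumes "unitary_character G \<xi>"
  shows "x \<in> carrier G \<Longrightarrow> y \<in> carrier G \<Longrightarrow> \<xi> (x \<otimes> y) = \<xi> x * \<xi> y" "x \<in> carrier G \<Longrightarrow> cmod (\<xi> x) = 1"
    "\<xi> \<one> = 1"
proof -
  show m: "x \<in> carrier G \<Longrightarrow> y \<in> carrier G \<Longrightarrow> \<xi> (x \<otimes> y) = \<xi> x * \<xi> y"
    and n: "x \<in> carrier G \<Longrightarrow> cmod (\<xi> x) = 1" for x y
    using assms by (auto simp: unitary_character_def hom_def circle_group_def)
  show "\<xi> \<one> = 1" using m[of \<one> \<one>] n[of \<one>] by auto
qed

lemma unitary_character_restrict:
  "unitary_character G \<xi> \<Longrightarrow> (\<lambda>x\<in>carrier G. \<xi> x) \<in> characters G"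
  by (auto simp: characters_def unitary_character_def hom_def circle_group_def)

lemma annih_empty: "annih G {} \<noteq> {}"
proof -
  have "{\<one>} \<lhd> G" by (simp add: normal_inv_iff triv_subgroup)
  then show ?thesis
    by (rule annih_of_character[where \<xi> = "\<lambda>_. 1"]) (auto simp: unitary_character_def hom_def circle_group_def)
qed

text \<open>The indicator of \<open>\<one>\<close> is a state that vanishes on the subgroup
  generated by \<open>a\<close> off \<open>\<one>\<close>. Inserting this subgroup with
  \<open>annih_insert\<close> yields a character that is nontrivial on it, hence at its generator
  \<open>a\<close>.\<close>

lemma separating_character:
  assumes cnt: "countable (carrier G)" and comm: "\<And>x y. x \<in> carrier G \<Longrightarrow> y \<in> carrier G \<Longrightarrow> x \<otimes> y = y \<otimes> x"
    and fin: "finite (carrier G)" and a: "a \<in> carrier G" "a \<noteq> \<one>"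
  shows "\<exists>\<xi>\<in>characters G. \<xi> a \<noteq> 1"
proof -
  let ?H = "generate G {a}"
  have sub: "{a} \<subseteq> carrier G" using a by simp
  have conj: "g \<otimes> x \<otimes> inv g = x" if "g \<in> carrier G" "x \<in> carrier G" for g x
    using comm[of g x] that by (simp add: m_assoc)
  have H: "?H \<lhd> G" by (rule normal_generateI[OF sub]) (use a conj in auto)
  have aH: "a \<in> ?H" by (auto intro: generate.incl)
  have finH: "finite ?H" using normal_subset[OF H] fin finite_subset by blast
  obtain f0 where f0: "f0 \<in> annih G {}" using annih_empty by blast
  define f where "f = (\<lambda>x. if x \<in> {\<one>} then f0 x else 0)"
  have f: "f \<in> annih G {}"
    unfolding f_def using triv_subgroup f0
    by (intro annihI pd_zero_extension[OF triv_subgroup] pd_subgroup annih_pd[OF f0]) auto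
  have "annih G {?H} \<noteq> {}"
  proof (rule annih_insert[OF _ f H finH])
    show "?H \<noteq> {\<one>}" using aH a by auto
  qed (auto simp: f_def)
  then have "\<exists>\<xi>. unitary_character (G\<lparr>carrier := carrier G\<rparr>) \<xi> \<and> (\<forall>A\<in>{?H}. \<exists>a\<in>A. \<xi> a \<noteq> 1)"
    using normal_subset[OF H] H finH by (intro character_of_annih[OF cnt normal_self comm]) auto
  then obtain \<xi> h where \<xi>: "unitary_character G \<xi>" "h \<in> ?H" "\<xi> h \<noteq> 1" by auto
  note D = unitary_characterD[OF \<xi>(1)]
  have "\<xi> a \<noteq> 1"
  proof
    assume 1: "\<xi> a = 1"
    have "\<xi> x = 1" if "x \<in> ?H" for x
      using that
    proof (induction rule: generate.induct)
      case (inv h)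
      then have "\<xi> (inv h) * \<xi> h = 1" using D(1)[of "inv h" h] D(3) a by auto
      then show ?case using inv 1 by simp
    next
      case (eng x y)
      then show ?case using D(1) generate_in_carrier[OF sub] by simp
    qed (use 1 D in auto)
    then show False using \<xi> by simp
  qed
  then show ?thesis using unitary_character_restrict[OF \<xi>(1)] a by (intro bexI[of _ "\<lambda>x\<in>carrier G. \<xi> x"]) auto
qed

text \<open>By Lagrange's theorem all values are roots of unity whose order divides
  \<open>order G\<close>.\<close>

lemma finite_characters:
  assumes fin: "finite (carrier G)"
  shows "finite (characters G)"
proof -
  have o: "order G \<noteq> 0" using fin one_closed by (auto simp: order_def card_gt_0_iff)
  have "characters G \<subseteq> carrier G \<rightarrow>\<^sub>E {z. z ^ order G = 1}"
  proof
    fix \<alpha> assume \<alpha>: "\<alpha> \<in> characters G"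
    then have u: "unitary_character G \<alpha>" by (simp add: characters_def)
    note D = unitary_characterD[OF u]
    have "\<alpha> (x [^] n) = \<alpha> x ^ n" if "x \<in> carrier G" for x and n :: nat
      by (induction n) (use that D in \<open>auto simp: mult.commute\<close>)
    then have "\<alpha> x ^ order G = 1" if "x \<in> carrier G" for x
      using that D(3) pow_order_eq_1 by metis
    then show "\<alpha> \<in> carrier G \<rightarrow>\<^sub>E {z. z ^ order G = 1}" using \<alpha> by (auto simp: characters_def PiE_iff)
  qed
  moreover have "finite {z :: complex. z ^ order G = 1}"
    using o finite_roots_unity[of "order G"] by auto
  ultimately show ?thesis using fin finite_PiE finite_subset by (metis (no_types, lifting))
qed

text \<open>Both orders of summation of \<open>\<xi> a\<close> over all characters \<open>\<xi>\<close> and all \<open>a\<close> leave only the trivial term.\<close>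

lemma card_characters:
  assumes comm: "\<And>x y. x \<in> carrier G \<Longrightarrow> y \<in> carrier G \<Longrightarrow> x \<otimes> y = y \<otimes> x"
    and fin: "finite (carrier G)"
  shows "card (characters G) = card (carrier G)"
proof -
  let ?X = "characters G" and ?A = "carrier G"
  have finX: "finite ?X" by (rule finite_characters[OF fin])
  have Du: "unitary_character G \<xi>" if "\<xi> \<in> ?X" for \<xi> using that by (simp add: characters_def)
  note D = unitary_characterD[OF Du]
  define e where "e = (\<lambda>x\<in>?A. 1 :: complex)"
  have eX: "e \<in> ?X" unfolding e_def
    by (rule unitary_character_restrict) (auto simp: unitary_character_def hom_def circle_group_def)
  have col: "(\<Sum>\<xi>\<in>?X. \<xi> a) = (if a = \<one> then of_nat (card ?X) else 0)" if a: "a \<in> ?A" for a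
  proof (cases "a = \<one>")
    case True
    have "(\<Sum>\<xi>\<in>?X. \<xi> a) = (\<Sum>\<xi>\<in>?X. 1)"
      unfolding True by (rule sum.cong[OF refl]) (rule D(3))
    then show ?thesis using True by simp
  next
    case False
    obtain \<eta> where \<eta>: "\<eta> \<in> ?X" "\<eta> a \<noteq> 1"
      using separating_character[OF countable_finite[OF fin] comm fin a False] by blast
    define m where "m c \<xi> = (\<lambda>x\<in>?A. c x * \<xi> x)" for c \<xi> :: "'a \<Rightarrow> complex"
    have m: "m c \<xi> \<in> ?X" if "c \<in> ?X" "\<xi> \<in> ?X" for c \<xi>
      unfolding m_def
      by (rule unitary_character_restrict)
        (use D(1)[OF that(1)] D(2)[OF that(1)] D(1)[OF that(2)] D(2)[OF that(2)] in
          \<open>auto simp: unitary_character_def hom_def circle_group_def norm_mult mult_ac\<close>)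
    define \<eta>' where "\<eta>' = (\<lambda>x\<in>?A. cnj (\<eta> x))"
    have \<eta>': "\<eta>' \<in> ?X"
      unfolding \<eta>'_def
      by (rule unitary_character_restrict)
        (use D(1)[OF \<eta>(1)] D(2)[OF \<eta>(1)] in \<open>auto simp: unitary_character_def hom_def circle_group_def\<close>)
    have cc: "\<eta> x * cnj (\<eta> x) = 1" if "x \<in> ?A" for x
      using D(2)[OF \<eta>(1) that] complex_norm_square[of "\<eta> x"] by simp
    have inv: "m \<eta>' (m \<eta> \<xi>) = \<xi>" "m \<eta> (m \<eta>' \<xi>) = \<xi>" if "\<xi> \<in> ?X" for \<xi>
    proof -
      have "m \<eta>' (m \<eta> \<xi>) x = \<xi> x \<and> m \<eta> (m \<eta>' \<xi>) x = \<xi> x" for x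
      proof (cases "x \<in> ?A")
        case True
        have "cnj (\<eta> x) * (\<eta> x * \<xi> x) = (\<eta> x * cnj (\<eta> x)) * \<xi> x" "\<eta> x * (cnj (\<eta> x) * \<xi> x) = (\<eta> x * cnj (\<eta> x)) * \<xi> x"
          by (simp_all add: mult_ac)
        then show ?thesis using True cc[OF True] by (simp add: m_def \<eta>'_def)
      next
        case False
        then show ?thesis using that by (simp add: m_def characters_def extensional_def)
      qed
      then show "m \<eta>' (m \<eta> \<xi>) = \<xi>" "m \<eta> (m \<eta>' \<xi>) = \<xi>" by auto
    qed
    have "(\<Sum>\<xi>\<in>?X. \<xi> a) = (\<Sum>\<xi>\<in>?X. m \<eta> \<xi> a)"
      by (rule sum.reindex_bij_witness[where i = "m \<eta>" and j = "m \<eta>'"])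
        (use inv m \<eta>(1) \<eta>' in auto)
    also have "\<dots> = \<eta> a * (\<Sum>\<xi>\<in>?X. \<xi> a)" using a by (simp add: m_def sum_distrib_left)
    finally show ?thesis using \<eta>(2) False by auto
  qed
  have row: "(\<Sum>a\<in>?A. \<xi> a) = (if \<xi> = e then of_nat (card ?A) else 0)" if \<xi>: "\<xi> \<in> ?X" for \<xi>
  proof (cases "\<xi> = e")
    case True
    then show ?thesis by (simp add: e_def)
  next
    case False
    have "\<exists>b\<in>?A. \<xi> b \<noteq> 1"
    proof (rule ccontr)
      assume c: "\<not> ?thesis"
      have "\<xi> = e" by (rule extensionalityI[of _ ?A]) (use c \<xi> in \<open>auto simp: e_def characters_def\<close>)
      then show False using False by simp
    qed
    then obtain b where b: "b \<in> ?A" "\<xi> b \<noteq> 1" by blast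
    have "(\<Sum>a\<in>?A. \<xi> a) = (\<Sum>a\<in>?A. \<xi> (b \<otimes> a))"
      by (rule sum.reindex_bij_witness[where i = "\<lambda>x. b \<otimes> x" and j = "\<lambda>x. inv b \<otimes> x"])
        (use b in \<open>auto simp: m_assoc[symmetric]\<close>)
    also have "\<dots> = \<xi> b * (\<Sum>a\<in>?A. \<xi> a)" using D(1)[OF \<xi> b(1)] by (simp add: sum_distrib_left)
    finally show ?thesis using b(2) False by auto
  qed
  have "(\<Sum>a\<in>?A. \<Sum>\<xi>\<in>?X. \<xi> a) = of_nat (card ?X)" using fin by (simp add: col)
  moreover have "(\<Sum>\<xi>\<in>?X. \<Sum>a\<in>?A. \<xi> a) = of_nat (card ?A)" using finX eX by (simp add: row)
  moreover have "(\<Sum>a\<in>?A. \<Sum>\<xi>\<in>?X. \<xi> a) = (\<Sum>\<xi>\<in>?X. \<Sum>a\<in>?A. \<xi> a)" by (rule sum.swap)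
  ultimately have "(of_nat (card ?X) :: complex) = of_nat (card ?A)" by (simp only:)
  then show ?thesis by simp
qed

end

section \<open>Sums of abelian feet: generating conjugacy classes against characters\<close>

context group
begin

text \<open>Nontriviality on the feet stands for \<open>conj_faithful\<close>: the intersection of
  the conjugate kernels is normal, so in a finite \<open>L\<close> it is trivial exactly if the
  kernel contains no foot.\<close>

definition faithful_character :: "'a set \<Rightarrow> ('a \<Rightarrow> complex) \<Rightarrow> bool" where
  "faithful_character L \<xi> \<longleftrightarrow> unitary_character (G\<lparr>carrier := L\<rparr>) \<xi> \<and>
     (\<forall>B\<in>finite_feet G. B \<subseteq> L \<longrightarrow> (\<exists>b\<in>B. \<xi> b \<noteq> 1))"

context
  fixes P assumes P: "P \<lhd> G" and P_comm: "\<And>x y. x \<in> P \<Longrightarrow> y \<in> P \<Longrightarrow> x \<otimes> y = y \<otimes> x"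
begin

lemma P_carrier: "x \<in> P \<Longrightarrow> x \<in> carrier G" using normal_subset[OF P] by auto

lemma P_lcomm: "x \<in> P \<Longrightarrow> y \<in> P \<Longrightarrow> z \<in> P \<Longrightarrow> x \<otimes> (y \<otimes> z) = y \<otimes> (x \<otimes> z)"
  using P_comm[of x y] P_carrier by (simp add: m_assoc[symmetric])

lemma P_mult: "x \<in> P \<Longrightarrow> y \<in> P \<Longrightarrow> x \<otimes> y \<in> P" and P_inv: "x \<in> P \<Longrightarrow> inv x \<in> P"
  using normal_mult[OF P] normal_minv[OF P] by auto

lemmas P_ac = P_comm P_lcomm P_carrier P_mult P_inv m_assoc

lemma conj_mult: "g \<in> carrier G \<Longrightarrow> x \<in> carrier G \<Longrightarrow> y \<in> carrier G \<Longrightarrow>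
    g \<otimes> (x \<otimes> y) \<otimes> inv g = (g \<otimes> x \<otimes> inv g) \<otimes> (g \<otimes> y \<otimes> inv g)"
  by (simp add: m_assoc) (simp add: m_assoc[symmetric])

lemma conj_inv: "g \<in> carrier G \<Longrightarrow> x \<in> carrier G \<Longrightarrow> g \<otimes> inv x \<otimes> inv g = inv (g \<otimes> x \<otimes> inv g)"
  by (simp add: inv_mult_group m_assoc)

lemma eqhomI:
  assumes X: "X \<lhd> G" and "\<And>x. x \<in> X \<Longrightarrow> \<theta> x \<in> Y" "\<And>x y. x \<in> X \<Longrightarrow> y \<in> X \<Longrightarrow> \<theta> (x \<otimes> y) = \<theta> x \<otimes> \<theta> y"
    "\<And>g x. g \<in> carrier G \<Longrightarrow> x \<in> X \<Longrightarrow> \<theta> (g \<otimes> x \<otimes> inv g) = g \<otimes> \<theta> x \<otimes> inv g"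
  shows "(\<lambda>x\<in>X. \<theta> x) \<in> eqhom G X Y"
  using assms normal_mult[OF X] normal_conj[OF X] by (auto simp: eqhom_def)

lemma eqhom_one:
  assumes X: "X \<lhd> G" and Y: "Y \<lhd> G" and \<theta>: "\<theta> \<in> eqhom G X Y"
  shows "\<theta> \<one> = \<one>"
proof -
  have o: "\<one> \<in> X" by (rule normal_one[OF X])
  have "\<theta> \<one> \<in> carrier G" using eqhomD(1)[OF \<theta> o] normal_subset[OF Y] by auto
  moreover have "\<theta> \<one> \<otimes> \<theta> \<one> = \<theta> \<one>" using eqhomD(2)[OF \<theta> o o] by simp
  ultimately show ?thesis by simp
qed

lemma eqhom_minv:
  assumes X: "X \<lhd> G" and Y: "Y \<lhd> G" and \<theta>: "\<theta> \<in> eqhom G X Y" and x: "x \<in> X"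
  shows "\<theta> (inv x) = inv (\<theta> x)"
proof -
  have c: "x \<in> carrier G" "\<theta> x \<in> carrier G" "\<theta> (inv x) \<in> carrier G"
    using x normal_subset[OF X] normal_subset[OF Y] eqhomD(1)[OF \<theta>] normal_minv[OF X x] by auto
  have "\<theta> (inv x) \<otimes> \<theta> x = \<one>"
    using eqhomD(2)[OF \<theta> normal_minv[OF X x] x] eqhom_one[OF X Y \<theta>] c by simp
  then show ?thesis using c by (metis inv_equality)
qed

lemma eqhom_comp:
  assumes X: "X \<lhd> G" and "\<theta> \<in> eqhom G X Y" "\<phi> \<in> eqhom G Y Z"
  shows "(\<lambda>x\<in>X. \<phi> (\<theta> x)) \<in> eqhom G X Z"
  by (intro eqhomI[OF X]) (simp_all add: eqhomD(1-3)[OF assms(2)] eqhomD(1-3)[OF assms(3)])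

lemma eqhom_mult:
  assumes X: "X \<lhd> G" and Y: "Y \<lhd> G" "Y \<subseteq> P" and \<theta>: "\<theta> \<in> eqhom G X Y" and \<phi>: "\<phi> \<in> eqhom G X Y"
  shows "(\<lambda>x\<in>X. \<theta> x \<otimes> \<phi> x) \<in> eqhom G X Y"
proof (rule eqhomI[OF X])
  have p: "\<theta> x \<in> P" "\<phi> x \<in> P" if "x \<in> X" for x using eqhomD(1)[OF \<theta> that] eqhomD(1)[OF \<phi> that] Y by auto
  show "\<theta> x \<otimes> \<phi> x \<in> Y" if "x \<in> X" for x
    using normal_mult[OF Y(1)] eqhomD(1)[OF \<theta> that] eqhomD(1)[OF \<phi> that] by simp
  show "\<theta> (x \<otimes> y) \<otimes> \<phi> (x \<otimes> y) = \<theta> x \<otimes> \<phi> x \<otimes> (\<theta> y \<otimes> \<phi> y)" if "x \<in> X" "y \<in> X" for x y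
    using eqhomD(2)[OF \<theta> that] eqhomD(2)[OF \<phi> that] p[OF that(1)] p[OF that(2)] by (simp add: P_ac)
  show "\<theta> (g \<otimes> x \<otimes> inv g) \<otimes> \<phi> (g \<otimes> x \<otimes> inv g) = g \<otimes> (\<theta> x \<otimes> \<phi> x) \<otimes> inv g"
    if "g \<in> carrier G" "x \<in> X" for g x
    using eqhomD(3)[OF \<theta> that] eqhomD(3)[OF \<phi> that] p[OF that(2)] that P_carrier by (simp add: conj_mult)
qed

lemma eqhom_pointwise_inv:
  assumes X: "X \<lhd> G" and Y: "Y \<lhd> G" "Y \<subseteq> P" and \<theta>: "\<theta> \<in> eqhom G X Y"
  shows "(\<lambda>x\<in>X. inv (\<theta> x)) \<in> eqhom G X Y"
proof (rule eqhomI[OF X])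
  have p: "\<theta> x \<in> P" if "x \<in> X" for x using eqhomD(1)[OF \<theta> that] Y by auto
  show "inv (\<theta> x) \<in> Y" if "x \<in> X" for x
    using normal_minv[OF Y(1)] eqhomD(1)[OF \<theta> that] by simp
  show "inv (\<theta> (x \<otimes> y)) = inv (\<theta> x) \<otimes> inv (\<theta> y)" if "x \<in> X" "y \<in> X" for x y
    using eqhomD(2)[OF \<theta> that] p[OF that(1)] p[OF that(2)] by (simp add: P_ac inv_mult_group)
  show "inv (\<theta> (g \<otimes> x \<otimes> inv g)) = g \<otimes> inv (\<theta> x) \<otimes> inv g" if "g \<in> carrier G" "x \<in> X" for g x
    using eqhomD(3)[OF \<theta> that] p[OF that(2)] that P_carrier by (simp add: conj_inv)
qed

lemma eqhom_id: "X \<lhd> G \<Longrightarrow> (\<lambda>x\<in>X. x) \<in> eqhom G X X"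
  by (rule eqhomI) auto

lemma eqhom_trivial: "X \<lhd> G \<Longrightarrow> Y \<lhd> G \<Longrightarrow> (\<lambda>x\<in>X. \<one>) \<in> eqhom G X Y"
  by (rule eqhomI) (auto dest: normal_one)

lemma eqhom_restrict:
  assumes "X \<lhd> G" "X \<subseteq> X'" "\<theta> \<in> eqhom G X' Y"
  shows "(\<lambda>x\<in>X. \<theta> x) \<in> eqhom G X Y"
  using assms(2) by (intro eqhomI[OF assms(1)]) (auto simp: eqhomD(1-3)[OF assms(3)] subset_iff)

lemma normalI_closed:
  assumes X: "X \<lhd> G" and "N \<subseteq> X" "\<one> \<in> N" "\<And>x y. x \<in> N \<Longrightarrow> y \<in> N \<Longrightarrow> x \<otimes> y \<in> N" "\<And>x. x \<in> N \<Longrightarrow> inv x \<in> N"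
    "\<And>g x. g \<in> carrier G \<Longrightarrow> x \<in> N \<Longrightarrow> g \<otimes> x \<otimes> inv g \<in> N"
  shows "N \<lhd> G"
  unfolding normal_inv_iff
proof (intro conjI ballI assms(6) subgroupI assms(4,5))
  show "N \<subseteq> carrier G" using assms(2) normal_subset[OF X] by auto
  show "N \<noteq> {}" using assms(3) by auto
qed

lemma eqhom_equalizer:
  assumes X: "X \<lhd> G" and Y: "Y \<lhd> G" and \<theta>: "\<theta> \<in> eqhom G X Y" and \<phi>: "\<phi> \<in> eqhom G X Y"
  shows "{x\<in>X. \<theta> x = \<phi> x} \<lhd> G"
proof (rule normalI_closed[OF X])
  show "\<one> \<in> {x\<in>X. \<theta> x = \<phi> x}"
    using normal_one[OF X] eqhom_one[OF X Y \<theta>] eqhom_one[OF X Y \<phi>] by simp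
  show "x \<otimes> y \<in> {x\<in>X. \<theta> x = \<phi> x}" if "x \<in> {x\<in>X. \<theta> x = \<phi> x}" "y \<in> {x\<in>X. \<theta> x = \<phi> x}" for x y
    using that normal_mult[OF X] eqhomD(2)[OF \<theta>] eqhomD(2)[OF \<phi>] by auto
  show "inv x \<in> {x\<in>X. \<theta> x = \<phi> x}" if "x \<in> {x\<in>X. \<theta> x = \<phi> x}" for x
    using that normal_minv[OF X] eqhom_minv[OF X Y \<theta>] eqhom_minv[OF X Y \<phi>] by auto
  show "g \<otimes> x \<otimes> inv g \<in> {x\<in>X. \<theta> x = \<phi> x}" if "g \<in> carrier G" "x \<in> {x\<in>X. \<theta> x = \<phi> x}" for g x
    using that normal_conj[OF X] eqhomD(3)[OF \<theta>] eqhomD(3)[OF \<phi>] by auto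
qed auto

lemma eqhom_image:
  assumes X: "X \<lhd> G" and Y: "Y \<lhd> G" and \<theta>: "\<theta> \<in> eqhom G X Y"
  shows "\<theta> ` X \<lhd> G"
proof (rule normalI_closed[OF Y])
  show "\<theta> ` X \<subseteq> Y" using eqhomD(1)[OF \<theta>] by auto
  show "\<one> \<in> \<theta> ` X" using eqhom_one[OF X Y \<theta>] normal_one[OF X] by force
  show "x \<otimes> y \<in> \<theta> ` X" if "x \<in> \<theta> ` X" "y \<in> \<theta> ` X" for x y
    using that normal_mult[OF X] by (auto simp: eqhomD(2)[OF \<theta>, symmetric])
  show "inv x \<in> \<theta> ` X" if "x \<in> \<theta> ` X" for x
    using that normal_minv[OF X] by (auto simp: eqhom_minv[OF X Y \<theta>, symmetric])
  show "g \<otimes> x \<otimes> inv g \<in> \<theta> ` X" if "g \<in> carrier G" "x \<in> \<theta> ` X" for g x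
    using that normal_conj[OF X] by (auto simp: eqhomD(3)[OF \<theta>, symmetric])
qed

text \<open>In the commutative group \<open>P\<close> the pointwise product of the identity and
  \<open>\<theta>\<close> is again an equivariant homomorphism, and the graph is its image.\<close>

lemma eqhom_graph:
  assumes X: "X \<lhd> G" "X \<subseteq> P" and Y: "Y \<lhd> G" "Y \<subseteq> P" and \<theta>: "\<theta> \<in> eqhom G X Y"
  shows "(\<lambda>x. x \<otimes> \<theta> x) ` X \<lhd> G"
proof -
  have \<theta>P: "\<theta> \<in> eqhom G X P" using eqhomD(1)[OF \<theta>] Y by (intro eqhom_codomain[OF \<theta>]) auto
  have idP: "(\<lambda>x\<in>X. x) \<in> eqhom G X P" using X by (intro eqhom_codomain[OF eqhom_id]) auto
  have "(\<lambda>x\<in>X. (\<lambda>x\<in>X. x) x \<otimes> \<theta> x) ` X \<lhd> G"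
    by (rule eqhom_image[OF X(1) P eqhom_mult[OF X(1) P order_refl idP \<theta>P]])
  moreover have "(\<lambda>x\<in>X. (\<lambda>x\<in>X. x) x \<otimes> \<theta> x) ` X = (\<lambda>x. x \<otimes> \<theta> x) ` X" by (auto simp: image_def)
  ultimately show ?thesis by simp
qed

text \<open>Converse of \<open>eqhom_graph\<close>. As \<open>N\<close> meets \<open>Y\<close>
  trivially, each \<open>x\<close> has exactly one \<open>y\<close> in \<open>Y\<close> with
  \<open>x \<otimes> y\<close> in \<open>N\<close>, and uniqueness makes this \<open>y\<close>
  depend on \<open>x\<close> multiplicatively and equivariantly.\<close>

lemma eqhom_of_graph:
  assumes X: "X \<lhd> G" "X \<subseteq> P" and Y: "Y \<lhd> G" "Y \<subseteq> P" and N: "N \<lhd> G" "N \<subseteq> P" "N \<inter> Y \<subseteq> {\<one>}" and XN: "X \<subseteq> N <#> Y"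
  shows "\<exists>\<theta>\<in>eqhom G X Y. \<forall>x\<in>X. x \<otimes> \<theta> x \<in> N"
proof -
  have ex: "\<exists>y\<in>Y. x \<otimes> y \<in> N" if x: "x \<in> X" for x
  proof -
    obtain n y where ny: "n \<in> N" "y \<in> Y" "x = n \<otimes> y" using XN x unfolding set_mult_def by blast
    then have "n \<in> carrier G" "y \<in> carrier G" using N(2) Y(2) P_carrier by blast+
    then have "x \<otimes> inv y = n" using ny(3) by (simp add: m_assoc)
    then show ?thesis using ny normal_minv[OF Y(1) ny(2)] by blast
  qed
  then obtain t where t: "\<And>x. x \<in> X \<Longrightarrow> t x \<in> Y" "\<And>x. x \<in> X \<Longrightarrow> x \<otimes> t x \<in> N" by metis
  have uniq: "y = t x" if x: "x \<in> X" and y: "y \<in> Y" "x \<otimes> y \<in> N" for x y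
  proof -
    have c: "x \<in> carrier G" "y \<in> carrier G" "t x \<in> carrier G"
      using x y t X Y P_carrier by blast+
    have "inv (x \<otimes> t x) \<otimes> (x \<otimes> y) = inv (t x) \<otimes> (inv x \<otimes> x) \<otimes> y"
      using c by (simp only: inv_mult_group m_assoc inv_closed m_closed)
    then have "inv (t x) \<otimes> y \<in> N"
      using normal_mult[OF N(1) normal_minv[OF N(1) t(2)[OF x]] y(2)] c by simp
    moreover have "inv (t x) \<otimes> y \<in> Y" using normal_mult[OF Y(1) normal_minv[OF Y(1) t(1)[OF x]] y(1)] .
    ultimately have "inv (t x) \<otimes> y = \<one>" using N(3) by blast
    then show ?thesis using c by (metis inv_closed inv_equality inv_inv)
  qed
  have "(\<lambda>x\<in>X. t x) \<in> eqhom G X Y"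
  proof (rule eqhomI[OF X(1) t(1)])
    fix x y assume xy: "x \<in> X" "y \<in> X"
    have p: "x \<in> P" "y \<in> P" "t x \<in> P" "t y \<in> P" using xy t X Y by blast+
    have "(x \<otimes> y) \<otimes> (t x \<otimes> t y) = (x \<otimes> t x) \<otimes> (y \<otimes> t y)" using p by (simp add: P_ac)
    then have "(x \<otimes> y) \<otimes> (t x \<otimes> t y) \<in> N" using normal_mult[OF N(1) t(2) t(2)] xy by simp
    then show "t (x \<otimes> y) = t x \<otimes> t y"
      using uniq[of "x \<otimes> y" "t x \<otimes> t y"] normal_mult[OF X(1) xy] normal_mult[OF Y(1) t(1) t(1), OF xy] by simp
  next
    fix g x assume g: "g \<in> carrier G" and x: "x \<in> X"
    have c: "x \<in> carrier G" "t x \<in> carrier G" using x t X Y P_carrier by blast+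
    have "(g \<otimes> x \<otimes> inv g) \<otimes> (g \<otimes> t x \<otimes> inv g) \<in> N"
      using normal_conj[OF N(1) g t(2)[OF x]] g c by (simp add: conj_mult)
    then show "t (g \<otimes> x \<otimes> inv g) = g \<otimes> t x \<otimes> inv g"
      using uniq[of "g \<otimes> x \<otimes> inv g"] normal_conj[OF X(1) g x] normal_conj[OF Y(1) g t(1)[OF x]] by simp
  qed
  then show ?thesis using t(2) by (intro bexI[of _ "\<lambda>x\<in>X. t x"]) auto
qed

lemma decompose_unique:
  assumes L: "L \<lhd> G" and B: "B \<lhd> G" and d: "L \<inter> B \<subseteq> {\<one>}"
    and m: "l \<in> L" "l' \<in> L" "b \<in> B" "b' \<in> B" and eq: "l \<otimes> b = l' \<otimes> b'"
  shows "l = l' \<and> b = b'"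
proof -
  have c: "l \<in> carrier G" "l' \<in> carrier G" "b \<in> carrier G" "b' \<in> carrier G"
    using m normal_subset[OF L] normal_subset[OF B] by auto
  have "inv l' \<otimes> l = b' \<otimes> inv b"
  proof -
    have "inv l' \<otimes> l = inv l' \<otimes> (l \<otimes> b) \<otimes> inv b" using c by (simp add: m_assoc)
    also have "\<dots> = b' \<otimes> inv b" unfolding eq using c by (simp add: m_assoc[symmetric])
    finally show ?thesis .
  qed
  moreover have "inv l' \<otimes> l \<in> L" "b' \<otimes> inv b \<in> B"
    using m normal_mult[OF L] normal_minv[OF L] normal_mult[OF B] normal_minv[OF B] by auto
  ultimately have "inv l' \<otimes> l = \<one>" "b' \<otimes> inv b = \<one>" using d by auto
  then have "l = l'" using c by (metis inv_closed inv_equality inv_inv)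
  then show ?thesis using eq c by simp
qed

text \<open>\<open>eqhom_of_graph\<close> with \<open>B\<close> as \<open>N\<close> and
  \<open>L\<close> as \<open>Y\<close> gives \<open>\<theta>\<close> with
  \<open>z \<otimes> \<theta> z\<close> in \<open>B\<close>. This product is the projection to
  \<open>B\<close>, and the inverse of \<open>\<theta> z\<close> is the projection to
  \<open>L\<close>.\<close>

lemma projections:
  assumes L: "L \<lhd> G" "L \<subseteq> P" and B: "B \<lhd> G" "B \<subseteq> P" and d: "L \<inter> B \<subseteq> {\<one>}"
  obtains pL pB where "pL \<in> eqhom G (L <#> B) L" "pB \<in> eqhom G (L <#> B) B"
    "\<And>z. z \<in> L <#> B \<Longrightarrow> z = pL z \<otimes> pB z"
    "\<And>l b. l \<in> L \<Longrightarrow> b \<in> B \<Longrightarrow> pL (l \<otimes> b) = l \<and> pB (l \<otimes> b) = b"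
proof -
  let ?Z = "L <#> B"
  have Z: "?Z \<lhd> G" by (rule normal_set_mult[OF L(1) B(1)])
  have ZP: "?Z \<subseteq> P" using L B P_mult by (auto simp: set_mult_def)
  have ZB: "?Z \<subseteq> B <#> L"
  proof
    fix z assume "z \<in> ?Z"
    then obtain l b where "l \<in> L" "b \<in> B" "z = l \<otimes> b" by (auto simp: set_mult_def)
    then have "z = b \<otimes> l" "b \<in> B" "l \<in> L" using P_comm L B by auto
    then show "z \<in> B <#> L" by (auto simp: set_mult_def)
  qed
  obtain \<theta> where \<theta>: "\<theta> \<in> eqhom G ?Z L" "\<forall>z\<in>?Z. z \<otimes> \<theta> z \<in> B"
    using eqhom_of_graph[OF Z ZP L B _ ZB] d by blast
  define pL where "pL = (\<lambda>z\<in>?Z. inv (\<theta> z))"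
  have pL: "pL \<in> eqhom G ?Z L" unfolding pL_def by (rule eqhom_pointwise_inv[OF Z L \<theta>(1)])
  define pB where "pB = (\<lambda>z\<in>?Z. (\<lambda>z\<in>?Z. z) z \<otimes> \<theta> z)"
  have "pB \<in> eqhom G ?Z P"
    unfolding pB_def
  proof (rule eqhom_mult[OF Z P order_refl])
    show "(\<lambda>z\<in>?Z. z) \<in> eqhom G ?Z P" using ZP by (intro eqhom_codomain[OF eqhom_id[OF Z]]) auto
    show "\<theta> \<in> eqhom G ?Z P" using eqhomD(1)[OF \<theta>(1)] L by (intro eqhom_codomain[OF \<theta>(1)]) auto
  qed
  then have pB: "pB \<in> eqhom G ?Z B" by (rule eqhom_codomain) (use \<theta>(2) in \<open>auto simp: pB_def\<close>)
  have dec: "z = pL z \<otimes> pB z" if z: "z \<in> ?Z" for z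
  proof -
    have "z \<in> P" "\<theta> z \<in> P" using z ZP eqhomD(1)[OF \<theta>(1) z] L by auto
    then have "inv (\<theta> z) \<otimes> (z \<otimes> \<theta> z) = inv (\<theta> z) \<otimes> (\<theta> z \<otimes> z)" using P_comm by simp
    then show ?thesis using z \<open>z \<in> P\<close> \<open>\<theta> z \<in> P\<close> P_carrier by (simp add: pL_def pB_def m_assoc[symmetric])
  qed
  have "pL (l \<otimes> b) = l \<and> pB (l \<otimes> b) = b" if "l \<in> L" "b \<in> B" for l b
  proof -
    have z: "l \<otimes> b \<in> ?Z" using that by (auto simp: set_mult_def)
    show ?thesis
      using decompose_unique[OF L(1) B(1) d eqhomD(1)[OF pL z] that(1) eqhomD(1)[OF pB z] that(2)] dec[OF z] by simp
  qed
  then show ?thesis using that[OF pL pB dec] by blast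
qed

lemma card_eqhom_sum_left:
  assumes L: "L \<lhd> G" "L \<subseteq> P" and B: "B \<lhd> G" "B \<subseteq> P" and d: "L \<inter> B \<subseteq> {\<one>}"
    and A: "A \<lhd> G" "A \<subseteq> P"
  shows "card (eqhom G (L <#> B) A) = card (eqhom G L A) * card (eqhom G B A)"
proof -
  let ?Z = "L <#> B"
  have Z: "?Z \<lhd> G" by (rule normal_set_mult[OF L(1) B(1)])
  note le = set_mult_le[OF L(1) B(1)]
  obtain pL pB where p: "pL \<in> eqhom G ?Z L" "pB \<in> eqhom G ?Z B" "\<And>z. z \<in> ?Z \<Longrightarrow> z = pL z \<otimes> pB z"
    "\<And>l b. l \<in> L \<Longrightarrow> b \<in> B \<Longrightarrow> pL (l \<otimes> b) = l \<and> pB (l \<otimes> b) = b"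
    using projections[OF L B d] by metis
  have pl: "pL l = l" "pB l = \<one>" if "l \<in> L" for l
    using p(4)[OF that normal_one[OF B(1)]] that L P_carrier by auto
  have pb: "pL b = \<one>" "pB b = b" if "b \<in> B" for b
    using p(4)[OF normal_one[OF L(1)] that] that B P_carrier by auto
  let ?f = "\<lambda>\<theta>. (\<lambda>x\<in>L. \<theta> x, \<lambda>x\<in>B. \<theta> x)"
  let ?g = "\<lambda>(\<theta>1, \<theta>2). \<lambda>z\<in>?Z. (\<lambda>z\<in>?Z. \<theta>1 (pL z)) z \<otimes> (\<lambda>z\<in>?Z. \<theta>2 (pB z)) z"
  have "bij_betw ?f (eqhom G ?Z A) (eqhom G L A \<times> eqhom G B A)"
  proof (rule bij_betw_byWitness[where f' = ?g])
    show "\<forall>\<theta>\<in>eqhom G ?Z A. ?g (?f \<theta>) = \<theta>"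
    proof
      fix \<theta> assume \<theta>: "\<theta> \<in> eqhom G ?Z A"
      have "?g (?f \<theta>) z = \<theta> z" for z
      proof (cases "z \<in> ?Z")
        case True
        have m: "pL z \<in> L" "pB z \<in> B" using eqhomD(1)[OF p(1) True] eqhomD(1)[OF p(2) True] by auto
        then have "\<theta> (pL z \<otimes> pB z) = \<theta> (pL z) \<otimes> \<theta> (pB z)" using le by (intro eqhomD(2)[OF \<theta>]) auto
        then show ?thesis using True m p(3)[OF True] by simp
      next
        case False then show ?thesis using eqhomD(4)[OF \<theta>] by (simp add: extensional_def)
      qed
      then show "?g (?f \<theta>) = \<theta>" by blast
    qed
    show "\<forall>q\<in>eqhom G L A \<times> eqhom G B A. ?f (?g q) = q"
    proof
      fix q assume "q \<in> eqhom G L A \<times> eqhom G B A"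
      then obtain \<theta>1 \<theta>2 where q: "q = (\<theta>1, \<theta>2)" "\<theta>1 \<in> eqhom G L A" "\<theta>2 \<in> eqhom G B A" by auto
      have "(\<lambda>x\<in>L. ?g (\<theta>1, \<theta>2) x) = \<theta>1"
        by (rule extensionalityI[of _ L])
          (use q eqhomD(4)[OF q(2)] pl le eqhom_one[OF B(1) A(1) q(3)] eqhomD(1)[OF q(2)] A P_carrier in \<open>auto simp: subset_iff\<close>)
      moreover have "(\<lambda>x\<in>B. ?g (\<theta>1, \<theta>2) x) = \<theta>2"
        by (rule extensionalityI[of _ B])
          (use q eqhomD(4)[OF q(3)] pb le eqhom_one[OF L(1) A(1) q(2)] eqhomD(1)[OF q(3)] A P_carrier in \<open>auto simp: subset_iff\<close>)
      ultimately show "?f (?g q) = q" by (simp only: q)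
    qed
    show "?f ` eqhom G ?Z A \<subseteq> eqhom G L A \<times> eqhom G B A"
      using eqhom_restrict[OF L(1) le(1)] eqhom_restrict[OF B(1) le(2)] by auto
    show "?g ` (eqhom G L A \<times> eqhom G B A) \<subseteq> eqhom G ?Z A"
      using eqhom_mult[OF Z A eqhom_comp[OF Z p(1)] eqhom_comp[OF Z p(2)]] by auto
  qed
  from bij_betw_same_card[OF this] show ?thesis by (simp only: card_cartesian_product)
qed

lemma card_eqhom_sum_right:
  assumes L: "L \<lhd> G" "L \<subseteq> P" and B: "B \<lhd> G" "B \<subseteq> P" and d: "L \<inter> B \<subseteq> {\<one>}"
    and A: "A \<lhd> G" "A \<subseteq> P"
  shows "card (eqhom G A (L <#> B)) = card (eqhom G A L) * card (eqhom G A B)"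
proof -
  let ?Z = "L <#> B"
  have Z: "?Z \<lhd> G" by (rule normal_set_mult[OF L(1) B(1)])
  have ZP: "?Z \<subseteq> P" using L B P_mult by (auto simp: set_mult_def)
  note le = set_mult_le[OF L(1) B(1)]
  obtain pL pB where p: "pL \<in> eqhom G ?Z L" "pB \<in> eqhom G ?Z B" "\<And>z. z \<in> ?Z \<Longrightarrow> z = pL z \<otimes> pB z"
    "\<And>l b. l \<in> L \<Longrightarrow> b \<in> B \<Longrightarrow> pL (l \<otimes> b) = l \<and> pB (l \<otimes> b) = b"
    using projections[OF L B d] by metis
  let ?f = "\<lambda>\<theta>. (\<lambda>x\<in>A. pL (\<theta> x), \<lambda>x\<in>A. pB (\<theta> x))"
  let ?g = "\<lambda>(\<theta>1, \<theta>2). \<lambda>x\<in>A. \<theta>1 x \<otimes> \<theta>2 x"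
  have "bij_betw ?f (eqhom G A ?Z) (eqhom G A L \<times> eqhom G A B)"
  proof (rule bij_betw_byWitness[where f' = ?g])
    show "\<forall>\<theta>\<in>eqhom G A ?Z. ?g (?f \<theta>) = \<theta>"
    proof
      fix \<theta> assume \<theta>: "\<theta> \<in> eqhom G A ?Z"
      show "?g (?f \<theta>) = \<theta>"
        by (rule extensionalityI[of _ A]) (use eqhomD(1,4)[OF \<theta>] p(3) in auto)
    qed
    show "\<forall>q\<in>eqhom G A L \<times> eqhom G A B. ?f (?g q) = q"
    proof
      fix q assume "q \<in> eqhom G A L \<times> eqhom G A B"
      then obtain \<theta>1 \<theta>2 where q: "q = (\<theta>1, \<theta>2)" "\<theta>1 \<in> eqhom G A L" "\<theta>2 \<in> eqhom G A B" by auto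
      have "(\<lambda>x\<in>A. pL (?g (\<theta>1, \<theta>2) x)) = \<theta>1"
        by (rule extensionalityI[of _ A]) (use eqhomD(1,4)[OF q(2)] eqhomD(1)[OF q(3)] p(4) in auto)
      moreover have "(\<lambda>x\<in>A. pB (?g (\<theta>1, \<theta>2) x)) = \<theta>2"
        by (rule extensionalityI[of _ A]) (use eqhomD(1)[OF q(2)] eqhomD(1,4)[OF q(3)] p(4) in auto)
      ultimately show "?f (?g q) = q" by (simp only: q)
    qed
    show "?f ` eqhom G A ?Z \<subseteq> eqhom G A L \<times> eqhom G A B"
      using eqhom_comp[OF A(1) _ p(1)] eqhom_comp[OF A(1) _ p(2)] by auto
    have "(\<lambda>x\<in>A. \<theta>1 x \<otimes> \<theta>2 x) \<in> eqhom G A ?Z" if "\<theta>1 \<in> eqhom G A L" "\<theta>2 \<in> eqhom G A B" for \<theta>1 \<theta>2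
      using le eqhomD(1)[OF that(1)] eqhomD(1)[OF that(2)]
      by (intro eqhom_mult[OF A(1) Z ZP] eqhom_codomain[OF that(1)] eqhom_codomain[OF that(2)]) auto
    then show "?g ` (eqhom G A L \<times> eqhom G A B) \<subseteq> eqhom G A ?Z" by auto
  qed
  from bij_betw_same_card[OF this] show ?thesis by (simp only: card_cartesian_product)
qed

text \<open>A nontrivial \<open>u\<close> in \<open>eqhom A B\<close> is bijective, and \<open>\<theta> \<mapsto> u\<^sup>-\<^sup>1 \<theta> u\<^sup>-\<^sup>1\<close> reverses the direction.\<close>

lemma card_eqhom_feet_le:
  assumes A: "A \<in> finite_feet G" "A \<subseteq> P" and B: "B \<in> finite_feet G" "B \<subseteq> P"
  shows "card (eqhom G A B) \<le> card (eqhom G B A)"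
proof -
  have An: "A \<lhd> G" "finite A" and Bn: "B \<lhd> G" "finite B" using finite_feet_normal A B by auto
  have fin: "finite (eqhom G B A)" by (rule finite_eqhom[OF Bn(2) An(2)])
  show ?thesis
  proof (cases "eqhom G A B \<subseteq> {\<lambda>x\<in>A. \<one>}")
    case True
    then have "card (eqhom G A B) \<le> 1" using card_mono[OF _ True] by simp
    moreover have "0 < card (eqhom G B A)" using eqhom_trivial[OF Bn(1) An(1)] fin card_gt_0_iff by blast
    ultimately show ?thesis by simp
  next
    case False
    then obtain u where u: "u \<in> eqhom G A B" "u \<noteq> (\<lambda>x\<in>A. \<one>)" by blast
    have K: "{x\<in>A. u x = (\<lambda>x\<in>A. \<one>) x} \<lhd> G"
      by (rule eqhom_equalizer[OF An(1) Bn(1) u(1) eqhom_trivial[OF An(1) Bn(1)]])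
    then have "{x\<in>A. u x = (\<lambda>x\<in>A. \<one>) x} = A \<or> {x\<in>A. u x = (\<lambda>x\<in>A. \<one>) x} = {\<one>}"
      using A(1) unfolding finite_feet_def foot_def by blast
    moreover have "{x\<in>A. u x = (\<lambda>x\<in>A. \<one>) x} \<noteq> A"
      using eqhom_eqI[OF u(1) eqhom_trivial[OF An(1) Bn(1)]] u(2) by blast
    ultimately have ker: "{x\<in>A. u x = (\<lambda>x\<in>A. \<one>) x} = {\<one>}" by blast
    have inj: "inj_on u A"
    proof (rule inj_onI)
      fix x y assume xy: "x \<in> A" "y \<in> A" "u x = u y"
      have c: "x \<in> carrier G" "y \<in> carrier G" "u y \<in> carrier G"
        using xy eqhomD(1)[OF u(1)] normal_subset[OF An(1)] normal_subset[OF Bn(1)] by auto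
      have m: "x \<otimes> inv y \<in> A" using normal_mult[OF An(1) xy(1) normal_minv[OF An(1) xy(2)]] .
      have "u (x \<otimes> inv y) = u x \<otimes> inv (u y)"
        using eqhomD(2)[OF u(1) xy(1) normal_minv[OF An(1) xy(2)]] eqhom_minv[OF An(1) Bn(1) u(1) xy(2)] by simp
      then have "x \<otimes> inv y \<in> {x\<in>A. u x = (\<lambda>x\<in>A. \<one>) x}" using xy c m by simp
      then have "x \<otimes> inv y = \<one>" unfolding ker by simp
      then show "x = y" using c by (metis inv_closed inv_equality inv_inv)
    qed
    have "u ` A \<noteq> {\<one>}"
    proof
      assume "u ` A = {\<one>}"
      then have "A \<subseteq> {x\<in>A. u x = (\<lambda>x\<in>A. \<one>) x}" by auto
      then show False using ker finite_feet_normal[OF A(1)] normal_one[OF An(1)] by blast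
    qed
    moreover have "u ` A \<subseteq> B" using eqhomD(1)[OF u(1)] by auto
    ultimately have surj: "u ` A = B"
      using B(1) eqhom_image[OF An(1) Bn(1) u(1)] unfolding finite_feet_def foot_def by blast
    define v where "v = (\<lambda>y\<in>B. inv_into A u y)"
    have vu: "v (u x) = x" if "x \<in> A" for x using that inj surj by (auto simp: v_def)
    have vB: "\<exists>x\<in>A. y = u x" if "y \<in> B" for y using that surj by blast
    have v: "v \<in> eqhom G B A"
    proof -
      have "(\<lambda>y\<in>B. v y) \<in> eqhom G B A"
      proof (rule eqhomI[OF Bn(1)])
        show "v y \<in> A" if "y \<in> B" for y using vB[OF that] vu by auto
        show "v (y \<otimes> y') = v y \<otimes> v y'" if yB: "y \<in> B" "y' \<in> B" for y y'
        proof -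
          obtain x x' where x: "x \<in> A" "x' \<in> A" "y = u x" "y' = u x'" using vB[OF yB(1)] vB[OF yB(2)] by auto
          then have "y \<otimes> y' = u (x \<otimes> x')" using eqhomD(2)[OF u(1)] by simp
          then show ?thesis using x vu normal_mult[OF An(1)] by simp
        qed
        show "v (g \<otimes> y \<otimes> inv g) = g \<otimes> v y \<otimes> inv g" if gy: "g \<in> carrier G" "y \<in> B" for g y
        proof -
          obtain x where x: "x \<in> A" "y = u x" using vB[OF gy(2)] by auto
          then have "g \<otimes> y \<otimes> inv g = u (g \<otimes> x \<otimes> inv g)" using eqhomD(3)[OF u(1) gy(1)] by simp
          then show ?thesis using x vu normal_conj[OF An(1) gy(1)] by simp
        qed
      qed
      moreover have "(\<lambda>y\<in>B. v y) = v" by (auto simp: v_def)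
      ultimately show ?thesis by simp
    qed
    let ?\<Phi> = "\<lambda>\<theta>. \<lambda>y\<in>B. v ((\<lambda>y\<in>B. \<theta> (v y)) y)"
    have inj\<Phi>: "inj_on ?\<Phi> (eqhom G A B)"
    proof (rule inj_onI)
      fix \<theta> \<phi> assume \<theta>: "\<theta> \<in> eqhom G A B" and \<phi>: "\<phi> \<in> eqhom G A B" and eq: "?\<Phi> \<theta> = ?\<Phi> \<phi>"
      show "\<theta> = \<phi>"
      proof (rule eqhom_eqI[OF \<theta> \<phi>])
        fix x assume x: "x \<in> A"
        have uB: "u x \<in> B" by (rule eqhomD(1)[OF u(1) x])
        have "v (\<theta> x) = v (\<phi> x)" using fun_cong[OF eq, of "u x"] uB vu[OF x] by simp
        moreover obtain a b where ab: "a \<in> A" "b \<in> A" "\<theta> x = u a" "\<phi> x = u b"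
          using vB[OF eqhomD(1)[OF \<theta> x]] vB[OF eqhomD(1)[OF \<phi> x]] by meson
        ultimately show "\<theta> x = \<phi> x" using vu by simp
      qed
    qed
    have "?\<Phi> ` eqhom G A B \<subseteq> eqhom G B A"
      using eqhom_comp[OF Bn(1) eqhom_comp[OF Bn(1) v] v] by auto
    then show ?thesis by (rule card_inj_on_le[OF inj\<Phi> _ fin])
  qed
qed

text \<open>A generator of the sum has the form \<open>x \<otimes> a\<close> with \<open>x\<close>
  generating \<open>L\<close>. For such \<open>x\<close> the elements \<open>a\<close> that fail are
  the values \<open>\<theta> x\<close>; as \<open>\<theta> x\<close> determines
  \<open>\<theta>\<close>, there are exactly \<open>card (eqhom G L A)\<close> of them.\<close>

lemma cyclic_step:
  assumes L: "L \<lhd> G" "L \<subseteq> P" "finite L" and A: "A \<in> finite_feet G" "A \<subseteq> P" and d: "L \<inter> A \<subseteq> {\<one>}"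
  shows "(\<exists>z\<in>L <#> A. normal_closure G z = L <#> A) \<longleftrightarrow>
    (\<exists>x\<in>L. normal_closure G x = L) \<and> card (eqhom G L A) < card A"
proof -
  have An: "A \<lhd> G" "finite A" "A \<noteq> {\<one>}" using finite_feet_normal A by auto
  let ?Z = "L <#> A"
  have Z: "?Z \<lhd> G" by (rule normal_set_mult[OF L(1) An(1)])
  have ZP: "?Z \<subseteq> P" using L A P_mult by (auto simp: set_mult_def)
  note le = set_mult_le[OF L(1) An(1)]
  have key: "(\<exists>a\<in>A. normal_closure G (x \<otimes> a) = ?Z) \<longleftrightarrow> card (eqhom G L A) < card A"
    if x: "x \<in> L" "normal_closure G x = L" for x
  proof -
    have xG: "x \<in> carrier G" using x normal_subset[OF L(1)] by auto
    \<comment> \<open>If \<open>a = \<theta> x\<close>, the normal closure lies in the graph of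
      \<open>\<theta>\<close>, which meets \<open>A\<close> trivially. Conversely, a proper normal
      closure does not contain \<open>A\<close>, so it meets this foot trivially and contains the
      graph of some \<open>\<theta>\<close>, which must send \<open>x\<close> to
      \<open>a\<close>.\<close>
    have bad: "(\<exists>\<theta>\<in>eqhom G L A. \<theta> x = a) \<longleftrightarrow> normal_closure G (x \<otimes> a) \<noteq> ?Z" if a: "a \<in> A" for a
    proof -
      have aG: "a \<in> carrier G" using a normal_subset[OF An(1)] by auto
      have xaZ: "x \<otimes> a \<in> ?Z" using x a by (auto simp: set_mult_def)
      note N = normal_closure_normal[of "x \<otimes> a"]
      let ?N = "normal_closure G (x \<otimes> a)"
      have Nn: "?N \<lhd> G" "x \<otimes> a \<in> ?N" "?N \<subseteq> ?Z" using N(1,2) N(3)[OF _ Z xaZ] xG aG by auto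
      show ?thesis
      proof
        assume "\<exists>\<theta>\<in>eqhom G L A. \<theta> x = a"
        then obtain \<theta> where \<theta>: "\<theta> \<in> eqhom G L A" "\<theta> x = a" by blast
        let ?g = "(\<lambda>x. x \<otimes> \<theta> x) ` L"
        have "?N \<subseteq> ?g"
          using N(3)[OF _ eqhom_graph[OF L(1,2) An(1) A(2) \<theta>(1)]] x \<theta>(2) xG aG by auto
        moreover obtain b where b: "b \<in> A" "b \<noteq> \<one>" using An normal_one[OF An(1)] by blast
        moreover have "b \<notin> ?g"
        proof
          assume "b \<in> ?g"
          then obtain l where l: "l \<in> L" "l \<otimes> \<theta> l = b" by auto
          have bG: "b \<in> carrier G" using b normal_subset[OF An(1)] by auto
          have lb: "l \<otimes> \<theta> l = \<one> \<otimes> b" using l bG by simp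
          have "l = \<one> \<and> \<theta> l = b"
            by (rule decompose_unique[OF L(1) An(1) d l(1) normal_one[OF L(1)] eqhomD(1)[OF \<theta>(1) l(1)] b(1) lb])
          then show False using eqhom_one[OF L(1) An(1) \<theta>(1)] b(2) by metis
        qed
        ultimately show "?N \<noteq> ?Z" using le(2) by blast
      next
        assume ne: "?N \<noteq> ?Z"
        have "\<not> A \<subseteq> ?N"
        proof
          assume s: "A \<subseteq> ?N"
          then have "x \<in> ?N" using normal_mem_iff(2)[OF Nn(1) _ xG, of a] a Nn(2) by auto
          then have "L \<subseteq> ?N" using normal_closure_normal(3)[OF xG Nn(1)] x(2) by simp
          then have "?Z \<subseteq> ?N" using s normal_mult[OF Nn(1)] by (auto simp: set_mult_def)
          then show False using ne Nn(3) by blast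
        qed
        then have "A \<inter> ?N = {\<one>}" using foot_Int[OF A(1) Nn(1)] by blast
        then have NA: "?N \<inter> A \<subseteq> {\<one>}" by blast
        have "x \<otimes> a \<otimes> inv a \<in> ?N <#> A"
          using Nn(2) normal_minv[OF An(1) a] by (auto simp: set_mult_def)
        then have "x \<in> ?N <#> A" using xG aG by (simp add: m_assoc)
        then have "L \<subseteq> ?N <#> A"
          using normal_closure_normal(3)[OF xG normal_set_mult[OF Nn(1) An(1)]] x(2) by simp
        then obtain \<theta> where \<theta>: "\<theta> \<in> eqhom G L A" "\<forall>l\<in>L. l \<otimes> \<theta> l \<in> ?N"
          using eqhom_of_graph[OF L(1,2) An(1) A(2) Nn(1) _ NA] Nn(3) ZP by blast
        have t: "\<theta> x \<in> A" "\<theta> x \<in> carrier G" using eqhomD(1)[OF \<theta>(1) x(1)] normal_subset[OF An(1)] by auto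
        have "inv (x \<otimes> a) \<otimes> (x \<otimes> \<theta> x) = inv a \<otimes> (inv x \<otimes> x) \<otimes> \<theta> x"
          using xG aG t by (simp only: inv_mult_group m_assoc inv_closed m_closed)
        then have "inv a \<otimes> \<theta> x \<in> ?N"
          using normal_mult[OF Nn(1) normal_minv[OF Nn(1,2)]] \<theta>(2) x(1) xG aG by fastforce
        moreover have "inv a \<otimes> \<theta> x \<in> A" using normal_mult[OF An(1) normal_minv[OF An(1) a] t(1)] .
        ultimately have "inv a \<otimes> \<theta> x = \<one>" using NA by blast
        then have "\<theta> x = a" using aG t by (metis inv_closed inv_equality inv_inv)
        then show "\<exists>\<theta>\<in>eqhom G L A. \<theta> x = a" using \<theta>(1) by blast
      qed
    qed
    have inj: "inj_on (\<lambda>\<theta>. \<theta> x) (eqhom G L A)"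
    proof (rule inj_onI)
      fix \<theta> \<phi> assume \<theta>: "\<theta> \<in> eqhom G L A" and \<phi>: "\<phi> \<in> eqhom G L A" and eq: "\<theta> x = \<phi> x"
      have "L \<subseteq> {l\<in>L. \<theta> l = \<phi> l}"
        using normal_closure_normal(3)[OF xG eqhom_equalizer[OF L(1) An(1) \<theta> \<phi>]] x eq by simp
      then show "\<theta> = \<phi>" by (intro eqhom_eqI[OF \<theta> \<phi>]) auto
    qed
    have sub: "(\<lambda>\<theta>. \<theta> x) ` eqhom G L A \<subseteq> A" using eqhomD(1) x(1) by fast
    have mem: "a \<in> (\<lambda>\<theta>. \<theta> x) ` eqhom G L A \<longleftrightarrow> normal_closure G (x \<otimes> a) \<noteq> ?Z" if "a \<in> A" for a
      unfolding bad[OF that, symmetric] image_iff Bex_def by (rule iff_exI) (rule conj_cong[OF refl], rule eq_commute)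
    have "(\<exists>a\<in>A. normal_closure G (x \<otimes> a) = ?Z) \<longleftrightarrow> \<not> A \<subseteq> (\<lambda>\<theta>. \<theta> x) ` eqhom G L A"
      unfolding subset_iff Bex_def using mem by (simp cong: conj_cong imp_cong)
    also have "\<dots> \<longleftrightarrow> card ((\<lambda>\<theta>. \<theta> x) ` eqhom G L A) < card A"
    proof
      assume "\<not> A \<subseteq> (\<lambda>\<theta>. \<theta> x) ` eqhom G L A"
      then show "card ((\<lambda>\<theta>. \<theta> x) ` eqhom G L A) < card A" by (intro psubset_card_mono[OF An(2)] psubsetI sub) (rule notI, simp)
    next
      assume "card ((\<lambda>\<theta>. \<theta> x) ` eqhom G L A) < card A"
      then show "\<not> A \<subseteq> (\<lambda>\<theta>. \<theta> x) ` eqhom G L A" using subset_antisym[OF sub] by (intro notI) simp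
    qed
    finally show ?thesis by (simp add: card_image[OF inj])
  qed
  show ?thesis
  proof
    \<comment> \<open>The component \<open>x\<close> in \<open>L\<close> of a generator of the sum
      generates \<open>L\<close>: the sum lies in \<open>?N <#> A\<close>, and the decomposition
      into components is unique.\<close>
    assume "\<exists>z\<in>?Z. normal_closure G z = ?Z"
    then obtain x a where xa: "x \<in> L" "a \<in> A" "normal_closure G (x \<otimes> a) = ?Z" by (auto simp: set_mult_def)
    have xG: "x \<in> carrier G" "a \<in> carrier G" using xa normal_subset[OF L(1)] normal_subset[OF An(1)] by auto
    let ?N = "normal_closure G x"
    note N = normal_closure_normal[OF xG(1)]
    have NL: "?N \<subseteq> L" using N(3)[OF L(1) xa(1)] .
    have "x \<otimes> a \<in> ?N <#> A" using N(2) xa(2) by (auto simp: set_mult_def)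
    then have Zs: "?Z \<subseteq> ?N <#> A"
      using normal_closure_normal(3)[of "x \<otimes> a", OF _ normal_set_mult[OF N(1) An(1)]] xG xa(3) by auto
    have "L \<subseteq> ?N"
    proof
      fix l assume l: "l \<in> L"
      then have "l \<in> ?N <#> A" using Zs le(1) by blast
      then have "\<exists>n\<in>?N. \<exists>b\<in>A. l = n \<otimes> b" by (auto simp: set_mult_def)
      then obtain n b where nb: "n \<in> ?N" "b \<in> A" "l = n \<otimes> b" by blast
      have nL: "n \<in> L" using nb(1) NL by blast
      have lG: "l \<in> carrier G" using l normal_subset[OF L(1)] by blast
      then have eq: "l \<otimes> \<one> = n \<otimes> b" using nb(3) by simp
      have "l = n"
        using decompose_unique[OF L(1) An(1) d l nL normal_one[OF An(1)] nb(2) eq] by (rule conjunct1)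
      then show "l \<in> ?N" using nb(1) by simp
    qed
    then have x: "normal_closure G x = L" using NL by blast
    then show "(\<exists>x\<in>L. normal_closure G x = L) \<and> card (eqhom G L A) < card A"
      using key[OF xa(1) x] xa by blast
  next
    assume "(\<exists>x\<in>L. normal_closure G x = L) \<and> card (eqhom G L A) < card A"
    then obtain x a where "x \<in> L" "a \<in> A" "normal_closure G (x \<otimes> a) = ?Z" using key by blast
    then show "\<exists>z\<in>?Z. normal_closure G z = ?Z" by (auto simp: set_mult_def)
  qed
qed

lemma P_subgroup_group:
  assumes L: "L \<lhd> G" "L \<subseteq> P"
  shows "group (G\<lparr>carrier := L\<rparr>)" "\<And>x y. x \<in> L \<Longrightarrow> y \<in> L \<Longrightarrow> x \<otimes> y = y \<otimes> x"
  using subgroup_imp_group[OF normal_imp_sub[OF L(1)]] P_comm L(2) by blast+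

lemma characterD:
  assumes L: "L \<lhd> G" and \<xi>: "unitary_character (G\<lparr>carrier := L\<rparr>) \<xi>"
  shows "x \<in> L \<Longrightarrow> y \<in> L \<Longrightarrow> \<xi> (x \<otimes> y) = \<xi> x * \<xi> y" "x \<in> L \<Longrightarrow> \<xi> x * cnj (\<xi> x) = 1" "\<xi> \<one> = 1"
    "x \<in> L \<Longrightarrow> cmod (\<xi> x) = 1" "x \<in> L \<Longrightarrow> \<xi> (inv x) = cnj (\<xi> x)"
proof -
  interpret L: group "G\<lparr>carrier := L\<rparr>" by (rule subgroup_imp_group[OF normal_imp_sub[OF L]])
  note D = L.unitary_characterD[OF \<xi>, simplified]
  show m: "x \<in> L \<Longrightarrow> y \<in> L \<Longrightarrow> \<xi> (x \<otimes> y) = \<xi> x * \<xi> y" and o: "\<xi> \<one> = 1" and n: "x \<in> L \<Longrightarrow> cmod (\<xi> x) = 1" for x y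
    using D by auto
  show c: "x \<in> L \<Longrightarrow> \<xi> x * cnj (\<xi> x) = 1" for x
    using n complex_norm_square[of "\<xi> x"] by simp
  show "\<xi> (inv x) = cnj (\<xi> x)" if x: "x \<in> L" for x
  proof -
    have "\<xi> (inv x) * \<xi> x = 1"
      using m[OF normal_minv[OF L x] x] o x normal_subset[OF L] by auto
    then have "\<xi> (inv x) * (\<xi> x * cnj (\<xi> x)) = cnj (\<xi> x)" by (simp add: mult.assoc[symmetric])
    then show ?thesis using c[OF x] by simp
  qed
qed

lemma faithful_character_normal:
  assumes \<xi>: "faithful_character L \<xi>" and N: "N \<lhd> G" "N \<subseteq> L" "finite N" "N \<noteq> {\<one>}"
  shows "\<exists>n\<in>N. \<xi> n \<noteq> 1"
  using exists_finite_foot[OF N(1,3,4)] \<xi> N(2) unfolding faithful_character_def by blast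

text \<open>\<open>A\<close> has \<open>card A\<close> characters, and those that cannot accompany
  \<open>\<xi>\<close> are \<open>cnj (\<xi> (\<theta> a))\<close>. Distinct \<open>\<theta>\<close>
  give distinct ones, and the restriction to \<open>A\<close> of a faithful character of the sum is
  not among them, so the bound is necessary. If it holds, some character of \<open>A\<close> is left
  over.\<close>

lemma character_step:
  assumes L: "L \<lhd> G" "L \<subseteq> P" "finite L" and A: "A \<in> finite_feet G" "A \<subseteq> P" and d: "L \<inter> A \<subseteq> {\<one>}"
  shows "(\<exists>\<xi>. faithful_character (L <#> A) \<xi>) \<longleftrightarrow> (\<exists>\<xi>. faithful_character L \<xi>) \<and> card (eqhom G A L) < card A"
proof -
  have An: "A \<lhd> G" "finite A" "A \<noteq> {\<one>}" using finite_feet_normal A by auto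
  let ?Z = "L <#> A" and ?GA = "G\<lparr>carrier := A\<rparr>"
  have Z: "?Z \<lhd> G" by (rule normal_set_mult[OF L(1) An(1)])
  have ZP: "?Z \<subseteq> P" using L A P_mult by (auto simp: set_mult_def)
  note le = set_mult_le[OF L(1) An(1)]
  interpret GA: group ?GA by (rule P_subgroup_group[OF An(1) A(2)])
  have cA: "card (characters ?GA) = card A"
    using GA.card_characters P_subgroup_group(2)[OF An(1) A(2)] An(2) by simp
  have finX: "finite (characters ?GA)" using GA.finite_characters An(2) by simp
  let ?k = "\<lambda>\<xi> \<theta>. \<lambda>a\<in>A. cnj (\<xi> (\<theta> a))"
  have kX: "?k \<xi> \<theta> \<in> characters ?GA" if \<xi>: "unitary_character (G\<lparr>carrier := L\<rparr>) \<xi>" and \<theta>: "\<theta> \<in> eqhom G A L" for \<xi> \<theta>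
  proof -
    have "unitary_character ?GA (\<lambda>a. cnj (\<xi> (\<theta> a)))"
      using characterD(1,4)[OF L(1) \<xi>] eqhomD(1,2)[OF \<theta>]
      by (auto simp: unitary_character_def hom_def circle_group_def)
    then show ?thesis using GA.unitary_character_restrict by simp
  qed
  have char_sub: "unitary_character (G\<lparr>carrier := M\<rparr>) \<xi>" if "unitary_character (G\<lparr>carrier := M'\<rparr>) \<xi>" "M \<subseteq> M'" for M M' \<xi>
    using that by (auto simp: unitary_character_def hom_def circle_group_def)
  show ?thesis
  proof
    assume "\<exists>\<xi>. faithful_character ?Z \<xi>"
    then obtain \<xi> where \<xi>: "faithful_character ?Z \<xi>" by blast
    then have uZ: "unitary_character (G\<lparr>carrier := ?Z\<rparr>) \<xi>" by (simp add: faithful_character_def)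
    have \<xi>L: "faithful_character L \<xi>"
      using \<xi> char_sub[OF uZ le(1)] le(1) unfolding faithful_character_def by blast
    then have uL: "unitary_character (G\<lparr>carrier := L\<rparr>) \<xi>" by (simp add: faithful_character_def)
    note DZ = characterD[OF Z uZ] and DL = characterD[OF L(1) uL]
    \<comment> \<open>Two \<open>\<theta>\<close> with the same character differ by an equivariant
      homomorphism \<open>?\<psi>\<close> such that \<open>\<xi>\<close> is \<open>1\<close> on its
      image, a normal subgroup of \<open>L\<close>; so the image is trivial.\<close>
    have inj: "inj_on (?k \<xi>) (eqhom G A L)"
    proof (rule inj_onI, rule ccontr)
      fix \<theta> \<phi> assume \<theta>: "\<theta> \<in> eqhom G A L" and \<phi>: "\<phi> \<in> eqhom G A L" and eq: "?k \<xi> \<theta> = ?k \<xi> \<phi>" and ne: "\<theta> \<noteq> \<phi>"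
      have e: "\<xi> (\<theta> a) = \<xi> (\<phi> a)" if "a \<in> A" for a
        using fun_cong[OF eq, of a] that by simp
      let ?\<psi> = "\<lambda>a\<in>A. \<theta> a \<otimes> (\<lambda>a\<in>A. inv (\<phi> a)) a"
      have \<psi>: "?\<psi> \<in> eqhom G A L"
        by (rule eqhom_mult[OF An(1) L(1,2) \<theta> eqhom_pointwise_inv[OF An(1) L(1,2) \<phi>]])
      have im: "?\<psi> ` A \<lhd> G" "?\<psi> ` A \<subseteq> L" using eqhom_image[OF An(1) L(1) \<psi>] eqhomD(1)[OF \<psi>] by auto
      have "?\<psi> ` A \<noteq> {\<one>}"
      proof
        assume i: "?\<psi> ` A = {\<one>}"
        have "\<theta> a = \<phi> a" if a: "a \<in> A" for a
        proof -
          have c: "\<theta> a \<in> carrier G" "\<phi> a \<in> carrier G"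
            using eqhomD(1)[OF \<theta> a] eqhomD(1)[OF \<phi> a] normal_subset[OF L(1)] by auto
          have "?\<psi> a = \<one>" using i a by blast
          then have "\<theta> a \<otimes> inv (\<phi> a) = \<one>" using a by simp
          then show ?thesis using c by (metis inv_closed inv_equality inv_inv)
        qed
        then show False using eqhom_eqI[OF \<theta> \<phi>] ne by blast
      qed
      then obtain n where "n \<in> ?\<psi> ` A" "\<xi> n \<noteq> 1"
        using faithful_character_normal[OF \<xi>L im] An(2) by blast
      then obtain a where a: "a \<in> A" "\<xi> (?\<psi> a) \<noteq> 1" by blast
      have "\<xi> (?\<psi> a) = \<xi> (\<theta> a) * cnj (\<xi> (\<phi> a))"
        using a DL(1,5) eqhomD(1)[OF \<theta> a(1)] eqhomD(1)[OF \<phi> a(1)] normal_minv[OF L(1)] by simp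
      then show False using a e[OF a(1)] DL(2)[OF eqhomD(1)[OF \<phi> a(1)]] by simp
    qed
    let ?\<alpha> = "\<lambda>a\<in>A. \<xi> a"
    have \<alpha>: "?\<alpha> \<in> characters ?GA"
      using GA.unitary_character_restrict[of \<xi>] char_sub[OF uZ le(2)] by simp
    \<comment> \<open>Otherwise \<open>\<xi>\<close> would be \<open>1\<close> on the graph of
      \<open>\<theta>\<close>, a nontrivial normal subgroup of the sum.\<close>
    have "?\<alpha> \<notin> ?k \<xi> ` eqhom G A L"
    proof
      assume "?\<alpha> \<in> ?k \<xi> ` eqhom G A L"
      then obtain \<theta> where \<theta>: "\<theta> \<in> eqhom G A L" "?\<alpha> = ?k \<xi> \<theta>" by blast
      have e: "\<xi> a = cnj (\<xi> (\<theta> a))" if "a \<in> A" for a using fun_cong[OF \<theta>(2), of a] that by simp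
      let ?g = "(\<lambda>x. x \<otimes> \<theta> x) ` A"
      have g: "?g \<lhd> G" by (rule eqhom_graph[OF An(1) A(2) L(1,2) \<theta>(1)])
      have "?g \<subseteq> ?Z"
        using le eqhomD(1)[OF \<theta>(1)] normal_mult[OF Z] by blast
      moreover have "?g \<noteq> {\<one>}"
      proof
        assume g1: "?g = {\<one>}"
        have "a = \<one>" if a: "a \<in> A" for a
        proof -
          have "a \<otimes> \<theta> a = \<one>" using g1 a by blast
          moreover have "a \<otimes> \<theta> a = \<theta> a \<otimes> a" using P_comm a A(2) eqhomD(1)[OF \<theta>(1) a] L(2) by blast
          ultimately have eq: "\<theta> a \<otimes> a = \<one> \<otimes> \<one>" by simp
          show ?thesis
            using decompose_unique[OF L(1) An(1) d eqhomD(1)[OF \<theta>(1) a] normal_one[OF L(1)] a normal_one[OF An(1)] eq]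
            by (rule conjunct2)
        qed
        then show False using An normal_one[OF An(1)] by blast
      qed
      ultimately obtain a where a: "a \<in> A" "\<xi> (a \<otimes> \<theta> a) \<noteq> 1"
        using faithful_character_normal[OF \<xi> g] An(2) by blast
      have "\<xi> (a \<otimes> \<theta> a) = \<xi> a * \<xi> (\<theta> a)" using DZ(1) a(1) eqhomD(1)[OF \<theta>(1) a(1)] le by blast
      also have "\<dots> = 1" using e[OF a(1)] DL(2)[OF eqhomD(1)[OF \<theta>(1) a(1)]] by (simp add: mult.commute)
      finally show False using a by simp
    qed
    then have "?k \<xi> ` eqhom G A L \<subset> characters ?GA" using \<alpha> kX[OF uL] by blast
    then have "card (?k \<xi> ` eqhom G A L) < card A" using psubset_card_mono[OF finX] cA by metis
    then show "(\<exists>\<xi>. faithful_character L \<xi>) \<and> card (eqhom G A L) < card A"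
      using \<xi>L card_image[OF inj] by auto
  next
    assume r: "(\<exists>\<xi>. faithful_character L \<xi>) \<and> card (eqhom G A L) < card A"
    then obtain \<xi> where \<xi>: "faithful_character L \<xi>" by blast
    then have uL: "unitary_character (G\<lparr>carrier := L\<rparr>) \<xi>" by (simp add: faithful_character_def)
    note DL = characterD[OF L(1) uL]
    have finE: "finite (eqhom G A L)" by (rule finite_eqhom[OF An(2) L(3)])
    have "card (?k \<xi> ` eqhom G A L) < card (characters ?GA)"
      using card_image_le[OF finE, of "?k \<xi>"] r cA by linarith
    then have "\<not> characters ?GA \<subseteq> ?k \<xi> ` eqhom G A L"
      using card_mono[OF finite_imageI[OF finE]] by (metis not_le)
    then obtain \<alpha> where \<alpha>: "\<alpha> \<in> characters ?GA" "\<alpha> \<notin> ?k \<xi> ` eqhom G A L" by blast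
    then have uA: "unitary_character ?GA \<alpha>" by (simp add: characters_def)
    note DA = characterD[OF An(1) uA]
    obtain pL pA where p: "pL \<in> eqhom G ?Z L" "pA \<in> eqhom G ?Z A" "\<And>z. z \<in> ?Z \<Longrightarrow> z = pL z \<otimes> pA z"
      "\<And>l a. l \<in> L \<Longrightarrow> a \<in> A \<Longrightarrow> pL (l \<otimes> a) = l \<and> pA (l \<otimes> a) = a"
      using projections[OF L(1,2) An(1) A(2) d] by metis
    define \<zeta> where "\<zeta> z = \<xi> (pL z) * \<alpha> (pA z)" for z
    have \<zeta>: "\<zeta> (l \<otimes> a) = \<xi> l * \<alpha> a" if "l \<in> L" "a \<in> A" for l a using p(4)[OF that] by (simp add: \<zeta>_def)
    have uZ: "unitary_character (G\<lparr>carrier := ?Z\<rparr>) \<zeta>"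
      using DL(1,4) DA(1,4) eqhomD(1,2)[OF p(1)] eqhomD(1,2)[OF p(2)]
      by (auto simp: unitary_character_def hom_def circle_group_def \<zeta>_def norm_mult mult_ac)
    \<comment> \<open>If \<open>\<zeta>\<close> is \<open>1\<close> on a foot \<open>B\<close>, then
      \<open>B\<close> is not contained in \<open>L\<close> and meets it trivially. It follows that
      \<open>B\<close> contains the graph of an equivariant homomorphism from \<open>A\<close> to
      \<open>L\<close>, and \<open>\<alpha>\<close> would be one of the excluded characters.\<close>
    have "\<exists>b\<in>B. \<zeta> b \<noteq> 1" if B: "B \<in> finite_feet G" "B \<subseteq> ?Z" for B
    proof (rule ccontr)
      assume "\<not> ?thesis"
      then have B1: "\<zeta> b = 1" if "b \<in> B" for b using that by blast
      have Bn: "B \<lhd> G" "B \<noteq> {\<one>}" using finite_feet_normal[OF B(1)] by auto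
      have BL: "\<not> B \<subseteq> L"
      proof
        assume s: "B \<subseteq> L"
        then obtain b where b: "b \<in> B" "\<xi> b \<noteq> 1" using \<xi> B(1) unfolding faithful_character_def by blast
        have bL: "b \<in> L" "b \<in> carrier G" using b s normal_subset[OF L(1)] by auto
        have "\<zeta> b = \<xi> b" using \<zeta>[OF bL(1) normal_one[OF An(1)]] DA(3) bL(2) by simp
        then show False using B1 b by simp
      qed
      then have BL1: "B \<inter> L \<subseteq> {\<one>}" using foot_Int[OF B(1) L(1)] by blast
      have BLn: "B <#> L \<lhd> G" by (rule normal_set_mult[OF Bn(1) L(1)])
      \<comment> \<open>Otherwise \<open>A\<close> meets \<open>B <#> L\<close> trivially. Writing
        \<open>b = l \<otimes> a\<close>, the component \<open>a = b \<otimes> inv l\<close> lies in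
        both and vanishes, so \<open>B\<close> would be contained in \<open>L\<close>.\<close>
      have "A \<subseteq> B <#> L"
      proof (rule ccontr)
        assume "\<not> ?thesis"
        then have A1: "A \<inter> (B <#> L) = {\<one>}" using foot_Int[OF A(1) BLn] by blast
        have "b \<in> L" if b: "b \<in> B" for b
        proof -
          obtain l a where la: "l \<in> L" "a \<in> A" "b = l \<otimes> a" using B(2) b by (auto simp: set_mult_def)
          have pP: "l \<in> P" "a \<in> P" using la L(2) A(2) by auto
          have "b \<otimes> inv l = a" using la(3) P_comm[OF pP] pP P_carrier by (simp add: m_assoc)
          then have "a \<in> B <#> L" using b normal_minv[OF L(1) la(1)] by (auto simp: set_mult_def)
          then have "a = \<one>" using A1 la(2) by blast
          then show ?thesis using la pP P_carrier by simp
        qed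
        then show False using BL by blast
      qed
      then obtain \<theta> where \<theta>: "\<theta> \<in> eqhom G A L" "\<forall>a\<in>A. a \<otimes> \<theta> a \<in> B"
        using eqhom_of_graph[OF An(1) A(2) L(1,2) Bn(1) _ BL1] B(2) ZP by blast
      have "\<alpha> a = cnj (\<xi> (\<theta> a))" if a: "a \<in> A" for a
      proof -
        have t: "\<theta> a \<in> L" by (rule eqhomD(1)[OF \<theta>(1) a])
        have "a \<otimes> \<theta> a = \<theta> a \<otimes> a" using P_comm a t A(2) L(2) by blast
        moreover have "\<zeta> (a \<otimes> \<theta> a) = 1" using \<theta>(2) a by (intro B1) blast
        ultimately have "\<xi> (\<theta> a) * \<alpha> a = 1" using \<zeta>[OF t a] by simp
        then have "(\<xi> (\<theta> a) * cnj (\<xi> (\<theta> a))) * \<alpha> a = cnj (\<xi> (\<theta> a))"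
          by (metis mult.assoc mult.commute mult_1_right)
        then show ?thesis using DL(2)[OF t] by simp
      qed
      then have "\<alpha> = ?k \<xi> \<theta>"
        using \<alpha>(1) by (intro extensionalityI[of _ A]) (auto simp: characters_def)
      then show False using \<alpha>(2) \<theta>(1) by blast
    qed
    then have "faithful_character ?Z \<zeta>" using uZ by (simp add: faithful_character_def)
    then show "\<exists>\<xi>. faithful_character ?Z \<xi>" by blast
  qed
qed

text \<open>\<open>cyclic_step\<close> and \<open>character_step\<close> reduce the two sides to the
  previous sum and to inequalities on numbers of equivariant homomorphisms in opposite directions.
  Equality of these numbers is carried along in the induction, as they multiply over direct sums and
  agree between feet.\<close>

lemma cyclic_iff_faithful_character:
  assumes "finite E" "\<And>i. i \<in> E \<Longrightarrow> A i \<in> finite_feet G \<and> A i \<subseteq> P"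
    and "\<And>i E'. i \<in> E \<Longrightarrow> E' \<subseteq> E - {i} \<Longrightarrow> A i \<inter> generate G (\<Union>j\<in>E'. A j) = {\<one>}"
  shows "(\<exists>x\<in>generate G (\<Union>i\<in>E. A i). normal_closure G x = generate G (\<Union>i\<in>E. A i)) \<longleftrightarrow>
      (\<exists>\<xi>. faithful_character (generate G (\<Union>i\<in>E. A i)) \<xi>)"
    and "\<And>B. B \<in> finite_feet G \<Longrightarrow> B \<subseteq> P \<Longrightarrow>
      card (eqhom G (generate G (\<Union>i\<in>E. A i)) B) = card (eqhom G B (generate G (\<Union>i\<in>E. A i)))"
proof -
  let ?L = "\<lambda>E. generate G (\<Union>i\<in>E. A i)"
  have "((\<exists>x\<in>?L E. normal_closure G x = ?L E) \<longleftrightarrow> (\<exists>\<xi>. faithful_character (?L E) \<xi>)) \<and>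
    (\<forall>B\<in>finite_feet G. B \<subseteq> P \<longrightarrow> card (eqhom G (?L E) B) = card (eqhom G B (?L E)))"
    using assms
  proof (induction E rule: finite_induct)
    case empty
    have 1: "{\<one>} \<lhd> G" by (simp add: normal_inv_iff triv_subgroup)
    have "normal_closure G \<one> = {\<one>}"
      using normal_closure_normal[OF one_closed] normal_closure_normal(3)[OF one_closed 1] by blast
    moreover have "faithful_character {\<one>} (\<lambda>_. 1)"
      using finite_feet_normal normal_one
      by (auto simp: faithful_character_def unitary_character_def hom_def circle_group_def)
    moreover have "card (eqhom G {\<one>} B) = card (eqhom G B {\<one>})" if "B \<in> finite_feet G" for B
    proof -
      have B: "B \<lhd> G" using that finite_feet_normal by blast
      have "eqhom G {\<one>} B = {\<lambda>x\<in>{\<one>}. \<one>}"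
        using eqhom_trivial[OF 1 B] eqhom_one[OF 1 B] by (auto intro!: eqhom_eqI[OF _ eqhom_trivial[OF 1 B]])
      moreover have "eqhom G B {\<one>} = {\<lambda>x\<in>B. \<one>}"
        using eqhom_trivial[OF B 1] by (auto intro!: eqhom_eqI[OF _ eqhom_trivial[OF B 1]] dest: eqhomD(1))
      ultimately show ?thesis by simp
    qed
    ultimately show ?case by (auto simp: generate_empty)
  next
    case (insert j E)
    have feet: "A i \<in> finite_feet G" "A i \<subseteq> P" if "i \<in> insert j E" for i using insert.prems(1)[OF that] by auto
    have nor: "A i \<lhd> G" if "i \<in> insert j E" for i using feet[OF that] finite_feet_normal by blast
    have conj: "((\<exists>x\<in>?L E. normal_closure G x = ?L E) \<longleftrightarrow> (\<exists>\<xi>. faithful_character (?L E) \<xi>)) \<and>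
      (\<forall>B\<in>finite_feet G. B \<subseteq> P \<longrightarrow> card (eqhom G (?L E) B) = card (eqhom G B (?L E)))"
    proof (rule insert.IH)
      show "A i \<in> finite_feet G \<and> A i \<subseteq> P" if "i \<in> E" for i
        by (rule insert.prems(1)[OF insertI2[OF that]])
      show "A i \<inter> generate G (\<Union>j\<in>E'. A j) = {\<one>}" if i: "i \<in> E" and E': "E' \<subseteq> E - {i}" for i E'
        by (rule insert.prems(2)[OF insertI2[OF i]]) (use E' in blast)
    qed
    note IH1 = conjunct1[OF conj]
    have IH2: "card (eqhom G (?L E) B) = card (eqhom G B (?L E))" if "B \<in> finite_feet G" "B \<subseteq> P" for B
      using conj that by simp
    have L: "?L E \<lhd> G" using nor by (intro normal_generate_UN) auto
    have LP: "?L E \<subseteq> P" using feet by (intro generate_subgroup_incl normal_imp_sub[OF P]) auto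
    have Lfin: "finite (?L E)" using insert(1) feet finite_feet_normal by (intro finite_generate_UN) auto
    have d: "?L E \<inter> A j \<subseteq> {\<one>}" using insert.prems(2)[of j E] insert(2) by auto
    have eq: "?L (insert j E) = ?L E <#> A j" by (rule generate_insert[OF nor])
    note F = feet[of j, simplified]
    have "card (eqhom G (?L E <#> A j) B) = card (eqhom G B (?L E <#> A j))" if B: "B \<in> finite_feet G" "B \<subseteq> P" for B
    proof -
      have Bn: "B \<lhd> G" using B finite_feet_normal by blast
      have "card (eqhom G (A j) B) = card (eqhom G B (A j))"
        using card_eqhom_feet_le[OF F B] card_eqhom_feet_le[OF B F] by simp
      then show ?thesis
        using card_eqhom_sum_left[OF L LP nor[of j] F(2) d Bn B(2)] card_eqhom_sum_right[OF L LP nor[of j] F(2) d Bn B(2)]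
          IH2[OF B] by simp
    qed
    moreover have "(\<exists>x\<in>?L E <#> A j. normal_closure G x = ?L E <#> A j) \<longleftrightarrow> (\<exists>\<xi>. faithful_character (?L E <#> A j) \<xi>)"
      using cyclic_step[OF L LP Lfin F d] character_step[OF L LP Lfin F d] IH1 IH2[OF F] by simp
    ultimately show ?case unfolding eq by blast
  qed
  then show "(\<exists>x\<in>?L E. normal_closure G x = ?L E) \<longleftrightarrow> (\<exists>\<xi>. faithful_character (?L E) \<xi>)"
    "\<And>B. B \<in> finite_feet G \<Longrightarrow> B \<subseteq> P \<Longrightarrow> card (eqhom G (?L E) B) = card (eqhom G B (?L E))" by blast+
qed

end

end

section \<open>The structure of the minisocle and the equivalences\<close>

context group
begin

lemma abelian_feet_finite: "abelian_feet G \<subseteq> finite_feet G"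
  and nonabelian_feet_finite: "nonabelian_feet G \<subseteq> finite_feet G"
  by (auto simp: abelian_feet_def nonabelian_feet_def)

lemma generate_feet_normal: "\<A> \<subseteq> finite_feet G \<Longrightarrow> generate G (\<Union>\<A>) \<lhd> G"
  using normal_generate_UN[of \<A> "\<lambda>x. x"] finite_feet_normal by auto

lemma feet_subset: "\<A> \<subseteq> finite_feet G \<Longrightarrow> \<Union>\<A> \<subseteq> carrier G"
  using finite_feet_normal normal_subset by blast

lemma subset_generate_Union: "A \<in> \<A> \<Longrightarrow> A \<subseteq> generate G (\<Union>\<A>)"
  by (auto intro: generate.incl)

lemma MA_normal: "MA G \<lhd> G" and minisocle_normal: "minisocle G \<lhd> G" and MH_normal: "MH G \<lhd> G"
  unfolding MA_def minisocle_def MH_def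
  by (intro generate_feet_normal abelian_feet_finite nonabelian_feet_finite order_refl)+

lemma generate_comm:
  assumes S: "S \<subseteq> carrier G" "\<And>x y. x \<in> S \<Longrightarrow> y \<in> S \<Longrightarrow> x \<otimes> y = y \<otimes> x"
    and x: "x \<in> generate G S" and y: "y \<in> generate G S"
  shows "x \<otimes> y = y \<otimes> x"
proof (rule generate_commute[OF S(1) generate_in_carrier[OF S(1) y] _ x])
  fix s assume s: "s \<in> S"
  have "y \<otimes> s = s \<otimes> y"
    by (rule generate_commute[OF S(1) _ S(2)[OF _ s] y]) (use s S in auto)
  then show "s \<otimes> y = y \<otimes> s" by simp
qed

lemma MA_comm:
  assumes "x \<in> MA G" "y \<in> MA G"
  shows "x \<otimes> y = y \<otimes> x"
proof (rule generate_comm[OF feet_subset[OF abelian_feet_finite] _ assms[unfolded MA_def]])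
  fix x y assume "x \<in> \<Union>(abelian_feet G)" "y \<in> \<Union>(abelian_feet G)"
  then obtain A B where A: "A \<in> abelian_feet G" "x \<in> A" and B: "B \<in> abelian_feet G" "y \<in> B" by blast
  show "x \<otimes> y = y \<otimes> x"
  proof (cases "A = B")
    case True
    interpret A: comm_group "G\<lparr>carrier := A\<rparr>" using A(1) by (simp add: abelian_feet_def)
    show ?thesis using A.m_comm[of x y] A(2) B(2) True by simp
  next
    case False
    then show ?thesis using finite_feet_commute[OF _ _ False A(2) B(2)] A(1) B(1) abelian_feet_finite by blast
  qed
qed

lemma foot_in_MA_abelian:
  assumes B: "B \<in> finite_feet G" "B \<subseteq> MA G"
  shows "B \<in> abelian_feet G"
proof -
  have "group (G\<lparr>carrier := B\<rparr>)"
    using finite_feet_normal[OF B(1)] by (intro subgroup_imp_group normal_imp_sub) simp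
  then have "comm_group (G\<lparr>carrier := B\<rparr>)"
    using MA_comm B(2) by (intro group.group_comm_groupI) auto
  then show ?thesis using B(1) by (simp add: abelian_feet_def)
qed

lemma internal_direct_sumI:
  assumes N: "N = generate G (\<Union>i\<in>I. A i)" and A: "\<And>i. i \<in> I \<Longrightarrow> A i \<lhd> G"
    and d: "\<And>i. i \<in> I \<Longrightarrow> A i \<inter> generate G (\<Union>j\<in>I - {i}. A j) \<subseteq> {\<one>}"
  shows "internal_direct_sum G I A N"
  unfolding internal_direct_sum_def
proof (intro conjI ballI N)
  show sub: "subgroup N G" unfolding N by (intro normal_imp_sub normal_generate_UN A)
  fix i assume i: "i \<in> I"
  have "A i \<subseteq> N" unfolding N using i by (auto intro: generate.incl)
  then show "A i \<lhd> G\<lparr>carrier := N\<rparr>" by (rule normal_restrict_supergroup[OF sub A[OF i]])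
  show "A i \<inter> generate G (\<Union>j\<in>I - {i}. A j) = {\<one>}"
    using d[OF i] normal_one[OF A[OF i]] generate.one by auto
qed

lemma MH_direct_sum: "internal_direct_sum G (nonabelian_feet G) (\<lambda>H. H) (MH G)"
proof (rule internal_direct_sumI)
  show "MH G = generate G (\<Union>H\<in>nonabelian_feet G. H)" by (simp add: MH_def)
  fix H assume H: "H \<in> nonabelian_feet G"
  show "H \<lhd> G" using H nonabelian_feet_finite finite_feet_normal by blast
  show "H \<inter> generate G (\<Union>j\<in>nonabelian_feet G - {H}. j) \<subseteq> {\<one>}"
    using nonabelian_foot_disjoint[OF H, of "nonabelian_feet G - {H}"] nonabelian_feet_finite by auto
qed

text \<open>Split off the component \<open>h\<close> of \<open>x\<close> in one foot
  \<open>H\<close>. The remaining factor commutes with \<open>H\<close>, so \<open>h\<close> is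
  central in \<open>H\<close> and trivial.\<close>

lemma nonabelian_feet_centerless:
  assumes "finite F" "F \<subseteq> nonabelian_feet G" "x \<in> generate G (\<Union>F)"
    and "\<And>H h. H \<in> F \<Longrightarrow> h \<in> H \<Longrightarrow> x \<otimes> h = h \<otimes> x"
  shows "x = \<one>"
  using assms
proof (induction F arbitrary: x rule: finite_induct)
  case empty
  then show ?case by (simp add: generate_empty)
next
  case (insert H F)
  have H: "H \<in> nonabelian_feet G" "H \<in> finite_feet G" and F: "F \<subseteq> finite_feet G"
    using insert.prems nonabelian_feet_finite by auto
  have n: "K \<lhd> G" if "K \<in> insert H F" for K using that H F finite_feet_normal by blast
  have "x \<in> generate G (\<Union>F) <#> H"
    using generate_insert[of H F "\<lambda>K. K", OF n] insert.prems(2) by simp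
  then have "\<exists>l\<in>generate G (\<Union>F). \<exists>h\<in>H. x = l \<otimes> h" by (auto simp: set_mult_def)
  then obtain l h where lh: "l \<in> generate G (\<Union>F)" "h \<in> H" "x = l \<otimes> h" by blast
  have HG: "H \<subseteq> carrier G" using n normal_subset by blast
  have lG: "l \<in> carrier G" using generate_in_carrier[OF feet_subset[OF F] lh(1)] .
  have hG: "h \<in> carrier G" using HG lh(2) by blast
  have "h = \<one>"
  proof (rule nonabelian_foot_center[OF H(1) lh(2)])
    fix k assume k: "k \<in> H"
    then have kG: "k \<in> carrier G" using HG by blast
    have lk: "l \<otimes> k = k \<otimes> l"
    proof (rule generate_commute[OF feet_subset[OF F] kG _ lh(1)])
      fix s assume "s \<in> \<Union>F"
      then show "s \<otimes> k = k \<otimes> s" using finite_feet_commute[OF _ H(2) _ _ k] F insert(2) by blast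
    qed
    have "l \<otimes> (h \<otimes> k) = (l \<otimes> h) \<otimes> k" using lG hG kG by (simp add: m_assoc)
    also have "\<dots> = k \<otimes> (l \<otimes> h)" using insert.prems(3)[OF insertI1 k] lh(3) by simp
    also have "\<dots> = (k \<otimes> l) \<otimes> h" using lG hG kG by (simp add: m_assoc)
    also have "\<dots> = l \<otimes> (k \<otimes> h)" unfolding lk[symmetric] using lG hG kG by (simp add: m_assoc)
    finally show "h \<otimes> k = k \<otimes> h" using lG hG kG by simp
  qed
  then have "x = l" using lh(3) lG by simp
  then show ?case using insert.IH[of x] insert.prems lh(1) by blast
qed

text \<open>An element of \<open>MA G\<close> commutes with every nonabelian foot because distinct
  feet commute; in \<open>MH G\<close> only \<open>\<one>\<close> does.\<close>

lemma MA_Int_MH: "MA G \<inter> MH G = {\<one>}"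
proof -
  have "x = \<one>" if x: "x \<in> MA G" "x \<in> MH G" for x
  proof -
    have "x \<in> generate G (\<Union>H\<in>nonabelian_feet G. H)" using x(2) by (simp add: MH_def)
    then obtain F where F: "F \<subseteq> nonabelian_feet G" "finite F" "x \<in> generate G (\<Union>H\<in>F. H)"
      using generate_finite_support by blast
    show ?thesis
    proof (rule nonabelian_feet_centerless[OF F(2,1)])
      show "x \<in> generate G (\<Union>F)" using F(3) by simp
      fix H h assume H: "H \<in> F" "h \<in> H"
      have Hn: "H \<in> nonabelian_feet G" using F(1) H(1) by blast
      then have Hf: "H \<in> finite_feet G" using nonabelian_feet_finite by blast
      have "h \<in> carrier G" using feet_subset[of "{H}"] Hf H(2) by blast
      then show "x \<otimes> h = h \<otimes> x"
      proof (rule generate_commute[OF feet_subset[OF abelian_feet_finite] _ _ x(1)[unfolded MA_def]])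
        fix s assume "s \<in> \<Union>(abelian_feet G)"
        then obtain A where A: "A \<in> abelian_feet G" "s \<in> A" by blast
        have "A \<noteq> H" using A(1) Hn by (auto simp: nonabelian_feet_def)
        then show "s \<otimes> h = h \<otimes> s" using finite_feet_commute[OF _ Hf _ A(2) H(2)] A(1) abelian_feet_finite by blast
      qed
    qed
  qed
  then show ?thesis using normal_one[OF MA_normal] normal_one[OF MH_normal] by blast
qed

lemma MA_subset_minisocle: "MA G \<subseteq> minisocle G" and MH_subset_minisocle: "MH G \<subseteq> minisocle G"
  unfolding MA_def MH_def minisocle_def
  by (intro mono_generate Union_mono abelian_feet_finite nonabelian_feet_finite)+

lemma minisocle_direct_sum: "internal_direct_sum G UNIV (\<lambda>b. if b then MA G else MH G) (minisocle G)"
proof (rule internal_direct_sumI)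
  have U: "(\<Union>b. if b then MA G else MH G) = MA G \<union> MH G" by (auto split: if_splits)
  have "\<Union>(finite_feet G) \<subseteq> MA G \<union> MH G"
  proof (rule Union_least)
    fix K assume K: "K \<in> finite_feet G"
    show "K \<subseteq> MA G \<union> MH G"
    proof (cases "K \<in> abelian_feet G")
      case True
      then show ?thesis unfolding MA_def by (intro le_supI1 subset_generate_Union)
    next
      case False
      then have "K \<in> nonabelian_feet G" using K by (simp add: nonabelian_feet_def)
      then show ?thesis unfolding MH_def by (intro le_supI2 subset_generate_Union)
    qed
  qed
  then have "minisocle G \<subseteq> generate G (MA G \<union> MH G)" unfolding minisocle_def by (rule mono_generate)
  moreover have "generate G (MA G \<union> MH G) \<subseteq> minisocle G"
    using MA_subset_minisocle MH_subset_minisocle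
    by (intro generate_subgroup_incl normal_imp_sub minisocle_normal) auto
  ultimately show "minisocle G = generate G (\<Union>b. if b then MA G else MH G)" unfolding U by blast
  show "(if b then MA G else MH G) \<lhd> G" for b using MA_normal MH_normal by simp
  fix b :: bool
  have g: "generate G M \<subseteq> M" if "M \<lhd> G" for M by (rule generate_subgroup_incl[OF order_refl normal_imp_sub[OF that]])
  have "UNIV - {b} = {\<not> b}" by auto
  then show "(if b then MA G else MH G) \<inter> generate G (\<Union>c\<in>UNIV - {b}. if c then MA G else MH G) \<subseteq> {\<one>}"
    using g[OF MA_normal] g[OF MH_normal] MA_Int_MH by (cases b) auto
qed

text \<open>Zorn's lemma for independent families of abelian feet. A foot outside the sum of a
  maximal family would meet this sum trivially and could be added.\<close>

lemma MA_direct_sum: "\<exists>\<B>. \<B> \<subseteq> abelian_feet G \<and> internal_direct_sum G \<B> (\<lambda>B. B) (MA G)"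
proof -
  define \<S> where "\<S> = {\<B>. \<B> \<subseteq> abelian_feet G \<and> (\<forall>B\<in>\<B>. B \<inter> generate G (\<Union>(\<B> - {B})) \<subseteq> {\<one>})}"
  have "\<exists>M\<in>\<S>. \<forall>X\<in>\<S>. M \<subseteq> X \<longrightarrow> X = M"
  proof (rule subset_Zorn)
    fix C assume C: "subset.chain \<S> C"
    then have CS: "X \<in> \<S>" if "X \<in> C" for X using that by (auto simp: subset.chain_def)
    have "\<Union>C \<in> \<S>"
      unfolding \<S>_def
    proof (intro CollectI conjI ballI subsetI)
      show "B \<in> abelian_feet G" if "B \<in> \<Union>C" for B using that CS by (auto simp: \<S>_def)
      fix B x assume B: "B \<in> \<Union>C" and x: "x \<in> B \<inter> generate G (\<Union>(\<Union>C - {B}))"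
      then have "x \<in> generate G (\<Union>K\<in>\<Union>C - {B}. K)" by simp
      \<comment> \<open>A violation of independence involves finitely many feet, and finitely many
        members of the union of a chain lie in one member of the chain.\<close>
      then have "\<exists>E\<subseteq>\<Union>C - {B}. finite E \<and> x \<in> generate G (\<Union>K\<in>E. K)" by (rule generate_finite_support)
      then obtain E where E: "E \<subseteq> \<Union>C - {B}" "finite E" "x \<in> generate G (\<Union>K\<in>E. K)" by (elim exE conjE)
      obtain X where X: "X \<in> C" "insert B E \<subseteq> X"
        by (rule finite_subset_Union_chain[OF _ _ _ C, of "insert B E"]) (use E B in auto)
      have "generate G (\<Union>K\<in>E. K) \<subseteq> generate G (\<Union>(X - {B}))" using X E by (intro mono_generate) auto
      then show "x \<in> {\<one>}" using CS[OF X(1)] X(2) x E(3) unfolding \<S>_def by blast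
    qed
    then show "\<exists>U\<in>\<S>. \<forall>X\<in>C. X \<subseteq> U" by blast
  qed
  then obtain \<B> where B: "\<B> \<in> \<S>" and max: "\<And>X. X \<in> \<S> \<Longrightarrow> \<B> \<subseteq> X \<Longrightarrow> X = \<B>" by blast
  have sub: "\<B> \<subseteq> abelian_feet G" and ind: "\<And>B. B \<in> \<B> \<Longrightarrow> B \<inter> generate G (\<Union>(\<B> - {B})) \<subseteq> {\<one>}"
    using B by (auto simp: \<S>_def)
  have fin: "\<B> \<subseteq> finite_feet G" using sub abelian_feet_finite by blast
  note gB = generate_feet_normal[OF fin]
  have "A \<subseteq> generate G (\<Union>\<B>)" if A: "A \<in> abelian_feet G" for A
  proof (rule ccontr)
    assume n: "\<not> ?thesis"
    have Af: "A \<in> finite_feet G" using A abelian_feet_finite by blast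
    then have An: "A \<lhd> G" using finite_feet_normal by blast
    have d: "A \<inter> generate G (\<Union>\<B>) = {\<one>}" using foot_Int[OF Af gB] n by blast
    have AB: "A \<notin> \<B>" using n subset_generate_Union by blast
    have "insert A \<B> \<in> \<S>"
      unfolding \<S>_def
    proof (intro CollectI conjI ballI subsetI)
      show "K \<in> abelian_feet G" if "K \<in> insert A \<B>" for K using that A sub by auto
      fix K x assume K: "K \<in> insert A \<B>" and x: "x \<in> K \<inter> generate G (\<Union>(insert A \<B> - {K}))"
      show "x \<in> {\<one>}"
      proof (cases "K = A")
        case True
        then have "insert A \<B> - {K} = \<B>" using AB by auto
        then show ?thesis using x d True by auto
      next
        case False
        then have KB: "K \<in> \<B>" and eq: "insert A \<B> - {K} = insert A (\<B> - {K})" using K by auto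
        let ?L = "generate G (\<Union>(\<B> - {K}))"
        have nor: "J \<lhd> G" if "J \<in> insert A (\<B> - {K})" for J using that fin An finite_feet_normal by blast
        \<comment> \<open>In \<open>x = l \<otimes> a\<close> both \<open>x\<close> and
          \<open>l\<close> lie in the sum over \<open>\<B>\<close>, which meets \<open>A\<close>
          trivially. So \<open>a = \<one>\<close>, and the independence of \<open>\<B>\<close> gives
          \<open>x = \<one>\<close>.\<close>
        have "x \<in> ?L <#> A"
          using generate_insert[of A "\<B> - {K}" "\<lambda>J. J", OF nor] x unfolding eq by simp
        then have "\<exists>l\<in>?L. \<exists>a\<in>A. x = l \<otimes> a" by (auto simp: set_mult_def)
        then obtain l a where la: "l \<in> ?L" "a \<in> A" "x = l \<otimes> a" by blast
        have "?L \<subseteq> generate G (\<Union>\<B>)" by (rule mono_generate) auto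
        then have l: "l \<in> generate G (\<Union>\<B>)" using la(1) by blast
        have xK: "x \<in> K" using x by blast
        then have "x \<in> generate G (\<Union>\<B>)" using subset_generate_Union[OF KB] by blast
        moreover have aG: "a \<in> carrier G" using la(2) normal_subset[OF An] by blast
        ultimately have "a \<in> generate G (\<Union>\<B>)" using normal_mem_iff(1)[OF gB l aG] la(3) by simp
        then have "a = \<one>" using d la(2) by blast
        then have "x = l" using la(3) l normal_subset[OF gB] by auto
        then show ?thesis using ind[OF KB] xK la(1) by blast
      qed
    qed
    then show False using max[of "insert A \<B>"] AB by blast
  qed
  then have "MA G \<subseteq> generate G (\<Union>\<B>)"
    unfolding MA_def by (intro generate_subgroup_incl normal_imp_sub gB) blast
  moreover have "generate G (\<Union>\<B>) \<subseteq> MA G" unfolding MA_def using sub by (intro mono_generate) blast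
  ultimately have "internal_direct_sum G \<B> (\<lambda>B. B) (MA G)"
    using ind fin finite_feet_normal by (intro internal_direct_sumI) auto
  then show ?thesis using sub by blast
qed

lemma irreducibly_represented_iff:
  fixes emb :: "real \<Rightarrow> 'v"
  assumes "countable (carrier G)" "inj emb"
  shows "irreducibly_represented TYPE('v) G \<longleftrightarrow> annih G (abelian_feet G) \<noteq> {}"
  using annih_of_faithful_irrep annih_mono[OF abelian_feet_finite]
    faithful_irrep_of_annih[OF assms] annih_nonabelian_feet by blast

text \<open>A foot on which a character is trivial is, being normal, in the kernels of all its
  conjugates. Conversely, every nontrivial normal subgroup inside \<open>MA G\<close> contains an
  abelian foot, so nontriviality on these is enough.\<close>

lemma conj_faithful_character_iff:
  assumes cnt: "countable (carrier G)"
  shows "has_conj_faithful_character G (MA G) \<longleftrightarrow> annih G (abelian_feet G) \<noteq> {}"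
proof
  have ab: "A \<lhd> G \<and> finite A \<and> A \<subseteq> MA G" if "A \<in> abelian_feet G" for A
    using that abelian_feet_finite finite_feet_normal subset_generate_Union[OF that] unfolding MA_def by blast
  have ker: "kernel (G\<lparr>carrier := MA G\<rparr>) circle_group \<xi> = {n\<in>MA G. \<xi> n = 1}" for \<xi>
    by (simp add: kernel_def circle_group_def)
  show "annih G (abelian_feet G) \<noteq> {}" if c: "has_conj_faithful_character G (MA G)"
  proof -
    obtain \<xi> where \<xi>: "unitary_character (G\<lparr>carrier := MA G\<rparr>) \<xi>" and cf: "conj_faithful G (MA G) circle_group \<xi>"
      using c unfolding has_conj_faithful_character_def by blast
    show ?thesis
    proof (rule annih_of_character[OF MA_normal ab \<xi>])
      fix A assume A: "A \<in> abelian_feet G"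
      show "\<exists>a\<in>A. \<xi> a \<noteq> 1"
      proof (rule ccontr)
        assume n: "\<not> ?thesis"
        have An: "A \<lhd> G" "A \<noteq> {\<one>}" using A abelian_feet_finite finite_feet_normal by blast+
        have "A \<subseteq> (\<Inter>\<gamma>\<in>carrier G. kernel (G\<lparr>carrier := MA G\<rparr>) circle_group (conj_rep G \<xi> \<gamma>))"
          unfolding ker conj_rep_def using n ab[OF A] normal_conj[OF An(1)] by blast
        then show False using cf An normal_one[OF An(1)] unfolding conj_faithful_def by blast
      qed
    qed
  qed
  assume "annih G (abelian_feet G) \<noteq> {}"
  then obtain \<xi> where \<xi>: "unitary_character (G\<lparr>carrier := MA G\<rparr>) \<xi>" "\<forall>A\<in>abelian_feet G. \<exists>a\<in>A. \<xi> a \<noteq> 1"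
    using character_of_annih[OF cnt MA_normal MA_comm ab] by blast
  interpret M: group "G\<lparr>carrier := MA G\<rparr>" by (rule subgroup_imp_group[OF normal_imp_sub[OF MA_normal]])
  note D = M.unitary_characterD[OF \<xi>(1), simplified]
  have "conj_faithful G (MA G) circle_group \<xi>"
  proof (rule conj_faithfulI[OF MA_normal, of "abelian_feet G"])
    show "\<exists>A\<in>abelian_feet G. A \<subseteq> N" if N: "N \<lhd> G" "N \<subseteq> MA G" "N \<noteq> {\<one>}" for N
    proof -
      have "N \<inter> generate G (\<Union>(abelian_feet G)) \<noteq> {\<one>}" using N unfolding MA_def by blast
      then obtain M where "M \<in> finite_feet G" "M \<subseteq> N" using generate_feet_contains_foot[OF abelian_feet_finite N(1)] by blast
      then show ?thesis using foot_in_MA_abelian N(2) by blast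
    qed
    show "subgroup (kernel (G\<lparr>carrier := MA G\<rparr>) circle_group \<xi>) G"
      unfolding ker
    proof (rule subgroupI)
      show "{n\<in>MA G. \<xi> n = 1} \<subseteq> carrier G" using normal_subset[OF MA_normal] by blast
      show "{n\<in>MA G. \<xi> n = 1} \<noteq> {}" using normal_one[OF MA_normal] D(3) by auto
      fix a assume a: "a \<in> {n\<in>MA G. \<xi> n = 1}"
      then have aM: "a \<in> MA G" "\<xi> a = 1" by auto
      have aG: "a \<in> carrier G" using aM(1) normal_subset[OF MA_normal] by blast
      have "\<xi> (inv a \<otimes> a) = \<xi> (inv a) * \<xi> a" by (rule D(1)[OF normal_minv[OF MA_normal aM(1)] aM(1)])
      then show "inv a \<in> {n\<in>MA G. \<xi> n = 1}" using aM aG D(3) normal_minv[OF MA_normal aM(1)] by simp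
      fix b assume "b \<in> {n\<in>MA G. \<xi> n = 1}"
      then show "a \<otimes> b \<in> {n\<in>MA G. \<xi> n = 1}" using aM D(1)[of a b] normal_mult[OF MA_normal, of a b] by simp
    qed
    show "\<not> A \<subseteq> kernel (G\<lparr>carrier := MA G\<rparr>) circle_group \<xi>" if "A \<in> abelian_feet G" for A
      unfolding ker using \<xi>(2) that by blast
  qed
  then show "has_conj_faithful_character G (MA G)" unfolding has_conj_faithful_character_def using \<xi>(1) by blast
qed

lemma conj_faithful_irrep_iff:
  fixes emb :: "real \<Rightarrow> 'v"
  assumes "countable (carrier G)" "inj emb"
  shows "has_conj_faithful_irrep TYPE('v) G (minisocle G) \<longleftrightarrow> annih G (abelian_feet G) \<noteq> {}"
proof
  have sub: "A \<subseteq> minisocle G" if "A \<in> finite_feet G" for A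
    unfolding minisocle_def by (rule subset_generate_Union[OF that])
  show "annih G (abelian_feet G) \<noteq> {}" if "has_conj_faithful_irrep TYPE('v) G (minisocle G)"
    using annih_of_conj_faithful_irrep[OF minisocle_normal order_refl sub that] annih_mono[OF abelian_feet_finite] by blast
  assume ne: "annih G (abelian_feet G) \<noteq> {}"
  show "has_conj_faithful_irrep TYPE('v) G (minisocle G)"
  proof (rule conj_faithful_irrep_of_annih[OF assms minisocle_normal order_refl sub _ annih_nonabelian_feet[OF ne]])
    fix N assume N: "N \<lhd> G" "N \<subseteq> minisocle G" "N \<noteq> {\<one>}"
    then have "N \<inter> generate G (\<Union>(finite_feet G)) \<noteq> {\<one>}" unfolding minisocle_def by blast
    then show "\<exists>A\<in>finite_feet G. A \<subseteq> N" using generate_feet_contains_foot[OF order_refl N(1)] by blast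
  qed
qed

lemma finite_subset_generate:
  assumes "finite S" "S \<subseteq> generate G (\<Union>i\<in>I. A i)"
  shows "\<exists>E\<subseteq>I. finite E \<and> S \<subseteq> generate G (\<Union>i\<in>E. A i)"
  using assms
proof (induction S rule: finite_induct)
  case empty
  show ?case by (rule exI[of _ "{}"]) simp
next
  case (insert x S)
  then obtain E where E: "E \<subseteq> I" "finite E" "S \<subseteq> generate G (\<Union>i\<in>E. A i)" by blast
  obtain E' where E': "E' \<subseteq> I" "finite E'" "x \<in> generate G (\<Union>i\<in>E'. A i)"
    using generate_finite_support[of x A I] insert.prems by blast
  have "generate G (\<Union>i\<in>E. A i) \<subseteq> generate G (\<Union>i\<in>E \<union> E'. A i)"
    "generate G (\<Union>i\<in>E'. A i) \<subseteq> generate G (\<Union>i\<in>E \<union> E'. A i)"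
    by (rule mono_generate, blast)+
  then show ?case using E E' by (intro exI[of _ "E \<union> E'"]) auto
qed

text \<open>Commuting a new component \<open>h \<in> H\<close> with an element of \<open>H\<close> isolates it from the others,
  so the normal closure picks up all of \<open>H\<close>.\<close>

lemma normal_closure_add_nonabelian:
  assumes "finite F" "F \<subseteq> nonabelian_feet G" and \<A>: "\<A> \<subseteq> abelian_feet G"
    and "\<exists>z\<in>generate G (\<Union>\<A>). normal_closure G z = generate G (\<Union>\<A>)"
  shows "\<exists>z\<in>generate G (\<Union>(\<A> \<union> F)). normal_closure G z = generate G (\<Union>(\<A> \<union> F))"
  using assms(1,2)
proof (induction F rule: finite_induct)
  case empty
  then show ?case using assms(4) by simp
next
  case (insert H F)
  let ?C = "\<A> \<union> F"
  let ?L = "generate G (\<Union>?C)"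
  obtain z where z: "z \<in> ?L" "normal_closure G z = ?L" using insert.IH insert.prems by blast
  have H: "H \<in> nonabelian_feet G" "H \<in> finite_feet G" using insert.prems nonabelian_feet_finite by auto
  have C: "?C \<subseteq> finite_feet G" using \<A> abelian_feet_finite insert.prems nonabelian_feet_finite by blast
  have HC: "H \<notin> ?C" using H(1) \<A> insert(2) by (auto simp: nonabelian_feet_def)
  have Hn: "H \<lhd> G" "H \<noteq> {\<one>}" using finite_feet_normal[OF H(2)] by auto
  note L = generate_feet_normal[OF C]
  have n: "K \<lhd> G" if "K \<in> insert H ?C" for K using that H C finite_feet_normal by blast
  have eq: "generate G (\<Union>(\<A> \<union> insert H F)) = ?L <#> H"
    using generate_insert[of H ?C "\<lambda>K. K", OF n] by simp
  obtain h where h: "h \<in> H" "h \<noteq> \<one>" using Hn normal_one[OF Hn(1)] by blast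
  obtain k where k: "k \<in> H" "h \<otimes> k \<noteq> k \<otimes> h" using nonabelian_foot_center[OF H(1) h(1)] h(2) by blast
  have c: "h \<in> carrier G" "k \<in> carrier G" "z \<in> carrier G"
    using h k z normal_subset[OF Hn(1)] normal_subset[OF L] by auto
  let ?z = "z \<otimes> h"
  have zG: "?z \<in> carrier G" using c by simp
  note N = normal_closure_normal[OF zG]
  let ?N = "normal_closure G ?z"
  have zk: "z \<otimes> k = k \<otimes> z"
  proof (rule generate_commute[OF feet_subset[OF C] c(2) _ z(1)])
    fix s assume "s \<in> \<Union>?C"
    then show "s \<otimes> k = k \<otimes> s" using finite_feet_commute[OF _ H(2) _ _ k(1)] C HC by blast
  qed
  have "?z \<otimes> (k \<otimes> inv ?z \<otimes> inv k) \<in> ?N"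
    by (rule normal_mult[OF N(1,2) normal_conj[OF N(1) c(2) normal_minv[OF N(1,2)]]])
  moreover have "(?z \<otimes> k \<otimes> inv ?z) \<otimes> inv k \<in> H"
    by (rule normal_mult[OF Hn(1) normal_conj[OF Hn(1) zG k(1)] normal_minv[OF Hn(1) k(1)]])
  moreover have "?z \<otimes> (k \<otimes> inv ?z \<otimes> inv k) = (?z \<otimes> k \<otimes> inv ?z) \<otimes> inv k" using zG c(2) by (simp add: m_assoc)
  moreover have "(?z \<otimes> k \<otimes> inv ?z) \<otimes> inv k \<noteq> \<one>"
  proof
    assume e: "(?z \<otimes> k \<otimes> inv ?z) \<otimes> inv k = \<one>"
    have "((?z \<otimes> k \<otimes> inv ?z) \<otimes> inv k) \<otimes> (k \<otimes> ?z) = ?z \<otimes> k \<otimes> (inv ?z \<otimes> (inv k \<otimes> k) \<otimes> ?z)"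
      using zG c(2) by (simp only: m_assoc m_closed inv_closed)
    then have "k \<otimes> ?z = ?z \<otimes> k" using e zG c(2) by simp
    then have "(k \<otimes> z) \<otimes> h = z \<otimes> (h \<otimes> k)" using c by (simp add: m_assoc)
    then have "z \<otimes> (k \<otimes> h) = z \<otimes> (h \<otimes> k)" unfolding zk[symmetric] using c by (simp add: m_assoc)
    then show False using k(2) c by simp
  qed
  ultimately have "H \<inter> ?N \<noteq> {\<one>}" by auto
  then have HN: "H \<subseteq> ?N" using foot_Int[OF H(2) N(1)] by blast
  then have "h \<in> ?N" using h(1) by blast
  then have "z \<in> ?N" using normal_mem_iff(2)[OF N(1) _ c(3), of h] N(2) by simp
  then have "?L \<subseteq> ?N" using normal_closure_normal(3)[OF c(3) N(1)] z(2) by simp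
  then have "?L <#> H \<subseteq> ?N" using HN normal_mult[OF N(1)] by (auto simp: set_mult_def)
  moreover have zZ: "?z \<in> ?L <#> H" using z(1) h(1) by (auto simp: set_mult_def)
  moreover have "?N \<subseteq> ?L <#> H" by (rule N(3)[OF normal_set_mult[OF L Hn(1)] zZ])
  ultimately show ?case unfolding eq by blast
qed

text \<open>From states to characters one passes to a finite subsum. For the converse, compactness
  leaves finitely many abelian feet; their union is finite and so lies in one finite subsum, whose
  character provides a state.\<close>

lemma cyclic_sums_iff:
  assumes cnt: "countable (carrier G)" and A: "\<And>i. i \<in> I \<Longrightarrow> A i \<in> abelian_feet G"
    and ds: "internal_direct_sum G I A (MA G)"
  shows "(\<forall>E. finite E \<and> E \<subseteq> I \<longrightarrow> (\<exists>x\<in>MA_sub G A E. normal_closure G x = MA_sub G A E)) \<longleftrightarrow>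
    annih G (abelian_feet G) \<noteq> {}"
proof -
  have Af: "A i \<in> finite_feet G \<and> A i \<subseteq> MA G" if "i \<in> I" for i
    using A[OF that] abelian_feet_finite subset_generate_Union[OF A[OF that]] unfolding MA_def by blast
  have L: "MA_sub G A E \<lhd> G" "MA_sub G A E \<subseteq> MA G" if "E \<subseteq> I" for E
  proof -
    show "MA_sub G A E \<lhd> G"
      unfolding MA_sub_def using that Af finite_feet_normal by (intro normal_generate_UN) blast
    show "MA_sub G A E \<subseteq> MA G"
      unfolding MA_sub_def using that Af by (intro generate_subgroup_incl normal_imp_sub MA_normal) blast
  qed
  have "(\<exists>x\<in>MA_sub G A E. normal_closure G x = MA_sub G A E) \<longleftrightarrow> (\<exists>\<xi>. faithful_character (MA_sub G A E) \<xi>)"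
    if E: "finite E" "E \<subseteq> I" for E
    unfolding MA_sub_def
  proof (rule cyclic_iff_faithful_character(1)[OF MA_normal MA_comm E(1)])
    show "A i \<in> finite_feet G \<and> A i \<subseteq> MA G" if "i \<in> E" for i using Af that E(2) by blast
    show "A i \<inter> generate G (\<Union>j\<in>E'. A j) = {\<one>}" if i: "i \<in> E" and E': "E' \<subseteq> E - {i}" for i E'
    proof -
      have iI: "i \<in> I" using i E(2) by blast
      then have d: "A i \<inter> generate G (\<Union>j\<in>I - {i}. A j) = {\<one>}" using ds by (simp add: internal_direct_sum_def)
      have "generate G (\<Union>j\<in>E'. A j) \<subseteq> generate G (\<Union>j\<in>I - {i}. A j)"
        using E' E(2) by (intro mono_generate UN_mono) auto
      moreover have "A i \<lhd> G" using Af[OF iI] finite_feet_normal by blast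
      then have "\<one> \<in> A i" by (rule normal_one)
      ultimately show ?thesis using d generate.one by blast
    qed
  qed
  moreover have "annih G (abelian_feet G) \<noteq> {} \<longleftrightarrow>
    (\<forall>E. finite E \<and> E \<subseteq> I \<longrightarrow> (\<exists>\<xi>. faithful_character (MA_sub G A E) \<xi>))"
  proof (intro iffI allI impI)
    fix E assume ne: "annih G (abelian_feet G) \<noteq> {}" and E: "finite E \<and> E \<subseteq> I"
    let ?L = "MA_sub G A E"
    note LE = L[OF conjunct2[OF E]]
    \<comment> \<open>Not only the summands: a sum of equivariantly isomorphic feet contains
      further, diagonal feet, and \<open>faithful_character\<close> refers to all of them.\<close>
    let ?\<A> = "{B\<in>finite_feet G. B \<subseteq> ?L}"
    have "?\<A> \<subseteq> abelian_feet G" using foot_in_MA_abelian LE(2) by blast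
    then have "annih G ?\<A> \<noteq> {}" using annih_mono ne by blast
    then have "\<exists>\<xi>. unitary_character (G\<lparr>carrier := ?L\<rparr>) \<xi> \<and> (\<forall>B\<in>?\<A>. \<exists>b\<in>B. \<xi> b \<noteq> 1)"
    proof (rule character_of_annih[OF cnt LE(1), rotated 2])
      show "x \<otimes> y = y \<otimes> x" if "x \<in> ?L" "y \<in> ?L" for x y
        by (rule MA_comm) (use that LE(2) in auto)
      show "B \<lhd> G \<and> finite B \<and> B \<subseteq> ?L" if "B \<in> ?\<A>" for B
        using that finite_feet_normal[of B] by simp
    qed
    then show "\<exists>\<xi>. faithful_character ?L \<xi>" unfolding faithful_character_def by blast
  next
    assume fc: "\<forall>E. finite E \<and> E \<subseteq> I \<longrightarrow> (\<exists>\<xi>. faithful_character (MA_sub G A E) \<xi>)"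
    show "annih G (abelian_feet G) \<noteq> {}"
    proof (rule annih_compactness)
      fix \<B> assume \<B>: "finite \<B>" "\<B> \<subseteq> abelian_feet G"
      have "finite (\<Union>\<B>)"
        using \<B> abelian_feet_finite finite_feet_normal by (intro finite_Union) blast+
      moreover have "MA G = generate G (\<Union>i\<in>I. A i)" using ds by (simp add: internal_direct_sum_def)
      then have "\<Union>\<B> \<subseteq> generate G (\<Union>i\<in>I. A i)"
        using \<B>(2) subset_generate_Union[of _ "abelian_feet G"] unfolding MA_def by blast
      ultimately have "\<exists>E\<subseteq>I. finite E \<and> \<Union>\<B> \<subseteq> generate G (\<Union>i\<in>E. A i)" by (rule finite_subset_generate)
      then obtain E where E: "E \<subseteq> I" "finite E" "\<Union>\<B> \<subseteq> MA_sub G A E"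
        unfolding MA_sub_def by (elim exE conjE)
      have "\<exists>\<xi>. faithful_character (MA_sub G A E) \<xi>" using fc E(1,2) by simp
      then obtain \<xi> where \<xi>: "faithful_character (MA_sub G A E) \<xi>" by (rule exE)
      have Bf: "B \<in> finite_feet G" "B \<subseteq> MA_sub G A E" if "B \<in> \<B>" for B
        using subsetD[OF abelian_feet_finite subsetD[OF \<B>(2) that]] order_trans[OF Union_upper[OF that] E(3)] by simp_all
      show "annih G \<B> \<noteq> {}"
      proof (rule annih_of_character[OF L(1)[OF E(1)]])
        show "B \<lhd> G \<and> finite B \<and> B \<subseteq> MA_sub G A E" if "B \<in> \<B>" for B
          using Bf[OF that] finite_feet_normal[of B] by simp
        show "unitary_character (G\<lparr>carrier := MA_sub G A E\<rparr>) \<xi>" using \<xi> by (simp add: faithful_character_def)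
        show "\<exists>b\<in>B. \<xi> b \<noteq> 1" if "B \<in> \<B>" for B
          using \<xi> Bf[OF that] by (simp add: faithful_character_def)
      qed
    qed
  qed
  ultimately show ?thesis by simp
qed

lemma cyclic_sums_nonabelian_iff:
  assumes A: "\<And>i. i \<in> I \<Longrightarrow> A i \<in> abelian_feet G"
  shows "(\<forall>E F. finite E \<and> E \<subseteq> I \<and> finite F \<and> F \<subseteq> nonabelian_feet G \<longrightarrow>
      (\<exists>z\<in>MS_sub G A E F. normal_closure G z = MS_sub G A E F)) \<longleftrightarrow>
    (\<forall>E. finite E \<and> E \<subseteq> I \<longrightarrow> (\<exists>x\<in>MA_sub G A E. normal_closure G x = MA_sub G A E))"
    (is "?MS \<longleftrightarrow> ?MA")
proof
  have MA: "MS_sub G A E {} = MA_sub G A E" for E by (simp add: MS_sub_def MA_sub_def)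
  assume ?MS
  then show ?MA by (metis MA empty_subsetI finite.emptyI)
next
  assume *: ?MA
  show ?MS
  proof (intro allI impI)
    fix E F assume EF: "finite E \<and> E \<subseteq> I \<and> finite F \<and> F \<subseteq> nonabelian_feet G"
    have eq: "MS_sub G A E F = generate G (\<Union>(A ` E \<union> F))" "MA_sub G A E = generate G (\<Union>(A ` E))"
      by (simp_all add: MS_sub_def MA_sub_def)
    have "A ` E \<subseteq> abelian_feet G" using A EF by blast
    moreover have "\<exists>z\<in>MA_sub G A E. normal_closure G z = MA_sub G A E" using * EF by simp
    ultimately show "\<exists>z\<in>MS_sub G A E F. normal_closure G z = MS_sub G A E F"
      using normal_closure_add_nonabelian[of F "A ` E"] EF unfolding eq by simp
  qed
qed

lemma irreducibly_represented_of_MA_trivial: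
  fixes emb :: "real \<Rightarrow> 'v"
  assumes "countable (carrier G)" "inj emb" "MA G = {\<one>}"
  shows "irreducibly_represented TYPE('v) G"
proof -
  have "abelian_feet G = {}"
  proof (rule ccontr)
    assume "abelian_feet G \<noteq> {}"
    then obtain A where A: "A \<in> abelian_feet G" by blast
    then have "A \<lhd> G" "A \<noteq> {\<one>}" using abelian_feet_finite finite_feet_normal by blast+
    then show False using subset_generate_Union[OF A] assms(3) normal_one unfolding MA_def by blast
  qed
  then show ?thesis unfolding irreducibly_represented_iff[OF assms(1,2)] by (simp add: annih_empty)
qed

end

text \<open>Every property is compared with \<open>annih\<close> of the abelian feet being nonempty.
  This condition does not mention the family \<open>A\<close>, so the equivalences hold for every
  decomposition of \<open>MA\<close>. The injection \<open>emb\<close> makes the type of the vectors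
  at least as large as the reals.\<close>

theorem theorem2:
  fixes \<Gamma> :: "('g, 'b) monoid_scheme" and emb :: "real \<Rightarrow> 'v"
  assumes "group \<Gamma>" and "countable (carrier \<Gamma>)"
    and "inj emb"
  shows
    "(\<exists>\<B>. \<B> \<subseteq> abelian_feet \<Gamma> \<and> internal_direct_sum \<Gamma> \<B> (\<lambda>B. B) (MA \<Gamma>)) \<and>
     internal_direct_sum \<Gamma> UNIV (\<lambda>b. if b then MA \<Gamma> else MH \<Gamma>) (minisocle \<Gamma>) \<and>
     internal_direct_sum \<Gamma> (nonabelian_feet \<Gamma>) (\<lambda>H. H) (MH \<Gamma>) \<and>
     (\<forall>(I :: 'i set) A.
        (\<forall>i\<in>I. A i \<in> abelian_feet \<Gamma>) \<and> internal_direct_sum \<Gamma> I A (MA \<Gamma>) \<longrightarrow>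
        (irreducibly_represented TYPE('v) \<Gamma> \<longleftrightarrow> has_conj_faithful_character \<Gamma> (MA \<Gamma>)) \<and>
        (irreducibly_represented TYPE('v) \<Gamma> \<longleftrightarrow>
           has_conj_faithful_irrep TYPE('v) \<Gamma> (minisocle \<Gamma>)) \<and>
        (irreducibly_represented TYPE('v) \<Gamma> \<longleftrightarrow>
           (\<forall>E. finite E \<and> E \<subseteq> I \<longrightarrow>
              (\<exists>x\<in>MA_sub \<Gamma> A E. generate \<Gamma> (conjugacy_class \<Gamma> x) = MA_sub \<Gamma> A E))) \<and>
        (irreducibly_represented TYPE('v) \<Gamma> \<longleftrightarrow>
           (\<forall>E F. finite E \<and> E \<subseteq> I \<and> finite F \<and> F \<subseteq> nonabelian_feet \<Gamma> \<longrightarrow>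
              (\<exists>z\<in>MS_sub \<Gamma> A E F.
                 generate \<Gamma> (conjugacy_class \<Gamma> z) = MS_sub \<Gamma> A E F)))) \<and>
     (MA \<Gamma> = {\<one>\<^bsub>\<Gamma>\<^esub>} \<longrightarrow> irreducibly_represented TYPE('v) \<Gamma>) \<and>
     (minisocle \<Gamma> = {\<one>\<^bsub>\<Gamma>\<^esub>} \<longrightarrow> irreducibly_represented TYPE('v) \<Gamma>)"
proof -
  interpret group \<Gamma> by (rule assms(1))
  note iff = irreducibly_represented_iff[OF assms(2,3)]
  have equiv: "(irreducibly_represented TYPE('v) \<Gamma> \<longleftrightarrow> has_conj_faithful_character \<Gamma> (MA \<Gamma>)) \<and>
        (irreducibly_represented TYPE('v) \<Gamma> \<longleftrightarrow>
           has_conj_faithful_irrep TYPE('v) \<Gamma> (minisocle \<Gamma>)) \<and>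
        (irreducibly_represented TYPE('v) \<Gamma> \<longleftrightarrow>
           (\<forall>E. finite E \<and> E \<subseteq> I \<longrightarrow>
              (\<exists>x\<in>MA_sub \<Gamma> A E. generate \<Gamma> (conjugacy_class \<Gamma> x) = MA_sub \<Gamma> A E))) \<and>
        (irreducibly_represented TYPE('v) \<Gamma> \<longleftrightarrow>
           (\<forall>E F. finite E \<and> E \<subseteq> I \<and> finite F \<and> F \<subseteq> nonabelian_feet \<Gamma> \<longrightarrow>
              (\<exists>z\<in>MS_sub \<Gamma> A E F.
                 generate \<Gamma> (conjugacy_class \<Gamma> z) = MS_sub \<Gamma> A E F)))"
    if A: "\<forall>i\<in>I. A i \<in> abelian_feet \<Gamma>" and ds: "internal_direct_sum \<Gamma> I A (MA \<Gamma>)" for I :: "'i set" and A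
  proof -
    have Ai: "A i \<in> abelian_feet \<Gamma>" if "i \<in> I" for i using A that by blast
    have iv: "(\<forall>E. finite E \<and> E \<subseteq> I \<longrightarrow>
        (\<exists>x\<in>MA_sub \<Gamma> A E. normal_closure \<Gamma> x = MA_sub \<Gamma> A E)) \<longleftrightarrow> annih \<Gamma> (abelian_feet \<Gamma>) \<noteq> {}"
      by (rule cyclic_sums_iff[OF assms(2) Ai ds])
    have v: "(\<forall>E F. finite E \<and> E \<subseteq> I \<and> finite F \<and> F \<subseteq> nonabelian_feet \<Gamma> \<longrightarrow>
        (\<exists>z\<in>MS_sub \<Gamma> A E F. normal_closure \<Gamma> z = MS_sub \<Gamma> A E F)) \<longleftrightarrow> annih \<Gamma> (abelian_feet \<Gamma>) \<noteq> {}"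
      unfolding iv[symmetric] by (rule cyclic_sums_nonabelian_iff[OF Ai])
    show ?thesis
      unfolding normal_closure_def[symmetric] iff iv v conj_faithful_character_iff[OF assms(2)]
        conj_faithful_irrep_iff[OF assms(2,3)]
      by simp
  qed
  have "MA \<Gamma> = {\<one>\<^bsub>\<Gamma>\<^esub>}" if "minisocle \<Gamma> = {\<one>\<^bsub>\<Gamma>\<^esub>}"
    using that MA_subset_minisocle normal_one[OF MA_normal] by blast
  then have triv: "minisocle \<Gamma> = {\<one>\<^bsub>\<Gamma>\<^esub>} \<longrightarrow> irreducibly_represented TYPE('v) \<Gamma>"
    "MA \<Gamma> = {\<one>\<^bsub>\<Gamma>\<^esub>} \<longrightarrow> irreducibly_represented TYPE('v) \<Gamma>"
    using irreducibly_represented_of_MA_trivial[OF assms(2,3)] by blast+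
  show ?thesis
    by (rule conjI[OF MA_direct_sum], rule conjI[OF minisocle_direct_sum], rule conjI[OF MH_direct_sum],
        rule conjI[OF _ conjI[OF triv(2,1)]], rule allI, rule allI, rule impI, erule conjE, rule equiv)
qed

end
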